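(* Let $\alpha\in(0,1]$, let $c,\varepsilon\in\mathbb{R}$ with $|\varepsilon|<1$, and let $0<\delta<1$. Let $\Omega=\{(x,y)\in\mathbb{R}^2: 0<x<1,\ -\pi<y<\pi\}$. Let $\varphi\in C^{3+\delta}[-\pi,\pi]$ and $\psi\in C^{2+\delta}[-\pi,\pi]$ satisfy $\varphi(-\pi)=\varphi(\pi)$, $\varphi'(-\pi)=\varphi'(\pi)$, $\psi(-\pi)=\psi(\pi)$, $\psi'(-\pi)=\psi'(\pi)$. Then there exists a unique regular solution $u$, with $u_y\in C(\bar\Omega)$, of $$D_x^\alpha D_x^\alpha u(x,y)+u_{yy}(x,y)-\varepsilon u_{yy}(x,-y)-c^2u(x,y)=0,\quad (x,y)\in\Omega,$$ satisfying $$u(0,y)=\varphi(y),\quad u(1,y)=\psi(y),\quad -\pi\le y\le\pi,$$ $$u(x,-\pi)=u(x,\pi),\quad u_y(x,-\pi)=u_y(x,\pi),\quad 0\le x\le 1,$$ and it can be written in the form $$u(x,y)=(1-x^\alpha)\varphi_0+x^\alpha\psi_0+\sum_{k=1}^\infty\left[\varphi_{2k}C_{\mu_{2k}}(x)+\psi_{2k}S_{\mu_{2k}}(x)\right]Y_{2k}(y)+\sum_{k=1}^\infty\left[\varphi_{2k-1}C_{\mu_{2k-1}}(x)+\psi_{2k-1}S_{\mu_{2k-1}}(x)\right]Y_{2k-1}(y).$$ Here $Y_{2k-1}(y)=\sin ky$, $\lambda_{2k-1}=(1+\varepsilon)k^2$ for $k=1,2,\dots$, and $Y_{2k}(y)=\cos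 ky$, $\lambda_{2k}=(1-\varepsilon)k^2$ for $k=0,1,\dots$; for every index $n\ge1$, $\mu_n>0$ is given by $\mu_n^2=\lambda_n+c^2$; and for every $n\ge0$, $\varphi_n=(\varphi,Y_n)$ and $\psi_n=(\psi,Y_n)$ are the Fourier coefficients of $\varphi$ and $\psi$ with respect to the system $\{Y_n\}$.
   Context: $D_x^\alpha$ is the Caputo derivative in $x$ of order $\alpha$: for $0<\alpha<1$, $D_x^\alpha u(x,y)=\frac{1}{\Gamma(1-\alpha)}\int_0^x (x-s)^{-\alpha}\frac{\partial u}{\partial s}(s,y)\,ds$, and $D_x^1=\partial/\partial x$. A regular solution of the equation is a function $u\in C(\bar\Omega)$ such that $D_x^\alpha u,\ D_x^\alpha D_x^\alpha u,\ u_{yy}\in C(\Omega)$ and the equation holds in $\Omega$. $C^{m+\delta}[-\pi,\pi]$ is the Hölder space of $m$ times continuously differentiable functions whose $m$-th derivative is Hölder continuous with exponent $\delta$. $(\cdot,\cdot)$ is the inner product of $L_2(-\pi,\pi)$. The $Y_n$ and $\lambda_n$ are the eigenfunctions and eigenvalues of $Y''(y)-\varepsilon Y''(-y)+\lambda Y(y)=0$, $-\pi<y<\pi$, $Y(-\pi)=Y(\pi)$, $Y'(-\pi)=Y'(\pi)$. The Mittag-Leffler type function is $E_{\alpha,\beta}(z)=\sum_{k=0}^\infty\frac{z^k}{\Gamma(\alpha k+\beta)}$. For $\mu>0$ and $t\in[0,1]$, $$C_\mu(t)=\frac{E_{\alpha,1}(\mu)E_{\alpha,1}(-\mu t^\alpha)-E_{\alpha,1}(-\mu)E_{\alpha,1}(\mu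 t^\alpha)}{2\mu E_{2\alpha,\alpha+1}(\mu^2)},\qquad S_\mu(t)=\frac{t^\alpha E_{2\alpha,\alpha+1}(\mu^2t^{2\alpha})}{E_{2\alpha,\alpha+1}(\mu^2)}.$$
   Formalization: For c≠0 the term (1−x^α)φ_0+x^αψ_0, which does not solve the equation (φ=ψ=1), is replaced by φ_0 C_{|c|}(x)+ψ_0 S_{|c|}(x); the coefficients are normalized as φ_n=(φ,Y_n)/(Y_n,Y_n), likewise ψ_n, since the Y_n are not unit vectors. *)

theory Defs
  imports "HOL-Analysis.Analysis"
begin

definition Omega :: "(real \<times> real) set" where
  "Omega = {0<..<1} \<times> {-pi<..<pi}"

definition Omega_bar :: "(real \<times> real) set" where
  "Omega_bar = {0..1} \<times> {-pi..pi}"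

text \<open>The derivative relative to \<open>S\<close>; on a closed interval it is one-sided at the end points.\<close>

definition deriv_on :: "real set \<Rightarrow> (real \<Rightarrow> real) \<Rightarrow> real \<Rightarrow> real" where
  "deriv_on S f y = vector_derivative f (at y within S)"

definition holder_on :: "real \<Rightarrow> real set \<Rightarrow> (real \<Rightarrow> real) \<Rightarrow> bool" where
  "holder_on \<delta> S f \<longleftrightarrow> (\<exists>K. \<forall>y\<in>S. \<forall>z\<in>S. \<bar>f y - f z\<bar> \<le> K * \<bar>y - z\<bar> powr \<delta>)"

text \<open>Continuity of the derivatives of order below \<open>m\<close> follows from their differentiability, and
  continuity of the \<open>m\<close>-th one from the Hoelder condition with exponent \<open>\<delta> > 0\<close>.\<close>

definition holder_space :: "nat \<Rightarrow> real \<Rightarrow> real set \<Rightarrow> (real \<Rightarrow> real) \<Rightarrow> bool" where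
  "holder_space m \<delta> S f \<longleftrightarrow>
     (\<forall>i<m. \<forall>y\<in>S. ((deriv_on S ^^ i) f) differentiable (at y within S)) \<and>
     holder_on \<delta> S ((deriv_on S ^^ m) f)"

text \<open>Since \<open>deriv\<close> and the Lebesgue integral are total, existence of the Caputo derivative is a
  separate predicate. The derivative of \<open>f\<close> is required at every point of \<open>(0,x)\<close>, and the
  integral is absolutely convergent. Only the values of \<open>f\<close> on \<open>(0,x)\<close> (for \<open>\<alpha> = 1\<close>: near
  \<open>x\<close>) matter, so the operator can be iterated.\<close>

definition has_caputo :: "real \<Rightarrow> (real \<Rightarrow> real) \<Rightarrow> real \<Rightarrow> bool" where
  "has_caputo \<alpha> f x \<longleftrightarrow>
     (if \<alpha> = 1 then f field_differentiable (at x)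
      else (\<forall>s\<in>{0<..<x}. f field_differentiable (at s)) \<and>
           set_integrable lborel {0<..<x} (\<lambda>s. (x - s) powr (-\<alpha>) * deriv f s))"

definition caputo :: "real \<Rightarrow> (real \<Rightarrow> real) \<Rightarrow> real \<Rightarrow> real" where
  "caputo \<alpha> f x =
     (if \<alpha> = 1 then deriv f x
      else 1 / Gamma (1 - \<alpha>) * (LINT s:{0<..<x}|lborel. (x - s) powr (-\<alpha>) * deriv f s))"

definition Dx :: "real \<Rightarrow> (real \<Rightarrow> real \<Rightarrow> real) \<Rightarrow> real \<Rightarrow> real \<Rightarrow> real" where
  "Dx \<alpha> u x y = caputo \<alpha> (\<lambda>s. u s y) x"

definition has_Dx :: "real \<Rightarrow> (real \<Rightarrow> real \<Rightarrow> real) \<Rightarrow> real \<Rightarrow> real \<Rightarrow> bool" where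
  "has_Dx \<alpha> u x y \<longleftrightarrow> has_caputo \<alpha> (\<lambda>s. u s y) x"

definition Dyy :: "(real \<Rightarrow> real \<Rightarrow> real) \<Rightarrow> real \<Rightarrow> real \<Rightarrow> real" where
  "Dyy u x y = deriv (deriv (u x)) y"

definition regular_solution :: "real \<Rightarrow> real \<Rightarrow> real \<Rightarrow> (real \<Rightarrow> real \<Rightarrow> real) \<Rightarrow> bool" where
  "regular_solution \<alpha> c \<epsilon> u \<longleftrightarrow>
     continuous_on Omega_bar (\<lambda>(x, y). u x y) \<and>
     (\<forall>(x, y)\<in>Omega. has_Dx \<alpha> u x y) \<and>
     continuous_on Omega (\<lambda>(x, y). Dx \<alpha> u x y) \<and>
     (\<forall>(x, y)\<in>Omega. has_Dx \<alpha> (Dx \<alpha> u) x y) \<and>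
     continuous_on Omega (\<lambda>(x, y). Dx \<alpha> (Dx \<alpha> u) x y) \<and>
     (\<forall>(x, y)\<in>Omega. u x field_differentiable (at y) \<and> deriv (u x) field_differentiable (at y)) \<and>
     continuous_on Omega (\<lambda>(x, y). Dyy u x y) \<and>
     (\<forall>(x, y)\<in>Omega. Dx \<alpha> (Dx \<alpha> u) x y + Dyy u x y - \<epsilon> * Dyy u x (-y) - c\<^sup>2 * u x y = 0)"

text \<open>The derivative in \<open>y\<close> up to the boundary, one-sided at \<open>y = \<plusminus>\<pi>\<close>.\<close>

definition Dy :: "(real \<Rightarrow> real \<Rightarrow> real) \<Rightarrow> real \<Rightarrow> real \<Rightarrow> real" where
  "Dy u x y = deriv_on {-pi..pi} (u x) y"

definition Dy_continuous_on_closure :: "(real \<Rightarrow> real \<Rightarrow> real) \<Rightarrow> bool" where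
  "Dy_continuous_on_closure u \<longleftrightarrow>
     (\<forall>(x, y)\<in>Omega_bar. u x differentiable (at y within {-pi..pi})) \<and>
     continuous_on Omega_bar (\<lambda>(x, y). Dy u x y)"

definition boundary_conditions ::
    "(real \<Rightarrow> real) \<Rightarrow> (real \<Rightarrow> real) \<Rightarrow> (real \<Rightarrow> real \<Rightarrow> real) \<Rightarrow> bool" where
  "boundary_conditions \<phi> \<psi> u \<longleftrightarrow>
     (\<forall>y\<in>{-pi..pi}. u 0 y = \<phi> y \<and> u 1 y = \<psi> y) \<and>
     (\<forall>x\<in>{0..1}. u x (-pi) = u x pi \<and> Dy u x (-pi) = Dy u x pi)"

definition bvp_solution ::
    "real \<Rightarrow> real \<Rightarrow> real \<Rightarrow> (real \<Rightarrow> real) \<Rightarrow> (real \<Rightarrow> real) \<Rightarrow> (real \<Rightarrow> real \<Rightarrow> real) \<Rightarrow> bool" where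
  "bvp_solution \<alpha> c \<epsilon> \<phi> \<psi> u \<longleftrightarrow>
     regular_solution \<alpha> c \<epsilon> u \<and> Dy_continuous_on_closure u \<and> boundary_conditions \<phi> \<psi> u"

definition Y :: "nat \<Rightarrow> real \<Rightarrow> real" where
  "Y n y = (if odd n then sin (real ((n + 1) div 2) * y) else cos (real (n div 2) * y))"

definition lam :: "real \<Rightarrow> nat \<Rightarrow> real" where
  "lam \<epsilon> n = (if odd n then (1 + \<epsilon>) * (real ((n + 1) div 2))\<^sup>2 else (1 - \<epsilon>) * (real (n div 2))\<^sup>2)"

definition mu :: "real \<Rightarrow> real \<Rightarrow> nat \<Rightarrow> real" where
  "mu c \<epsilon> n = sqrt (lam \<epsilon> n + c\<^sup>2)"

definition L2_inner :: "(real \<Rightarrow> real) \<Rightarrow> (real \<Rightarrow> real) \<Rightarrow> real" where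
  "L2_inner f g = (LINT y:{-pi..pi}|lborel. f y * g y)"

text \<open>The functions \<open>Y n\<close> are orthogonal but not normalized, so the Fourier coefficients carry the
  factor \<open>1 / \<parallel>Y n\<parallel>\<^sup>2\<close>, which is \<open>1 / (2\<pi>)\<close> for \<open>n = 0\<close> and \<open>1 / \<pi>\<close> otherwise.\<close>

definition fourier_coeff :: "(real \<Rightarrow> real) \<Rightarrow> nat \<Rightarrow> real" where
  "fourier_coeff f n = L2_inner f (Y n) / L2_inner (Y n) (Y n)"

definition mittag_leffler :: "real \<Rightarrow> real \<Rightarrow> real \<Rightarrow> real" where
  "mittag_leffler \<alpha> \<beta> z = (\<Sum>k. z ^ k / Gamma (\<alpha> * real k + \<beta>))"

definition C_fun :: "real \<Rightarrow> real \<Rightarrow> real \<Rightarrow> real" where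
  "C_fun \<alpha> \<mu> t =
     (mittag_leffler \<alpha> 1 \<mu> * mittag_leffler \<alpha> 1 (-\<mu> * t powr \<alpha>)
        - mittag_leffler \<alpha> 1 (-\<mu>) * mittag_leffler \<alpha> 1 (\<mu> * t powr \<alpha>))
     / (2 * \<mu> * mittag_leffler (2 * \<alpha>) (\<alpha> + 1) (\<mu>\<^sup>2))"

definition S_fun :: "real \<Rightarrow> real \<Rightarrow> real \<Rightarrow> real" where
  "S_fun \<alpha> \<mu> t =
     t powr \<alpha> * mittag_leffler (2 * \<alpha>) (\<alpha> + 1) (\<mu>\<^sup>2 * t powr (2 * \<alpha>))
     / mittag_leffler (2 * \<alpha>) (\<alpha> + 1) (\<mu>\<^sup>2)"

text \<open>The mode constant in \<open>y\<close> solves \<open>D\<^sup>\<alpha> D\<^sup>\<alpha> X = c\<^sup>2 X\<close>, \<open>X 0 = p\<close>, \<open>X 1 = q\<close>. For \<open>c = 0\<close> this is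
  \<open>(1 - x\<^sup>\<alpha>) p + x\<^sup>\<alpha> q\<close>; for \<open>c \<noteq> 0\<close> that expression is not a solution (take \<open>p = q = 1\<close>), and the
  mode is the one with \<open>\<mu>\<^sub>0 = \<bar>c\<bar>\<close>. The first form is the limit of the second as \<open>c\<close> tends to \<open>0\<close>.\<close>

definition zero_mode :: "real \<Rightarrow> real \<Rightarrow> real \<Rightarrow> real \<Rightarrow> real \<Rightarrow> real" where
  "zero_mode \<alpha> c p q x =
     (if c = 0 then (1 - x powr \<alpha>) * p + x powr \<alpha> * q
      else p * C_fun \<alpha> \<bar>c\<bar> x + q * S_fun \<alpha> \<bar>c\<bar> x)"

definition mode :: "real \<Rightarrow> real \<Rightarrow> real \<Rightarrow> (real \<Rightarrow> real) \<Rightarrow> (real \<Rightarrow> real) \<Rightarrow> nat \<Rightarrow> real \<Rightarrow> real \<Rightarrow> real"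
  where
  "mode \<alpha> c \<epsilon> \<phi> \<psi> n x y =
     (fourier_coeff \<phi> n * C_fun \<alpha> (mu c \<epsilon> n) x + fourier_coeff \<psi> n * S_fun \<alpha> (mu c \<epsilon> n) x) * Y n y"

end

theory Submission
  imports Defs
begin

text \<open>Existence: separation of variables. The \<open>n\<close>-th factor in \<open>x\<close> is the solution of
  \<open>D\<^sup>\<alpha> D\<^sup>\<alpha> X = \<mu>\<^sub>n\<^sup>2 X\<close> with \<open>X 0 = \<phi>\<^sub>n\<close>, \<open>X 1 = \<psi>\<^sub>n\<close>. The comparison principle for \<open>D\<^sup>\<alpha>\<close> gives decay bounds for
  \<open>E\<^sub>\<alpha>(-z)\<close>; with growth bounds for \<open>E\<^sub>\<alpha>(z)\<close> they control these factors uniformly in \<open>\<mu>\<^sub>n\<close>, and the Hoelder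
  conditions on \<open>\<phi>\<close> and \<open>\<psi>\<close> provide the decay of the Fourier coefficients which makes the series converge together
  with the derivatives occurring in the equation.

  Uniqueness: let \<open>v\<close> be the difference of two solutions and \<open>V\<close> one of its Fourier coefficients in \<open>y\<close>.
  Nothing is assumed about \<open>D\<^sup>\<alpha> v\<close> near the boundary, so the equation for \<open>v\<close> cannot be integrated in \<open>y\<close>
  directly. Applying the fractional integral of order \<open>2 - 2\<alpha>\<close> in \<open>x\<close> first turns it, for each \<open>y\<close>,
  into \<open>Q'' = c\<^sup>2 v - v\<^sub>y\<^sub>y + \<epsilon> v\<^sub>y\<^sub>y(x, -y)\<close>, whose right-hand side becomes bounded after
  integration over a window in \<open>y\<close>. Solving for \<open>Q\<close> leaves two free constants: one of them is removed by a scale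
  argument using the Lipschitz continuity of \<open>v\<close> in \<open>y\<close>, and the other one by \<open>v 1 y = 0\<close>. Hence
  \<open>V = 0\<close>, and \<open>v = 0\<close> by completeness of the trigonometric system.\<close>

section \<open>Gamma and Beta functions\<close>

text \<open>Uniqueness meets an obstacle that is absent for a single y. For fixed y and \<alpha> < 1
  the function \<open>Q\<close> has no linear term, because \<open>Q x / x\<close> tends to 0 with
  x; but this limit need not be uniform in y, so a linear term may reappear after integration in y
  and has to be excluded separately. The other free function, x to the power 2 - \<alpha>, carries
  the unknown value of the first Caputo derivative at 0. It is a genuine degree of freedom, and only
  the condition at x = 1 can remove it. The order 2 - 2\<alpha> compensates the deficit of two
  derivatives of order \<alpha> against two ordinary ones.

  For existence only a decay of order z^(-1/2) is extracted for E(-z) and E'(-z), where E is the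
  Mittag-Leffler function with \<beta> = 1. It suffices: the coefficients of \<phi> are O(k^-3), and
  k^2 * k^(-1/2) * k^-3 is summable. It also leaves x-derivatives of size x^(\<alpha>/2 - 1), which
  the Caputo kernel can integrate, whereas the order 1/z would lead to 1/x, which is not integrable
  at 0.\<close>

lemma Gamma_add_le:
  fixes x s :: real
  assumes "0 < x" "0 \<le> s" "s \<le> 1"
  shows "Gamma (x + s) \<le> x powr s * Gamma x"
proof -
  \<comment> \<open>\<open>ln \<circ> Gamma\<close> lies below its chord over [x, x + 1], and Gamma
    (x + 1) = x * Gamma x.\<close>
  have "(ln \<circ> Gamma) ((1 - s) *\<^sub>R x + s *\<^sub>R (x + 1)) \<le> (1 - s) * (ln \<circ> Gamma) x + s * (ln \<circ> Gamma) (x + 1)"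
    by (rule convex_onD[OF log_convex_Gamma_real]) (use assms in auto)
  moreover have "(1 - s) *\<^sub>R x + s *\<^sub>R (x + 1) = x + s"
    by (simp add: algebra_simps)
  moreover have "ln (Gamma (x + 1)) = ln x + ln (Gamma x)"
    using assms by (subst Gamma_plus1) (auto simp: ln_mult less_imp_neq[OF Gamma_real_pos, symmetric] elim!: nonpos_Ints_cases')
  ultimately have "ln (Gamma (x + s)) \<le> s * ln x + ln (Gamma x)"
    by (simp add: algebra_simps)
  also have "\<dots> = ln (x powr s * Gamma x)"
    using assms less_imp_neq[OF Gamma_real_pos[of x]] by (simp add: ln_mult ln_powr)
  finally show ?thesis
    using assms by (subst (asm) ln_le_cancel_iff) auto
qed

text \<open>The upper bound \<open>Gamma_add_le\<close> is applied from x + s up to x + 1; since s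
  <= x, the base x + s may be replaced by 2 * x.\<close>

lemma Gamma_ratio_ge:
  fixes x s :: real
  assumes "1 \<le> x" "0 < s" "s \<le> 1"
  shows "x powr s * Gamma x \<le> 2 * Gamma (x + s)"
proof -
  have "x * Gamma x = Gamma (x + 1)"
    using assms by (subst Gamma_plus1) (auto elim!: nonpos_Ints_cases')
  also have "\<dots> \<le> (x + s) powr (1 - s) * Gamma (x + s)"
    using Gamma_add_le[of "x + s" "1 - s"] assms by (simp add: algebra_simps)
  also have "\<dots> \<le> (2 * x) powr (1 - s) * Gamma (x + s)"
    using assms by (intro mult_right_mono powr_mono2) (auto intro!: less_imp_le Gamma_real_pos)
  also have "(2 * x) powr (1 - s) = 2 powr (1 - s) * x powr (1 - s)"
    using assms by (simp add: powr_mult)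
  also have "2 powr (1 - s) * x powr (1 - s) * Gamma (x + s)
      \<le> 2 powr 1 * x powr (1 - s) * Gamma (x + s)"
    using assms by (intro mult_right_mono powr_mono) (auto intro!: less_imp_le Gamma_real_pos)
  finally have "x powr s * (x * Gamma x) \<le> x powr s * (2 * x powr (1 - s) * Gamma (x + s))"
    by (intro mult_left_mono) auto
  also have "\<dots> = x * (2 * Gamma (x + s))"
    using assms by (simp add: powr_add[symmetric] mult_ac)
  also have "x powr s * (x * Gamma x) = x * (x powr s * Gamma x)"
    by simp
  finally show ?thesis
    using assms by simp
qed

text \<open>The Beta integral comes as a gauge integral, while Caputo derivatives are Lebesgue
  integrals over \<open>lborel\<close>; for nonnegative Borel functions the two agree.\<close>

lemma set_integrable_lborel_nonneg:
  fixes f :: "real \<Rightarrow> real"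
  assumes "(f has_integral I) S" "\<And>s. s \<in> S \<Longrightarrow> 0 \<le> f s" "set_borel_measurable lborel S f"
  shows "set_integrable lborel S f" "(LINT s:S|lborel. f s) = I"
proof -
  have "set_integrable lebesgue S f"
    using assms by (intro nonnegative_absolutely_integrable_1) auto
  then show *: "set_integrable lborel S f"
    using assms(3) unfolding set_integrable_def set_borel_measurable_def
    by (subst (asm) integrable_completion) auto
  show "(LINT s:S|lborel. f s) = I"
    using set_borel_integral_eq_integral(2)[OF *] assms(1) by (simp add: integral_unique)
qed

text \<open>Euler's Beta integral under the substitution s = x * t. It gives the fractional integral
  of a power, and its integrability part serves as a majorant for singular integrands later.\<close>

lemma Beta_kernel:
  fixes b d x :: real
  assumes "0 < b" "0 < d" "0 < x"
  shows "set_integrable lborel {0<..<x} (\<lambda>s. (x - s) powr (b - 1) * s powr (d - 1))"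
    and "(LINT s:{0<..<x}|lborel. (x - s) powr (b - 1) * s powr (d - 1)) = Beta b d * x powr (b + d - 1)"
proof -
  have "((\<lambda>t. t powr (d - 1) * (1 - t) powr (b - 1)) has_integral Beta d b) (cbox 0 1)"
    using has_integral_Beta_real[OF assms(2,1)] by simp
  from has_integral_affinity[OF this, of "1 / x" 0]
  moreover have "(\<lambda>t. t * x) ` {0..1} = {0..x}"
    using image_mult_atLeastAtMost[of x 0 1] assms by (simp add: mult.commute[of _ x])
  ultimately have "((\<lambda>t. (t / x) powr (d - 1) * (1 - t / x) powr (b - 1)) has_integral x * Beta d b) {0..x}"
    using assms by simp
  from has_integral_mult_right[OF this, of "x powr (b + d - 2)"]
  have "((\<lambda>t. x powr (b + d - 2) * ((t / x) powr (d - 1) * (1 - t / x) powr (b - 1)))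
      has_integral x powr (b + d - 2) * (x * Beta d b)) {0<..<x}"
    by (simp add: has_integral_Icc_iff_Ioo)
  also have "x powr (b + d - 2) * (x * Beta d b) = Beta b d * x powr (b + d - 1)"
    using powr_mult_base[of x "b + d - 2"] assms by (simp add: Beta_commute mult_ac)
  finally have "((\<lambda>s. (x - s) powr (b - 1) * s powr (d - 1)) has_integral Beta b d * x powr (b + d - 1)) {0<..<x}"
  proof (rule has_integral_eq[rotated])
    fix s assume s: "s \<in> {0<..<x}"
    have "x powr (b + d - 2) = x powr (d - 1) * x powr (b - 1)"
      using assms by (simp add: powr_add[symmetric] algebra_simps)
    moreover have "(x - s) = x * (1 - s / x)" using assms by (simp add: field_simps)
    ultimately show "x powr (b + d - 2) * ((s / x) powr (d - 1) * (1 - s / x) powr (b - 1)) =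
        (x - s) powr (b - 1) * s powr (d - 1)"
      using assms s by (simp add: powr_mult powr_divide)
  qed
  from set_integrable_lborel_nonneg[OF this]
  show "set_integrable lborel {0<..<x} (\<lambda>s. (x - s) powr (b - 1) * s powr (d - 1))"
    and "(LINT s:{0<..<x}|lborel. (x - s) powr (b - 1) * s powr (d - 1)) = Beta b d * x powr (b + d - 1)"
    by (auto simp: set_borel_measurable_def)
qed

lemma Beta_pos: "0 < a \<Longrightarrow> 0 < b \<Longrightarrow> 0 < Beta a (b::real)"
  by (auto simp: Beta_def)

section \<open>Power series in a fractional power\<close>

lemma powser_everywhere_abs:
  fixes a :: "nat \<Rightarrow> real"
  assumes "\<And>z. summable (\<lambda>k. a k * z ^ k)"
  shows "summable (\<lambda>k. \<bar>a k\<bar> * z ^ k)" "summable (\<lambda>k. \<bar>a k * z ^ k\<bar>)"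
proof -
  show *: "summable (\<lambda>k. \<bar>a k * z ^ k\<bar>)" for z
    using powser_insidea[OF assms[of "\<bar>z\<bar> + 1"], of z] by simp
  show "summable (\<lambda>k. \<bar>a k\<bar> * z ^ k)"
    by (rule summable_rabs_cancel) (use *[of z] in \<open>simp add: abs_mult\<close>)
qed

text \<open>Termwise integration is allowed because Beta decreases in its second argument: the
  integrated series is dominated by \<open>Beta b d\<close> times a power series that converges
  absolutely everywhere.\<close>

lemma frac_integral_powser:
  fixes a :: "nat \<Rightarrow> real" and \<alpha> b d x :: real
  assumes \<alpha>: "0 < \<alpha>" "0 < b" "0 < d" "0 < x" and a: "\<And>z. summable (\<lambda>k. a k * z ^ k)"
  shows "set_integrable lborel {0<..<x}
      (\<lambda>s. (x - s) powr (b - 1) * (s powr (d - 1) * (\<Sum>k. a k * (s powr \<alpha>) ^ k)))"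
    and "(LINT s:{0<..<x}|lborel. (x - s) powr (b - 1) * (s powr (d - 1) * (\<Sum>k. a k * (s powr \<alpha>) ^ k)))
      = x powr (b + d - 1) * (\<Sum>k. a k * Beta b (d + \<alpha> * k) * (x powr \<alpha>) ^ k)"
    and "summable (\<lambda>k. a k * Beta b (d + \<alpha> * k) * (x powr \<alpha>) ^ k)"
proof -
  define g where "g k s = indicator {0<..<x} s * ((x - s) powr (b - 1) * s powr (d + \<alpha> * k - 1))" for k :: nat and s
  have g: "integrable lborel (g k)" "(\<integral>s. g k s \<partial>lborel) = Beta b (d + \<alpha> * k) * x powr (b + d - 1) * (x powr \<alpha>) ^ k" for k
    using Beta_kernel[of b "d + \<alpha> * k" x] assms
    unfolding g_def set_integrable_def set_lebesgue_integral_def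
    by (auto simp: add_pos_nonneg powr_realpow[symmetric] powr_powr powr_add[symmetric] algebra_simps)
  have g0: "0 \<le> g k s" for k s by (auto simp: g_def)
  have geq: "g k s = indicator {0<..<x} s * ((x - s) powr (b - 1) * s powr (d - 1) * (s powr \<alpha>) ^ k)" for k s
    by (auto simp: g_def indicator_def powr_realpow[symmetric] powr_powr powr_add[symmetric] algebra_simps)
  have B: "Beta b (d + \<alpha> * k) \<le> Beta b d" for k :: nat
    using Beta_real_mono[of b b d "d + \<alpha> * k"] assms by auto
  have B0: "0 < Beta b (d + \<alpha> * k)" for k :: nat
    using assms by (intro Beta_pos add_pos_nonneg) auto
  have sB: "summable (\<lambda>k. \<bar>a k * Beta b (d + \<alpha> * k) * (x powr \<alpha>) ^ k\<bar>)"
  proof (rule summable_comparison_test')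
    show "summable (\<lambda>k. Beta b d * (\<bar>a k\<bar> * (x powr \<alpha>) ^ k))"
      by (intro summable_mult powser_everywhere_abs a)
    show "norm \<bar>a k * Beta b (d + \<alpha> * k) * (x powr \<alpha>) ^ k\<bar> \<le> Beta b d * (\<bar>a k\<bar> * (x powr \<alpha>) ^ k)" if "k \<ge> 0" for k
      using mult_right_mono[OF B[of k], of "\<bar>a k\<bar> * (x powr \<alpha>) ^ k"] less_imp_le[OF B0[of k]]
      by (simp add: abs_mult mult_ac)
  qed
  then show "summable (\<lambda>k. a k * Beta b (d + \<alpha> * k) * (x powr \<alpha>) ^ k)"
    by (rule summable_rabs_cancel)
  have int: "integrable lborel (\<lambda>s. a k * g k s)" for k
    using g by simp
  have 1: "AE s in lborel. summable (\<lambda>k. norm (a k * g k s))"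
  proof (rule AE_I2)
    fix s :: real
    have "summable (\<lambda>k. (indicator {0<..<x} s * ((x - s) powr (b - 1) * s powr (d - 1))) * \<bar>a k * (s powr \<alpha>) ^ k\<bar>)"
      by (intro summable_mult powser_everywhere_abs a)
    then show "summable (\<lambda>k. norm (a k * g k s))"
      by (simp add: geq abs_mult mult_ac)
  qed
  have 2: "summable (\<lambda>k. \<integral>s. norm (a k * g k s) \<partial>lborel)"
  proof -
    have "(\<integral>s. norm (a k * g k s) \<partial>lborel) = x powr (b + d - 1) * \<bar>a k * Beta b (d + \<alpha> * k) * (x powr \<alpha>) ^ k\<bar>" for k
      using g(2)[of k] g0 B0[of k] by (simp add: abs_mult abs_of_nonneg mult_ac)
    then show ?thesis
      using summable_mult[OF sB, of "x powr (b + d - 1)"] by simp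
  qed
  have sg: "(\<Sum>k. a k * g k s) = indicator {0<..<x} s * ((x - s) powr (b - 1) * (s powr (d - 1) * (\<Sum>k. a k * (s powr \<alpha>) ^ k)))" for s
  proof -
    have "(\<Sum>k. a k * g k s) = (\<Sum>k. (indicator {0<..<x} s * ((x - s) powr (b - 1) * s powr (d - 1))) * (a k * (s powr \<alpha>) ^ k))"
      by (simp add: geq mult_ac)
    then show ?thesis
      by (subst (asm) suminf_mult) (auto intro!: a simp: mult_ac)
  qed
  show "set_integrable lborel {0<..<x}
      (\<lambda>s. (x - s) powr (b - 1) * (s powr (d - 1) * (\<Sum>k. a k * (s powr \<alpha>) ^ k)))"
    using integrable_suminf[OF int 1 2] unfolding sg set_integrable_def by simp
  have "(LINT s:{0<..<x}|lborel. (x - s) powr (b - 1) * (s powr (d - 1) * (\<Sum>k. a k * (s powr \<alpha>) ^ k)))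
     = (\<integral>s. (\<Sum>k. a k * g k s) \<partial>lborel)"
    unfolding sg set_lebesgue_integral_def by simp
  also have "\<dots> = (\<Sum>k. \<integral>s. a k * g k s \<partial>lborel)"
    by (rule integral_suminf[OF int 1 2])
  also have "\<dots> = (\<Sum>k. x powr (b + d - 1) * (a k * Beta b (d + \<alpha> * k) * (x powr \<alpha>) ^ k))"
    using g by (simp add: mult_ac)
  also have "\<dots> = x powr (b + d - 1) * (\<Sum>k. a k * Beta b (d + \<alpha> * k) * (x powr \<alpha>) ^ k)"
    using summable_rabs_cancel[OF sB] by (rule suminf_mult)
  finally show "(LINT s:{0<..<x}|lborel. (x - s) powr (b - 1) * (s powr (d - 1) * (\<Sum>k. a k * (s powr \<alpha>) ^ k)))
      = x powr (b + d - 1) * (\<Sum>k. a k * Beta b (d + \<alpha> * k) * (x powr \<alpha>) ^ k)" .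
qed

lemma powser_frac_deriv:
  fixes a :: "nat \<Rightarrow> real"
  assumes a: "\<And>z. summable (\<lambda>k. a k * z ^ k)" and s: "0 < s"
  shows "((\<lambda>s. \<Sum>k. a k * (s powr \<alpha>) ^ k) has_field_derivative
      \<alpha> * s powr (\<alpha> - 1) * (\<Sum>k. diffs a k * (s powr \<alpha>) ^ k)) (at s)"
proof -
  have "((\<lambda>z. \<Sum>k. a k * z ^ k) has_field_derivative (\<Sum>k. diffs a k * (s powr \<alpha>) ^ k)) (at (s powr \<alpha>))"
    by (rule termdiffs_strong_converges_everywhere[OF a])
  from DERIV_chain2[where g = "\<lambda>s. s powr \<alpha>", OF this has_real_derivative_powr[OF s, of \<alpha>]] show ?thesis
    by (simp add: mult_ac)
qed

text \<open>On series in s powr \<alpha> the Caputo derivative acts as a weighted shift of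
  coefficients: s powr (\<alpha> * k) / Gamma (\<alpha> * k + 1) goes to its predecessor. This is
  why Mittag-Leffler functions are eigenfunctions.\<close>

lemma caputo_powser:
  fixes a :: "nat \<Rightarrow> real"
  assumes \<alpha>: "0 < \<alpha>" "\<alpha> \<le> 1" and a: "\<And>z. summable (\<lambda>k. a k * z ^ k)" and x: "0 < x"
  defines "f \<equiv> \<lambda>s. \<Sum>k. a k * (s powr \<alpha>) ^ k"
  shows "has_caputo \<alpha> f x"
    and "caputo \<alpha> f x = (\<Sum>k. a (Suc k) * (Gamma (\<alpha> * Suc k + 1) / Gamma (\<alpha> * k + 1)) * (x powr \<alpha>) ^ k)"
proof -
  have der: "(f has_field_derivative \<alpha> * s powr (\<alpha> - 1) * (\<Sum>k. diffs a k * (s powr \<alpha>) ^ k)) (at s)" if "0 < s" for s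
    unfolding f_def by (rule powser_frac_deriv[OF a that])
  have da: "summable (\<lambda>k. diffs a k * z ^ k)" for z
    by (rule termdiff_converges_all) (rule a)
  have ne: "\<alpha> * Suc k \<notin> \<int>\<^sub>\<le>\<^sub>0" for k
  proof -
    have "0 < \<alpha> * real (Suc k)" using \<alpha> by (intro mult_pos_pos) auto
    then show ?thesis by (meson nonpos_Ints_nonpos not_le)
  qed
  have G: "Gamma (\<alpha> * Suc k + 1) = \<alpha> * Suc k * Gamma (\<alpha> * Suc k)" for k
    by (rule Gamma_plus1[OF ne])
  have fd: "f field_differentiable (at s)" if "0 < s" for s
    using der[OF that] unfolding field_differentiable_def by blast
  show "has_caputo \<alpha> f x"
  proof (cases "\<alpha> = 1")
    case True
    then show ?thesis
      using fd[OF x] by (simp add: has_caputo_def)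
  next
    case False
    have "set_integrable lborel {0<..<x} (\<lambda>s. (x - s) powr ((1 - \<alpha>) - 1) * (s powr (\<alpha> - 1) * (\<Sum>k. diffs a k * (s powr \<alpha>) ^ k)))"
      using \<alpha> False x by (intro frac_integral_powser da) auto
    then have "set_integrable lborel {0<..<x} (\<lambda>s. \<alpha> * ((x - s) powr (- \<alpha>) * (s powr (\<alpha> - 1) * (\<Sum>k. diffs a k * (s powr \<alpha>) ^ k))))"
      by simp
    also have "?this \<longleftrightarrow> set_integrable lborel {0<..<x} (\<lambda>s. (x - s) powr (- \<alpha>) * deriv f s)"
      by (rule set_integrable_cong) (auto simp: DERIV_imp_deriv[OF der])
    finally show ?thesis
      using False fd by (simp add: has_caputo_def)
  qed
  show "caputo \<alpha> f x = (\<Sum>k. a (Suc k) * (Gamma (\<alpha> * Suc k + 1) / Gamma (\<alpha> * k + 1)) * (x powr \<alpha>) ^ k)"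
  proof (cases "\<alpha> = 1")
    case True
    have "Gamma (real (Suc k) + 1) / Gamma (real k + 1) = Suc k" for k
      using G[of k] True by (simp add: add_ac Gamma_eq_zero_iff) (auto elim!: nonpos_Ints_cases')
    then show ?thesis
      using True x by (simp add: caputo_def DERIV_imp_deriv[OF der] diffs_def mult_ac del: of_nat_Suc)
  next
    case False
    have "(LINT s:{0<..<x}|lborel. (x - s) powr (- \<alpha>) * deriv f s)
       = (LINT s:{0<..<x}|lborel. \<alpha> * ((x - s) powr ((1 - \<alpha>) - 1) * (s powr (\<alpha> - 1) * (\<Sum>k. diffs a k * (s powr \<alpha>) ^ k))))"
      by (intro set_lebesgue_integral_cong) (auto simp: DERIV_imp_deriv[OF der])
    also have "\<dots> = \<alpha> * (LINT s:{0<..<x}|lborel. (x - s) powr ((1 - \<alpha>) - 1) * (s powr (\<alpha> - 1) * (\<Sum>k. diffs a k * (s powr \<alpha>) ^ k)))"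
      by simp
    also have "\<dots> = \<alpha> * (\<Sum>k. diffs a k * Beta (1 - \<alpha>) (\<alpha> + \<alpha> * k) * (x powr \<alpha>) ^ k)"
      using \<alpha> False x by (subst frac_integral_powser) (auto intro!: da)
    finally have "caputo \<alpha> f x = (\<alpha> / Gamma (1 - \<alpha>)) * (\<Sum>k. diffs a k * Beta (1 - \<alpha>) (\<alpha> + \<alpha> * k) * (x powr \<alpha>) ^ k)"
      using False by (simp add: caputo_def)
    also have "\<dots> = (\<Sum>k. (\<alpha> / Gamma (1 - \<alpha>)) * (diffs a k * Beta (1 - \<alpha>) (\<alpha> + \<alpha> * k) * (x powr \<alpha>) ^ k))"
      using \<alpha> False x by (intro suminf_mult[symmetric] frac_integral_powser) (auto intro!: da)
    also have "\<dots> = (\<Sum>k. a (Suc k) * (Gamma (\<alpha> * Suc k + 1) / Gamma (\<alpha> * k + 1)) * (x powr \<alpha>) ^ k)"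
    proof (rule suminf_cong)
      fix k
      have "Gamma (1 - \<alpha>) > 0" using \<alpha> False by auto
      moreover have "\<alpha> + \<alpha> * k = \<alpha> * Suc k" "1 - \<alpha> + \<alpha> * Suc k = \<alpha> * k + 1" by (simp_all add: algebra_simps)
      then have "Beta (1 - \<alpha>) (\<alpha> + \<alpha> * k) = Gamma (1 - \<alpha>) * Gamma (\<alpha> * Suc k) / Gamma (\<alpha> * k + 1)"
        by (simp only: Beta_def)
      ultimately show "(\<alpha> / Gamma (1 - \<alpha>)) * (diffs a k * Beta (1 - \<alpha>) (\<alpha> + \<alpha> * k) * (x powr \<alpha>) ^ k) =
        a (Suc k) * (Gamma (\<alpha> * Suc k + 1) / Gamma (\<alpha> * k + 1)) * (x powr \<alpha>) ^ k"
        by (simp only: G diffs_def) simp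
    qed
    finally show ?thesis .
  qed
qed

section \<open>Mittag-Leffler functions\<close>

definition ml_coeff :: "real \<Rightarrow> nat \<Rightarrow> real" where
  "ml_coeff \<alpha> k = 1 / Gamma (\<alpha> * real k + 1)"

definition ml_deriv :: "real \<Rightarrow> real \<Rightarrow> real" where
  "ml_deriv \<alpha> z = (\<Sum>k. diffs (ml_coeff \<alpha>) k * z ^ k)"

lemma ml_coeff_pos: "0 \<le> \<alpha> \<Longrightarrow> 0 < ml_coeff \<alpha> k"
  by (simp add: ml_coeff_def add_nonneg_pos)

lemma ml_coeff_0 [simp]: "ml_coeff \<alpha> 0 = 1"
  by (simp add: ml_coeff_def)

lemma mittag_leffler_1: "mittag_leffler \<alpha> 1 z = (\<Sum>k. ml_coeff \<alpha> k * z ^ k)"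
  by (simp add: mittag_leffler_def ml_coeff_def)

text \<open>Consecutive coefficients have a ratio of order k powr (- \<alpha>); as this tends to 0,
  the series is entire.\<close>

lemma ml_coeff_Suc_le:
  assumes "0 < \<alpha>" "\<alpha> \<le> 1"
  shows "ml_coeff \<alpha> (Suc k) \<le> 2 * (\<alpha> * real k + 1) powr (- \<alpha>) * ml_coeff \<alpha> k"
proof -
  have p: "0 < Gamma (\<alpha> * real k + 1)" "0 < Gamma (\<alpha> * real k + 1 + \<alpha>)" "0 < (\<alpha> * real k + 1) powr \<alpha>"
    using assms add_nonneg_pos[of "\<alpha> * real k" 1] by (auto intro!: Gamma_real_pos add_nonneg_pos)
  have "\<alpha> * real (Suc k) + 1 = \<alpha> * real k + 1 + \<alpha>" by (simp add: algebra_simps)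
  moreover have "(\<alpha> * real k + 1) powr \<alpha> * Gamma (\<alpha> * real k + 1) \<le> 2 * Gamma (\<alpha> * real k + 1 + \<alpha>)"
    using assms by (intro Gamma_ratio_ge) auto
  ultimately show ?thesis
    using p by (simp add: ml_coeff_def powr_minus field_simps)
qed

text \<open>The coefficients fall no faster than those of the exponential function. Bounding a
  coefficient by a later one is what absorbs powers of z in
  \<open>mittag_leffler_growth\<close>.\<close>

lemma ml_coeff_le_Suc:
  assumes "0 < \<alpha>" "\<alpha> \<le> 1"
  shows "ml_coeff \<alpha> k \<le> real (Suc k) * ml_coeff \<alpha> (Suc k)"
proof -
  have k: "0 < \<alpha> * real k + 1"
    using assms by (intro add_nonneg_pos) auto
  have p: "0 < Gamma (\<alpha> * real k + 1)" "0 < Gamma (\<alpha> * real k + 1 + \<alpha>)"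
    by (rule Gamma_real_pos[OF k], rule Gamma_real_pos[OF add_pos_pos[OF k assms(1)]])
  have p1: "1 \<le> \<alpha> * real k + 1" using assms by simp
  have eq: "\<alpha> * real (Suc k) + 1 = \<alpha> * real k + 1 + \<alpha>" by (simp add: algebra_simps)
  have "(\<alpha> * real k + 1) powr \<alpha> \<le> (\<alpha> * real k + 1) powr 1"
    using assms p1 by (intro powr_mono) auto
  also have "\<dots> = \<alpha> * real k + 1" using k by simp
  also have "\<dots> \<le> real (Suc k)" using assms mult_right_mono[of \<alpha> 1 "real k"] by simp
  finally have "(\<alpha> * real k + 1) powr \<alpha> * Gamma (\<alpha> * real k + 1) \<le> real (Suc k) * Gamma (\<alpha> * real k + 1)"
    using p by (intro mult_right_mono) auto
  moreover have "Gamma (\<alpha> * real k + 1 + \<alpha>) \<le> (\<alpha> * real k + 1) powr \<alpha> * Gamma (\<alpha> * real k + 1)"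
    using assms k by (intro Gamma_add_le) auto
  ultimately have "Gamma (\<alpha> * real k + 1 + \<alpha>) \<le> real (Suc k) * Gamma (\<alpha> * real k + 1)"
    by simp
  then show ?thesis
    using p unfolding ml_coeff_def eq by (simp add: field_simps del: of_nat_Suc)
qed

lemma summable_ml_coeff:
  assumes "0 < \<alpha>" "\<alpha> \<le> 1"
  shows "summable (\<lambda>k. ml_coeff \<alpha> k * z ^ k)"
proof -
  \<comment> \<open>Chosen so that (\<alpha> * n) powr \<alpha> >= 4 * |z| for n >= N; by
    \<open>ml_coeff_Suc_le\<close> consecutive terms then have ratio at most 1/2.\<close>
  obtain N :: nat where N: "(4 * \<bar>z\<bar> + 1) powr (1 / \<alpha>) / \<alpha> \<le> real N"
    using real_arch_simple by blast
  show ?thesis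
  proof (rule summable_ratio_test[of "1/2" N])
    fix n assume n: "N \<le> n"
    have "(4 * \<bar>z\<bar> + 1) powr (1 / \<alpha>) \<le> \<alpha> * real N"
      using N assms by (simp add: field_simps)
    also have "\<dots> \<le> \<alpha> * real n + 1"
      using mult_left_mono[of "real N" "real n" \<alpha>] n assms by linarith
    finally have "((4 * \<bar>z\<bar> + 1) powr (1 / \<alpha>)) powr \<alpha> \<le> (\<alpha> * real n + 1) powr \<alpha>"
      using assms by (intro powr_mono2) auto
    then have big: "4 * \<bar>z\<bar> \<le> (\<alpha> * real n + 1) powr \<alpha>"
      using assms by (simp add: powr_powr)
    have "0 < (\<alpha> * real n + 1) powr \<alpha>"
      using assms add_nonneg_pos[of "\<alpha> * real n" 1] by auto
    then have "2 * (\<alpha> * real n + 1) powr (- \<alpha>) * \<bar>z\<bar> \<le> 1 / 2"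
      using big by (simp add: powr_minus field_simps)
    then have "2 * (\<alpha> * real n + 1) powr (- \<alpha>) * \<bar>z\<bar> * (ml_coeff \<alpha> n * \<bar>z\<bar> ^ n) \<le> 1 / 2 * (ml_coeff \<alpha> n * \<bar>z\<bar> ^ n)"
      using ml_coeff_pos[of \<alpha> n] assms by (intro mult_right_mono) auto
    also have "2 * (\<alpha> * real n + 1) powr (- \<alpha>) * \<bar>z\<bar> * (ml_coeff \<alpha> n * \<bar>z\<bar> ^ n) =
        2 * (\<alpha> * real n + 1) powr (- \<alpha>) * ml_coeff \<alpha> n * \<bar>z\<bar> ^ Suc n"
      by simp
    finally have "2 * (\<alpha> * real n + 1) powr (- \<alpha>) * ml_coeff \<alpha> n * \<bar>z\<bar> ^ Suc n \<le> 1 / 2 * (ml_coeff \<alpha> n * \<bar>z\<bar> ^ n)" .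
    moreover have "ml_coeff \<alpha> (Suc n) * \<bar>z\<bar> ^ Suc n \<le> 2 * (\<alpha> * real n + 1) powr (- \<alpha>) * ml_coeff \<alpha> n * \<bar>z\<bar> ^ Suc n"
      using assms by (intro mult_right_mono ml_coeff_Suc_le) auto
    moreover have "norm (ml_coeff \<alpha> k * z ^ k) = ml_coeff \<alpha> k * \<bar>z\<bar> ^ k" for k
      using ml_coeff_pos[of \<alpha> k] assms by (simp add: abs_mult power_abs)
    ultimately show "norm (ml_coeff \<alpha> (Suc n) * z ^ Suc n) \<le> 1 / 2 * norm (ml_coeff \<alpha> n * z ^ n)"
      by (metis order_trans)
  qed simp
qed

text \<open>Multiplying the k-th coefficient by k is the Euler operator z * d/dz.\<close>

lemma summable_index_mult:
  fixes a :: "nat \<Rightarrow> real"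
  assumes "\<And>z. summable (\<lambda>k. a k * z ^ k)"
  shows "summable (\<lambda>k. real k * a k * z ^ k)"
    and "(\<Sum>k. real k * a k * z ^ k) = z * (\<Sum>k. diffs a k * z ^ k)"
proof -
  have d: "summable (\<lambda>k. diffs a k * z ^ k)"
    by (rule termdiff_converges_all) (rule assms)
  have eq: "z * (diffs a k * z ^ k) = real (Suc k) * a (Suc k) * z ^ Suc k" for k
    by (simp add: diffs_def mult_ac)
  have "summable (\<lambda>k. real (Suc k) * a (Suc k) * z ^ Suc k)"
    using summable_mult[OF d, of z] unfolding eq .
  then show *: "summable (\<lambda>k. real k * a k * z ^ k)"
    by (subst (asm) summable_Suc_iff)
  have "(\<Sum>k. real k * a k * z ^ k) = (\<Sum>k. real (Suc k) * a (Suc k) * z ^ Suc k)"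
    using suminf_split_head[OF *] by simp
  also have "\<dots> = z * (\<Sum>k. diffs a k * z ^ k)"
    using suminf_mult[OF d, of z] unfolding eq .
  finally show "(\<Sum>k. real k * a k * z ^ k) = z * (\<Sum>k. diffs a k * z ^ k)" .
qed

lemma has_deriv_mittag_leffler:
  assumes "0 < \<alpha>" "\<alpha> \<le> 1"
  shows "(mittag_leffler \<alpha> 1 has_field_derivative ml_deriv \<alpha> z) (at z)"
  unfolding mittag_leffler_1[abs_def] ml_deriv_def
  by (rule termdiffs_strong_converges_everywhere) (rule summable_ml_coeff[OF assms])

lemma mittag_leffler_1_0 [simp]: "mittag_leffler \<alpha> 1 0 = 1"
  unfolding mittag_leffler_1 by (subst powser_zero) simp

lemma caputo_mittag_leffler:
  assumes "0 < \<alpha>" "\<alpha> \<le> 1" "0 < x"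
  shows "((\<lambda>s. mittag_leffler \<alpha> 1 (l * s powr \<alpha>)) has_field_derivative
      l * \<alpha> * x powr (\<alpha> - 1) * ml_deriv \<alpha> (l * x powr \<alpha>)) (at x)"
    and "has_caputo \<alpha> (\<lambda>s. mittag_leffler \<alpha> 1 (l * s powr \<alpha>)) x"
    and "caputo \<alpha> (\<lambda>s. mittag_leffler \<alpha> 1 (l * s powr \<alpha>)) x = l * mittag_leffler \<alpha> 1 (l * x powr \<alpha>)"
proof -
  define a where "a k = ml_coeff \<alpha> k * l ^ k" for k
  have a: "summable (\<lambda>k. a k * z ^ k)" for z
    using summable_ml_coeff[OF assms(1,2), of "l * z"] by (simp add: a_def power_mult_distrib mult_ac)
  have f: "(\<lambda>s. mittag_leffler \<alpha> 1 (l * s powr \<alpha>)) = (\<lambda>s. \<Sum>k. a k * (s powr \<alpha>) ^ k)"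
    by (simp add: mittag_leffler_1 a_def power_mult_distrib mult_ac)
  show "has_caputo \<alpha> (\<lambda>s. mittag_leffler \<alpha> 1 (l * s powr \<alpha>)) x"
    unfolding f by (rule caputo_powser[OF assms(1,2) a assms(3)])
  have "caputo \<alpha> (\<lambda>s. mittag_leffler \<alpha> 1 (l * s powr \<alpha>)) x =
      (\<Sum>k. l * (ml_coeff \<alpha> k * (l * x powr \<alpha>) ^ k))"
    unfolding f caputo_powser[OF assms(1,2) a assms(3)]
  proof (rule suminf_cong)
    fix k
    have "0 < Gamma (\<alpha> * Suc k + 1)"
      using assms by (intro Gamma_real_pos add_nonneg_pos) auto
    then show "a (Suc k) * (Gamma (\<alpha> * Suc k + 1) / Gamma (\<alpha> * k + 1)) * (x powr \<alpha>) ^ k =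
        l * (ml_coeff \<alpha> k * (l * x powr \<alpha>) ^ k)"
      by (simp add: a_def ml_coeff_def power_mult_distrib del: of_nat_Suc)
  qed
  also have "\<dots> = l * mittag_leffler \<alpha> 1 (l * x powr \<alpha>)"
    unfolding mittag_leffler_1 by (intro suminf_mult summable_ml_coeff assms)
  finally show "caputo \<alpha> (\<lambda>s. mittag_leffler \<alpha> 1 (l * s powr \<alpha>)) x = l * mittag_leffler \<alpha> 1 (l * x powr \<alpha>)" .
  have "((\<lambda>s. l * s powr \<alpha>) has_field_derivative l * (\<alpha> * x powr (\<alpha> - 1))) (at x)"
    by (intro DERIV_cmult has_real_derivative_powr assms)
  from DERIV_chain2[where g = "\<lambda>s. l * s powr \<alpha>", OF has_deriv_mittag_leffler[OF assms(1,2)] this]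
  show "((\<lambda>s. mittag_leffler \<alpha> 1 (l * s powr \<alpha>)) has_field_derivative
      l * \<alpha> * x powr (\<alpha> - 1) * ml_deriv \<alpha> (l * x powr \<alpha>)) (at x)"
    by (simp add: mult_ac)
qed

text \<open>The extremum principle. Integrating by parts against \<open>(t - s) powr (-\<alpha>)\<close> moves the derivative
  onto the kernel, which then only meets the nonnegative function \<open>f s - f t\<close>.\<close>

lemma caputo_neg_at_min:
  assumes \<alpha>: "0 < \<alpha>" "\<alpha> < 1" and t: "0 < t"
    and cont: "continuous_on {0..t} f"
    and der: "\<And>s. 0 < s \<Longrightarrow> s \<le> t \<Longrightarrow> f field_differentiable (at s)"
    and cap: "has_caputo \<alpha> f t"
    and min: "\<And>s. 0 \<le> s \<Longrightarrow> s \<le> t \<Longrightarrow> f t \<le> f s" and less: "f t < f 0"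
  shows "caputo \<alpha> f t < 0"
proof -
  define G where "G s = (t - s) powr (- \<alpha>) * (f s - f t)" for s
  define G' where "G' s = (t - s) powr (- \<alpha>) * deriv f s + \<alpha> * (t - s) powr (- \<alpha> - 1) * (f s - f t)" for s
  have f': "(f has_field_derivative deriv f s) (at s)" if "0 < s" "s \<le> t" for s
    using der[OF that] by (simp add: DERIV_deriv_iff_field_differentiable)
  have Gder: "(G has_field_derivative G' s) (at s)" if "s \<in> {0<..<t}" for s
  proof -
    have "((\<lambda>s. (t - s) powr (- \<alpha>)) has_field_derivative \<alpha> * (t - s) powr (- \<alpha> - 1)) (at s)"
      using that by (auto intro!: derivative_eq_intros simp: field_simps)
    moreover have "((\<lambda>s. f s - f t) has_field_derivative deriv f s) (at s)"
      using f'[of s] that by (auto intro!: derivative_eq_intros)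
    ultimately show ?thesis
      unfolding G_def G'_def by (auto dest: DERIV_mult simp: mult_ac add_ac)
  qed
  \<comment> \<open>At the singular end point f s - f t is O(t - s) by differentiability at t, and
    the remaining power 1 - \<alpha> of t - s is positive.\<close>
  have "continuous (at s within {0..t}) G" if s: "s \<in> {0..t}" for s
  proof (cases "s = t")
    case False
    then show ?thesis
      unfolding G_def using s cont
      by (intro continuous_intros) (auto simp: continuous_on_eq_continuous_within)
  next
    case True
    have l1: "((\<lambda>s. (f s - f t) / (s - t)) \<longlongrightarrow> deriv f t) (at t within {0..t})"
      using f'[of t] t by (auto simp: has_field_derivative_iff intro: tendsto_within_subset)
    have l2: "((\<lambda>s. - ((t - s) powr (1 - \<alpha>))) \<longlongrightarrow> - 0) (at t within {0..t})"
    proof (intro tendsto_minus)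
      have "continuous_on {0..t} (\<lambda>s. (t - s) powr (1 - \<alpha>))"
        using \<alpha> by (intro continuous_on_powr' continuous_intros) auto
      then have "((\<lambda>s. (t - s) powr (1 - \<alpha>)) \<longlongrightarrow> (t - t) powr (1 - \<alpha>)) (at t within {0..t})"
        unfolding continuous_on_def by (rule bspec) (use t in auto)
      then show "((\<lambda>s. (t - s) powr (1 - \<alpha>)) \<longlongrightarrow> 0) (at t within {0..t})"
        by simp
    qed
    have "((\<lambda>s. - ((t - s) powr (1 - \<alpha>)) * ((f s - f t) / (s - t))) \<longlongrightarrow> - 0 * deriv f t) (at t within {0..t})"
      by (rule tendsto_mult[OF l2 l1])
    then have "((\<lambda>s. - ((t - s) powr (1 - \<alpha>)) * ((f s - f t) / (s - t))) \<longlongrightarrow> 0) (at t within {0..t})"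
      by simp
    then have "(G \<longlongrightarrow> 0) (at t within {0..t})"
    proof (rule Lim_transform_eventually)
      have "- ((t - s) powr (1 - \<alpha>)) * ((f s - f t) / (s - t)) = G s" if "s < t" for s
        using that powr_mult_base[of "t - s" "- \<alpha>"] by (simp add: G_def field_simps)
      then show "\<forall>\<^sub>F s in at t within {0..t}. - ((t - s) powr (1 - \<alpha>)) * ((f s - f t) / (s - t)) = G s"
        by (auto simp: eventually_at intro!: exI[of _ 1])
    qed
    then show ?thesis using True by (simp add: continuous_within G_def)
  qed
  then have "continuous_on {0..t} G"
    by (simp add: continuous_on_eq_continuous_within)
  then have I1: "(G' has_integral (G t - G 0)) {0..t}"
    using t Gder by (intro fundamental_theorem_of_calculus_interior)
      (auto simp: has_real_derivative_iff_has_vector_derivative[symmetric])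
  have si: "set_integrable lborel {0<..<t} (\<lambda>s. (t - s) powr (-\<alpha>) * deriv f s)"
    using cap \<alpha> by (auto simp: has_caputo_def)
  have I2: "((\<lambda>s. (t - s) powr (-\<alpha>) * deriv f s) has_integral
      (LINT s:{0<..<t}|lborel. (t - s) powr (-\<alpha>) * deriv f s)) {0..t}"
    using set_borel_integral_eq_integral[OF si] by (simp add: has_integral_Icc_iff_Ioo has_integral_integral)
  \<comment> \<open>The second summand of \<open>G'\<close> is nonnegative since t is a minimum.
    Dropping it bounds the Caputo integral by G t - G 0 = - (f 0 - f t) * t powr (-
    \<alpha>).\<close>
  have "(LINT s:{0<..<t}|lborel. (t - s) powr (-\<alpha>) * deriv f s) \<le> G t - G 0"
    using I2 I1
  proof (rule has_integral_le)
    fix s assume "s \<in> {0..t}"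
    then show "(t - s) powr (-\<alpha>) * deriv f s \<le> G' s"
      using min[of s] \<alpha> by (auto simp: G'_def)
  qed
  also have "G t - G 0 < 0" using less t by (auto simp: G_def)
  finally show ?thesis
    using \<alpha> by (auto simp: caputo_def divide_less_0_iff mult_less_0_iff)
qed


text \<open>With z = s powr \<alpha> the hypothesis \<open>le\<close> says that the sum of f and its
  Caputo derivative is nonnegative. As a 0 >= 0, a negative value would force a negative minimum at
  some t > 0, where the Caputo derivative would be negative as well.\<close>

lemma frac_comparison:
  fixes a :: "nat \<Rightarrow> real" and \<alpha> :: real
  assumes \<alpha>: "0 < \<alpha>" "\<alpha> < 1" and a: "\<And>z. summable (\<lambda>k. a k * z ^ k)" and a0: "0 \<le> a 0"
    and le: "\<And>z. 0 < z \<Longrightarrow>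
      0 \<le> (\<Sum>k. a k * z ^ k) + (\<Sum>k. a (Suc k) * (Gamma (\<alpha> * Suc k + 1) / Gamma (\<alpha> * k + 1)) * z ^ k)"
    and z: "0 \<le> z"
  shows "0 \<le> (\<Sum>k. a k * z ^ k)"
proof (rule ccontr)
  assume neg: "\<not> 0 \<le> (\<Sum>k. a k * z ^ k)"
  define f where "f s = (\<Sum>k. a k * (s powr \<alpha>) ^ k)" for s
  define T where "T = z powr (1 / \<alpha>)"
  have T: "T powr \<alpha> = z" "0 \<le> T"
    using z \<alpha> by (auto simp: T_def powr_powr)
  have fT: "f T < 0" using neg T by (simp add: f_def)
  have f0: "f 0 = a 0" by (simp add: f_def powser_zero)
  have "continuous_on {0..T} f"
  proof -
    have "continuous_on UNIV (\<lambda>z. \<Sum>k. a k * z ^ k)"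
      by (intro DERIV_continuous_on[of _ _ "\<lambda>z. \<Sum>k. diffs a k * z ^ k"])
        (auto intro: termdiffs_strong_converges_everywhere[OF a])
    moreover have "continuous_on {0..T} (\<lambda>s. s powr \<alpha>)"
      using \<alpha> by (intro continuous_on_powr' continuous_intros) auto
    ultimately show ?thesis
      unfolding f_def by (rule continuous_on_compose2) auto
  qed
  then obtain t where t: "0 \<le> t" "t \<le> T" and min: "\<And>s. 0 \<le> s \<Longrightarrow> s \<le> T \<Longrightarrow> f t \<le> f s"
    using continuous_attains_inf[of "{0..T}" f] T by auto
  have ft: "f t < 0" using min[of T] T fT by simp
  then have t0: "0 < t" using t f0 a0 by (cases "t = 0") auto
  have "caputo \<alpha> f t < 0"
  proof (rule caputo_neg_at_min[OF \<alpha> t0])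
    show "continuous_on {0..t} f"
      using \<open>continuous_on {0..T} f\<close> t by (auto intro: continuous_on_subset)
    show "f field_differentiable (at s)" if "0 < s" for s
      using powser_frac_deriv[OF a that, of \<alpha>] unfolding f_def[abs_def] field_differentiable_def by blast
    show "has_caputo \<alpha> f t"
      unfolding f_def[abs_def] using \<alpha> t0 by (intro caputo_powser a) auto
    show "f t < f 0" using ft f0 a0 by simp
  qed (use min t in auto)
  moreover have "caputo \<alpha> f t = (\<Sum>k. a (Suc k) * (Gamma (\<alpha> * Suc k + 1) / Gamma (\<alpha> * k + 1)) * (t powr \<alpha>) ^ k)"
    unfolding f_def[abs_def] using \<alpha> t0 by (intro caputo_powser a) auto
  moreover have "0 \<le> f t + (\<Sum>k. a (Suc k) * (Gamma (\<alpha> * Suc k + 1) / Gamma (\<alpha> * k + 1)) * (t powr \<alpha>) ^ k)"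
    unfolding f_def using t0 by (intro le) auto
  ultimately show False using ft by simp
qed

text \<open>The comparison principle is applied to the functions
  \<open>\<Sum>k. q k * (-z) ^ k / \<Gamma>(\<alpha> k + 1)\<close>, on which \<open>D\<^sup>\<alpha> + 1\<close> acts by \<open>q k \<mapsto> q k - q (k + 1)\<close>.\<close>

lemma alternating_comparison:
  assumes \<alpha>: "0 < \<alpha>" "\<alpha> < 1"
    and q: "\<And>z. summable (\<lambda>k. q k * ml_coeff \<alpha> k * z ^ k)"
      "\<And>z. summable (\<lambda>k. q (Suc k) * ml_coeff \<alpha> k * z ^ k)"
    and q0: "0 \<le> q 0"
    and le: "\<And>z. 0 < z \<Longrightarrow> 0 \<le> (\<Sum>k. (q k - q (Suc k)) * ml_coeff \<alpha> k * (- z) ^ k)"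
    and z: "0 \<le> z"
  shows "0 \<le> (\<Sum>k. q k * ml_coeff \<alpha> k * (- z) ^ k)"
proof -
  have sg: "(- z) ^ k = (- 1) ^ k * z ^ k" for k and z :: real
    by (rule power_minus)
  define a where "a k = q k * ml_coeff \<alpha> k * (- 1) ^ k" for k
  have a: "a k * z ^ k = q k * ml_coeff \<alpha> k * (- z) ^ k" for k z
    by (simp add: a_def sg[of z])
  have a': "a (Suc k) * (Gamma (\<alpha> * Suc k + 1) / Gamma (\<alpha> * k + 1)) * z ^ k = - (q (Suc k) * ml_coeff \<alpha> k * (- z) ^ k)" for k z
  proof -
    have "0 < Gamma (\<alpha> * Suc k + 1)"
      using \<alpha> by (intro Gamma_real_pos add_nonneg_pos) auto
    then show ?thesis
      by (simp add: a_def ml_coeff_def sg[of z] del: of_nat_Suc)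
  qed
  have "0 \<le> (\<Sum>k. a k * z ^ k)"
  proof (rule frac_comparison[OF \<alpha> _ _ _ z])
    show "summable (\<lambda>k. a k * z ^ k)" for z
      unfolding a by (rule q)
    show "0 \<le> a 0" using q0 by (simp add: a_def)
    fix z :: real assume z: "0 < z"
    have "0 \<le> (\<Sum>k. (q k - q (Suc k)) * ml_coeff \<alpha> k * (- z) ^ k)" by (rule le[OF z])
    also have "\<dots> = (\<Sum>k. q k * ml_coeff \<alpha> k * (- z) ^ k - q (Suc k) * ml_coeff \<alpha> k * (- z) ^ k)"
      by (simp add: algebra_simps)
    also have "\<dots> = (\<Sum>k. q k * ml_coeff \<alpha> k * (- z) ^ k) - (\<Sum>k. q (Suc k) * ml_coeff \<alpha> k * (- z) ^ k)"
      by (rule suminf_diff[symmetric]) (rule q)+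
    also have "\<dots> = (\<Sum>k. q k * ml_coeff \<alpha> k * (- z) ^ k) + (\<Sum>k. - (q (Suc k) * ml_coeff \<alpha> k * (- z) ^ k))"
      by (subst suminf_minus) (use q in auto)
    finally show "0 \<le> (\<Sum>k. a k * z ^ k) + (\<Sum>k. a (Suc k) * (Gamma (\<alpha> * Suc k + 1) / Gamma (\<alpha> * k + 1)) * z ^ k)"
      unfolding a a' .
  qed
  then show ?thesis unfolding a .
qed

text \<open>The choices q k = 1, - k and k^2 - k give E(-z), z * E'(-z) and z^2 * E''(-z). Their
  differences q k - q (k + 1) are 0, 1 and - 2 * k, so the sign of each function follows from that
  of the previous one.\<close>

lemma mittag_leffler_minus_signs:
  assumes \<alpha>: "0 < \<alpha>" "\<alpha> < 1" and z: "0 < z"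
  shows "0 \<le> mittag_leffler \<alpha> 1 (- z)" and "0 \<le> ml_deriv \<alpha> (- z)"
    and "0 \<le> (\<Sum>k. diffs (diffs (ml_coeff \<alpha>)) k * (- z) ^ k)"
proof -
  have s0: "summable (\<lambda>k. ml_coeff \<alpha> k * z ^ k)" for z
    using \<alpha> by (intro summable_ml_coeff) auto
  note s1 = summable_index_mult(1)[OF s0]
  have s2: "summable (\<lambda>k. real k * real k * ml_coeff \<alpha> k * z ^ k)" for z
    using summable_index_mult(1)[OF s1] by (simp add: mult_ac)
  have E0: "0 \<le> (\<Sum>k. 1 * ml_coeff \<alpha> k * (- z) ^ k)" if "0 \<le> z" for z
    by (rule alternating_comparison[OF \<alpha> _ _ _ _ that]) (use s0 in auto)
  then show "0 \<le> mittag_leffler \<alpha> 1 (- z)"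
    using z by (simp add: mittag_leffler_1)
  have E1: "0 \<le> (\<Sum>k. - real k * ml_coeff \<alpha> k * (- z) ^ k)" if "0 \<le> z" for z
  proof (rule alternating_comparison[OF \<alpha> _ _ _ _ that])
    show "summable (\<lambda>k. - real k * ml_coeff \<alpha> k * z ^ k)" for z
      using summable_minus[OF s1] by simp
    show "summable (\<lambda>k. - real (Suc k) * ml_coeff \<alpha> k * z ^ k)" for z
      using summable_minus[OF summable_add[OF s1 s0]] by (simp add: algebra_simps)
    show "0 \<le> (\<Sum>k. (- real k - - real (Suc k)) * ml_coeff \<alpha> k * (- z) ^ k)" if "0 < z" for z
      using E0[of z] that by simp
  qed auto
  have E1': "(\<Sum>k. - real k * ml_coeff \<alpha> k * (- z) ^ k) = z * ml_deriv \<alpha> (- z)" for z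
  proof -
    have "(\<Sum>k. - (real k * ml_coeff \<alpha> k * (- z) ^ k)) = - (\<Sum>k. real k * ml_coeff \<alpha> k * (- z) ^ k)"
      by (rule suminf_minus) (rule s1)
    then show ?thesis
      by (simp add: summable_index_mult[OF s0] ml_deriv_def)
  qed
  show "0 \<le> ml_deriv \<alpha> (- z)"
    using E1[of z] z unfolding E1' by (simp add: zero_le_mult_iff)
  have "0 \<le> (\<Sum>k. (real k * real k - real k) * ml_coeff \<alpha> k * (- z) ^ k)"
  proof (rule alternating_comparison[OF \<alpha>])
    show "summable (\<lambda>k. (real k * real k - real k) * ml_coeff \<alpha> k * z ^ k)" for z
      using summable_diff[OF s2 s1] by (simp add: algebra_simps)
    show "summable (\<lambda>k. (real (Suc k) * real (Suc k) - real (Suc k)) * ml_coeff \<alpha> k * z ^ k)" for z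
      using summable_add[OF s2 s1] by (simp add: algebra_simps)
    fix z :: real assume "0 < z"
    then have "0 \<le> 2 * (\<Sum>k. - real k * ml_coeff \<alpha> k * (- z) ^ k)"
      using E1[of z] by simp
    also have "\<dots> = (\<Sum>k. 2 * (- real k * ml_coeff \<alpha> k * (- z) ^ k))"
      using summable_minus[OF s1] by (intro suminf_mult[symmetric]) simp
    also have "\<dots> = (\<Sum>k. ((real k * real k - real k) - (real (Suc k) * real (Suc k) - real (Suc k))) * ml_coeff \<alpha> k * (- z) ^ k)"
      by (intro suminf_cong) (simp add: algebra_simps)
    finally show "0 \<le> (\<Sum>k. ((real k * real k - real k) - (real (Suc k) * real (Suc k) - real (Suc k))) * ml_coeff \<alpha> k * (- z) ^ k)" .
  qed (use z in auto)
  also have "\<dots> = z ^ 2 * (\<Sum>k. diffs (diffs (ml_coeff \<alpha>)) k * (- z) ^ k)"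
  proof -
    have d: "summable (\<lambda>k. diffs (ml_coeff \<alpha>) k * z ^ k)" for z
      by (rule termdiff_converges_all) (rule s0)
    have "(\<Sum>k. (real k * real k - real k) * ml_coeff \<alpha> k * (- z) ^ k) =
        (\<Sum>k. real k * (real k * ml_coeff \<alpha> k) * (- z) ^ k - real k * ml_coeff \<alpha> k * (- z) ^ k)"
      by (intro suminf_cong) (simp add: algebra_simps)
    also have "\<dots> = (\<Sum>k. real k * (real k * ml_coeff \<alpha> k) * (- z) ^ k) - (\<Sum>k. real k * ml_coeff \<alpha> k * (- z) ^ k)"
      by (rule suminf_diff[symmetric]) (rule summable_index_mult[OF s1] s1)+
    also have "(\<Sum>k. real k * (real k * ml_coeff \<alpha> k) * (- z) ^ k) =
        (- z) * (\<Sum>k. diffs (\<lambda>k. real k * ml_coeff \<alpha> k) k * (- z) ^ k)"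
      by (rule summable_index_mult[OF s1])
    also have "(\<Sum>k. diffs (\<lambda>k. real k * ml_coeff \<alpha> k) k * (- z) ^ k)
       = (\<Sum>k. real k * diffs (ml_coeff \<alpha>) k * (- z) ^ k + diffs (ml_coeff \<alpha>) k * (- z) ^ k)"
      by (intro suminf_cong) (simp add: diffs_def algebra_simps)
    also have "\<dots> = (\<Sum>k. real k * diffs (ml_coeff \<alpha>) k * (- z) ^ k) + (\<Sum>k. diffs (ml_coeff \<alpha>) k * (- z) ^ k)"
      by (rule suminf_add[symmetric]) (rule summable_index_mult[OF d] d)+
    also have "(\<Sum>k. real k * diffs (ml_coeff \<alpha>) k * (- z) ^ k) = (- z) * (\<Sum>k. diffs (diffs (ml_coeff \<alpha>)) k * (- z) ^ k)"
      by (rule summable_index_mult[OF d])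
    also have "(\<Sum>k. real k * ml_coeff \<alpha> k * (- z) ^ k) = (- z) * (\<Sum>k. diffs (ml_coeff \<alpha>) k * (- z) ^ k)"
      by (rule summable_index_mult[OF s0])
    finally show ?thesis by (simp add: algebra_simps power2_eq_square)
  qed
  finally show "0 \<le> (\<Sum>k. diffs (diffs (ml_coeff \<alpha>)) k * (- z) ^ k)"
    using z by (simp add: zero_le_mult_iff)
qed

section \<open>Decay and growth bounds for Mittag-Leffler functions\<close>

lemma mittag_leffler_1_exp: "mittag_leffler 1 1 z = exp z"
proof -
  have "Gamma (real k + 1) = fact k" for k
    using Gamma_fact[of k, where 'a = real] by (simp add: add.commute)
  then show ?thesis
    by (simp add: mittag_leffler_1 ml_coeff_def exp_def divide_inverse mult.commute)
qed

lemma has_deriv_ml_deriv: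
  assumes "0 < \<alpha>" "\<alpha> \<le> 1"
  shows "(ml_deriv \<alpha> has_field_derivative (\<Sum>k. diffs (diffs (ml_coeff \<alpha>)) k * z ^ k)) (at z)"
  unfolding ml_deriv_def[abs_def]
  by (rule termdiffs_strong_converges_everywhere, rule termdiff_converges_all, rule summable_ml_coeff[OF assms])

lemma ml_deriv_nonneg_mono:
  assumes \<alpha>: "0 < \<alpha>" "\<alpha> \<le> 1" and "0 \<le> x" "x \<le> y"
  shows "1 \<le> mittag_leffler \<alpha> 1 x" "mittag_leffler \<alpha> 1 x \<le> mittag_leffler \<alpha> 1 y"
    "0 \<le> ml_deriv \<alpha> x" "ml_deriv \<alpha> x \<le> ml_deriv \<alpha> y"
proof -
  have c: "0 \<le> ml_coeff \<alpha> k" for k using ml_coeff_pos[of \<alpha> k] \<alpha> by simp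
  have d: "0 \<le> diffs (ml_coeff \<alpha>) k" for k using c by (simp add: diffs_def)
  have s: "summable (\<lambda>k. ml_coeff \<alpha> k * z ^ k)" for z by (rule summable_ml_coeff[OF \<alpha>])
  have ds: "summable (\<lambda>k. diffs (ml_coeff \<alpha>) k * z ^ k)" for z by (rule termdiff_converges_all) (rule s)
  have *: "mittag_leffler \<alpha> 1 x \<le> mittag_leffler \<alpha> 1 y" if "0 \<le> x" "x \<le> y" for x y
    unfolding mittag_leffler_1 using c that by (intro suminf_le s mult_left_mono power_mono) auto
  show "mittag_leffler \<alpha> 1 x \<le> mittag_leffler \<alpha> 1 y" by (rule *) fact+
  show "1 \<le> mittag_leffler \<alpha> 1 x" using *[of 0 x] assms by simp
  show "0 \<le> ml_deriv \<alpha> x"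
    unfolding ml_deriv_def using d assms by (intro suminf_nonneg ds mult_nonneg_nonneg) auto
  show "ml_deriv \<alpha> x \<le> ml_deriv \<alpha> y"
    unfolding ml_deriv_def using d assms by (intro suminf_le ds mult_left_mono power_mono) auto
qed

text \<open>By the signs of the first two derivatives, \<open>z \<mapsto> E\<^sub>\<alpha>(-z)\<close> is nonincreasing and convex, so its slope
  at \<open>z\<close> is at most the average slope \<open>2 / z\<close> over \<open>[z/2, z]\<close>.\<close>

lemma ml_deriv_minus_bounds:
  assumes \<alpha>: "0 < \<alpha>" "\<alpha> < 1" and z: "0 < z"
  shows "mittag_leffler \<alpha> 1 (- z) \<le> 1" "ml_deriv \<alpha> (- z) \<le> ml_deriv \<alpha> 0" "ml_deriv \<alpha> (- z) \<le> 2 / z"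
proof -
  have a1: "\<alpha> \<le> 1" using \<alpha> by simp
  have d1: "0 \<le> ml_deriv \<alpha> w" if "w \<le> 0" for w
    using mittag_leffler_minus_signs(2)[OF \<alpha>, of "- w"] ml_deriv_nonneg_mono(3)[OF \<alpha>(1) a1, of 0 0] that
    by (cases "w = 0") auto
  have d2: "0 \<le> (\<Sum>k. diffs (diffs (ml_coeff \<alpha>)) k * w ^ k)" if "w \<le> 0" for w
  proof (cases "w = 0")
    case True
    have "0 < ml_coeff \<alpha> 2" using \<alpha> by (intro ml_coeff_pos) auto
    then show ?thesis unfolding True by (subst powser_zero) (simp add: diffs_def numeral_2_eq_2)
  next
    case False
    then show ?thesis using mittag_leffler_minus_signs(3)[OF \<alpha>, of "- w"] that by simp
  qed
  have E: "mittag_leffler \<alpha> 1 v \<le> mittag_leffler \<alpha> 1 w" if "v \<le> w" "w \<le> 0" for v w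
    by (rule DERIV_nonneg_imp_nondecreasing[OF that(1)])
      (use has_deriv_mittag_leffler[OF \<alpha>(1) a1] d1 that in \<open>auto intro!: exI\<close>)
  have E1: "ml_deriv \<alpha> v \<le> ml_deriv \<alpha> w" if "v \<le> w" "w \<le> 0" for v w
    by (rule DERIV_nonneg_imp_nondecreasing[OF that(1)])
      (use has_deriv_ml_deriv[OF \<alpha>(1) a1] d2 that in \<open>auto intro!: exI\<close>)
  show le1: "mittag_leffler \<alpha> 1 (- z) \<le> 1" using E[of "- z" 0] z by simp
  show "ml_deriv \<alpha> (- z) \<le> ml_deriv \<alpha> 0" using E1[of "- z" 0] z by simp
  obtain \<xi> where \<xi>: "- z < \<xi>" "\<xi> < - z / 2"
      "mittag_leffler \<alpha> 1 (- z / 2) - mittag_leffler \<alpha> 1 (- z) = (- z / 2 - - z) * ml_deriv \<alpha> \<xi>"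
    using MVT2[of "- z" "- z / 2" "mittag_leffler \<alpha> 1" "ml_deriv \<alpha>"] has_deriv_mittag_leffler[OF \<alpha>(1) a1] z by auto
  have "z / 2 * ml_deriv \<alpha> (- z) \<le> z / 2 * ml_deriv \<alpha> \<xi>"
    using \<xi> z by (intro mult_left_mono E1) auto
  also have "\<dots> = mittag_leffler \<alpha> 1 (- z / 2) - mittag_leffler \<alpha> 1 (- z)"
    unfolding \<xi>(3) by simp
  also have "\<dots> \<le> 1"
    using mittag_leffler_minus_signs(1)[OF \<alpha> z] E[of "- z / 2" 0] z by simp
  finally show "ml_deriv \<alpha> (- z) \<le> 2 / z"
    using z by (simp add: field_simps)
qed

lemma powr_minus_half: "0 < z \<Longrightarrow> z powr (-1/2) = inverse (sqrt z)" for z :: real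
  using powr_minus[of z "1/2"] by (simp add: powr_half_sqrt)

text \<open>For \<alpha> < 1 the geometric mean of the bounds E'(0) and 2/z for E'(-z) gives the
  power -1/2. For E(-z) itself this is inserted into the Caputo integral of E(- s powr \<alpha>), an
  eigenfunction with eigenvalue -1. The exponent -1/2 in place of -1 keeps that integral convergent
  at 0.\<close>

lemma mittag_leffler_minus_decay:
  assumes \<alpha>: "0 < \<alpha>" "\<alpha> \<le> 1"
  obtains K where "0 < K"
    "\<And>z. 0 < z \<Longrightarrow> 0 \<le> mittag_leffler \<alpha> 1 (- z) \<and> mittag_leffler \<alpha> 1 (- z) \<le> 1 \<and>
        mittag_leffler \<alpha> 1 (- z) \<le> K * z powr (-1/2) \<and>
        0 \<le> ml_deriv \<alpha> (- z) \<and> ml_deriv \<alpha> (- z) \<le> K \<and> ml_deriv \<alpha> (- z) \<le> K * z powr (-1/2)"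
proof (cases "\<alpha> = 1")
  case True
  have "(mittag_leffler 1 1 has_field_derivative exp z) (at z)" for z
    unfolding mittag_leffler_1_exp[abs_def] by (rule DERIV_exp)
  then have d: "ml_deriv 1 z = exp z" for z
    using DERIV_unique[OF has_deriv_mittag_leffler[of 1 z]] by simp
  have "exp (- z) \<le> z powr (-1/2)" if z: "0 < z" for z :: real
  proof -
    have "sqrt z \<le> 1 + z"
      using z by (intro real_le_lsqrt) (auto simp: power2_eq_square algebra_simps)
    also have "\<dots> \<le> exp z" by (rule exp_ge_add_one_self)
    finally have "sqrt z \<le> exp z" .
    then show ?thesis
      unfolding powr_minus_half[OF z] using z by (simp add: exp_minus le_imp_inverse_le)
  qed
  then show ?thesis
    using that[of 1] by (auto simp: True mittag_leffler_1_exp d)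
next
  case False
  then have \<alpha>': "\<alpha> < 1" using \<alpha> by simp
  define K1 where "K1 = sqrt (2 * ml_deriv \<alpha> 0)"
  have d0: "0 \<le> ml_deriv \<alpha> 0" using ml_deriv_nonneg_mono(3)[OF \<alpha>, of 0 0] by simp
  have K1: "ml_deriv \<alpha> (- z) \<le> K1 * z powr (-1/2)" if z: "0 < z" for z
  proof -
    have n: "0 \<le> ml_deriv \<alpha> (- z)" by (rule mittag_leffler_minus_signs(2)[OF \<alpha>(1) \<alpha>' z])
    have "ml_deriv \<alpha> (- z) * ml_deriv \<alpha> (- z) \<le> ml_deriv \<alpha> 0 * (2 / z)"
      using n ml_deriv_minus_bounds(2,3)[OF \<alpha>(1) \<alpha>' z] d0 by (intro mult_mono) auto
    then have "(ml_deriv \<alpha> (- z))\<^sup>2 \<le> 2 * ml_deriv \<alpha> 0 / z"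
      by (simp add: power2_eq_square mult.commute)
    then have "ml_deriv \<alpha> (- z) \<le> sqrt (2 * ml_deriv \<alpha> 0 / z)"
      by (rule real_le_rsqrt)
    also have "\<dots> = K1 * z powr (-1/2)"
      unfolding powr_minus_half[OF z] K1_def real_sqrt_divide by (simp only: divide_inverse)
    finally show ?thesis .
  qed
  have K10: "0 \<le> K1" using d0 by (simp add: K1_def)
  \<comment> \<open>From the Beta integral of (t - s) powr (- \<alpha>) * s powr (\<alpha> / 2 - 1),
    taken at t powr \<alpha> = z.\<close>
  define K2 where "K2 = \<alpha> * K1 * Beta (1 - \<alpha>) (\<alpha> / 2) / Gamma (1 - \<alpha>)"
  have K20: "0 \<le> K2" unfolding K2_def using \<alpha> \<alpha>' K10 Beta_pos[of "1 - \<alpha>" "\<alpha> / 2"]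
    by (auto intro!: divide_nonneg_nonneg mult_nonneg_nonneg)
  have K2: "mittag_leffler \<alpha> 1 (- z) \<le> K2 * z powr (-1/2)" if z: "0 < z" for z
  proof -
    define t where "t = z powr (1 / \<alpha>)"
    have t: "0 < t" "t powr \<alpha> = z" "t powr (- \<alpha> / 2) = z powr (-1/2)"
      using z \<alpha> by (auto simp: t_def powr_powr)
    define e where "e s = mittag_leffler \<alpha> 1 (-1 * s powr \<alpha>)" for s
    have e': "deriv e s = - (\<alpha> * s powr (\<alpha> - 1) * ml_deriv \<alpha> (- (s powr \<alpha>)))" if "0 < s" for s
      using DERIV_imp_deriv[OF caputo_mittag_leffler(1)[OF \<alpha> that, of "-1"]] by (simp add: e_def[abs_def])
    have hc: "has_caputo \<alpha> e t" and cap: "caputo \<alpha> e t = - mittag_leffler \<alpha> 1 (- z)"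
      using caputo_mittag_leffler(2,3)[OF \<alpha> t(1), of "-1"] t by (simp_all add: e_def[abs_def])
    have si: "set_integrable lborel {0<..<t} (\<lambda>s. (t - s) powr (-\<alpha>) * deriv e s)"
      using hc False by (simp add: has_caputo_def)
    have sB: "set_integrable lborel {0<..<t} (\<lambda>s. (t - s) powr (- \<alpha>) * s powr (\<alpha> / 2 - 1))"
      using Beta_kernel(1)[of "1 - \<alpha>" "\<alpha> / 2" t] \<alpha> \<alpha>' t by simp
    have "mittag_leffler \<alpha> 1 (- z) = 1 / Gamma (1 - \<alpha>) * (LINT s:{0<..<t}|lborel. - ((t - s) powr (-\<alpha>) * deriv e s))"
      using cap False set_integral_uminus[OF si] by (simp add: caputo_def)
    also have "\<dots> \<le> 1 / Gamma (1 - \<alpha>) * (LINT s:{0<..<t}|lborel. \<alpha> * K1 * ((t - s) powr (- \<alpha>) * s powr (\<alpha> / 2 - 1)))"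
    proof (intro mult_left_mono set_integral_mono)
      show "set_integrable lborel {0<..<t} (\<lambda>s. - ((t - s) powr (-\<alpha>) * deriv e s))"
        using set_integrable_mult_right[of "-1", OF si] by simp
      show "set_integrable lborel {0<..<t} (\<lambda>s. \<alpha> * K1 * ((t - s) powr (- \<alpha>) * s powr (\<alpha> / 2 - 1)))"
        using sB by simp
      fix s assume s: "s \<in> {0<..<t}"
      have "ml_deriv \<alpha> (- (s powr \<alpha>)) \<le> K1 * (s powr \<alpha>) powr (-1/2)"
        using s by (intro K1) auto
      then have "\<alpha> * s powr (\<alpha> - 1) * ml_deriv \<alpha> (- (s powr \<alpha>)) \<le> \<alpha> * s powr (\<alpha> - 1) * (K1 * (s powr \<alpha>) powr (-1/2))"
        using \<alpha> by (intro mult_left_mono) auto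
      also have "\<dots> = \<alpha> * K1 * (s powr (\<alpha> - 1) * s powr (- \<alpha> / 2))"
        using s by (simp add: powr_powr)
      also have "s powr (\<alpha> - 1) * s powr (- \<alpha> / 2) = s powr (\<alpha> / 2 - 1)"
        by (simp add: powr_add[symmetric])
      finally have "(t - s) powr (- \<alpha>) * (\<alpha> * s powr (\<alpha> - 1) * ml_deriv \<alpha> (- (s powr \<alpha>)))
          \<le> (t - s) powr (- \<alpha>) * (\<alpha> * K1 * s powr (\<alpha> / 2 - 1))"
        by (intro mult_left_mono) auto
      then show "- ((t - s) powr (-\<alpha>) * deriv e s) \<le> \<alpha> * K1 * ((t - s) powr (- \<alpha>) * s powr (\<alpha> / 2 - 1))"
        using s by (simp add: e' mult_ac)
    qed (use \<alpha>' in \<open>auto intro!: less_imp_le Gamma_real_pos\<close>)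
    also have "\<dots> = 1 / Gamma (1 - \<alpha>) * (\<alpha> * K1 * (Beta (1 - \<alpha>) (\<alpha> / 2) * t powr (- \<alpha> / 2)))"
      using Beta_kernel(2)[of "1 - \<alpha>" "\<alpha> / 2" t] \<alpha> \<alpha>' t by simp
    also have "\<dots> = K2 * z powr (-1/2)" using t by (simp add: K2_def)
    finally show ?thesis .
  qed
  show ?thesis
  proof (rule that[of "ml_deriv \<alpha> 0 + K1 + K2 + 1"])
    show "0 < ml_deriv \<alpha> 0 + K1 + K2 + 1" using d0 K10 K20 by simp
    fix z :: real assume z: "0 < z"
    have m: "k * z powr (-1/2) \<le> (ml_deriv \<alpha> 0 + K1 + K2 + 1) * z powr (-1/2)" if "k = K1 \<or> k = K2" for k
      using that d0 K10 K20 by (intro mult_right_mono) auto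
    show "0 \<le> mittag_leffler \<alpha> 1 (- z) \<and> mittag_leffler \<alpha> 1 (- z) \<le> 1 \<and>
        mittag_leffler \<alpha> 1 (- z) \<le> (ml_deriv \<alpha> 0 + K1 + K2 + 1) * z powr (-1/2) \<and>
        0 \<le> ml_deriv \<alpha> (- z) \<and> ml_deriv \<alpha> (- z) \<le> ml_deriv \<alpha> 0 + K1 + K2 + 1 \<and>
        ml_deriv \<alpha> (- z) \<le> (ml_deriv \<alpha> 0 + K1 + K2 + 1) * z powr (-1/2)"
      using mittag_leffler_minus_signs(1,2)[OF \<alpha>(1) \<alpha>' z] ml_deriv_minus_bounds(1,2)[OF \<alpha>(1) \<alpha>' z]
        K1[OF z] K2[OF z] m[of K1] m[of K2] d0 K10 K20 by auto
  qed
qed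

text \<open>Coefficientwise comparison: the factor z^2 shifts the index by two, which costs a
  polynomial factor in k by \<open>ml_coeff_le_Suc\<close>, and \<rho> ^ k outweighs it. The
  constant term is removed on the right because E(z) - 1 is the quantity that \<open>ml_odd\<close>
  dominates.\<close>

lemma mittag_leffler_growth:
  assumes \<alpha>: "0 < \<alpha>" "\<alpha> \<le> 1" and \<rho>: "0 \<le> \<rho>" "\<rho> < 1"
  obtains C where "0 < C"
    "\<And>z. 0 \<le> z \<Longrightarrow> z\<^sup>2 * mittag_leffler \<alpha> 1 (\<rho> * z) \<le> C * (mittag_leffler \<alpha> 1 z - 1)"
    "\<And>z. 0 \<le> z \<Longrightarrow> z\<^sup>2 * ml_deriv \<alpha> (\<rho> * z) \<le> C * (mittag_leffler \<alpha> 1 z - 1)"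
proof -
  define c where "c = ml_coeff \<alpha>"
  have c0: "0 \<le> c k" for k using ml_coeff_pos[of \<alpha> k] \<alpha> by (simp add: c_def)
  have s: "summable (\<lambda>k. c k * z ^ k)" for z unfolding c_def by (rule summable_ml_coeff[OF \<alpha>])
  note s1 = summable_index_mult(1)[OF s]
  \<comment> \<open>A cube root, since a factor of size (k + 2)^3 has to be absorbed: one power
    \<sigma> ^ k for each factor.\<close>
  define \<sigma> where "\<sigma> = root 3 \<rho>"
  have \<sigma>: "0 \<le> \<sigma>" "\<sigma> < 1" "\<sigma> ^ 3 = \<rho>"
    using \<rho> by (auto simp: \<sigma>_def)
  have "(\<lambda>n. real n * \<sigma> ^ n) \<longlonglongrightarrow> 0"
    using powser_times_n_limit_0[of \<sigma>] \<sigma> by simp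
  then have "Bseq (\<lambda>n. real n * \<sigma> ^ n)"
    by (intro convergent_imp_Bseq) (auto simp: convergent_def)
  then obtain B0 where B0: "0 < B0" "\<And>n. norm (real n * \<sigma> ^ n) \<le> B0"
    by (auto simp: Bseq_def)
  define B where "B = B0 + 2"
  have B: "(real n + 2) * \<sigma> ^ n \<le> B" for n
    using B0(2)[of n] power_le_one[of \<sigma> n] \<sigma> by (simp add: B_def abs_mult algebra_simps)
  have B3: "(real n + 2) ^ 3 * \<rho> ^ n \<le> B ^ 3" for n
  proof -
    have "((real n + 2) * \<sigma> ^ n) ^ 3 \<le> B ^ 3"
      using B \<sigma> by (intro power_mono) auto
    then show ?thesis
      unfolding \<sigma>(3)[symmetric] by (simp add: power_mult_distrib power_mult[symmetric] mult.commute)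
  qed
  have c2: "c k \<le> (real k + 1) * (real k + 2) * c (k + 2)" for k
  proof -
    have "c k \<le> real (Suc k) * c (Suc k)" unfolding c_def by (rule ml_coeff_le_Suc[OF \<alpha>])
    also have "\<dots> \<le> real (Suc k) * (real (Suc (Suc k)) * c (Suc (Suc k)))"
      unfolding c_def by (intro mult_left_mono ml_coeff_le_Suc \<alpha>) auto
    finally show ?thesis by (simp add: algebra_simps)
  qed
  have coef: "(real k + 1) * c k * \<rho> ^ k \<le> B ^ 3 * c (k + 2)" for k
  proof -
    have "(real k + 1) * c k * \<rho> ^ k \<le> (real k + 1) * ((real k + 1) * (real k + 2) * c (k + 2)) * \<rho> ^ k"
      using \<rho> by (intro mult_right_mono mult_left_mono c2) auto
    also have "\<dots> = ((real k + 1) * (real k + 1) * (real k + 2)) * (c (k + 2) * \<rho> ^ k)"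
      by simp
    also have "\<dots> \<le> ((real k + 2) ^ 3) * (c (k + 2) * \<rho> ^ k)"
      unfolding power3_eq_cube using \<rho> c0 by (intro mult_right_mono mult_mono) auto
    also have "\<dots> = ((real k + 2) ^ 3 * \<rho> ^ k) * c (k + 2)" by simp
    also have "\<dots> \<le> B ^ 3 * c (k + 2)"
      by (intro mult_right_mono B3 c0)
    finally show ?thesis .
  qed
  have tail: "(\<Sum>k. c (k + 2) * z ^ (k + 2)) \<le> mittag_leffler \<alpha> 1 z - 1" "summable (\<lambda>k. c (k + 2) * z ^ (k + 2))"
    if "0 \<le> z" for z
  proof -
    show "summable (\<lambda>k. c (k + 2) * z ^ (k + 2))"
      using s[of z] by (subst summable_iff_shift) auto
    have "(\<Sum>k. c k * z ^ k) = (\<Sum>k. c (k + 2) * z ^ (k + 2)) + (\<Sum>k<2. c k * z ^ k)"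
      by (rule suminf_split_initial_segment[OF s])
    then show "(\<Sum>k. c (k + 2) * z ^ (k + 2)) \<le> mittag_leffler \<alpha> 1 z - 1"
      using c0[of 1] that by (simp add: mittag_leffler_1 c_def numeral_2_eq_2)
  qed
  \<comment> \<open>Stated for arbitrary coefficients, as it is needed for E and for E' at \<rho> *
    z.\<close>
  have main: "z\<^sup>2 * (\<Sum>k. a k * z ^ k) \<le> D * B ^ 3 * (mittag_leffler \<alpha> 1 z - 1)"
    if z: "0 \<le> z" and D: "0 \<le> D" and a: "\<And>k. a k \<le> D * ((real k + 1) * c k * \<rho> ^ k)" "\<And>z. summable (\<lambda>k. a k * z ^ k)" for a z D
  proof -
    have "z\<^sup>2 * (\<Sum>k. a k * z ^ k) = (\<Sum>k. z\<^sup>2 * (a k * z ^ k))"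
      by (rule suminf_mult[symmetric]) (rule a)
    also have "\<dots> \<le> (\<Sum>k. D * B ^ 3 * (c (k + 2) * z ^ (k + 2)))"
    proof (intro suminf_le summable_mult a tail z)
      fix k
      have "a k \<le> D * (B ^ 3 * c (k + 2))"
        using a(1)[of k] mult_left_mono[OF coef D] by (rule order_trans)
      then have "a k * z ^ (k + 2) \<le> D * (B ^ 3 * c (k + 2)) * z ^ (k + 2)"
        using z by (intro mult_right_mono) auto
      then show "z\<^sup>2 * (a k * z ^ k) \<le> D * B ^ 3 * (c (k + 2) * z ^ (k + 2))"
        by (simp add: power_add power2_eq_square mult_ac)
    qed
    also have "\<dots> = D * B ^ 3 * (\<Sum>k. c (k + 2) * z ^ (k + 2))"
      by (rule suminf_mult[OF tail(2)[OF z]])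
    also have "\<dots> \<le> D * B ^ 3 * (mittag_leffler \<alpha> 1 z - 1)"
      using tail(1)[OF z] D B0 by (intro mult_left_mono) (auto simp: B_def)
    finally show ?thesis .
  qed
  show ?thesis
  proof (rule that[of "2 * B ^ 3"])
    show "0 < 2 * B ^ 3" using B0 by (simp add: B_def)
    fix z :: real assume z: "0 \<le> z"
    have "c k * \<rho> ^ k \<le> 2 * ((real k + 1) * c k * \<rho> ^ k)" for k
    proof -
      have "1 * (c k * \<rho> ^ k) \<le> (2 * (real k + 1)) * (c k * \<rho> ^ k)"
        using c0 \<rho> by (intro mult_right_mono) auto
      then show ?thesis by (simp only: mult.assoc mult_1)
    qed
    from main[OF z _ this, simplified] show "z\<^sup>2 * mittag_leffler \<alpha> 1 (\<rho> * z) \<le> 2 * B ^ 3 * (mittag_leffler \<alpha> 1 z - 1)"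
      using s[of "\<rho> * z" for z] unfolding mittag_leffler_1[of \<alpha> "\<rho> * z"] c_def[symmetric]
      by (simp add: power_mult_distrib mult_ac)
    have "diffs c k * \<rho> ^ k \<le> 2 * ((real k + 1) * c k * \<rho> ^ k)" for k
    proof -
      have "(\<alpha> * real k + 1) powr (- \<alpha>) \<le> (\<alpha> * real k + 1) powr 0"
        using \<alpha> by (intro powr_mono) auto
      also have "\<dots> \<le> 1" by simp
      finally have "2 * (\<alpha> * real k + 1) powr (- \<alpha>) * c k \<le> 2 * 1 * c k"
        by (intro mult_right_mono mult_left_mono c0) auto
      then have "c (Suc k) \<le> 2 * c k"
        using ml_coeff_Suc_le[OF \<alpha>, of k] by (simp add: c_def)
      then have "(real k + 1) * c (Suc k) * \<rho> ^ k \<le> (real k + 1) * (2 * c k) * \<rho> ^ k"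
        using \<rho> by (intro mult_right_mono mult_left_mono) auto
      then show ?thesis by (simp add: diffs_def algebra_simps)
    qed
    from main[OF z _ this, simplified] show "z\<^sup>2 * ml_deriv \<alpha> (\<rho> * z) \<le> 2 * B ^ 3 * (mittag_leffler \<alpha> 1 z - 1)"
      using termdiff_converges_all[OF s, of "\<rho> * z" for z] unfolding ml_deriv_def c_def[symmetric]
      by (simp add: power_mult_distrib mult_ac)
  qed
qed

section \<open>The modes in the variable x\<close>

lemma caputo_lincomb:
  assumes f: "has_caputo \<alpha> f x" and g: "has_caputo \<alpha> g x"
  shows "has_caputo \<alpha> (\<lambda>s. a * f s + b * g s) x"
    and "caputo \<alpha> (\<lambda>s. a * f s + b * g s) x = a * caputo \<alpha> f x + b * caputo \<alpha> g x"
proof -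
  have d: "((\<lambda>s. a * f s + b * g s) has_field_derivative a * deriv f s + b * deriv g s) (at s)"
    if "f field_differentiable (at s)" "g field_differentiable (at s)" for s
    using that[folded DERIV_deriv_iff_field_differentiable] by (auto intro!: derivative_eq_intros)
  then have d': "(\<lambda>s. a * f s + b * g s) field_differentiable (at s)"
      "deriv (\<lambda>s. a * f s + b * g s) s = a * deriv f s + b * deriv g s"
    if "f field_differentiable (at s)" "g field_differentiable (at s)" for s
    using that by (auto simp: field_differentiable_def DERIV_imp_deriv)
  have eq: "(x - s) powr (-\<alpha>) * deriv (\<lambda>s. a * f s + b * g s) s =
      a * ((x - s) powr (-\<alpha>) * deriv f s) + b * ((x - s) powr (-\<alpha>) * deriv g s)"
    if "\<alpha> \<noteq> 1" "s \<in> {0<..<x}" for s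
    using f g that d'(2)[of s] by (simp add: has_caputo_def algebra_simps)
  have si: "set_integrable lborel {0<..<x} (\<lambda>s. a * ((x - s) powr (-\<alpha>) * deriv f s))"
       "set_integrable lborel {0<..<x} (\<lambda>s. b * ((x - s) powr (-\<alpha>) * deriv g s))" if "\<alpha> \<noteq> 1"
    using f g that by (auto simp: has_caputo_def intro!: set_integrable_mult_right)
  show "has_caputo \<alpha> (\<lambda>s. a * f s + b * g s) x"
  proof (cases "\<alpha> = 1")
    case True
    then show ?thesis using f g d' by (simp add: has_caputo_def)
  next
    case False
    have "set_integrable lborel {0<..<x} (\<lambda>s. (x - s) powr (-\<alpha>) * deriv (\<lambda>s. a * f s + b * g s) s) \<longleftrightarrow>
        set_integrable lborel {0<..<x} (\<lambda>s. a * ((x - s) powr (-\<alpha>) * deriv f s) + b * ((x - s) powr (-\<alpha>) * deriv g s))"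
      using eq[OF False] by (intro set_integrable_cong) auto
    then show ?thesis using False f g d' set_integral_add(1)[OF si[OF False]] by (simp add: has_caputo_def)
  qed
  show "caputo \<alpha> (\<lambda>s. a * f s + b * g s) x = a * caputo \<alpha> f x + b * caputo \<alpha> g x"
  proof (cases "\<alpha> = 1")
    case True
    then show ?thesis using f g d' by (simp add: has_caputo_def caputo_def)
  next
    case False
    have "(LINT s:{0<..<x}|lborel. (x - s) powr (-\<alpha>) * deriv (\<lambda>s. a * f s + b * g s) s) =
        (LINT s:{0<..<x}|lborel. a * ((x - s) powr (-\<alpha>) * deriv f s) + b * ((x - s) powr (-\<alpha>) * deriv g s))"
      using eq[OF False] by (intro set_lebesgue_integral_cong) auto
    then show ?thesis using False set_integral_add(2)[OF si[OF False]]
      by (simp add: caputo_def algebra_simps)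
  qed
qed

text \<open>Only values on an open interval around the points of (0, x] enter. Hence the first
  Caputo derivative may be replaced by a formula valid on (0, 1) before the second one is
  taken.\<close>

lemma caputo_cong:
  assumes "x < b" "\<And>s. s \<in> {0<..<b} \<Longrightarrow> f s = g s" "0 < x"
  shows "has_caputo \<alpha> f x \<longleftrightarrow> has_caputo \<alpha> g x" "caputo \<alpha> f x = caputo \<alpha> g x"
proof -
  have ev: "eventually (\<lambda>r. f r = g r) (nhds s)" if "s \<in> {0<..<b}" for s
    by (rule eventually_mono[OF eventually_nhds_in_open[of "{0<..<b}"]]) (use that assms in auto)
  have d: "deriv f s = deriv g s" if "s \<in> {0<..<b}" for s
    by (rule deriv_cong_ev[OF ev[OF that]]) simp
  have fd: "f field_differentiable (at s) \<longleftrightarrow> g field_differentiable (at s)" if "s \<in> {0<..<b}" for s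
    unfolding field_differentiable_def by (intro ex_cong1 DERIV_cong_ev ev[OF that]) auto
  have "set_integrable lborel {0<..<x} (\<lambda>s. (x - s) powr (-\<alpha>) * deriv f s) \<longleftrightarrow>
      set_integrable lborel {0<..<x} (\<lambda>s. (x - s) powr (-\<alpha>) * deriv g s)"
    using d assms by (intro set_integrable_cong) auto
  then show "has_caputo \<alpha> f x \<longleftrightarrow> has_caputo \<alpha> g x"
    using fd assms unfolding has_caputo_def by auto
  have "(LINT s:{0<..<x}|lborel. (x - s) powr (-\<alpha>) * deriv f s) =
      (LINT s:{0<..<x}|lborel. (x - s) powr (-\<alpha>) * deriv g s)"
    using d assms by (intro set_lebesgue_integral_cong) auto
  then show "caputo \<alpha> f x = caputo \<alpha> g x"
    using d assms unfolding caputo_def by auto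
qed

section \<open>Modes as combinations of growing and decaying Mittag-Leffler functions\<close>

definition ml_odd :: "real \<Rightarrow> real \<Rightarrow> real" where
  "ml_odd \<alpha> z = (mittag_leffler \<alpha> 1 z - mittag_leffler \<alpha> 1 (- z)) / 2"

text \<open>\<open>ml_odd\<close> is a fractional sinh. The odd terms of E have index 2 * k + 1, and
  \<alpha> * (2 * k + 1) + 1 = 2 * \<alpha> * k + (\<alpha> + 1). This turns the denominators of
  \<open>C_fun\<close> and \<open>S_fun\<close> into differences of E at \<mu> and -\<mu>.\<close>

lemma ml_odd_conv:
  assumes "0 < \<alpha>" "\<alpha> \<le> 1"
  shows "z * mittag_leffler (2 * \<alpha>) (\<alpha> + 1) (z\<^sup>2) = ml_odd \<alpha> z"
proof -
  define f where "f k = (ml_coeff \<alpha> k * z ^ k - ml_coeff \<alpha> k * (- z) ^ k) / 2" for k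
  have s: "summable (\<lambda>k. ml_coeff \<alpha> k * w ^ k)" for w by (rule summable_ml_coeff[OF assms])
  have f: "f sums ml_odd \<alpha> z"
    unfolding f_def ml_odd_def mittag_leffler_1 by (intro sums_divide sums_diff summable_sums s)
  have f': "f (2 * k + 1) = z * ((z\<^sup>2) ^ k / Gamma (2 * \<alpha> * real k + (\<alpha> + 1)))" for k
    by (simp add: f_def ml_coeff_def power_mult[symmetric] algebra_simps)
  have mono: "strict_mono (\<lambda>k::nat. 2 * k + 1)" by (simp add: strict_mono_def)
  have zero: "f n = 0" if "n \<notin> range (\<lambda>k::nat. 2 * k + 1)" for n
  proof -
    have "even n" using that by (metis oddE rangeI)
    then show ?thesis by (simp add: f_def)
  qed
  have "(\<lambda>k. f (2 * k + 1)) sums ml_odd \<alpha> z"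
    using sums_mono_reindex[where f = f, OF mono zero] f by blast
  then have sums: "(\<lambda>k. z * ((z\<^sup>2) ^ k / Gamma (2 * \<alpha> * real k + (\<alpha> + 1)))) sums ml_odd \<alpha> z"
    unfolding f' .
  show ?thesis
  proof (cases "z = 0")
    case True
    then show ?thesis by (simp add: ml_odd_def)
  next
    case False
    have "(\<lambda>k. (z\<^sup>2) ^ k / Gamma (2 * \<alpha> * real k + (\<alpha> + 1))) sums (ml_odd \<alpha> z / z)"
      using sums_divide[OF sums, of z] False by simp
    then show ?thesis
      using False by (simp add: mittag_leffler_def sums_iff)
  qed
qed

lemma ml_odd_pos:
  assumes \<alpha>: "0 < \<alpha>" "\<alpha> \<le> 1" and z: "0 < z"
  shows "0 < ml_odd \<alpha> z" "mittag_leffler \<alpha> 1 z - 1 \<le> 2 * ml_odd \<alpha> z"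
proof -
  obtain K where K: "\<And>z. 0 < z \<Longrightarrow> mittag_leffler \<alpha> 1 (- z) \<le> 1"
    using mittag_leffler_minus_decay[OF \<alpha>] by metis
  \<comment> \<open>With \<rho> = 0 the growth estimate reads z^2 <= C * (E(z) - 1), so that E(z) >
    1 strictly, while E(-z) <= 1.\<close>
  obtain C where "0 < C" "z\<^sup>2 * mittag_leffler \<alpha> 1 (0 * z) \<le> C * (mittag_leffler \<alpha> 1 z - 1)"
    using mittag_leffler_growth[OF \<alpha>, of 0] z by (metis less_imp_le order_refl zero_less_one)
  moreover have "0 < z\<^sup>2" using z by simp
  ultimately have "0 < C * (mittag_leffler \<alpha> 1 z - 1)" by (simp only: mult_zero_left mittag_leffler_1_0 mult_1_right)
  with \<open>0 < C\<close> have "1 < mittag_leffler \<alpha> 1 z" by (simp add: zero_less_mult_iff)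
  then show "0 < ml_odd \<alpha> z" using K[OF z] by (simp add: ml_odd_def)
  show "mittag_leffler \<alpha> 1 z - 1 \<le> 2 * ml_odd \<alpha> z" using K[OF z] by (simp add: ml_odd_def)
qed

lemma ml_odd_mono:
  assumes \<alpha>: "0 < \<alpha>" "\<alpha> \<le> 1" and z: "0 \<le> z" "z \<le> w"
  shows "0 \<le> ml_odd \<alpha> z" "ml_odd \<alpha> z \<le> ml_odd \<alpha> w"
proof -
  obtain K where K: "\<And>z. 0 < z \<Longrightarrow> 0 \<le> ml_deriv \<alpha> (- z)"
    using mittag_leffler_minus_decay[OF \<alpha>] by metis
  show "0 \<le> ml_odd \<alpha> z"
    using ml_odd_pos(1)[OF \<alpha>, of z] z by (cases "z = 0") (auto simp: ml_odd_def)
  show "ml_odd \<alpha> z \<le> ml_odd \<alpha> w"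
  proof (rule DERIV_nonneg_imp_nondecreasing[OF z(2)])
    fix x assume x: "z \<le> x" "x \<le> w"
    have "((\<lambda>x. mittag_leffler \<alpha> 1 (- x)) has_field_derivative ml_deriv \<alpha> (- x) * - 1) (at x)"
      by (rule DERIV_chain2[OF has_deriv_mittag_leffler[OF \<alpha>]]) (auto intro!: derivative_eq_intros)
    then have "(ml_odd \<alpha> has_field_derivative (ml_deriv \<alpha> x + ml_deriv \<alpha> (- x)) / 2) (at x)"
      unfolding ml_odd_def[abs_def] using has_deriv_mittag_leffler[OF \<alpha>, of x]
      by (auto intro!: derivative_eq_intros)
    moreover have "0 \<le> ml_deriv \<alpha> x" using x z by (intro ml_deriv_nonneg_mono[OF \<alpha>]) auto
    moreover have "0 \<le> ml_deriv \<alpha> (- x)"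
      using K[of x] x z \<open>0 \<le> ml_deriv \<alpha> x\<close> by (cases "x = 0") auto
    ultimately show "\<exists>y. (ml_odd \<alpha> has_field_derivative y) (at x) \<and> 0 \<le> y"
      by (intro exI[of _ "(ml_deriv \<alpha> x + ml_deriv \<alpha> (- x)) / 2"]) auto
  qed
qed

lemma S_fun_eq:
  assumes "0 < \<alpha>" "\<alpha> \<le> 1" "0 < \<mu>"
  shows "S_fun \<alpha> \<mu> t = ml_odd \<alpha> (\<mu> * t powr \<alpha>) / ml_odd \<alpha> \<mu>"
proof -
  have "t powr (2 * \<alpha>) = (t powr \<alpha>)\<^sup>2"
    by (simp add: power2_eq_square powr_add[symmetric])
  then have "\<mu>\<^sup>2 * t powr (2 * \<alpha>) = (\<mu> * t powr \<alpha>)\<^sup>2" by (simp add: power_mult_distrib)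
  moreover have "ml_odd \<alpha> (\<mu> * t powr \<alpha>) = \<mu> * t powr \<alpha> * mittag_leffler (2 * \<alpha>) (\<alpha> + 1) ((\<mu> * t powr \<alpha>)\<^sup>2)"
    using ml_odd_conv[OF assms(1,2)] by simp
  moreover have "ml_odd \<alpha> \<mu> = \<mu> * mittag_leffler (2 * \<alpha>) (\<alpha> + 1) (\<mu>\<^sup>2)"
    using ml_odd_conv[OF assms(1,2)] by simp
  ultimately show ?thesis
    using assms(3) by (simp add: S_fun_def)
qed

text \<open>The decaying solution, corrected by the multiple of \<open>S_fun\<close> that makes it
  vanish at t = 1. In contrast to the defining quotient this form has no large factors: for 0 <= t
  <= 1 both terms are bounded by 1.\<close>

lemma C_fun_eq:
  assumes "0 < \<alpha>" "\<alpha> \<le> 1" "0 < \<mu>"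
  shows "C_fun \<alpha> \<mu> t = mittag_leffler \<alpha> 1 (- \<mu> * t powr \<alpha>) - mittag_leffler \<alpha> 1 (- \<mu>) * S_fun \<alpha> \<mu> t"
proof -
  have O: "2 * \<mu> * mittag_leffler (2 * \<alpha>) (\<alpha> + 1) (\<mu>\<^sup>2) = mittag_leffler \<alpha> 1 \<mu> - mittag_leffler \<alpha> 1 (- \<mu>)"
    using ml_odd_conv[OF assms(1,2), of \<mu>] by (simp add: ml_odd_def)
  have "mittag_leffler \<alpha> 1 \<mu> - mittag_leffler \<alpha> 1 (- \<mu>) \<noteq> 0"
    using ml_odd_pos(1)[OF assms] by (simp add: ml_odd_def)
  then show ?thesis
    unfolding C_fun_def O S_fun_eq[OF assms] by (simp add: ml_odd_def field_simps)
qed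

definition modal :: "real \<Rightarrow> real \<Rightarrow> real \<Rightarrow> real \<Rightarrow> real \<Rightarrow> real" where
  "modal \<alpha> \<mu> p q x = p * C_fun \<alpha> \<mu> x + q * S_fun \<alpha> \<mu> x"

text \<open>The weight of the growing solution E(\<mu> * x powr \<alpha>) in the mode with values p
  at 0 and q at 1; the decaying solution has the weight p minus this one.\<close>

definition modal_coeff :: "real \<Rightarrow> real \<Rightarrow> real \<Rightarrow> real \<Rightarrow> real" where
  "modal_coeff \<alpha> \<mu> p q = (q - p * mittag_leffler \<alpha> 1 (- \<mu>)) / (2 * ml_odd \<alpha> \<mu>)"

text \<open>The Caputo derivative of \<open>modal\<close>: the growing part is multiplied by \<mu>,
  the decaying part by -\<mu>.\<close>

definition modal_D :: "real \<Rightarrow> real \<Rightarrow> real \<Rightarrow> real \<Rightarrow> real \<Rightarrow> real" where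
  "modal_D \<alpha> \<mu> p q x = \<mu> * modal_coeff \<alpha> \<mu> p q * mittag_leffler \<alpha> 1 (\<mu> * x powr \<alpha>)
     + - \<mu> * (p - modal_coeff \<alpha> \<mu> p q) * mittag_leffler \<alpha> 1 (- \<mu> * x powr \<alpha>)"

lemma modal_eq:
  assumes "0 < \<alpha>" "\<alpha> \<le> 1" "0 < \<mu>"
  shows "modal \<alpha> \<mu> p q x = modal_coeff \<alpha> \<mu> p q * mittag_leffler \<alpha> 1 (\<mu> * x powr \<alpha>)
     + (p - modal_coeff \<alpha> \<mu> p q) * mittag_leffler \<alpha> 1 (- \<mu> * x powr \<alpha>)"
  using ml_odd_pos(1)[OF assms]
  unfolding modal_def C_fun_eq[OF assms] S_fun_eq[OF assms] modal_coeff_def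
  by (simp add: ml_odd_def[of \<alpha> "\<mu> * x powr \<alpha>"] field_simps)

lemma modal_boundary:
  assumes \<alpha>: "0 < \<alpha>" "\<alpha> \<le> 1" and \<mu>: "0 < \<mu>"
  shows "modal \<alpha> \<mu> p q 0 = p" "modal \<alpha> \<mu> p q 1 = q" "continuous_on {0..1} (modal \<alpha> \<mu> p q)"
    and "0 \<le> x \<Longrightarrow> x \<le> 1 \<Longrightarrow> \<bar>modal \<alpha> \<mu> p q x\<bar> \<le> 2 * \<bar>p\<bar> + \<bar>q\<bar>"
proof -
  have O: "0 < ml_odd \<alpha> \<mu>" by (rule ml_odd_pos[OF \<alpha> \<mu>])
  show "modal \<alpha> \<mu> p q 0 = p"
    unfolding modal_eq[OF assms] by simp
  show "modal \<alpha> \<mu> p q 1 = q"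
    unfolding modal_def C_fun_eq[OF assms] S_fun_eq[OF assms] using O by simp
  have "continuous_on UNIV (mittag_leffler \<alpha> 1)"
    by (intro DERIV_continuous_on) (auto intro: has_deriv_mittag_leffler[OF \<alpha>])
  then have E: "continuous_on {0..1} (\<lambda>x. mittag_leffler \<alpha> 1 (l * x powr \<alpha>))" for l
    using \<alpha> by (intro continuous_on_compose2[of UNIV "mittag_leffler \<alpha> 1" "{0..1}"] continuous_on_powr' continuous_intros) auto
  show "continuous_on {0..1} (modal \<alpha> \<mu> p q)"
    unfolding modal_eq[OF assms] by (intro continuous_intros E)
  assume x: "0 \<le> x" "x \<le> 1"
  have z: "0 \<le> \<mu> * x powr \<alpha>" "\<mu> * x powr \<alpha> \<le> \<mu>"
    using \<mu> x \<alpha> powr_mono2[of \<alpha> x 1] by auto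
  obtain K where K: "\<And>z. 0 < z \<Longrightarrow> 0 \<le> mittag_leffler \<alpha> 1 (- z) \<and> mittag_leffler \<alpha> 1 (- z) \<le> 1"
    using mittag_leffler_minus_decay[OF \<alpha>] by metis
  have e: "\<bar>mittag_leffler \<alpha> 1 (- z)\<bar> \<le> 1" if "0 \<le> z" for z
    using K[of z] that by (cases "z = 0") auto
  have S: "\<bar>S_fun \<alpha> \<mu> x\<bar> \<le> 1"
    using ml_odd_mono[OF \<alpha> z] O unfolding S_fun_eq[OF assms] by simp
  have "\<bar>mittag_leffler \<alpha> 1 (- \<mu>) * S_fun \<alpha> \<mu> x\<bar> \<le> 1 * 1"
    unfolding abs_mult using S e[of \<mu>] \<mu> by (intro mult_mono) auto
  then have "\<bar>C_fun \<alpha> \<mu> x\<bar> \<le> 2"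
    unfolding C_fun_eq[OF assms] using e[OF z(1)] by simp
  then have "\<bar>p * C_fun \<alpha> \<mu> x\<bar> \<le> \<bar>p\<bar> * 2" "\<bar>q * S_fun \<alpha> \<mu> x\<bar> \<le> \<bar>q\<bar> * 1"
    unfolding abs_mult using S by (intro mult_left_mono; simp)+
  then show "\<bar>modal \<alpha> \<mu> p q x\<bar> \<le> 2 * \<bar>p\<bar> + \<bar>q\<bar>"
    unfolding modal_def by linarith
qed

lemma modal_caputo:
  assumes \<alpha>: "0 < \<alpha>" "\<alpha> \<le> 1" and \<mu>: "0 < \<mu>" and x: "0 < x"
  shows "(modal \<alpha> \<mu> p q has_field_derivative \<mu> * \<alpha> * x powr (\<alpha> - 1) *
      (modal_coeff \<alpha> \<mu> p q * ml_deriv \<alpha> (\<mu> * x powr \<alpha>) - (p - modal_coeff \<alpha> \<mu> p q) * ml_deriv \<alpha> (- \<mu> * x powr \<alpha>))) (at x)"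
    and "(modal_D \<alpha> \<mu> p q has_field_derivative \<mu>\<^sup>2 * \<alpha> * x powr (\<alpha> - 1) *
      (modal_coeff \<alpha> \<mu> p q * ml_deriv \<alpha> (\<mu> * x powr \<alpha>) + (p - modal_coeff \<alpha> \<mu> p q) * ml_deriv \<alpha> (- \<mu> * x powr \<alpha>))) (at x)"
    and "has_caputo \<alpha> (modal \<alpha> \<mu> p q) x" "caputo \<alpha> (modal \<alpha> \<mu> p q) x = modal_D \<alpha> \<mu> p q x"
    and "has_caputo \<alpha> (modal_D \<alpha> \<mu> p q) x" "caputo \<alpha> (modal_D \<alpha> \<mu> p q) x = \<mu>\<^sup>2 * modal \<alpha> \<mu> p q x"
proof -
  note E = caputo_mittag_leffler[OF \<alpha> x]
  note eq = modal_eq[OF \<alpha> \<mu>, abs_def] modal_D_def[abs_def]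
  show "(modal \<alpha> \<mu> p q has_field_derivative \<mu> * \<alpha> * x powr (\<alpha> - 1) *
      (modal_coeff \<alpha> \<mu> p q * ml_deriv \<alpha> (\<mu> * x powr \<alpha>) - (p - modal_coeff \<alpha> \<mu> p q) * ml_deriv \<alpha> (- \<mu> * x powr \<alpha>))) (at x)"
    unfolding eq by (rule DERIV_cong[OF DERIV_add[OF DERIV_cmult DERIV_cmult]], rule E, rule E) (simp add: algebra_simps)
  show "(modal_D \<alpha> \<mu> p q has_field_derivative \<mu>\<^sup>2 * \<alpha> * x powr (\<alpha> - 1) *
      (modal_coeff \<alpha> \<mu> p q * ml_deriv \<alpha> (\<mu> * x powr \<alpha>) + (p - modal_coeff \<alpha> \<mu> p q) * ml_deriv \<alpha> (- \<mu> * x powr \<alpha>))) (at x)"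
    unfolding eq by (rule DERIV_cong[OF DERIV_add[OF DERIV_cmult DERIV_cmult]], rule E, rule E)
      (simp add: algebra_simps power2_eq_square)
  show "has_caputo \<alpha> (modal \<alpha> \<mu> p q) x" "has_caputo \<alpha> (modal_D \<alpha> \<mu> p q) x"
    unfolding eq by (intro caputo_lincomb E)+
  show "caputo \<alpha> (modal \<alpha> \<mu> p q) x = modal_D \<alpha> \<mu> p q x"
    unfolding eq caputo_lincomb(2)[OF E(2) E(2)] E(3) by (simp add: algebra_simps)
  show "caputo \<alpha> (modal_D \<alpha> \<mu> p q) x = \<mu>\<^sup>2 * modal \<alpha> \<mu> p q x"
    unfolding eq caputo_lincomb(2)[OF E(2) E(2)] E(3) by (simp add: algebra_simps power2_eq_square)
qed

text \<open>For x <= r < 1 the growing part is evaluated at z <= \<rho> * \<mu> with \<rho> < 1,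
  while its weight is divided by \<open>ml_odd\<close> at \<mu>; the growth estimate therefore gains
  \<mu> powr (-2). The decaying part gains only \<mu> powr (-1/2), which after multiplication by
  \<mu>^2 leaves the factor \<mu> powr (3/2) at p and costs x powr (- \<alpha> / 2) near 0.\<close>

lemma modal_bounds:
  assumes \<alpha>: "0 < \<alpha>" "\<alpha> \<le> 1" and m: "0 < m" and r: "0 < r" "r < 1"
  obtains C where "\<And>\<mu> p q x. m \<le> \<mu> \<Longrightarrow> 0 < x \<Longrightarrow> x \<le> r \<Longrightarrow>
      \<mu>\<^sup>2 * \<bar>modal \<alpha> \<mu> p q x\<bar> \<le> C * (\<bar>q\<bar> + \<bar>p\<bar> * (1 + \<mu> powr (3/2))) * x powr (- \<alpha> / 2) \<and>
      \<bar>deriv (modal \<alpha> \<mu> p q) x\<bar> \<le> C * (\<bar>q\<bar> + \<bar>p\<bar> * (1 + \<mu> powr (3/2))) * x powr (\<alpha> / 2 - 1) \<and>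
      \<bar>modal_D \<alpha> \<mu> p q x\<bar> \<le> C * (\<bar>q\<bar> + \<bar>p\<bar> * (1 + \<mu> powr (3/2))) \<and>
      \<bar>deriv (modal_D \<alpha> \<mu> p q) x\<bar> \<le> C * (\<bar>q\<bar> + \<bar>p\<bar> * (1 + \<mu> powr (3/2))) * x powr (\<alpha> / 2 - 1)"
proof -
  define \<rho> where "\<rho> = r powr \<alpha>"
  have \<rho>: "0 \<le> \<rho>" "\<rho> < 1" using r \<alpha> powr_less_mono2[of \<alpha> r 1] by (auto simp: \<rho>_def)
  obtain C0 where C0: "0 < C0"
    "\<And>z. 0 \<le> z \<Longrightarrow> z\<^sup>2 * mittag_leffler \<alpha> 1 (\<rho> * z) \<le> C0 * (mittag_leffler \<alpha> 1 z - 1)"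
    "\<And>z. 0 \<le> z \<Longrightarrow> z\<^sup>2 * ml_deriv \<alpha> (\<rho> * z) \<le> C0 * (mittag_leffler \<alpha> 1 z - 1)"
    using mittag_leffler_growth[OF \<alpha> \<rho>] by metis
  obtain K where K: "0 < K" "\<And>z. 0 < z \<Longrightarrow> 0 \<le> mittag_leffler \<alpha> 1 (- z) \<and> mittag_leffler \<alpha> 1 (- z) \<le> 1 \<and>
        mittag_leffler \<alpha> 1 (- z) \<le> K * z powr (-1/2) \<and>
        0 \<le> ml_deriv \<alpha> (- z) \<and> ml_deriv \<alpha> (- z) \<le> K \<and> ml_deriv \<alpha> (- z) \<le> K * z powr (-1/2)"
    using mittag_leffler_minus_decay[OF \<alpha>] by metis
  \<comment> \<open>The sum of the constants of the four estimates, so that each of them is at most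
    \<open>C\<close>.\<close>
  define C where "C = 2 * C0 + K + ((1 + K) * C0 / m + K) + (2 * C0 / m + 1) + ((1 + K) * C0 + K)"
  have Cge: "2 * C0 + K \<le> C" "(1 + K) * C0 / m + K \<le> C" "2 * C0 / m + 1 \<le> C" "(1 + K) * C0 + K \<le> C"
    using C0(1) K(1) m by (auto simp: C_def add_nonneg_nonneg)
  show ?thesis
  proof (rule that)
    fix \<mu> p q x :: real assume m\<mu>: "m \<le> \<mu>" and x: "0 < x" "x \<le> r"
    have \<mu>: "0 < \<mu>" using m\<mu> m by simp
    define z where "z = \<mu> * x powr \<alpha>"
    define A where "A = modal_coeff \<alpha> \<mu> p q"
    define B where "B = p - A"
    define w where "w = q - p * mittag_leffler \<alpha> 1 (- \<mu>)"
    \<comment> \<open>A common bound for |A|, |A| * E(z) and |A| * E'(z).\<close>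
    define a where "a = \<bar>w\<bar> * C0 / \<mu>\<^sup>2"
    define D where "D = \<bar>q\<bar> + \<bar>p\<bar> * (1 + \<mu> powr (3/2))"
    have O: "0 < ml_odd \<alpha> \<mu>" "mittag_leffler \<alpha> 1 \<mu> - 1 \<le> 2 * ml_odd \<alpha> \<mu>" by (rule ml_odd_pos[OF \<alpha> \<mu>])+
    have z: "0 < z" "z \<le> \<rho> * \<mu>"
      using x \<mu> \<alpha> by (auto simp: z_def \<rho>_def intro!: powr_mono2)
    have x1: "x \<le> 1" using x r by simp
    have px: "1 \<le> x powr (- \<alpha> / 2)" "x powr (\<alpha> - 1) \<le> x powr (\<alpha> / 2 - 1)" "0 < x powr (\<alpha> / 2 - 1)"
      using x x1 \<alpha> powr_mono'[of "- \<alpha> / 2" 0 x] by (auto intro!: powr_mono')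
    have w: "\<bar>w\<bar> \<le> \<bar>q\<bar> + \<bar>p\<bar>"
    proof -
      have "\<bar>p * mittag_leffler \<alpha> 1 (- \<mu>)\<bar> \<le> \<bar>p\<bar> * 1"
        unfolding abs_mult using K(2)[OF \<mu>] by (intro mult_left_mono) auto
      then show ?thesis unfolding w_def by linarith
    qed
    have p0: "0 \<le> \<mu> powr (3/2)" by simp
    have \<mu>1: "\<mu> \<le> 1 + \<mu> powr (3/2)"
    proof (cases "\<mu> \<le> 1")
      case False
      then have "\<mu> powr 1 \<le> \<mu> powr (3/2)" by (intro powr_mono) auto
      then show ?thesis using \<mu> by simp
    qed (use p0 in linarith)
    have Deq: "D = \<bar>q\<bar> + \<bar>p\<bar> + \<bar>p\<bar> * \<mu> powr (3/2)" by (simp add: D_def algebra_simps)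
    have pp: "0 \<le> \<bar>p\<bar> * \<mu> powr (3/2)" by simp
    have pm: "\<bar>p\<bar> * \<mu> \<le> \<bar>p\<bar> + \<bar>p\<bar> * \<mu> powr (3/2)"
      using mult_left_mono[OF \<mu>1, of "\<bar>p\<bar>"] by (simp add: algebra_simps)
    have D: "\<bar>w\<bar> + \<bar>p\<bar> * \<mu> powr (3/2) \<le> D" "\<bar>w\<bar> \<le> D" "\<bar>p\<bar> * \<mu> \<le> D" "0 \<le> D"
      "\<bar>p\<bar> * \<mu> powr (3/2) \<le> D"
      unfolding Deq using w pp pm by linarith+
    have Ab: "\<bar>A\<bar> * e \<le> a" if "\<mu>\<^sup>2 * e \<le> C0 * (mittag_leffler \<alpha> 1 \<mu> - 1)" for e
    proof -
      have "\<mu>\<^sup>2 * e \<le> C0 * (2 * ml_odd \<alpha> \<mu>)"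
        using order_trans[OF that mult_left_mono[OF O(2)]] C0(1) by simp
      then have "e / (2 * ml_odd \<alpha> \<mu>) \<le> C0 / \<mu>\<^sup>2"
        using O(1) \<mu> by (simp add: field_simps)
      then have "\<bar>w\<bar> * (e / (2 * ml_odd \<alpha> \<mu>)) \<le> \<bar>w\<bar> * (C0 / \<mu>\<^sup>2)"
        by (intro mult_left_mono) auto
      then show ?thesis
        using O(1) by (simp add: A_def modal_coeff_def w_def[symmetric] a_def abs_divide abs_mult)
    qed
    have AE: "\<bar>A\<bar> * mittag_leffler \<alpha> 1 z \<le> a" "\<bar>A\<bar> * ml_deriv \<alpha> z \<le> a" "\<bar>A\<bar> \<le> a"
    proof -
      have "\<mu>\<^sup>2 * mittag_leffler \<alpha> 1 z \<le> \<mu>\<^sup>2 * mittag_leffler \<alpha> 1 (\<rho> * \<mu>)"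
        using z by (intro mult_left_mono ml_deriv_nonneg_mono[OF \<alpha>]) auto
      from order_trans[OF this C0(2)[of \<mu>]] \<mu> show *: "\<bar>A\<bar> * mittag_leffler \<alpha> 1 z \<le> a" by (intro Ab) simp
      have "\<mu>\<^sup>2 * ml_deriv \<alpha> z \<le> \<mu>\<^sup>2 * ml_deriv \<alpha> (\<rho> * \<mu>)"
        using z by (intro mult_left_mono ml_deriv_nonneg_mono[OF \<alpha>]) auto
      from order_trans[OF this C0(3)[of \<mu>]] \<mu> show "\<bar>A\<bar> * ml_deriv \<alpha> z \<le> a" by (intro Ab) simp
      have "\<bar>A\<bar> * 1 \<le> \<bar>A\<bar> * mittag_leffler \<alpha> 1 z"
        using z by (intro mult_left_mono ml_deriv_nonneg_mono[OF \<alpha>]) auto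
      then show "\<bar>A\<bar> \<le> a" using * by simp
    qed
    have B: "\<bar>B\<bar> \<le> \<bar>p\<bar> + a" using AE(3) by (simp add: B_def)
    have a0: "0 \<le> a" using AE(3) by simp
    have a2: "\<mu>\<^sup>2 * a = C0 * \<bar>w\<bar>" using \<mu> by (simp add: a_def)
    have a1: "\<mu> * a \<le> C0 / m * \<bar>w\<bar>"
    proof -
      have "\<mu> * a = C0 / \<mu> * \<bar>w\<bar>" using \<mu> by (simp add: a_def power2_eq_square)
      also have "\<dots> \<le> C0 / m * \<bar>w\<bar>" using m m\<mu> C0(1) by (intro mult_right_mono divide_left_mono) auto
      finally show ?thesis .
    qed
    note Kz = K(2)[OF z(1)]
    have zh: "\<mu>\<^sup>2 * z powr (-1/2) = \<mu> powr (3/2) * x powr (- \<alpha> / 2)"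
    proof -
      have "\<mu>\<^sup>2 * z powr (-1/2) = \<mu> powr 2 * (\<mu> powr (-1/2) * x powr (- \<alpha> / 2))"
        using \<mu> x by (simp add: z_def powr_mult powr_powr)
      then show ?thesis by (simp add: powr_add[symmetric])
    qed
    note E = modal_caputo[OF \<alpha> \<mu> x(1), of p q, folded A_def, folded B_def, folded z_def]
    have BE: "\<bar>B\<bar> * e \<le> \<bar>p\<bar> * e + a * k" if "0 \<le> e" "e \<le> k" for e k
    proof -
      have "\<bar>B\<bar> * e \<le> (\<bar>p\<bar> + a) * e" using B that by (intro mult_right_mono) auto
      also have "\<dots> \<le> \<bar>p\<bar> * e + a * k" using mult_left_mono[OF that(2) a0] by (simp add: algebra_simps)
      finally show ?thesis .
    qed
    have zeq: "- \<mu> * x powr \<alpha> = - z" by (simp add: z_def)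
    have lin: "c1 * \<bar>w\<bar> + c2 * d \<le> C * D" if "0 \<le> c1" "0 \<le> c2" "c1 + c2 \<le> C" "d \<le> D" for c1 c2 d
    proof -
      have "c1 * \<bar>w\<bar> + c2 * d \<le> c1 * D + c2 * D"
        using D that by (intro add_mono mult_left_mono) auto
      also have "\<dots> = (c1 + c2) * D" by (simp add: algebra_simps)
      also have "\<dots> \<le> C * D" by (rule mult_right_mono[OF that(3) D(4)])
      finally show ?thesis .
    qed
    have 1: "\<mu>\<^sup>2 * \<bar>modal \<alpha> \<mu> p q x\<bar> \<le> C * D * x powr (- \<alpha> / 2)"
    proof -
      have "\<bar>modal \<alpha> \<mu> p q x\<bar> \<le> \<bar>A\<bar> * mittag_leffler \<alpha> 1 z + \<bar>B\<bar> * mittag_leffler \<alpha> 1 (- z)"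
        unfolding modal_eq[OF \<alpha> \<mu>] A_def[symmetric] zeq using Kz ml_deriv_nonneg_mono(1)[OF \<alpha>, of z z] z
        by (simp add: B_def z_def[symmetric]) (intro order_trans[OF abs_triangle_ineq], simp add: abs_mult)
      also have "\<dots> \<le> a + (\<bar>p\<bar> * mittag_leffler \<alpha> 1 (- z) + a * 1)"
        using AE Kz by (intro add_mono BE) auto
      also have "\<dots> \<le> a + (\<bar>p\<bar> * (K * z powr (-1/2)) + a * 1)"
        using Kz a0 by (intro add_mono mult_left_mono) auto
      finally have "\<mu>\<^sup>2 * \<bar>modal \<alpha> \<mu> p q x\<bar> \<le> \<mu>\<^sup>2 * (a + (\<bar>p\<bar> * (K * z powr (-1/2)) + a * 1))"
        by (intro mult_left_mono) auto
      also have "\<dots> = 2 * (\<mu>\<^sup>2 * a) + K * \<bar>p\<bar> * (\<mu>\<^sup>2 * z powr (-1/2))"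
        by (simp add: algebra_simps)
      also have "\<dots> = 2 * C0 * \<bar>w\<bar> * 1 + K * (\<bar>p\<bar> * \<mu> powr (3/2)) * x powr (- \<alpha> / 2)"
        unfolding zh a2 by simp
      also have "\<dots> \<le> 2 * C0 * \<bar>w\<bar> * x powr (- \<alpha> / 2) + K * (\<bar>p\<bar> * \<mu> powr (3/2)) * x powr (- \<alpha> / 2)"
        using px C0(1) K(1) by (intro add_mono mult_left_mono) auto
      also have "\<dots> = (2 * C0 * \<bar>w\<bar> + K * (\<bar>p\<bar> * \<mu> powr (3/2))) * x powr (- \<alpha> / 2)"
        by (simp add: algebra_simps)
      also have "\<dots> \<le> C * D * x powr (- \<alpha> / 2)"
        using C0(1) K(1) Cge(1) D by (intro mult_right_mono lin) auto
      finally show ?thesis .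
    qed
    have 3: "\<bar>modal_D \<alpha> \<mu> p q x\<bar> \<le> C * D"
    proof -
      have "\<bar>modal_D \<alpha> \<mu> p q x\<bar> = \<bar>\<mu> * (A * mittag_leffler \<alpha> 1 z - B * mittag_leffler \<alpha> 1 (- z))\<bar>"
        unfolding modal_D_def A_def[symmetric] zeq by (simp add: B_def z_def[symmetric] algebra_simps)
      also have "\<dots> \<le> \<mu> * (\<bar>A\<bar> * mittag_leffler \<alpha> 1 z + \<bar>B\<bar> * mittag_leffler \<alpha> 1 (- z))"
        unfolding abs_mult using Kz \<mu> ml_deriv_nonneg_mono(1)[OF \<alpha>, of z z] z
        by (simp, intro order_trans[OF abs_triangle_ineq4], simp add: abs_mult)
      also have "\<dots> \<le> \<mu> * (a + (\<bar>p\<bar> * mittag_leffler \<alpha> 1 (- z) + a * 1))"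
        using AE Kz \<mu> by (intro mult_left_mono add_mono BE) auto
      also have "\<dots> \<le> \<mu> * (a + (\<bar>p\<bar> * 1 + a * 1))"
        using Kz \<mu> a0 by (intro mult_left_mono add_mono) auto
      also have "\<dots> = 2 * (\<mu> * a) + 1 * (\<bar>p\<bar> * \<mu>)" by (simp add: algebra_simps)
      also have "\<dots> \<le> 2 * (C0 / m * \<bar>w\<bar>) + 1 * (\<bar>p\<bar> * \<mu>)"
        using a1 by linarith
      also have "\<dots> = 2 * C0 / m * \<bar>w\<bar> + 1 * (\<bar>p\<bar> * \<mu>)" by simp
      also have "\<dots> \<le> C * D" using C0(1) m Cge(3) D by (intro lin) auto
      finally show ?thesis .
    qed
    have d1: "0 \<le> ml_deriv \<alpha> z" using z by (intro ml_deriv_nonneg_mono[OF \<alpha>]) auto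
    have tri: "\<bar>A * ml_deriv \<alpha> z - B * ml_deriv \<alpha> (- z)\<bar> \<le> \<bar>A\<bar> * ml_deriv \<alpha> z + \<bar>B\<bar> * ml_deriv \<alpha> (- z)"
       "\<bar>A * ml_deriv \<alpha> z + B * ml_deriv \<alpha> (- z)\<bar> \<le> \<bar>A\<bar> * ml_deriv \<alpha> z + \<bar>B\<bar> * ml_deriv \<alpha> (- z)"
      using Kz d1 abs_triangle_ineq4[of "A * ml_deriv \<alpha> z" "B * ml_deriv \<alpha> (- z)"]
        abs_triangle_ineq[of "A * ml_deriv \<alpha> z" "B * ml_deriv \<alpha> (- z)"] by (simp_all add: abs_mult)
    have 2: "\<bar>deriv (modal \<alpha> \<mu> p q) x\<bar> \<le> C * D * x powr (\<alpha> / 2 - 1)"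
    proof -
      have "\<bar>deriv (modal \<alpha> \<mu> p q) x\<bar> = \<alpha> * x powr (\<alpha> - 1) * (\<mu> * \<bar>A * ml_deriv \<alpha> z - B * ml_deriv \<alpha> (- z)\<bar>)"
        using DERIV_imp_deriv[OF E(1)[unfolded zeq]] \<alpha> \<mu> by (simp add: abs_mult)
      also have "\<dots> \<le> 1 * x powr (\<alpha> / 2 - 1) * (\<mu> * (\<bar>A\<bar> * ml_deriv \<alpha> z + \<bar>B\<bar> * ml_deriv \<alpha> (- z)))"
        using tri \<alpha> \<mu> px by (intro mult_mono mult_nonneg_nonneg) auto
      also have "\<dots> \<le> 1 * x powr (\<alpha> / 2 - 1) * (\<mu> * (a + (\<bar>p\<bar> * ml_deriv \<alpha> (- z) + a * K)))"
        using AE Kz \<mu> by (intro mult_left_mono add_mono BE) auto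
      also have "\<dots> \<le> 1 * x powr (\<alpha> / 2 - 1) * (\<mu> * (a + (\<bar>p\<bar> * K + a * K)))"
        using Kz \<mu> a0 by (intro mult_left_mono add_mono) auto
      also have "\<dots> = x powr (\<alpha> / 2 - 1) * ((1 + K) * (\<mu> * a) + K * (\<bar>p\<bar> * \<mu>))"
        by (simp add: algebra_simps)
      also have "\<dots> \<le> x powr (\<alpha> / 2 - 1) * ((1 + K) * (C0 / m * \<bar>w\<bar>) + K * (\<bar>p\<bar> * \<mu>))"
        using a1 K(1) by (intro mult_left_mono add_mono) auto
      also have "\<dots> = x powr (\<alpha> / 2 - 1) * ((1 + K) * C0 / m * \<bar>w\<bar> + K * (\<bar>p\<bar> * \<mu>))" by simp
      also have "\<dots> \<le> x powr (\<alpha> / 2 - 1) * (C * D)"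
        using C0(1) m K(1) Cge(2) D by (intro mult_left_mono lin) auto
      finally show ?thesis by (simp add: mult_ac)
    qed
    have 4: "\<bar>deriv (modal_D \<alpha> \<mu> p q) x\<bar> \<le> C * D * x powr (\<alpha> / 2 - 1)"
    proof -
      have "\<bar>deriv (modal_D \<alpha> \<mu> p q) x\<bar> = \<alpha> * x powr (\<alpha> - 1) * (\<mu>\<^sup>2 * \<bar>A * ml_deriv \<alpha> z + B * ml_deriv \<alpha> (- z)\<bar>)"
        using DERIV_imp_deriv[OF E(2)[unfolded zeq]] \<alpha> \<mu> by (simp add: abs_mult)
      also have "\<dots> \<le> 1 * x powr (\<alpha> - 1) * (\<mu>\<^sup>2 * (\<bar>A\<bar> * ml_deriv \<alpha> z + \<bar>B\<bar> * ml_deriv \<alpha> (- z)))"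
        using tri \<alpha> \<mu> by (intro mult_mono mult_nonneg_nonneg) auto
      also have "\<dots> \<le> 1 * x powr (\<alpha> - 1) * (\<mu>\<^sup>2 * (a + (\<bar>p\<bar> * ml_deriv \<alpha> (- z) + a * K)))"
        using AE Kz \<mu> by (intro mult_left_mono add_mono BE) auto
      also have "\<dots> \<le> 1 * x powr (\<alpha> - 1) * (\<mu>\<^sup>2 * (a + (\<bar>p\<bar> * (K * z powr (-1/2)) + a * K)))"
        using Kz \<mu> a0 by (intro mult_left_mono add_mono) auto
      also have "\<dots> = x powr (\<alpha> - 1) * ((1 + K) * (\<mu>\<^sup>2 * a)) + x powr (\<alpha> - 1) * (K * \<bar>p\<bar> * (\<mu>\<^sup>2 * z powr (-1/2)))"
        by (simp add: algebra_simps)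
      also have "x powr (\<alpha> - 1) * (K * \<bar>p\<bar> * (\<mu>\<^sup>2 * z powr (-1/2))) = (x powr (\<alpha> - 1) * x powr (- \<alpha> / 2)) * (K * (\<bar>p\<bar> * \<mu> powr (3/2)))"
        unfolding zh by simp
      also have "x powr (\<alpha> - 1) * x powr (- \<alpha> / 2) = x powr (\<alpha> / 2 - 1)"
        by (simp add: powr_add[symmetric])
      also have "x powr (\<alpha> - 1) * ((1 + K) * (\<mu>\<^sup>2 * a)) \<le> x powr (\<alpha> / 2 - 1) * ((1 + K) * (\<mu>\<^sup>2 * a))"
        using px K(1) a0 by (intro mult_right_mono) auto
      finally have "\<bar>deriv (modal_D \<alpha> \<mu> p q) x\<bar> \<le> x powr (\<alpha> / 2 - 1) * ((1 + K) * C0 * \<bar>w\<bar> + K * (\<bar>p\<bar> * \<mu> powr (3/2)))"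
        unfolding a2 by (simp add: algebra_simps)
      also have "\<dots> \<le> x powr (\<alpha> / 2 - 1) * (C * D)"
        using C0(1) K(1) Cge(4) D by (intro mult_left_mono lin) auto
      finally show ?thesis by (simp add: mult_ac)
    qed
    show "\<mu>\<^sup>2 * \<bar>modal \<alpha> \<mu> p q x\<bar> \<le> C * (\<bar>q\<bar> + \<bar>p\<bar> * (1 + \<mu> powr (3/2))) * x powr (- \<alpha> / 2) \<and>
      \<bar>deriv (modal \<alpha> \<mu> p q) x\<bar> \<le> C * (\<bar>q\<bar> + \<bar>p\<bar> * (1 + \<mu> powr (3/2))) * x powr (\<alpha> / 2 - 1) \<and>
      \<bar>modal_D \<alpha> \<mu> p q x\<bar> \<le> C * (\<bar>q\<bar> + \<bar>p\<bar> * (1 + \<mu> powr (3/2))) \<and>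
      \<bar>deriv (modal_D \<alpha> \<mu> p q) x\<bar> \<le> C * (\<bar>q\<bar> + \<bar>p\<bar> * (1 + \<mu> powr (3/2))) * x powr (\<alpha> / 2 - 1)"
      using 1 2 3 4 unfolding D_def by blast
  qed
qed

section \<open>Trigonometric series\<close>

text \<open>The wave number k shared by Y (2k - 1) = sin ky and Y (2k) = cos ky.\<close>

definition freq :: "nat \<Rightarrow> real" where
  "freq n = real ((n + 1) div 2)"

lemma Y_eq: "Y n y = (if odd n then sin (freq n * y) else cos (freq n * y))"
  by (auto simp: Y_def freq_def elim!: evenE)

lemma lam_eq: "lam \<epsilon> n = (if odd n then 1 + \<epsilon> else 1 - \<epsilon>) * (freq n)\<^sup>2"
  by (auto simp: lam_def freq_def elim!: evenE)

lemma freq_0 [simp]: "freq 0 = 0" by (simp add: freq_def)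

lemma freq_ge: "1 \<le> n \<Longrightarrow> 1 \<le> freq n" "real n \<le> 2 * freq n" "0 \<le> freq n"
proof -
  have "n \<le> 2 * ((n + 1) div 2)" by presburger
  then show "real n \<le> 2 * freq n" by (simp add: freq_def)
  assume "1 \<le> n"
  then have "1 \<le> (n + 1) div 2" by presburger
  then show "1 \<le> freq n" by (simp add: freq_def)
qed (simp add: freq_def)

lemma summable_freq_powr:
  assumes "s < -1"
  shows "summable (\<lambda>n. freq n powr s)"
proof (rule summable_comparison_test')
  show "summable (\<lambda>n. 2 powr (- s) * real n powr s)"
    using assms summable_real_powr_iff[of s] by (intro summable_mult) auto
  show "norm (freq n powr s) \<le> 2 powr (- s) * real n powr s" if "1 \<le> n" for n
  proof -
    have "freq n powr s \<le> (real n / 2) powr s"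
      using freq_ge[of n] that assms by (intro powr_mono2') auto
    also have "\<dots> = 2 powr (- s) * real n powr s"
      by (simp add: powr_divide powr_minus_divide)
    finally show ?thesis by simp
  qed
qed

lemma Y_abs_le: "\<bar>Y n y\<bar> \<le> 1"
  by (simp add: Y_eq)

lemma continuous_on_Y [continuous_intros]: "continuous_on S (Y n)"
  unfolding Y_eq[abs_def] by (cases "odd n") (auto intro!: continuous_intros)

lemma sin_freq_pi: "sin (freq n * pi) = 0"
  unfolding freq_def by (rule sin_npi)

lemma Y_periodic: "Y n (- pi) = Y n pi"
  by (simp add: Y_eq sin_freq_pi)

lemma integral_Y_Y:
  "integral {-pi..pi} (\<lambda>y. Y m y * Y n y) = (if m = n then if n = 0 then 2 * pi else pi else 0)"
proof -
  \<comment> \<open>Wave numbers as integers, because i - j may be negative in the product-to-sum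
    formulas.\<close>
  define i j where "i = int ((m + 1) div 2)" and "j = int ((n + 1) div 2)"
  have fr: "freq m = real_of_int i" "freq n = real_of_int j" by (simp_all add: i_def j_def freq_def)
  note c = has_integral_cos_nx and s = has_integral_sin_nx
  have cd: "((\<lambda>y. cos (real_of_int (i - j) * y)) has_integral (if i = j then 2 * pi else 0)) {-pi..pi}"
    using c[of "i - j"] by (simp only: right_minus_eq)
  have ij: "0 \<le> i" "0 \<le> j" by (auto simp: i_def j_def)
  consider "odd m" "odd n" | "even m" "even n" | "odd m" "even n" | "even m" "odd n" by blast
  then show ?thesis
  proof cases
    case 1
    have eq: "(\<lambda>y. Y m y * Y n y) = (\<lambda>y. (cos (real_of_int (i - j) * y) - cos (real_of_int (i + j) * y)) / 2)"
      using 1 by (intro ext) (simp add: Y_eq fr sin_times_sin algebra_simps)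
    have I: "((\<lambda>y. Y m y * Y n y) has_integral
        ((if i = j then 2 * pi else 0) - (if i + j = 0 then 2 * pi else 0)) / 2) {-pi..pi}"
      unfolding eq by (intro has_integral_divide has_integral_diff cd c)
    have "i + j \<noteq> 0" "i = j \<longleftrightarrow> m = n" "n \<noteq> 0"
      using 1 unfolding i_def j_def by presburger+
    then show ?thesis unfolding integral_unique[OF I] by auto
  next
    case 2
    have eq: "(\<lambda>y. Y m y * Y n y) = (\<lambda>y. (cos (real_of_int (i - j) * y) + cos (real_of_int (i + j) * y)) / 2)"
      using 2 by (intro ext) (simp add: Y_eq fr cos_times_cos algebra_simps)
    have I: "((\<lambda>y. Y m y * Y n y) has_integral
        ((if i = j then 2 * pi else 0) + (if i + j = 0 then 2 * pi else 0)) / 2) {-pi..pi}"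
      unfolding eq by (intro has_integral_divide has_integral_add cd c)
    have "i + j = 0 \<longleftrightarrow> m = 0 \<and> n = 0" "i = j \<longleftrightarrow> m = n"
      using 2 unfolding i_def j_def by presburger+
    then show ?thesis unfolding integral_unique[OF I] by auto
  next
    case 3
    have eq: "(\<lambda>y. Y m y * Y n y) = (\<lambda>y. (sin (real_of_int (i + j) * y) + sin (real_of_int (i - j) * y)) / 2)"
      using 3 by (intro ext) (simp add: Y_eq fr sin_times_cos left_diff_distrib distrib_right)
    have I: "((\<lambda>y. Y m y * Y n y) has_integral (0 + 0) / 2) {-pi..pi}"
      unfolding eq by (intro has_integral_divide has_integral_add s)
    have "m \<noteq> n" using 3 by auto
    then show ?thesis unfolding integral_unique[OF I] by auto
  next
    case 4
    have eq: "(\<lambda>y. Y m y * Y n y) = (\<lambda>y. (sin (real_of_int (i + j) * y) - sin (real_of_int (i - j) * y)) / 2)"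
      using 4 by (intro ext) (simp add: Y_eq fr cos_times_sin left_diff_distrib distrib_right)
    have I: "((\<lambda>y. Y m y * Y n y) has_integral (0 - 0) / 2) {-pi..pi}"
      unfolding eq by (intro has_integral_divide has_integral_diff s)
    have "m \<noteq> n" using 4 by auto
    then show ?thesis unfolding integral_unique[OF I] by auto
  qed
qed

lemma L2_inner_Y:
  assumes "continuous_on {-pi..pi} f"
  shows "L2_inner f (Y n) = integral {-pi..pi} (\<lambda>y. f y * Y n y)"
  unfolding L2_inner_def
  by (intro set_borel_integral_eq_integral borel_integrable_atLeastAtMost' continuous_intros assms)

lemma fourier_coeff_eq:
  assumes "continuous_on {-pi..pi} f"
  shows "fourier_coeff f n = integral {-pi..pi} (\<lambda>y. f y * Y n y) / (if n = 0 then 2 * pi else pi)"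
  unfolding fourier_coeff_def L2_inner_Y[OF assms] L2_inner_Y[OF continuous_on_Y] by (simp add: integral_Y_Y)

lemma trig_by_parts:
  fixes f f' :: "real \<Rightarrow> real"
  assumes k: "k \<noteq> 0" and f: "\<And>y. y \<in> {a..b} \<Longrightarrow> (f has_vector_derivative f' y) (at y within {a..b})"
    and f': "continuous_on {a..b} f'" and ab: "a \<le> b"
  shows "integral {a..b} (\<lambda>y. f y * cos (k * y)) =
      (f b * sin (k * b) - f a * sin (k * a)) / k - integral {a..b} (\<lambda>y. f' y * sin (k * y)) / k"
    and "integral {a..b} (\<lambda>y. f y * sin (k * y)) =
      - (f b * cos (k * b) - f a * cos (k * a)) / k + integral {a..b} (\<lambda>y. f' y * cos (k * y)) / k"
proof -
  have cf: "continuous_on {a..b} f"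
    using f by (rule continuous_on_vector_derivative)
  have fd: "(f has_field_derivative f' y) (at y within {a..b})" if "y \<in> {a..b}" for y
    using f[OF that] by (simp add: has_real_derivative_iff_has_vector_derivative)
  have "((\<lambda>y. f' y * sin (k * y) + k * (f y * cos (k * y))) has_integral f b * sin (k * b) - f a * sin (k * a)) {a..b}"
    using ab fd by (intro fundamental_theorem_of_calculus)
      (auto intro!: derivative_eq_intros simp: has_real_derivative_iff_has_vector_derivative[symmetric])
  then have "f b * sin (k * b) - f a * sin (k * a) = integral {a..b} (\<lambda>y. f' y * sin (k * y) + k * (f y * cos (k * y)))"
    by (simp add: integral_unique)
  also have "\<dots> = integral {a..b} (\<lambda>y. f' y * sin (k * y)) + k * integral {a..b} (\<lambda>y. f y * cos (k * y))"
    by (subst integral_add) (auto intro!: integrable_continuous_real continuous_intros cf f')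
  finally show "integral {a..b} (\<lambda>y. f y * cos (k * y)) =
      (f b * sin (k * b) - f a * sin (k * a)) / k - integral {a..b} (\<lambda>y. f' y * sin (k * y)) / k"
    using k by (simp add: field_simps)
  have "((\<lambda>y. f' y * cos (k * y) - k * (f y * sin (k * y))) has_integral f b * cos (k * b) - f a * cos (k * a)) {a..b}"
    using ab fd by (intro fundamental_theorem_of_calculus)
      (auto intro!: derivative_eq_intros simp: has_real_derivative_iff_has_vector_derivative[symmetric])
  then have "f b * cos (k * b) - f a * cos (k * a) = integral {a..b} (\<lambda>y. f' y * cos (k * y) - k * (f y * sin (k * y)))"
    by (simp add: integral_unique)
  also have "\<dots> = integral {a..b} (\<lambda>y. f' y * cos (k * y)) - k * integral {a..b} (\<lambda>y. f y * sin (k * y))"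
    by (subst integral_diff) (auto intro!: integrable_continuous_real continuous_intros cf f')
  finally show "integral {a..b} (\<lambda>y. f y * sin (k * y)) =
      - (f b * cos (k * b) - f a * cos (k * a)) / k + integral {a..b} (\<lambda>y. f' y * cos (k * y)) / k"
    using k by (simp add: field_simps)
qed

section \<open>Decay of Fourier coefficients\<close>

lemma holder_on_imp_continuous_on:
  assumes "holder_on \<delta> S f" "0 < \<delta>"
  shows "continuous_on S f"
proof -
  obtain K where K: "\<And>y z. y \<in> S \<Longrightarrow> z \<in> S \<Longrightarrow> \<bar>f y - f z\<bar> \<le> K * \<bar>y - z\<bar> powr \<delta>"
    using assms unfolding holder_on_def by blast
  show ?thesis
    unfolding continuous_on_def
  proof
    fix z assume z: "z \<in> S"
    have "((\<lambda>y. K * \<bar>y - z\<bar> powr \<delta>) \<longlongrightarrow> K * \<bar>z - z\<bar> powr \<delta>) (at z within S)"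
      using assms(2) by (intro tendsto_intros tendsto_powr') auto
    then have "((\<lambda>y. K * \<bar>y - z\<bar> powr \<delta>) \<longlongrightarrow> 0) (at z within S)" using assms(2) by simp
    then have "((\<lambda>y. f y - f z) \<longlongrightarrow> 0) (at z within S)"
      by (rule Lim_null_comparison[rotated]) (use K z in \<open>auto simp: eventually_at_filter\<close>)
    then show "(f \<longlongrightarrow> f z) (at z within S)" by (rule LIM_zero_cancel)
  qed
qed

lemma holder_space_derivs:
  assumes "holder_space m \<delta> S f" "0 < \<delta>"
  defines "D i \<equiv> (deriv_on S ^^ i) f"
  shows "i < m \<Longrightarrow> y \<in> S \<Longrightarrow> (D i has_vector_derivative D (Suc i) y) (at y within S)"
    and "i \<le> m \<Longrightarrow> continuous_on S (D i)" and "holder_on \<delta> S (D m)"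
proof -
  show d: "(D i has_vector_derivative D (Suc i) y) (at y within S)" if "i < m" "y \<in> S" for i y
  proof -
    have "D i differentiable (at y within S)" using assms(1) that by (auto simp: holder_space_def D_def)
    then show ?thesis by (simp add: D_def deriv_on_def vector_derivative_works)
  qed
  show "holder_on \<delta> S (D m)" using assms(1) by (simp add: holder_space_def D_def)
  then have "continuous_on S (D m)" using assms(2) by (rule holder_on_imp_continuous_on)
  moreover have "continuous_on S (D i)" if "i < m" using d[OF that] by (rule continuous_on_vector_derivative)
  ultimately show "continuous_on S (D i)" if "i \<le> m" using that by (cases "i = m") auto
qed

text \<open>Shifting by half a period changes the sign of the oscillating factor.\<close>

lemma holder_oscillation:
  assumes h: "holder_on \<delta> {-pi..pi} f" and \<delta>: "0 < \<delta>" "\<delta> < 1"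
  shows "\<exists>C. \<forall>k w. 1 \<le> k \<longrightarrow> continuous_on UNIV w \<longrightarrow> (\<forall>y. \<bar>w y\<bar> \<le> 1) \<longrightarrow> (\<forall>y. w (y + pi / k) = - w y) \<longrightarrow>
      \<bar>integral {-pi..pi} (\<lambda>y. f y * w y)\<bar> \<le> C * k powr (- \<delta>)"
proof -
  obtain K where K: "\<And>y z. y \<in> {-pi..pi} \<Longrightarrow> z \<in> {-pi..pi} \<Longrightarrow> \<bar>f y - f z\<bar> \<le> K * \<bar>y - z\<bar> powr \<delta>"
    using h unfolding holder_on_def by blast
  have K0: "0 \<le> K"
  proof -
    have "0 \<le> K * \<bar>0 - pi\<bar> powr \<delta>" by (rule order_trans[OF abs_ge_zero K]) auto
    then show ?thesis by (simp add: zero_le_mult_iff)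
  qed
  have cf: "continuous_on {-pi..pi} f" by (rule holder_on_imp_continuous_on[OF h \<delta>(1)])
  then have "bounded (f ` {-pi..pi})" by (intro compact_imp_bounded compact_continuous_image) auto
  then obtain M where M: "\<And>y. y \<in> {-pi..pi} \<Longrightarrow> \<bar>f y\<bar> \<le> M" by (auto simp: bounded_iff simp del: atLeastAtMost_iff)
  have M0: "0 \<le> M" using M[of 0] abs_ge_zero[of "f 0"] by auto
  show ?thesis
  proof (intro exI[of _ "(M + K) * pi * pi powr \<delta>"] allI impI)
    fix k :: real and w :: "real \<Rightarrow> real"
    assume k: "1 \<le> k" and cw: "continuous_on UNIV w" and "\<forall>y. \<bar>w y\<bar> \<le> 1" "\<forall>y. w (y + pi / k) = - w y"
    then have w1: "\<bar>w y\<bar> \<le> 1" and ws: "w (y + pi / k) = - w y" for y by auto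
    define h where "h = pi / k"
    have h: "0 < h" "h \<le> pi" using k by (auto simp: h_def field_simps)
    have cw': "continuous_on S w" for S using cw by (rule continuous_on_subset) auto
    have cf': "continuous_on {a..b} f" if "-pi \<le> a" "b \<le> pi" for a b
      using cf by (rule continuous_on_subset) (use that in auto)
    have I: "(\<lambda>y. f y * w y) integrable_on {a..b}" if "-pi \<le> a" "b \<le> pi" for a b
      using that by (intro integrable_continuous_real continuous_intros cw' cf')
    define F where "F = (\<lambda>a b. integral {a..b} (\<lambda>y. f y * w y))"
    \<comment> \<open>The integral is split twice, separating the last and then the first piece of
      length h. The shift by h flips the sign of w, so the sum of both splittings contains f only
      through f y - f (y + h) and the two end pieces.\<close>
    have e1: "F (-pi) pi = F (-pi) (pi - h) + F (pi - h) pi"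
      unfolding F_def using h by (intro Henstock_Kurzweil_Integration.integral_combine[symmetric] I) auto
    have e2: "F (-pi) pi = F (-pi) (-pi + h) + F (-pi + h) pi"
      unfolding F_def using h by (intro Henstock_Kurzweil_Integration.integral_combine[symmetric] I) auto
    have cs: "continuous_on {-pi..pi - h} (\<lambda>y. f (y + h))"
      using h by (intro continuous_on_compose2[OF cf] continuous_intros) auto
    have "F (-pi + h) pi = integral {-pi..pi - h} (\<lambda>y. f (y + h) * w (y + h))"
      unfolding F_def using integral_shift_Icc_real[of "-pi" "pi - h" "\<lambda>y. f y * w y" h]
      by (simp add: o_def add.commute)
    also have "\<dots> = integral {-pi..pi - h} (\<lambda>y. - (f (y + h) * w y))"
      using ws by (simp add: h_def)
    finally have e3: "F (-pi + h) pi = - integral {-pi..pi - h} (\<lambda>y. f (y + h) * w y)" by simp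
    have e4: "integral {-pi..pi - h} (\<lambda>y. (f y - f (y + h)) * w y) = F (-pi) (pi - h) - integral {-pi..pi - h} (\<lambda>y. f (y + h) * w y)"
      unfolding F_def left_diff_distrib using h
      by (intro integral_diff I integrable_continuous_real continuous_intros cs cw') auto
    have b: "\<bar>F a b\<bar> \<le> M * (b - a)" if "-pi \<le> a" "b \<le> pi" "a \<le> b" for a b
    proof -
      have "norm (F a b) \<le> M * (b - a)"
        unfolding F_def
      proof (rule integral_bound)
        show "norm (f t * w t) \<le> M" if t: "t \<in> {a..b}" for t
        proof -
          have "\<bar>f t\<bar> * \<bar>w t\<bar> \<le> M * 1"
            using M[of t] w1[of t] t \<open>-pi \<le> a\<close> \<open>b \<le> pi\<close> M0 by (intro mult_mono) auto
          then show ?thesis by (simp add: abs_mult)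
        qed
      qed (use that in \<open>auto intro!: continuous_intros cw' cf'\<close>)
      then show ?thesis by simp
    qed
    have "norm (integral {-pi..pi - h} (\<lambda>y. (f y - f (y + h)) * w y)) \<le> K * h powr \<delta> * (pi - h - - pi)"
    proof (rule integral_bound)
      fix t assume t: "t \<in> {-pi..pi - h}"
      have "\<bar>f t - f (t + h)\<bar> * \<bar>w t\<bar> \<le> (K * h powr \<delta>) * 1"
        using K[of t "t + h"] w1[of t] t h K0 by (intro mult_mono) auto
      then show "norm ((f t - f (t + h)) * w t) \<le> K * h powr \<delta>" by (simp add: abs_mult)
    qed (use h in \<open>auto intro!: continuous_intros cw' cf' cs\<close>)
    also have "\<dots> \<le> K * h powr \<delta> * (2 * pi)"
      using h K0 by (intro mult_left_mono) auto
    finally have b3: "\<bar>integral {-pi..pi - h} (\<lambda>y. (f y - f (y + h)) * w y)\<bar> \<le> K * h powr \<delta> * (2 * pi)" by simp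
    \<comment> \<open>The end pieces are O(h), which is no worse than the Hoelder order because h is
      bounded by pi.\<close>
    have hd: "h \<le> pi * h powr \<delta>"
    proof -
      have "h = h powr (1 - \<delta>) * h powr \<delta>" using h by (simp add: powr_add[symmetric])
      also have "\<dots> \<le> pi powr (1 - \<delta>) * h powr \<delta>"
        using h \<delta> by (intro mult_right_mono powr_mono2) auto
      also have "\<dots> \<le> pi powr 1 * h powr \<delta>"
        using \<delta> pi_gt3 by (intro mult_right_mono powr_mono) auto
      finally show ?thesis by simp
    qed
    have "2 * F (-pi) pi = F (-pi) (-pi + h) + F (pi - h) pi + integral {-pi..pi - h} (\<lambda>y. (f y - f (y + h)) * w y)"
      using e1 e2 e3 e4 by simp
    moreover have "\<bar>F (-pi) (-pi + h)\<bar> \<le> M * h" "\<bar>F (pi - h) pi\<bar> \<le> M * h"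
      using b[of "-pi" "-pi + h"] b[of "pi - h" pi] h by auto
    ultimately have "\<bar>F (-pi) pi\<bar> \<le> M * h + K * h powr \<delta> * pi"
      using b3 by linarith
    also have "M * h \<le> M * (pi * h powr \<delta>)" using hd M0 by (rule mult_left_mono)
    also have "M * (pi * h powr \<delta>) + K * h powr \<delta> * pi = (M + K) * pi * h powr \<delta>"
      by (simp add: algebra_simps)
    also have "h powr \<delta> = pi powr \<delta> * k powr (- \<delta>)"
      using k by (simp add: h_def powr_divide powr_minus_divide)
    finally show "\<bar>integral {-pi..pi} (\<lambda>y. f y * w y)\<bar> \<le> ((M + K) * pi * pi powr \<delta>) * k powr (- \<delta>)"
      by (simp add: F_def mult_ac)
  qed
qed

text \<open>The boundary terms vanish: those with a cosine by periodicity, those with a sine because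
  sin (freq n * pi) = 0.\<close>

lemma fourier_coeff_twice_by_parts:
  fixes f :: "real \<Rightarrow> real"
  assumes f: "\<And>y. y \<in> {-pi..pi} \<Longrightarrow> (f has_vector_derivative f1 y) (at y within {-pi..pi})"
    and f1: "\<And>y. y \<in> {-pi..pi} \<Longrightarrow> (f1 has_vector_derivative f2 y) (at y within {-pi..pi})"
    and f2: "continuous_on {-pi..pi} f2"
    and per: "f (-pi) = f pi" "f1 (-pi) = f1 pi" and n: "1 \<le> n"
  shows "fourier_coeff f n = - integral {-pi..pi} (\<lambda>y. f2 y * Y n y) / (pi * (freq n)\<^sup>2)"
proof -
  have k: "freq n \<noteq> 0" using freq_ge(1)[OF n] by simp
  have cf1: "continuous_on {-pi..pi} f1" using f1 by (rule continuous_on_vector_derivative)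
  have cf: "continuous_on {-pi..pi} f" using f by (rule continuous_on_vector_derivative)
  note p1 = trig_by_parts[OF k f cf1] and p2 = trig_by_parts[OF k f1 f2]
  show ?thesis
  proof (cases "odd n")
    case True
    have "integral {-pi..pi} (\<lambda>y. f y * sin (freq n * y)) = integral {-pi..pi} (\<lambda>y. f1 y * cos (freq n * y)) / freq n"
      using p1(2) per by simp
    also have "integral {-pi..pi} (\<lambda>y. f1 y * cos (freq n * y)) = - integral {-pi..pi} (\<lambda>y. f2 y * sin (freq n * y)) / freq n"
      using p2(1) sin_freq_pi[of n] by simp
    finally show ?thesis
      using n True by (simp add: fourier_coeff_eq[OF cf] Y_eq power2_eq_square mult_ac)
  next
    case False
    have "integral {-pi..pi} (\<lambda>y. f y * cos (freq n * y)) = - integral {-pi..pi} (\<lambda>y. f1 y * sin (freq n * y)) / freq n"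
      using p1(1) sin_freq_pi[of n] by simp
    also have "integral {-pi..pi} (\<lambda>y. f1 y * sin (freq n * y)) = integral {-pi..pi} (\<lambda>y. f2 y * cos (freq n * y)) / freq n"
      using p2(2) per by simp
    finally show ?thesis
      using n False by (simp add: fourier_coeff_eq[OF cf] Y_eq power2_eq_square mult_ac)
  qed
qed

text \<open>A third integration by parts is possible, but the second derivative of \<phi> is not
  assumed periodic. The boundary term that it leaves against a cosine is bounded, which is the same
  order as the remaining integral.\<close>

lemma fourier_coeff_C3_bound:
  assumes h: "holder_space 3 \<delta> {-pi..pi} \<phi>" "0 < \<delta>"
    and per: "\<phi> (-pi) = \<phi> pi" "deriv_on {-pi..pi} \<phi> (-pi) = deriv_on {-pi..pi} \<phi> pi"
  obtains C where "\<And>n. 1 \<le> n \<Longrightarrow> \<bar>fourier_coeff \<phi> n\<bar> \<le> C * freq n powr (-3)"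
proof -
  define D where "D i = (deriv_on {-pi..pi} ^^ i) \<phi>" for i
  have D: "(D i has_vector_derivative D (Suc i) y) (at y within {-pi..pi})" if "i < 3" "y \<in> {-pi..pi}" for i y
    unfolding D_def using holder_space_derivs(1)[OF h that] .
  have Dc: "continuous_on {-pi..pi} (D i)" if "i \<le> 3" for i
    unfolding D_def using holder_space_derivs(2)[OF h that] .
  have bd: "\<exists>M. \<forall>y\<in>{-pi..pi}. \<bar>D i y\<bar> \<le> M" if "i \<le> 3" for i
  proof -
    have "bounded (D i ` {-pi..pi})" using Dc[OF that] by (intro compact_imp_bounded compact_continuous_image) auto
    then show ?thesis by (auto simp: bounded_iff)
  qed
  obtain M2 M3 where M2: "\<And>y. y \<in> {-pi..pi} \<Longrightarrow> \<bar>D 2 y\<bar> \<le> M2" and M3: "\<And>y. y \<in> {-pi..pi} \<Longrightarrow> \<bar>D 3 y\<bar> \<le> M3"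
    using bd[of 2] bd[of 3] by (auto simp del: atLeastAtMost_iff)
  have n3: "Suc 2 = 3" by simp
  show ?thesis
  proof (rule that)
    fix n :: nat assume n: "1 \<le> n"
    have k: "freq n \<noteq> 0" "1 \<le> freq n" using freq_ge(1)[OF n] by auto
    have D2: "(D 2 has_vector_derivative D 3 y) (at y within {-pi..pi})" if "y \<in> {-pi..pi}" for y
      using D[of 2 y] that by (simp add: n3)
    note p = trig_by_parts[OF k(1) D2 Dc[OF order_refl]]
    have i3: "\<bar>integral {-pi..pi} (\<lambda>y. D 3 y * w y)\<bar> \<le> M3 * (2 * pi)" if "continuous_on UNIV w" "\<And>y. \<bar>w y\<bar> \<le> 1" for w
    proof -
      have "norm (integral {-pi..pi} (\<lambda>y. D 3 y * w y)) \<le> M3 * (pi - - pi)"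
      proof (rule integral_bound)
        show "continuous_on {-pi..pi} (\<lambda>y. D 3 y * w y)"
          using that by (intro continuous_intros Dc continuous_on_subset[OF that(1)]) auto
        fix t assume t: "t \<in> {-pi..pi}"
        have "\<bar>D 3 t\<bar> * \<bar>w t\<bar> \<le> M3 * 1"
          using M3[OF t] that(2)[of t] by (intro mult_mono) auto
        then show "norm (D 3 t * w t) \<le> M3" by (simp add: abs_mult)
      qed auto
      then show ?thesis by simp
    qed
    have "\<bar>integral {-pi..pi} (\<lambda>y. D 2 y * Y n y)\<bar> \<le> (2 * M2 + M3 * (2 * pi)) / freq n"
    proof (cases "odd n")
      case True
      have "\<bar>cos (freq n * pi)\<bar> \<le> 1" by simp
      then have "\<bar>(D 2 pi - D 2 (-pi)) * cos (freq n * pi)\<bar> \<le> (2 * M2) * 1"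
        unfolding abs_mult using M2[of pi] M2[of "-pi"] by (intro mult_mono) auto
      moreover have "\<bar>integral {-pi..pi} (\<lambda>y. D 3 y * cos (freq n * y))\<bar> \<le> M3 * (2 * pi)"
        by (intro i3 continuous_intros) auto
      moreover have "integral {-pi..pi} (\<lambda>y. D 2 y * Y n y) = (- ((D 2 pi - D 2 (-pi)) * cos (freq n * pi))
          + integral {-pi..pi} (\<lambda>y. D 3 y * cos (freq n * y))) / freq n"
        using p(2) True sin_freq_pi[of n] by (simp add: Y_eq algebra_simps diff_divide_distrib add_divide_distrib)
      ultimately show ?thesis
        using k by (simp add: abs_divide divide_right_mono)
    next
      case False
      have "0 \<le> M2" using M2[of 0] abs_ge_zero[of "D 2 0"] by simp
      moreover have "\<bar>integral {-pi..pi} (\<lambda>y. D 3 y * sin (freq n * y))\<bar> \<le> M3 * (2 * pi)"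
        by (intro i3 continuous_intros) auto
      moreover have "integral {-pi..pi} (\<lambda>y. D 2 y * Y n y) = - integral {-pi..pi} (\<lambda>y. D 3 y * sin (freq n * y)) / freq n"
        using p(1) False sin_freq_pi[of n] by (simp add: Y_eq)
      ultimately show ?thesis
        using k by (simp add: abs_divide divide_right_mono)
    qed
    moreover have "fourier_coeff \<phi> n = - integral {-pi..pi} (\<lambda>y. D 2 y * Y n y) / (pi * (freq n)\<^sup>2)"
    proof (rule fourier_coeff_twice_by_parts[OF _ _ _ _ _ n])
      show "(\<phi> has_vector_derivative D 1 y) (at y within {-pi..pi})" if "y \<in> {-pi..pi}" for y
        using D[of 0 y] that by (simp add: D_def)
      show "(D 1 has_vector_derivative D 2 y) (at y within {-pi..pi})" if "y \<in> {-pi..pi}" for y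
        using D[of 1 y] that by (simp add: numeral_2_eq_2)
    qed (use per Dc[of 2] in \<open>auto simp: D_def\<close>)
    then have "\<bar>fourier_coeff \<phi> n\<bar> = \<bar>integral {-pi..pi} (\<lambda>y. D 2 y * Y n y)\<bar> / (pi * (freq n)\<^sup>2)"
      by (simp add: abs_mult)
    ultimately have "\<bar>fourier_coeff \<phi> n\<bar> \<le> (2 * M2 + M3 * (2 * pi)) / freq n / (pi * (freq n)\<^sup>2)"
      by (simp only:) (rule divide_right_mono, auto)
    also have "\<dots> = ((2 * M2 + M3 * (2 * pi)) / pi) * freq n powr (-3)"
      using k by (simp add: powr_neg_numeral power2_eq_square power3_eq_cube)
    finally show "\<bar>fourier_coeff \<phi> n\<bar> \<le> ((2 * M2 + M3 * (2 * pi)) / pi) * freq n powr (-3)" .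
  qed
qed

text \<open>Two integrations by parts leave the second derivative of \<psi> against
  \<open>Y n\<close>. The shift by pi / freq n flips the sign of \<open>Y n\<close>, so
  \<open>holder_oscillation\<close> contributes the remaining power.\<close>

lemma fourier_coeff_C2_bound:
  assumes h: "holder_space 2 \<delta> {-pi..pi} \<psi>" "0 < \<delta>" "\<delta> < 1"
    and per: "\<psi> (-pi) = \<psi> pi" "deriv_on {-pi..pi} \<psi> (-pi) = deriv_on {-pi..pi} \<psi> pi"
  obtains C where "\<And>n. 1 \<le> n \<Longrightarrow> \<bar>fourier_coeff \<psi> n\<bar> \<le> C * freq n powr (-2 - \<delta>)"
proof -
  define D where "D i = (deriv_on {-pi..pi} ^^ i) \<psi>" for i
  have D: "(D i has_vector_derivative D (Suc i) y) (at y within {-pi..pi})" if "i < 2" "y \<in> {-pi..pi}" for i y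
    unfolding D_def using holder_space_derivs(1)[OF h(1,2) that] .
  have Dc: "continuous_on {-pi..pi} (D i)" if "i \<le> 2" for i
    unfolding D_def using holder_space_derivs(2)[OF h(1,2) that] .
  have "holder_on \<delta> {-pi..pi} (D 2)"
    unfolding D_def using holder_space_derivs(3)[OF h(1,2)] .
  then obtain C where C: "\<And>k w. 1 \<le> k \<Longrightarrow> continuous_on UNIV w \<Longrightarrow> \<forall>y. \<bar>w y\<bar> \<le> 1 \<Longrightarrow> \<forall>y. w (y + pi / k) = - w y \<Longrightarrow>
      \<bar>integral {-pi..pi} (\<lambda>y. D 2 y * w y)\<bar> \<le> C * k powr (- \<delta>)"
    using holder_oscillation[OF _ h(2,3)] by blast
  show ?thesis
  proof (rule that)
    fix n :: nat assume n: "1 \<le> n"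
    have k: "freq n \<noteq> 0" "1 \<le> freq n" using freq_ge(1)[OF n] by auto
    have "freq n * (y + pi / freq n) = freq n * y + pi" for y
      using k by (simp add: distrib_left)
    then have "\<bar>integral {-pi..pi} (\<lambda>y. D 2 y * Y n y)\<bar> \<le> C * freq n powr (- \<delta>)"
      by (intro C k continuous_intros allI Y_abs_le) (simp add: Y_eq)
    moreover have "fourier_coeff \<psi> n = - integral {-pi..pi} (\<lambda>y. D 2 y * Y n y) / (pi * (freq n)\<^sup>2)"
    proof (rule fourier_coeff_twice_by_parts[OF _ _ _ _ _ n])
      show "(\<psi> has_vector_derivative D 1 y) (at y within {-pi..pi})" if "y \<in> {-pi..pi}" for y
        using D[of 0 y] that by (simp add: D_def)
      show "(D 1 has_vector_derivative D 2 y) (at y within {-pi..pi})" if "y \<in> {-pi..pi}" for y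
        using D[of 1 y] that by (simp add: numeral_2_eq_2)
    qed (use per Dc[of 2] in \<open>auto simp: D_def\<close>)
    then have "\<bar>fourier_coeff \<psi> n\<bar> = \<bar>integral {-pi..pi} (\<lambda>y. D 2 y * Y n y)\<bar> / (pi * (freq n)\<^sup>2)"
      by (simp add: abs_mult)
    ultimately have "\<bar>fourier_coeff \<psi> n\<bar> \<le> C * freq n powr (- \<delta>) / (pi * (freq n)\<^sup>2)"
      by (simp only:) (rule divide_right_mono, auto)
    also have "\<dots> = (C / pi) * (freq n powr (- \<delta>) * freq n powr (-2))"
      using k by (simp add: powr_neg_numeral)
    also have "freq n powr (- \<delta>) * freq n powr (-2) = freq n powr (-2 - \<delta>)"
      by (subst powr_add[symmetric]) (rule arg_cong[of _ _ "(powr) (freq n)"], simp)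
    finally show "\<bar>fourier_coeff \<psi> n\<bar> \<le> (C / pi) * freq n powr (-2 - \<delta>)" .
  qed
qed

text \<open>Stone-Weierstrass on the unit circle. Since f (-pi) = f pi, f corresponds to a
  continuous function there; it is orthogonal to all polynomials in cos and sin, and approximating f
  by such polynomials gives a vanishing integral of f^2.\<close>

lemma trig_complete:
  assumes f: "continuous_on {-pi..pi} f" "f (-pi) = f pi"
    and orth: "\<And>n. integral {-pi..pi} (\<lambda>y. f y * Y n y) = 0" and y: "y \<in> {-pi..pi}"
  shows "f y = 0"
proof -
  define I where "I g = integral {-pi..pi} (\<lambda>y. f y * g y)" for g
  \<comment> \<open>\<open>P g\<close> speaks of all products of g with cos ky and sin ky. This
    makes it stable under multiplication by cos and sin, as the induction over polynomials
    requires.\<close>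
  define P where "P g \<longleftrightarrow> continuous_on UNIV g \<and>
      (\<forall>k::int. I (\<lambda>y. g y * cos (k * y)) = 0 \<and> I (\<lambda>y. g y * sin (k * y)) = 0)" for g :: "real \<Rightarrow> real"
  have int: "(\<lambda>y. f y * g y) integrable_on {-pi..pi}" if "continuous_on UNIV g" for g
    using that by (intro integrable_continuous_real continuous_intros f continuous_on_subset[OF that]) auto
  have I_lin: "I (\<lambda>y. a * g y + b * h y) = a * I g + b * I h" if "continuous_on UNIV g" "continuous_on UNIV h" for a b g h
  proof -
    have "I (\<lambda>y. a * g y + b * h y) = integral {-pi..pi} (\<lambda>y. a * (f y * g y) + b * (f y * h y))"
      by (simp add: I_def algebra_simps)
    also have "\<dots> = integral {-pi..pi} (\<lambda>y. a * (f y * g y)) + integral {-pi..pi} (\<lambda>y. b * (f y * h y))"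
      using that by (intro integral_add integrable_on_mult_right int)
    finally show ?thesis by (simp add: I_def)
  qed
  have cont: "continuous_on UNIV (\<lambda>y. g y * cos (real_of_int k * y))" "continuous_on UNIV (\<lambda>y. g y * sin (real_of_int k * y))"
    if "continuous_on UNIV g" for g k
    using that by (auto intro!: continuous_intros)
  have P1: "P (\<lambda>_. 1)"
    unfolding P_def
  proof (intro conjI allI)
    fix k :: int
    obtain m :: nat where m: "k = int m \<or> k = - int m" by (metis int_cases2)
    have c: "cos (real_of_int k * y) = Y (2 * m) y" for y
      using m by (auto simp: Y_def)
    show "I (\<lambda>y. 1 * cos (real_of_int k * y)) = 0"
      unfolding c using orth[of "2 * m"] by (simp add: I_def)
    show "I (\<lambda>y. 1 * sin (real_of_int k * y)) = 0"
    proof (cases "m = 0")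
      case True
      then show ?thesis using m by (simp add: I_def)
    next
      case False
      have "Suc (2 * m - 1) div 2 = m" "odd (2 * m - 1)" using False by presburger+
      then have s: "Y (2 * m - 1) y = sin (real m * y)" for y by (simp add: Y_def)
      have "I (\<lambda>y. sin (real m * y)) = 0"
        using orth[of "2 * m - 1"] unfolding I_def s .
      moreover have "I (\<lambda>y. - sin (real m * y)) = - I (\<lambda>y. sin (real m * y))"
        by (simp add: I_def)
      ultimately show ?thesis using m by auto
    qed
  qed auto
  have Padd: "P (\<lambda>y. a * g y + b * h y)" if "P g" "P h" for a b g h
  proof -
    have c: "continuous_on UNIV g" "continuous_on UNIV h" using that by (auto simp: P_def)
    have "I (\<lambda>y. (a * g y + b * h y) * cos (real_of_int k * y)) =
        I (\<lambda>y. a * (g y * cos (real_of_int k * y)) + b * (h y * cos (real_of_int k * y)))"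
      "I (\<lambda>y. (a * g y + b * h y) * sin (real_of_int k * y)) =
        I (\<lambda>y. a * (g y * sin (real_of_int k * y)) + b * (h y * sin (real_of_int k * y)))" for k
      by (simp_all add: algebra_simps)
    then show ?thesis
      using that c unfolding P_def by (auto intro!: continuous_intros simp: I_lin cont)
  qed
  have Pcos: "P (\<lambda>y. g y * cos y)" and Psin: "P (\<lambda>y. g y * sin y)" if "P g" for g
  proof -
    have c: "continuous_on UNIV g" using that by (auto simp: P_def)
    have e: "g y * cos y * cos (real_of_int k * y) = 1/2 * (g y * cos (real_of_int (k - 1) * y)) + 1/2 * (g y * cos (real_of_int (k + 1) * y))"
      "g y * cos y * sin (real_of_int k * y) = 1/2 * (g y * sin (real_of_int (k + 1) * y)) + 1/2 * (g y * sin (real_of_int (k - 1) * y))"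
      "g y * sin y * cos (real_of_int k * y) = 1/2 * (g y * sin (real_of_int (k + 1) * y)) + (-1/2) * (g y * sin (real_of_int (k - 1) * y))"
      "g y * sin y * sin (real_of_int k * y) = 1/2 * (g y * cos (real_of_int (k - 1) * y)) + (-1/2) * (g y * cos (real_of_int (k + 1) * y))" for k y
      by (simp_all add: left_diff_distrib distrib_right cos_diff cos_add sin_diff sin_add algebra_simps)
    show "P (\<lambda>y. g y * cos y)"
      using that unfolding P_def e by (simp only: I_lin[OF cont(1)[OF c] cont(1)[OF c]] I_lin[OF cont(2)[OF c] cont(2)[OF c]])
         (auto intro!: continuous_intros)
    show "P (\<lambda>y. g y * sin y)"
      using that unfolding P_def e by (simp only: I_lin[OF cont(1)[OF c] cont(1)[OF c]] I_lin[OF cont(2)[OF c] cont(2)[OF c]])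
         (auto intro!: continuous_intros)
  qed
  have poly: "P (\<lambda>y. g y * p (cis y))" if "real_polynomial_function p" "P g" for p :: "complex \<Rightarrow> real" and g
    using that
  proof (induction arbitrary: g rule: real_polynomial_function.induct)
    case (linear h)
    interpret bounded_linear h by fact
    have "h (cis y) = h 1 * cos y + h \<i> * sin y" for y
    proof -
      have "cis y = cos y *\<^sub>R 1 + sin y *\<^sub>R \<i>" by (simp add: complex_eq_iff)
      then show ?thesis by (simp add: add scaleR)
    qed
    then have "(\<lambda>y. g y * h (cis y)) = (\<lambda>y. h 1 * (g y * cos y) + h \<i> * (g y * sin y))"
      by (simp add: algebra_simps)
    then show ?case using Padd[OF Pcos Psin, OF \<open>P g\<close> \<open>P g\<close>] by simp
  next
    case (const c)
    have "(\<lambda>y. g y * c) = (\<lambda>y. c * g y + 0 * g y)" by auto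
    then show ?case using Padd[OF const const, of c 0] by simp
  next
    case (add p q)
    have "(\<lambda>y. g y * (p (cis y) + q (cis y))) = (\<lambda>y. 1 * (g y * p (cis y)) + 1 * (g y * q (cis y)))"
      by (simp add: algebra_simps)
    then show ?case using Padd[OF add.IH(1) add.IH(2), of g g 1 1] add.prems by simp
  next
    case (mult p q)
    show ?case using mult.IH(2)[OF mult.IH(1)[OF mult.prems]] by (simp add: mult_ac)
  qed
  define F where "F z = f (Arg z)" for z
  have Fcis: "F (cis y) = f y" if "y \<in> {-pi..pi}" for y
  proof (cases "y = -pi")
    case True
    have "Arg (cis y) = pi" using Arg_cis[of pi] True by (simp add: cis.ctr complex_eq_iff)
    then show ?thesis using f True by (simp add: F_def)
  next
    case False
    then show ?thesis using that by (simp add: F_def Arg_cis)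
  qed
  have sph: "sphere 0 1 = cis ` {-pi..pi}"
  proof
    show "sphere 0 1 \<subseteq> cis ` {-pi..pi}"
    proof
      fix z :: complex assume "z \<in> sphere 0 1"
      then have "z = cis (Arg z)" by (subst cis_Arg) (auto simp: sgn_div_norm)
      then show "z \<in> cis ` {-pi..pi}" using Arg_bounded[of z] by (intro image_eqI[of _ _ "Arg z"]) auto
    qed
  qed auto
  \<comment> \<open>\<open>Arg\<close> jumps at -1, so continuity is read off the graph: it is a
    continuous image of the compact interval, hence closed.\<close>
  have contF: "continuous_on (sphere 0 1) F"
  proof (rule continuous_from_closed_graph)
    show "compact (f ` {-pi..pi})" by (intro compact_continuous_image f) auto
    show "F \<in> sphere 0 1 \<rightarrow> f ` {-pi..pi}" unfolding sph using Fcis by auto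
    have "(\<lambda>z. (z, F z)) ` sphere 0 1 = (\<lambda>y. (cis y, f y)) ` {-pi..pi}"
      unfolding sph image_image using Fcis by (intro image_cong) auto
    moreover have "compact ((\<lambda>y. (cis y, f y)) ` {-pi..pi})"
      by (intro compact_continuous_image continuous_intros f continuous_on_cis) auto
    ultimately show "closed ((\<lambda>z. (z, F z)) ` sphere 0 1)" by (simp add: compact_imp_closed)
  qed
  have "bounded (f ` {-pi..pi})" using f by (intro compact_imp_bounded compact_continuous_image) auto
  then obtain M where M: "\<And>y. y \<in> {-pi..pi} \<Longrightarrow> \<bar>f y\<bar> \<le> M" by (auto simp: bounded_iff simp del: atLeastAtMost_iff)
  have M0: "0 \<le> M" using M[of 0] abs_ge_zero[of "f 0"] by auto
  have small: "integral {-pi..pi} (\<lambda>y. f y * f y) \<le> e * (M * (2 * pi))" if e: "0 < e" for e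
  proof -
    obtain g where g: "real_polynomial_function g" "\<And>z. z \<in> sphere 0 1 \<Longrightarrow> \<bar>F z - g z\<bar> < e"
      using Stone_Weierstrass_real_polynomial_function[OF compact_sphere contF e] by blast
    have "P (\<lambda>y. 1 * g (cis y))" by (rule poly[OF g(1) P1])
    then have gP: "P (\<lambda>y. g (cis y))" by simp
    then have gc: "continuous_on UNIV (\<lambda>y. g (cis y))" by (simp add: P_def)
    have "I (\<lambda>y. g (cis y) * cos (real_of_int 0 * y)) = 0" using gP unfolding P_def by blast
    then have g0: "integral {-pi..pi} (\<lambda>y. f y * g (cis y)) = 0" by (simp add: I_def)
    have ff: "(\<lambda>y. f y * f y) integrable_on {-pi..pi}" by (intro integrable_continuous_real continuous_intros f)
    have c2: "continuous_on {-pi..pi} (\<lambda>y. f y * (f y - g (cis y)))"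
      by (intro continuous_intros f continuous_on_subset[OF gc]) auto
    \<comment> \<open>Subtracting the vanishing integral of f times the approximation leaves a
      factor of size e.\<close>
    have "integral {-pi..pi} (\<lambda>y. f y * f y) = integral {-pi..pi} (\<lambda>y. f y * f y) - integral {-pi..pi} (\<lambda>y. f y * g (cis y))"
      by (simp add: g0)
    also have "\<dots> = integral {-pi..pi} (\<lambda>y. f y * (f y - g (cis y)))"
      unfolding right_diff_distrib by (rule integral_diff[symmetric, OF ff int[OF gc]])
    also have "\<dots> \<le> norm (integral {-pi..pi} (\<lambda>y. f y * (f y - g (cis y))))" by simp
    also have "\<dots> \<le> (M * e) * (pi - - pi)"
    proof (rule integral_bound[OF _ c2])
      fix t assume t: "t \<in> {-pi..pi}"
      have "\<bar>F (cis t) - g (cis t)\<bar> < e" by (rule g(2)) auto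
      then have "\<bar>f t\<bar> * \<bar>f t - g (cis t)\<bar> \<le> M * e"
        using M[OF t] M0 Fcis[OF t] by (intro mult_mono) auto
      then show "norm (f t * (f t - g (cis t))) \<le> M * e" by (simp add: abs_mult)
    qed auto
    finally show ?thesis by (simp add: mult_ac)
  qed
  have "integral {-pi..pi} (\<lambda>y. f y * f y) \<le> 0"
  proof (rule field_le_epsilon)
    fix e :: real assume e: "0 < e"
    have p: "0 < M * (2 * pi) + 1" using M0 by (intro add_nonneg_pos) auto
    have "integral {-pi..pi} (\<lambda>y. f y * f y) \<le> e / (M * (2 * pi) + 1) * (M * (2 * pi))"
      using e p by (intro small) auto
    also have "\<dots> \<le> e" using e p M0 by (simp add: field_simps)
    finally show "integral {-pi..pi} (\<lambda>y. f y * f y) \<le> 0 + e" by simp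
  qed
  moreover have "0 \<le> integral {-pi..pi} (\<lambda>y. f y * f y)"
    by (intro integral_nonneg integrable_continuous_real continuous_intros f) auto
  ultimately have "integral {-pi..pi} (\<lambda>y. f y * f y) = 0" by simp
  then have "\<forall>y\<in>{-pi..pi}. f y * f y = 0"
    by (subst (asm) integral_eq_0_iff) (auto intro!: continuous_intros f)
  then show ?thesis using y by auto
qed

text \<open>Absolute summability makes the series converge uniformly, so that its sum has the same
  coefficients as f; completeness then identifies the two.\<close>

lemma fourier_series:
  assumes f: "continuous_on {-pi..pi} f" "f (-pi) = f pi"
    and sum: "summable (\<lambda>n. \<bar>fourier_coeff f n\<bar>)" and y: "y \<in> {-pi..pi}"
  shows "f y = (\<Sum>n. fourier_coeff f n * Y n y)"
proof -
  define g where "g y = (\<Sum>n. fourier_coeff f n * Y n y)" for y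
  have ul: "uniform_limit {-pi..pi} (\<lambda>N y. \<Sum>n<N. fourier_coeff f n * Y n y) g sequentially"
    unfolding g_def
  proof (rule Weierstrass_m_test[OF _ sum])
    show "norm (fourier_coeff f n * Y n y) \<le> \<bar>fourier_coeff f n\<bar>" for n y
      using mult_left_mono[OF Y_abs_le[of n y], of "\<bar>fourier_coeff f n\<bar>"] by (simp add: abs_mult)
  qed
  have gc: "continuous_on {-pi..pi} g"
    by (rule uniform_limit_theorem[OF _ ul]) (auto intro!: always_eventually continuous_intros)
  have orth: "integral {-pi..pi} (\<lambda>y. (f y - g y) * Y m y) = 0" for m
  proof -
    have "bounded (Y m ` {-pi..pi})"
      by (intro compact_imp_bounded compact_continuous_image continuous_intros) auto
    moreover have "bounded (g ` {-pi..pi})"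
      by (intro compact_imp_bounded compact_continuous_image gc) auto
    ultimately have ul2: "uniform_limit {-pi..pi} (\<lambda>N y. (\<Sum>n<N. fourier_coeff f n * Y n y) * Y m y) (\<lambda>y. g y * Y m y) sequentially"
      by (intro uniform_lim_mult ul uniform_limit_const)
    obtain I J where IJ: "\<And>N. ((\<lambda>y. (\<Sum>n<N. fourier_coeff f n * Y n y) * Y m y) has_integral I N) {-pi..pi}"
      "((\<lambda>y. g y * Y m y) has_integral J) {-pi..pi}" "I \<longlonglongrightarrow> J"
      by (rule uniform_limit_integral[OF ul2]) (auto intro!: continuous_intros)
    define c where "c = (if m = 0 then 2 * pi else pi)"
    have "I N = (\<Sum>n<N. fourier_coeff f n * integral {-pi..pi} (\<lambda>y. Y n y * Y m y))" for N
    proof -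
      have "I N = integral {-pi..pi} (\<lambda>y. \<Sum>n<N. fourier_coeff f n * (Y n y * Y m y))"
        using IJ(1)[of N] by (simp add: integral_unique sum_distrib_right mult.assoc)
      also have "\<dots> = (\<Sum>n<N. integral {-pi..pi} (\<lambda>y. fourier_coeff f n * (Y n y * Y m y)))"
        by (intro integral_sum integrable_continuous_real continuous_intros) auto
      finally show ?thesis by simp
    qed
    moreover have "fourier_coeff f n * integral {-pi..pi} (\<lambda>y. Y n y * Y m y) = (if n = m then fourier_coeff f m * c else 0)" for n
      by (simp add: integral_Y_Y c_def)
    ultimately have "I N = fourier_coeff f m * c" if "m < N" for N
      using that by simp
    then have "I \<longlonglongrightarrow> fourier_coeff f m * c"
      by (intro tendsto_eventually) (auto simp: eventually_sequentially intro!: exI[of _ "Suc m"])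
    then have "J = fourier_coeff f m * c" using IJ(3) LIMSEQ_unique by blast
    then have "J = integral {-pi..pi} (\<lambda>y. f y * Y m y)"
      by (simp add: fourier_coeff_eq[OF f(1)] c_def)
    moreover have "integral {-pi..pi} (\<lambda>y. (f y - g y) * Y m y) =
        integral {-pi..pi} (\<lambda>y. f y * Y m y) - integral {-pi..pi} (\<lambda>y. g y * Y m y)"
      unfolding left_diff_distrib by (intro integral_diff integrable_continuous_real continuous_intros f gc)
    ultimately show ?thesis using IJ(2) by (simp add: integral_unique)
  qed
  have "f y - g y = 0"
  proof (rule trig_complete[OF _ _ orth y])
    show "continuous_on {-pi..pi} (\<lambda>y. f y - g y)" by (intro continuous_intros f gc)
    show "f (-pi) - g (-pi) = f pi - g pi" using f(2) by (simp add: g_def Y_periodic)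
  qed
  then show ?thesis by (simp add: g_def)
qed

section \<open>Termwise operations\<close>

lemma series_has_field_derivative_powr_bound:
  fixes f :: "nat \<Rightarrow> real \<Rightarrow> real"
  assumes \<beta>: "\<beta> \<le> 1" and A: "summable A"
    and f: "\<And>n s. s \<in> {0<..<b} \<Longrightarrow> f n field_differentiable (at s)"
    and bd: "\<And>n s. s \<in> {0<..<b} \<Longrightarrow> \<bar>deriv (f n) s\<bar> \<le> A n * s powr (\<beta> - 1)"
    and sum: "\<And>s. s \<in> {0<..<b} \<Longrightarrow> summable (\<lambda>n. f n s)"
    and s: "s \<in> {0<..<b}"
  shows "((\<lambda>s. \<Sum>n. f n s) has_field_derivative (\<Sum>n. deriv (f n) s)) (at s)"
proof (rule has_field_derivative_series'(2))
  \<comment> \<open>A neighbourhood of s that stays away from 0, where the majorant with exponent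
    \<beta> - 1 may be singular.\<close>
  define S where "S = {s / 2<..<b}"
  have S: "S \<subseteq> {0<..<b}" "s \<in> S" using s by (auto simp: S_def)
  show "convex S" by (simp add: S_def)
  show "s \<in> interior S" using S by (simp add: S_def interior_open)
  show "s \<in> S" by (rule S)
  show "summable (\<lambda>n. f n s)" by (rule sum[OF s])
  show "(f n has_field_derivative deriv (f n) t) (at t within S)" if "t \<in> S" for n t
    using f[OF subsetD[OF S(1) that], of n]
    by (auto simp: DERIV_deriv_iff_field_differentiable[symmetric] intro: has_field_derivative_at_within)
  have A0: "0 \<le> A n" for n
  proof -
    have "0 \<le> A n * s powr (\<beta> - 1)" by (rule order_trans[OF abs_ge_zero bd[OF s]])
    then show ?thesis using s by (simp add: zero_le_mult_iff)
  qed
  show "uniformly_convergent_on S (\<lambda>n t. \<Sum>i<n. deriv (f i) t)"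
  proof (rule Weierstrass_m_test'_ev[OF always_eventually summable_mult2[OF A]], intro allI ballI)
    fix n t assume t: "t \<in> S"
    have "\<bar>deriv (f n) t\<bar> \<le> A n * t powr (\<beta> - 1)" using S t by (intro bd) auto
    also have "\<dots> \<le> A n * (s / 2) powr (\<beta> - 1)"
      using t s \<beta> A0 by (intro mult_left_mono powr_mono2') (auto simp: S_def)
    finally show "norm (deriv (f n) t) \<le> A n * (s / 2) powr (\<beta> - 1)" by simp
  qed
qed

text \<open>For \<alpha> < 1 sum and integral are interchanged by domination: the n-th integrand is
  at most A n times (x - s) powr (- \<alpha>) * s powr (\<beta> - 1), a convergent Beta
  integral.\<close>

lemma caputo_series:
  fixes f :: "nat \<Rightarrow> real \<Rightarrow> real"
  assumes \<alpha>: "0 < \<alpha>" "\<alpha> \<le> 1" and \<beta>: "0 < \<beta>" "\<beta> \<le> 1" and A: "summable A" and x: "0 < x" "x < b"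
    and f: "\<And>n s. s \<in> {0<..<b} \<Longrightarrow> f n field_differentiable (at s)"
    and bd: "\<And>n s. s \<in> {0<..<b} \<Longrightarrow> \<bar>deriv (f n) s\<bar> \<le> A n * s powr (\<beta> - 1)"
    and sum: "\<And>s. s \<in> {0<..<b} \<Longrightarrow> summable (\<lambda>n. f n s)"
    and cap: "\<And>n. has_caputo \<alpha> (f n) x"
  shows "has_caputo \<alpha> (\<lambda>s. \<Sum>n. f n s) x"
    and "caputo \<alpha> (\<lambda>s. \<Sum>n. f n s) x = (\<Sum>n. caputo \<alpha> (f n) x)"
proof -
  define F where "F s = (\<Sum>n. f n s)" for s
  have F: "(F has_field_derivative (\<Sum>n. deriv (f n) s)) (at s)" if "s \<in> {0<..<b}" for s
    unfolding F_def by (rule series_has_field_derivative_powr_bound[OF \<beta>(2) A f bd sum that])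
  have fd: "F field_differentiable (at s)" if "s \<in> {0<..<b}" for s
    using F[OF that] unfolding field_differentiable_def by blast
  note dF = DERIV_imp_deriv[OF F]
  have "has_caputo \<alpha> F x \<and> caputo \<alpha> F x = (\<Sum>n. caputo \<alpha> (f n) x)"
  proof (cases "\<alpha> = 1")
    case True
    then show ?thesis using fd[of x] dF[of x] x by (simp add: has_caputo_def caputo_def)
  next
    case False
    then have \<alpha>1: "\<alpha> < 1" using \<alpha> by simp
    define g where "g n s = indicator {0<..<x} s * ((x - s) powr (-\<alpha>) * deriv (f n) s)" for n s
    define k where "k s = indicator {0<..<x} s * ((x - s) powr (-\<alpha>) * s powr (\<beta> - 1))" for s
    have k: "integrable lborel k"
      using Beta_kernel(1)[of "1 - \<alpha>" \<beta> x] \<alpha>1 \<beta> x by (simp add: k_def[abs_def] set_integrable_def)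
    have g: "integrable lborel (g n)" for n
      using cap[of n] False by (simp add: has_caputo_def g_def[abs_def] set_integrable_def)
    have gk: "norm (g n s) \<le> A n * k s" for n s
    proof (cases "s \<in> {0<..<x}")
      case True
      then have "(x - s) powr (-\<alpha>) * \<bar>deriv (f n) s\<bar> \<le> (x - s) powr (-\<alpha>) * (A n * s powr (\<beta> - 1))"
        using x by (intro mult_left_mono bd) auto
      then show ?thesis using True by (simp add: g_def k_def abs_mult mult_ac)
    qed (simp add: g_def k_def)
    have sg: "summable (\<lambda>n. norm (g n s))" for s
      by (rule summable_comparison_test'[OF summable_mult2[OF A, of "k s"]]) (use gk in auto)
    have s2: "summable (\<lambda>n. \<integral>s. norm (g n s) \<partial>lborel)"
    proof (rule summable_comparison_test'[OF summable_mult2[OF A, of "integral\<^sup>L lborel k"]])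
      fix n
      have "(\<integral>s. norm (g n s) \<partial>lborel) \<le> (\<integral>s. A n * k s \<partial>lborel)"
        using g k gk by (intro integral_mono) auto
      then show "norm (\<integral>s. norm (g n s) \<partial>lborel) \<le> A n * integral\<^sup>L lborel k" by simp
    qed
    have eq: "(\<Sum>n. g n s) = indicator {0<..<x} s * ((x - s) powr (-\<alpha>) * deriv F s)" for s
    proof (cases "s \<in> {0<..<x}")
      case True
      have "summable (\<lambda>n. deriv (f n) s)"
        by (rule summable_comparison_test'[OF summable_mult2[OF A, of "s powr (\<beta> - 1)"]]) (use bd True x in auto)
      then have "(\<Sum>n. (x - s) powr (-\<alpha>) * deriv (f n) s) = (x - s) powr (-\<alpha>) * (\<Sum>n. deriv (f n) s)"
        by (rule suminf_mult)
      then show ?thesis using True dF[of s] x by (simp add: g_def)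
    qed (simp add: g_def)
    note I = integrable_suminf[OF g AE_I2[OF sg] s2] integral_suminf[OF g AE_I2[OF sg] s2]
    have c: "caputo \<alpha> (f n) x = 1 / Gamma (1 - \<alpha>) * (\<integral>s. g n s \<partial>lborel)" for n
      using False by (simp add: caputo_def g_def set_lebesgue_integral_def)
    have sI: "summable (\<lambda>n. \<integral>s. g n s \<partial>lborel)"
      by (rule summable_comparison_test'[OF s2]) (use integral_norm_bound in auto)
    have "has_caputo \<alpha> F x"
      using I(1) False fd x by (simp add: has_caputo_def eq set_integrable_def)
    moreover have "caputo \<alpha> F x = 1 / Gamma (1 - \<alpha>) * (\<Sum>n. \<integral>s. g n s \<partial>lborel)"
      using I(2) False by (simp add: caputo_def eq set_lebesgue_integral_def)
    ultimately show ?thesis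
      unfolding c by (subst suminf_mult[OF sI]) simp
  qed
  then show "has_caputo \<alpha> (\<lambda>s. \<Sum>n. f n s) x"
    and "caputo \<alpha> (\<lambda>s. \<Sum>n. f n s) x = (\<Sum>n. caputo \<alpha> (f n) x)"
    by (auto simp: F_def[abs_def])
qed

lemma caputo_const: "has_caputo \<alpha> (\<lambda>s. k) x" "caputo \<alpha> (\<lambda>s. k) x = 0"
  by (auto simp: has_caputo_def caputo_def field_differentiable_def set_integrable_def set_lebesgue_integral_def intro!: exI[of _ 0])

lemma caputo_powr:
  assumes "0 < \<alpha>" "\<alpha> \<le> 1" "0 < x"
  shows "has_caputo \<alpha> (\<lambda>s. s powr \<alpha>) x" "caputo \<alpha> (\<lambda>s. s powr \<alpha>) x = Gamma (\<alpha> + 1)"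
proof -
  define a :: "nat \<Rightarrow> real" where "a = (\<lambda>k. if k = 1 then 1 else 0)"
  have s: "(\<lambda>k. a k * z ^ k) sums z" for z :: real
  proof -
    have "(\<lambda>k. a k * z ^ k) = (\<lambda>k. if k = 1 then z ^ k else 0)" by (auto simp: a_def)
    then show ?thesis using sums_single[of 1 "\<lambda>k. z ^ k"] by simp
  qed
  have f: "(\<lambda>s. s powr \<alpha>) = (\<lambda>s. \<Sum>k. a k * (s powr \<alpha>) ^ k)"
    using sums_unique[OF s] by auto
  have a: "summable (\<lambda>k. a k * z ^ k)" for z using s by (rule sums_summable)
  show "has_caputo \<alpha> (\<lambda>s. s powr \<alpha>) x"
    unfolding f by (rule caputo_powser[OF assms(1,2) a assms(3)])
  have "(\<Sum>k. a (Suc k) * (Gamma (\<alpha> * Suc k + 1) / Gamma (\<alpha> * k + 1)) * (x powr \<alpha>) ^ k)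
    = (\<Sum>k\<in>{0}. a (Suc k) * (Gamma (\<alpha> * Suc k + 1) / Gamma (\<alpha> * k + 1)) * (x powr \<alpha>) ^ k)"
    by (rule suminf_finite) (auto simp: a_def)
  then show "caputo \<alpha> (\<lambda>s. s powr \<alpha>) x = Gamma (\<alpha> + 1)"
    unfolding f caputo_powser[OF assms(1,2) a assms(3)] by (simp add: a_def)
qed

text \<open>Majorants are required only on strips r <= x <= r', since the bounds for the modes are
  singular at x = 0 and their constants depend on the distance to x = 1.\<close>

lemma continuous_on_Omega_suminf:
  assumes c: "\<And>n. continuous_on Omega (\<lambda>(x, y). g n x y)"
    and A: "\<And>r r'. 0 < r \<Longrightarrow> r < r' \<Longrightarrow> r' < 1 \<Longrightarrow>
       \<exists>A. summable A \<and> (\<forall>n x y. r \<le> x \<longrightarrow> x \<le> r' \<longrightarrow> \<bar>g n x y\<bar> \<le> A n)"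
  shows "continuous_on Omega (\<lambda>(x, y). \<Sum>n. g n x y :: real)"
proof -
  have "isCont (\<lambda>(x, y). \<Sum>n. g n x y) p" if p: "p \<in> Omega" for p
  proof -
    obtain x0 y0 where p0: "p = (x0, y0)" "0 < x0" "x0 < 1" "-pi < y0" "y0 < pi"
      using p by (auto simp: Omega_def)
    define U where "U = {x0 / 2<..<(x0 + 1) / 2} \<times> {-pi<..<pi}"
    have U: "open U" "p \<in> U" "U \<subseteq> Omega"
      using p0 by (auto simp: U_def Omega_def intro: open_Times)
    obtain A where A: "summable A" "\<And>n x y. x0 / 2 \<le> x \<Longrightarrow> x \<le> (x0 + 1) / 2 \<Longrightarrow> \<bar>g n x y\<bar> \<le> A n"
      using A[of "x0 / 2" "(x0 + 1) / 2"] p0 by auto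
    have "uniform_limit U (\<lambda>N p. \<Sum>n<N. (\<lambda>(x, y). g n x y) p) (\<lambda>p. \<Sum>n. (\<lambda>(x, y). g n x y) p) sequentially"
      by (rule Weierstrass_m_test[OF _ A(1)]) (use A(2) in \<open>auto simp: U_def\<close>)
    then have "continuous_on U (\<lambda>p. \<Sum>n. (\<lambda>(x, y). g n x y) p)"
      by (rule uniform_limit_theorem[rotated]) 
        (auto intro!: always_eventually continuous_on_sum continuous_on_subset[OF c U(3)])
    then have "isCont (\<lambda>p. \<Sum>n. (\<lambda>(x, y). g n x y) p) p"
      using U by (simp add: continuous_on_eq_continuous_at)
    then show ?thesis by (simp add: case_prod_beta')
  qed
  then show ?thesis
    by (intro continuous_at_imp_continuous_on) auto
qed

lemma continuous_on_Omega_bar_suminf: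
  assumes c: "\<And>n. continuous_on Omega_bar (\<lambda>(x, y). g n x y)"
    and A: "summable A" "\<And>n x y. 0 \<le> x \<Longrightarrow> x \<le> 1 \<Longrightarrow> \<bar>g n x y\<bar> \<le> A n"
  shows "continuous_on Omega_bar (\<lambda>(x, y). \<Sum>n. g n x y :: real)"
proof -
  have "uniform_limit Omega_bar (\<lambda>N p. \<Sum>n<N. (\<lambda>(x, y). g n x y) p) (\<lambda>p. \<Sum>n. (\<lambda>(x, y). g n x y) p) sequentially"
    by (rule Weierstrass_m_test[OF _ A(1)]) (use A(2) in \<open>auto simp: Omega_bar_def\<close>)
  then have "continuous_on Omega_bar (\<lambda>p. \<Sum>n. (\<lambda>(x, y). g n x y) p)"
    by (rule uniform_limit_theorem[rotated]) (auto intro!: always_eventually continuous_on_sum c)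
  then show ?thesis by (simp add: case_prod_beta')
qed

definition Y1 :: "nat \<Rightarrow> real \<Rightarrow> real" where
  "Y1 n y = (if odd n then freq n * cos (freq n * y) else - (freq n * sin (freq n * y)))"

lemma has_deriv_Y: "(Y n has_field_derivative Y1 n y) (at y within S)"
  unfolding Y_eq[abs_def] Y1_def by (cases "odd n") (auto intro!: derivative_eq_intros)

lemma has_deriv_Y1: "(Y1 n has_field_derivative - ((freq n)\<^sup>2 * Y n y)) (at y within S)"
  unfolding Y1_def[abs_def] Y_eq by (cases "odd n") (auto intro!: derivative_eq_intros simp: power2_eq_square)

lemma Y1_abs_le: "\<bar>Y1 n y\<bar> \<le> freq n"
  using freq_ge(3)[of n] mult_left_mono[OF abs_cos_le_one, of "freq n"] mult_left_mono[OF abs_sin_le_one, of "freq n"]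
  by (auto simp: Y1_def abs_mult)

lemma continuous_on_Y1 [continuous_intros]: "continuous_on S (Y1 n)"
  unfolding Y1_def[abs_def] by (cases "odd n") (auto intro!: continuous_intros)

lemma Y1_periodic: "Y1 n (- pi) = Y1 n pi"
  by (simp add: Y1_def sin_freq_pi)

lemma series_Y_derivs:
  assumes s1: "summable (\<lambda>n. freq n * \<bar>b n\<bar>)" and s0: "summable (\<lambda>n. \<bar>b n\<bar>)"
  shows "((\<lambda>y. \<Sum>n. b n * Y n y) has_field_derivative (\<Sum>n. b n * Y1 n y)) (at y)"
    and "summable (\<lambda>n. (freq n)\<^sup>2 * \<bar>b n\<bar>) \<Longrightarrow>
      ((\<lambda>y. \<Sum>n. b n * Y1 n y) has_field_derivative (\<Sum>n. - (freq n)\<^sup>2 * b n * Y n y)) (at y)"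
proof -
  have a0: "\<bar>b n * Y n y\<bar> \<le> \<bar>b n\<bar>" for n y
    using mult_left_mono[OF Y_abs_le[of n y], of "\<bar>b n\<bar>"] by (simp add: abs_mult)
  have a1: "\<bar>b n * Y1 n y\<bar> \<le> freq n * \<bar>b n\<bar>" for n y
    using mult_left_mono[OF Y1_abs_le[of n y], of "\<bar>b n\<bar>"] by (simp add: abs_mult mult_ac)
  show "((\<lambda>y. \<Sum>n. b n * Y n y) has_field_derivative (\<Sum>n. b n * Y1 n y)) (at y)"
  proof (rule has_field_derivative_series'(2)[of UNIV])
    show "uniformly_convergent_on UNIV (\<lambda>n y. \<Sum>i<n. b i * Y1 i y)"
      by (rule Weierstrass_m_test'_ev[OF _ s1]) (use a1 in auto)
    show "((\<lambda>y. b n * Y n y) has_field_derivative b n * Y1 n y) (at y)" for n y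
      by (intro DERIV_cmult has_deriv_Y)
    show "summable (\<lambda>n. b n * Y n y)" by (rule summable_comparison_test'[OF s0]) (use a0 in auto)
  qed auto
  assume s2: "summable (\<lambda>n. (freq n)\<^sup>2 * \<bar>b n\<bar>)"
  show "((\<lambda>y. \<Sum>n. b n * Y1 n y) has_field_derivative (\<Sum>n. - (freq n)\<^sup>2 * b n * Y n y)) (at y)"
  proof (rule has_field_derivative_series'(2)[of UNIV])
    have "norm (- (freq n)\<^sup>2 * b n * Y n y) \<le> (freq n)\<^sup>2 * \<bar>b n\<bar>" for n y
      using mult_left_mono[OF a0[of n y], of "(freq n)\<^sup>2"] by (simp add: abs_mult mult.assoc)
    then show "uniformly_convergent_on UNIV (\<lambda>n y. \<Sum>i<n. - (freq i)\<^sup>2 * b i * Y i y)"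
      by (intro Weierstrass_m_test'_ev[OF _ s2]) auto
    show "((\<lambda>y. b n * Y1 n y) has_field_derivative - (freq n)\<^sup>2 * b n * Y n y) (at y)" for n y
      using DERIV_cmult[OF has_deriv_Y1[of n y UNIV], of "b n"] by (simp add: mult_ac)
    show "summable (\<lambda>n. b n * Y1 n y)" by (rule summable_comparison_test'[OF s1]) (use a1 in auto)
  qed auto
qed

section \<open>Existence\<close>

lemma Y_minus: "Y n (- y) = (if odd n then - Y n y else Y n y)"
  by (simp add: Y_eq)

text \<open>Formulated for abstract factors \<open>X n\<close> with Caputo derivatives
  \<open>P n\<close>, so that the zero mode and the others are treated alike. \<open>B\<close>
  controls u and its first y-derivative up to the boundary; \<open>bounds\<close> controls the
  derivatives that occur in the equation, inside the domain.\<close>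

lemma series_solution:
  fixes X P :: "nat \<Rightarrow> real \<Rightarrow> real" and B :: "nat \<Rightarrow> real"
  assumes \<alpha>: "0 < \<alpha>" "\<alpha> \<le> 1"
    and B: "summable B" "summable (\<lambda>n. freq n * B n)"
    and XB: "\<And>n x. 0 \<le> x \<Longrightarrow> x \<le> 1 \<Longrightarrow> \<bar>X n x\<bar> \<le> B n"
    and Xc: "\<And>n. continuous_on {0..1} (X n)"
    and Xd: "\<And>n x. 0 < x \<Longrightarrow> X n field_differentiable (at x)"
    and Pd: "\<And>n x. 0 < x \<Longrightarrow> P n field_differentiable (at x)"
    and XP: "\<And>n x. 0 < x \<Longrightarrow> has_caputo \<alpha> (X n) x" "\<And>n x. 0 < x \<Longrightarrow> caputo \<alpha> (X n) x = P n x"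
    and PX: "\<And>n x. 0 < x \<Longrightarrow> has_caputo \<alpha> (P n) x"
      "\<And>n x. 0 < x \<Longrightarrow> caputo \<alpha> (P n) x = (lam \<epsilon> n + c\<^sup>2) * X n x"
    and bounds: "\<And>r. 0 < r \<Longrightarrow> r < 1 \<Longrightarrow> \<exists>A. summable A \<and> (\<forall>n x. 0 < x \<longrightarrow> x \<le> r \<longrightarrow>
        (freq n)\<^sup>2 * \<bar>X n x\<bar> \<le> A n * x powr (- \<alpha> / 2) \<and> \<bar>lam \<epsilon> n + c\<^sup>2\<bar> * \<bar>X n x\<bar> \<le> A n * x powr (- \<alpha> / 2) \<and>
        \<bar>deriv (X n) x\<bar> \<le> A n * x powr (\<alpha> / 2 - 1) \<and>
        \<bar>P n x\<bar> \<le> A n \<and> \<bar>deriv (P n) x\<bar> \<le> A n * x powr (\<alpha> / 2 - 1))"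
    and bc: "\<And>y. y \<in> {-pi..pi} \<Longrightarrow> \<phi> y = (\<Sum>n. X n 0 * Y n y)" "\<And>y. y \<in> {-pi..pi} \<Longrightarrow> \<psi> y = (\<Sum>n. X n 1 * Y n y)"
  shows "bvp_solution \<alpha> c \<epsilon> \<phi> \<psi> (\<lambda>x y. \<Sum>n. X n x * Y n y)"
proof -
  define u where "u x y = (\<Sum>n. X n x * Y n y)" for x y
  define w where "w x y = (\<Sum>n. P n x * Y n y)" for x y
  define g where "g x y = (\<Sum>n. (lam \<epsilon> n + c\<^sup>2) * X n x * Y n y)" for x y
  define uy where "uy x y = (\<Sum>n. X n x * Y1 n y)" for x y
  define uyy where "uyy x y = (\<Sum>n. - (freq n)\<^sup>2 * X n x * Y n y)" for x y
  have mY: "\<bar>b * Y n y\<bar> \<le> \<bar>b\<bar>" for b n y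
    using mult_left_mono[OF Y_abs_le[of n y], of "\<bar>b\<bar>"] by (simp add: abs_mult)
  have B0: "0 \<le> B n" for n using XB[of 0 n] abs_ge_zero[of "X n 0"] by simp
  have sX: "summable (\<lambda>n. \<bar>X n x\<bar>)" "summable (\<lambda>n. freq n * \<bar>X n x\<bar>)" if "0 \<le> x" "x \<le> 1" for x
  proof -
    show "summable (\<lambda>n. \<bar>X n x\<bar>)"
      by (rule summable_comparison_test'[OF B(1)]) (use XB that in auto)
    show "summable (\<lambda>n. freq n * \<bar>X n x\<bar>)"
      by (rule summable_comparison_test'[OF B(2)]) (use XB that freq_ge(3) in \<open>auto simp: abs_mult intro!: mult_left_mono\<close>)
  qed
  have sXY: "summable (\<lambda>n. X n x * Y n y)" if "0 \<le> x" "x \<le> 1" for x y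
    by (rule summable_comparison_test'[OF sX(1)[OF that]]) (use mY in auto)
  have cY: "continuous_on S (\<lambda>p. Y n (snd p))" "continuous_on S (\<lambda>p. Y1 n (snd p))" for n and S :: "(real \<times> real) set"
    by (rule continuous_on_compose2[OF continuous_on_Y[of UNIV] continuous_on_snd], auto)
      (rule continuous_on_compose2[OF continuous_on_Y1[of UNIV] continuous_on_snd], auto)
  have cXb: "continuous_on Omega_bar (\<lambda>p. X n (fst p))" for n
    by (rule continuous_on_compose2[OF Xc continuous_on_fst]) (auto simp: Omega_bar_def)
  have cX: "continuous_on Omega (\<lambda>p. X n (fst p))" for n
    by (rule continuous_on_subset[OF cXb]) (auto simp: Omega_def Omega_bar_def)
  have cP: "continuous_on Omega (\<lambda>p. P n (fst p))" for n
  proof (rule continuous_on_compose2[OF _ continuous_on_fst])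
    show "continuous_on {0<..} (P n)"
      using Pd by (intro continuous_at_imp_continuous_on ballI field_differentiable_imp_continuous_at) auto
  qed (auto simp: Omega_def)
  have u_cont: "continuous_on Omega_bar (\<lambda>(x, y). u x y)"
    unfolding u_def
  proof (rule continuous_on_Omega_bar_suminf[OF _ B(1)])
    show "continuous_on Omega_bar (\<lambda>(x, y). X n x * Y n y)" for n
      unfolding case_prod_beta' by (intro continuous_intros cXb cY)
    show "\<bar>X n x * Y n y\<bar> \<le> B n" if "0 \<le> x" "x \<le> 1" for n x y
      using mY[of "X n x" n y] XB[OF that, of n] by linarith
  qed
  have uy_cont: "continuous_on Omega_bar (\<lambda>(x, y). uy x y)"
    unfolding uy_def
  proof (rule continuous_on_Omega_bar_suminf[OF _ B(2)])
    show "continuous_on Omega_bar (\<lambda>(x, y). X n x * Y1 n y)" for n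
      unfolding case_prod_beta' by (intro continuous_intros cXb cY)
    show "\<bar>X n x * Y1 n y\<bar> \<le> freq n * B n" if "0 \<le> x" "x \<le> 1" for n x y
      unfolding abs_mult using XB[OF that, of n] Y1_abs_le[of n y] B0[of n]
      by (subst mult.commute[of "freq n"]) (intro mult_mono; simp)
  qed
  have up: "x powr (- \<alpha> / 2) \<le> r powr (- \<alpha> / 2)" if "0 < r" "r \<le> x" for r x
    using that \<alpha> by (intro powr_mono2') auto
  have w_cont: "continuous_on Omega (\<lambda>(x, y). w x y)"
    unfolding w_def
  proof (rule continuous_on_Omega_suminf)
    show "continuous_on Omega (\<lambda>(x, y). P n x * Y n y)" for n
      unfolding case_prod_beta' by (intro continuous_intros cP cY)
    fix r r' :: real assume r: "0 < r" "r < r'" "r' < 1"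
    obtain A where A: "summable A" "\<And>n x. 0 < x \<Longrightarrow> x \<le> r' \<Longrightarrow> \<bar>P n x\<bar> \<le> A n"
      using bounds[of r'] r by auto
    have "\<bar>P n x * Y n y\<bar> \<le> A n" if "r \<le> x" "x \<le> r'" for n x y
      using A(2)[of x n] mY[of "P n x" n y] that r by linarith
    then show "\<exists>A. summable A \<and> (\<forall>n x y. r \<le> x \<longrightarrow> x \<le> r' \<longrightarrow> \<bar>P n x * Y n y\<bar> \<le> A n)"
      using A(1) by blast
  qed
  have g_cont: "continuous_on Omega (\<lambda>(x, y). g x y)"
    unfolding g_def
  proof (rule continuous_on_Omega_suminf)
    show "continuous_on Omega (\<lambda>(x, y). (lam \<epsilon> n + c\<^sup>2) * X n x * Y n y)" for n
      unfolding case_prod_beta' by (intro continuous_intros cX cY)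
    fix r r' :: real assume r: "0 < r" "r < r'" "r' < 1"
    obtain A where A: "summable A" "\<And>n x. 0 < x \<Longrightarrow> x \<le> r' \<Longrightarrow> \<bar>lam \<epsilon> n + c\<^sup>2\<bar> * \<bar>X n x\<bar> \<le> A n * x powr (- \<alpha> / 2)"
      "\<And>n x. 0 < x \<Longrightarrow> x \<le> r' \<Longrightarrow> \<bar>P n x\<bar> \<le> A n"
      using bounds[of r'] r by auto
    have A0: "0 \<le> A n" for n using A(3)[of r n] r abs_ge_zero[of "P n r"] by linarith
    have "\<bar>(lam \<epsilon> n + c\<^sup>2) * X n x * Y n y\<bar> \<le> A n * r powr (- \<alpha> / 2)" if "r \<le> x" "x \<le> r'" for n x y
      using A(2)[of x n] mY[of "(lam \<epsilon> n + c\<^sup>2) * X n x" n y] that r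
        mult_left_mono[OF up[of r x] A0[of n]] by (simp add: abs_mult)
    then show "\<exists>A. summable A \<and> (\<forall>n x y. r \<le> x \<longrightarrow> x \<le> r' \<longrightarrow> \<bar>(lam \<epsilon> n + c\<^sup>2) * X n x * Y n y\<bar> \<le> A n)"
      using summable_mult2[OF A(1)] by blast
  qed
  have s2: "summable (\<lambda>n. (freq n)\<^sup>2 * \<bar>X n x\<bar>)" "summable (\<lambda>n. (lam \<epsilon> n + c\<^sup>2) * X n x * Y n y)"
    if x: "0 < x" "x < 1" for x y
  proof -
    obtain A where A: "summable A" "\<And>n. (freq n)\<^sup>2 * \<bar>X n x\<bar> \<le> A n * x powr (- \<alpha> / 2)"
      "\<And>n. \<bar>lam \<epsilon> n + c\<^sup>2\<bar> * \<bar>X n x\<bar> \<le> A n * x powr (- \<alpha> / 2)"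
      using bounds[of x] x by auto
    show "summable (\<lambda>n. (freq n)\<^sup>2 * \<bar>X n x\<bar>)"
      by (rule summable_comparison_test'[OF summable_mult2[OF A(1)]]) (use A(2) in auto)
    show "summable (\<lambda>n. (lam \<epsilon> n + c\<^sup>2) * X n x * Y n y)"
    proof (rule summable_comparison_test'[OF summable_mult2[OF A(1)]])
      show "norm ((lam \<epsilon> n + c\<^sup>2) * X n x * Y n y) \<le> A n * x powr (- \<alpha> / 2)" for n
        using A(3)[of n] mY[of "(lam \<epsilon> n + c\<^sup>2) * X n x" n y] by (simp add: abs_mult)
    qed
  qed
  have uyy_cont: "continuous_on Omega (\<lambda>(x, y). uyy x y)"
    unfolding uyy_def
  proof (rule continuous_on_Omega_suminf)
    show "continuous_on Omega (\<lambda>(x, y). - (freq n)\<^sup>2 * X n x * Y n y)" for n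
      unfolding case_prod_beta' by (intro continuous_intros cX cY)
    fix r r' :: real assume r: "0 < r" "r < r'" "r' < 1"
    obtain A where A: "summable A" "\<And>n x. 0 < x \<Longrightarrow> x \<le> r' \<Longrightarrow> (freq n)\<^sup>2 * \<bar>X n x\<bar> \<le> A n * x powr (- \<alpha> / 2)"
      "\<And>n x. 0 < x \<Longrightarrow> x \<le> r' \<Longrightarrow> \<bar>P n x\<bar> \<le> A n"
      using bounds[of r'] r by auto
    have A0: "0 \<le> A n" for n using A(3)[of r n] r abs_ge_zero[of "P n r"] by linarith
    have "\<bar>- (freq n)\<^sup>2 * X n x * Y n y\<bar> \<le> A n * r powr (- \<alpha> / 2)" if "r \<le> x" "x \<le> r'" for n x y
      using A(2)[of x n] mY[of "- (freq n)\<^sup>2 * X n x" n y] that r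
        mult_left_mono[OF up[of r x] A0[of n]] by (simp add: abs_mult)
    then show "\<exists>A. summable A \<and> (\<forall>n x y. r \<le> x \<longrightarrow> x \<le> r' \<longrightarrow> \<bar>- (freq n)\<^sup>2 * X n x * Y n y\<bar> \<le> A n)"
      using summable_mult2[OF A(1)] by blast
  qed
  have \<beta>: "0 < \<alpha> / 2" "\<alpha> / 2 \<le> 1" using \<alpha> by auto
  have dmult: "(\<lambda>s. f s * k) field_differentiable (at s)" "deriv (\<lambda>s. f s * k) s = deriv f s * k"
    if "f field_differentiable (at s)" for f :: "real \<Rightarrow> real" and k s
  proof -
    have "((\<lambda>s. f s * k) has_field_derivative deriv f s * k) (at s)"
      using that by (intro DERIV_cmult_right) (simp add: DERIV_deriv_iff_field_differentiable)
    then show "(\<lambda>s. f s * k) field_differentiable (at s)" "deriv (\<lambda>s. f s * k) s = deriv f s * k"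
      by (auto simp: field_differentiable_def DERIV_imp_deriv)
  qed
  have cmult: "has_caputo \<alpha> (\<lambda>s. f s * k) x" "caputo \<alpha> (\<lambda>s. f s * k) x = caputo \<alpha> f x * k"
    if "has_caputo \<alpha> f x" for f k x
    using caputo_lincomb[OF that that, of k 0] by (simp_all add: mult.commute)
  have Du: "has_caputo \<alpha> (\<lambda>s. u s y) x \<and> caputo \<alpha> (\<lambda>s. u s y) x = w x y" if x: "0 < x" "x < 1" for x y
  proof -
    \<comment> \<open>A point between x and 1, so that the bounds on (0, b] cover a neighbourhood of
      x.\<close>
    define b where "b = (x + 1) / 2"
    have b: "x < b" "b < 1" "0 < b" using x by (auto simp: b_def)
    obtain A where A: "summable A" "\<And>n x. 0 < x \<Longrightarrow> x \<le> b \<Longrightarrow> \<bar>deriv (X n) x\<bar> \<le> A n * x powr (\<alpha> / 2 - 1)"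
      using bounds[OF b(3,2)] by auto
    note cs = caputo_series[OF \<alpha> \<beta> A(1) x(1) b(1), of "\<lambda>n s. X n s * Y n y"]
    have bd: "\<bar>deriv (\<lambda>s. X n s * Y n y) s\<bar> \<le> A n * s powr (\<alpha> / 2 - 1)" if s: "s \<in> {0<..<b}" for n s
      using A(2)[of s n] mY[of "deriv (X n) s" n y] s dmult(2)[OF Xd, of s n] by simp
    have "has_caputo \<alpha> (\<lambda>s. \<Sum>n. X n s * Y n y) x" "caputo \<alpha> (\<lambda>s. \<Sum>n. X n s * Y n y) x = (\<Sum>n. caputo \<alpha> (\<lambda>s. X n s * Y n y) x)"
      by (rule cs; use bd b sXY dmult(1)[OF Xd] cmult(1)[OF XP(1)] x in auto)+
    then show ?thesis
      using XP x by (simp add: u_def w_def cmult(2))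
  qed
  have Dw: "has_caputo \<alpha> (\<lambda>s. w s y) x \<and> caputo \<alpha> (\<lambda>s. w s y) x = g x y" if x: "0 < x" "x < 1" for x y
  proof -
    define b where "b = (x + 1) / 2"
    have b: "x < b" "b < 1" "0 < b" using x by (auto simp: b_def)
    obtain A where A: "summable A" "\<And>n x. 0 < x \<Longrightarrow> x \<le> b \<Longrightarrow> \<bar>deriv (P n) x\<bar> \<le> A n * x powr (\<alpha> / 2 - 1)"
      "\<And>n x. 0 < x \<Longrightarrow> x \<le> b \<Longrightarrow> \<bar>P n x\<bar> \<le> A n"
      using bounds[OF b(3,2)] by auto
    have sP: "summable (\<lambda>n. P n s * Y n y)" if s: "s \<in> {0<..<b}" for s
    proof (rule summable_comparison_test'[OF A(1)])
      show "norm (P n s * Y n y) \<le> A n" for n using A(3)[of s n] mY[of "P n s" n y] s by simp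
    qed
    note cs = caputo_series[OF \<alpha> \<beta> A(1) x(1) b(1), of "\<lambda>n s. P n s * Y n y"]
    have bd: "\<bar>deriv (\<lambda>s. P n s * Y n y) s\<bar> \<le> A n * s powr (\<alpha> / 2 - 1)" if s: "s \<in> {0<..<b}" for n s
      using A(2)[of s n] mY[of "deriv (P n) s" n y] s dmult(2)[OF Pd, of s n] by simp
    have "has_caputo \<alpha> (\<lambda>s. \<Sum>n. P n s * Y n y) x" "caputo \<alpha> (\<lambda>s. \<Sum>n. P n s * Y n y) x = (\<Sum>n. caputo \<alpha> (\<lambda>s. P n s * Y n y) x)"
      by (rule cs; use bd b sP dmult(1)[OF Pd] cmult(1)[OF PX(1)] x in auto)+
    then show ?thesis
      using PX x by (simp add: w_def g_def cmult(2))
  qed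
  have Dx_u: "Dx \<alpha> u x y = w x y" if "0 < x" "x < 1" for x y
    using Du[OF that] by (simp add: Dx_def)
  have DxDx: "has_Dx \<alpha> (Dx \<alpha> u) x y" "Dx \<alpha> (Dx \<alpha> u) x y = g x y" if x: "0 < x" "x < 1" for x y
  proof -
    have e: "Dx \<alpha> u s y = w s y" if "s \<in> {0<..<1}" for s using Dx_u that by auto
    show "has_Dx \<alpha> (Dx \<alpha> u) x y"
      unfolding has_Dx_def using caputo_cong(1)[OF x(2) e x(1)] Dw[OF x] by simp
    show "Dx \<alpha> (Dx \<alpha> u) x y = g x y"
      unfolding Dx_def[of \<alpha> "Dx \<alpha> u"] using caputo_cong(2)[OF x(2) e x(1)] Dw[OF x] by simp
  qed
  have uy: "(u x has_field_derivative uy x y) (at y)" if "0 \<le> x" "x \<le> 1" for x y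
    unfolding u_def[abs_def] uy_def using sX[OF that] by (intro series_Y_derivs(1))
  have duy: "deriv (u x) = uy x" if "0 \<le> x" "x \<le> 1" for x
    using uy[OF that] by (intro ext DERIV_imp_deriv)
  have uyy: "(uy x has_field_derivative uyy x y) (at y)" if "0 < x" "x < 1" for x y
    unfolding uy_def[abs_def] uyy_def using sX[of x] s2(1)[OF that] that by (intro series_Y_derivs(2)) auto
  have Dyy: "Dyy u x y = uyy x y" if "0 < x" "x < 1" for x y
    unfolding Dyy_def using duy[of x] DERIV_imp_deriv[OF uyy[OF that]] that by simp
  have eqn: "g x y + uyy x y - \<epsilon> * uyy x (-y) - c\<^sup>2 * u x y = 0" if x: "0 < x" "x < 1" for x y
  proof -
    have sf: "(\<lambda>n. - (freq n)\<^sup>2 * X n x * Y n z) sums uyy x z" for z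
    proof -
      have "summable (\<lambda>n. - (freq n)\<^sup>2 * X n x * Y n z)"
      proof (rule summable_comparison_test'[OF s2(1)[OF x]])
        show "norm (- (freq n)\<^sup>2 * X n x * Y n z) \<le> (freq n)\<^sup>2 * \<bar>X n x\<bar>" for n
          using mY[of "- (freq n)\<^sup>2 * X n x" n z] by (simp add: abs_mult)
      qed
      then show ?thesis by (simp add: uyy_def summable_sums)
    qed
    have sg: "(\<lambda>n. (lam \<epsilon> n + c\<^sup>2) * X n x * Y n y) sums g x y"
      using s2(2)[OF x] by (simp add: g_def summable_sums)
    have su: "(\<lambda>n. X n x * Y n y) sums u x y"
      using sXY[of x y] x by (simp add: u_def summable_sums)
    have "(\<lambda>n. (lam \<epsilon> n + c\<^sup>2) * X n x * Y n y + (- (freq n)\<^sup>2 * X n x * Y n y) - \<epsilon> * (- (freq n)\<^sup>2 * X n x * Y n (-y))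
        - c\<^sup>2 * (X n x * Y n y)) sums (g x y + uyy x y - \<epsilon> * uyy x (-y) - c\<^sup>2 * u x y)"
      by (intro sums_diff sums_add sums_mult sg sf su)
    \<comment> \<open>The reflection multiplies the odd modes by -1; this is where the factors 1 +
      \<epsilon> and 1 - \<epsilon> of \<open>lam\<close> come from.\<close>
    moreover have "(lam \<epsilon> n + c\<^sup>2) * X n x * Y n y + (- (freq n)\<^sup>2 * X n x * Y n y) - \<epsilon> * (- (freq n)\<^sup>2 * X n x * Y n (-y))
        - c\<^sup>2 * (X n x * Y n y) = 0" for n
      by (cases "odd n") (simp_all add: lam_eq Y_minus algebra_simps)
    ultimately show ?thesis by (simp add: sums_iff)
  qed
  have Om: "0 < x \<and> x < 1 \<and> -pi < y \<and> y < pi" if "(x, y) \<in> Omega" for x y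
    using that by (auto simp: Omega_def)
  have reg: "regular_solution \<alpha> c \<epsilon> u"
    unfolding regular_solution_def
  proof (intro conjI ballI)
    show "continuous_on Omega_bar (\<lambda>(x, y). u x y)" by (rule u_cont)
    have "continuous_on Omega (\<lambda>(x, y). Dx \<alpha> u x y) \<longleftrightarrow> continuous_on Omega (\<lambda>(x, y). w x y)"
      by (intro continuous_on_cong) (use Dx_u Om in auto)
    then show "continuous_on Omega (\<lambda>(x, y). Dx \<alpha> u x y)" using w_cont by simp
    have "continuous_on Omega (\<lambda>(x, y). Dx \<alpha> (Dx \<alpha> u) x y) \<longleftrightarrow> continuous_on Omega (\<lambda>(x, y). g x y)"
      by (intro continuous_on_cong) (use DxDx Om in auto)
    then show "continuous_on Omega (\<lambda>(x, y). Dx \<alpha> (Dx \<alpha> u) x y)" using g_cont by simp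
    have "continuous_on Omega (\<lambda>(x, y). Dyy u x y) \<longleftrightarrow> continuous_on Omega (\<lambda>(x, y). uyy x y)"
      by (intro continuous_on_cong) (use Dyy Om in auto)
    then show "continuous_on Omega (\<lambda>(x, y). Dyy u x y)" using uyy_cont by simp
  next
    fix p assume p: "p \<in> Omega"
    obtain x y where xy: "p = (x, y)" by fastforce
    note x = Om[OF p[unfolded xy]]
    show "case p of (x, y) \<Rightarrow> has_Dx \<alpha> u x y"
      using Du[of x y] x xy by (simp add: has_Dx_def)
    show "case p of (x, y) \<Rightarrow> has_Dx \<alpha> (Dx \<alpha> u) x y"
      using DxDx x xy by simp
    have "u x field_differentiable (at y)" using uy[of x y] x by (auto simp: field_differentiable_def)
    moreover have "deriv (u x) field_differentiable (at y)"
      using uyy[of x y] duy[of x] x by (auto simp: field_differentiable_def)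
    ultimately show "case p of (x, y) \<Rightarrow> u x field_differentiable (at y) \<and> deriv (u x) field_differentiable (at y)"
      using xy by simp
    show "case p of (x, y) \<Rightarrow> Dx \<alpha> (Dx \<alpha> u) x y + Dyy u x y - \<epsilon> * Dyy u x (- y) - c\<^sup>2 * u x y = 0"
      using xy x DxDx(2) Dyy eqn[of x y] by simp
  qed
  have Dy: "Dy u x y = uy x y" "u x differentiable (at y within {-pi..pi})" if "0 \<le> x" "x \<le> 1" "y \<in> {-pi..pi}" for x y
  proof -
    have "(u x has_vector_derivative uy x y) (at y within {-pi..pi})"
      using uy[OF that(1,2), of y] by (simp add: has_real_derivative_iff_has_vector_derivative has_vector_derivative_at_within)
    moreover have "-pi < pi" using pi_gt_zero by simp
    ultimately show "Dy u x y = uy x y" "u x differentiable (at y within {-pi..pi})"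
      using that(3) unfolding Dy_def deriv_on_def
      by (auto intro!: vector_derivative_within_closed_interval differentiableI_vector)
  qed
  have Ob: "0 \<le> x \<and> x \<le> 1 \<and> y \<in> {-pi..pi}" if "(x, y) \<in> Omega_bar" for x y
    using that by (auto simp: Omega_bar_def)
  have "continuous_on Omega_bar (\<lambda>(x, y). Dy u x y) \<longleftrightarrow> continuous_on Omega_bar (\<lambda>(x, y). uy x y)"
    by (intro continuous_on_cong) (use Dy Ob in auto)
  then have dyc: "Dy_continuous_on_closure u"
    unfolding Dy_continuous_on_closure_def using uy_cont Dy(2) Ob by auto
  have "boundary_conditions \<phi> \<psi> u"
    unfolding boundary_conditions_def using bc
    by (auto simp: u_def Dy(1) uy_def Y_periodic Y1_periodic)
  with reg dyc show ?thesis
    unfolding bvp_solution_def u_def[abs_def] by simp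
qed

section \<open>The mode that is constant in y\<close>

lemma zero_mode_eq_modal: "c \<noteq> 0 \<Longrightarrow> zero_mode \<alpha> c p q = modal \<alpha> \<bar>c\<bar> p q"
  by (simp add: zero_mode_def[abs_def] modal_def[abs_def])

definition zero_mode_D :: "real \<Rightarrow> real \<Rightarrow> real \<Rightarrow> real \<Rightarrow> real \<Rightarrow> real" where
  "zero_mode_D \<alpha> c p q = (if c = 0 then (\<lambda>x. (q - p) * Gamma (\<alpha> + 1)) else modal_D \<alpha> \<bar>c\<bar> p q)"

lemma zero_mode_boundary:
  assumes \<alpha>: "0 < \<alpha>" "\<alpha> \<le> 1"
  shows "zero_mode \<alpha> c p q 0 = p" "zero_mode \<alpha> c p q 1 = q" "continuous_on {0..1} (zero_mode \<alpha> c p q)"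
    and "0 \<le> x \<Longrightarrow> x \<le> 1 \<Longrightarrow> \<bar>zero_mode \<alpha> c p q x\<bar> \<le> 2 * \<bar>p\<bar> + \<bar>q\<bar>"
proof -
  have "zero_mode \<alpha> c p q 0 = p \<and> zero_mode \<alpha> c p q 1 = q \<and> continuous_on {0..1} (zero_mode \<alpha> c p q) \<and>
     (\<forall>x. 0 \<le> x \<longrightarrow> x \<le> 1 \<longrightarrow> \<bar>zero_mode \<alpha> c p q x\<bar> \<le> 2 * \<bar>p\<bar> + \<bar>q\<bar>)"
  proof (cases "c = 0")
    case False
    then show ?thesis unfolding zero_mode_eq_modal[OF False] using modal_boundary[OF \<alpha>, of "\<bar>c\<bar>"] by auto
  next
    case True
    have "continuous_on {0..1} (zero_mode \<alpha> c p q)"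
      unfolding zero_mode_def[abs_def] using \<alpha> True
      by (auto intro!: continuous_intros continuous_on_powr')
    moreover have "\<bar>(1 - x powr \<alpha>) * p + x powr \<alpha> * q\<bar> \<le> 2 * \<bar>p\<bar> + \<bar>q\<bar>" if "0 \<le> x" "x \<le> 1" for x
    proof -
      have "0 \<le> x powr \<alpha>" "x powr \<alpha> \<le> 1" using that \<alpha> powr_mono2[of \<alpha> x 1] by auto
      then have "\<bar>(1 - x powr \<alpha>) * p\<bar> \<le> 1 * \<bar>p\<bar>" "\<bar>x powr \<alpha> * q\<bar> \<le> 1 * \<bar>q\<bar>"
        unfolding abs_mult by (intro mult_right_mono; simp)+
      then show ?thesis by linarith
    qed
    ultimately show ?thesis using True by (simp add: zero_mode_def)
  qed
  then show "zero_mode \<alpha> c p q 0 = p" "zero_mode \<alpha> c p q 1 = q" "continuous_on {0..1} (zero_mode \<alpha> c p q)"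
    "0 \<le> x \<Longrightarrow> x \<le> 1 \<Longrightarrow> \<bar>zero_mode \<alpha> c p q x\<bar> \<le> 2 * \<bar>p\<bar> + \<bar>q\<bar>" by auto
qed

lemma zero_mode_deriv:
  assumes "0 < \<alpha>" "0 < x" "c = 0"
  shows "(zero_mode \<alpha> c p q has_field_derivative (q - p) * (\<alpha> * x powr (\<alpha> - 1))) (at x)"
proof -
  have "((\<lambda>x. p + (q - p) * x powr \<alpha>) has_field_derivative 0 + (q - p) * (\<alpha> * x powr (\<alpha> - 1))) (at x)"
    by (intro DERIV_add DERIV_const DERIV_cmult has_real_derivative_powr assms)
  moreover have "zero_mode \<alpha> c p q = (\<lambda>x. p + (q - p) * x powr \<alpha>)"
    using assms by (auto simp: zero_mode_def algebra_simps)
  ultimately show ?thesis by simp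
qed

lemma zero_mode_caputo:
  assumes \<alpha>: "0 < \<alpha>" "\<alpha> \<le> 1" and x: "0 < x"
  shows "zero_mode \<alpha> c p q field_differentiable (at x)" "zero_mode_D \<alpha> c p q field_differentiable (at x)"
    and "has_caputo \<alpha> (zero_mode \<alpha> c p q) x" "caputo \<alpha> (zero_mode \<alpha> c p q) x = zero_mode_D \<alpha> c p q x"
    and "has_caputo \<alpha> (zero_mode_D \<alpha> c p q) x" "caputo \<alpha> (zero_mode_D \<alpha> c p q) x = c\<^sup>2 * zero_mode \<alpha> c p q x"
proof -
  have "zero_mode \<alpha> c p q field_differentiable (at x) \<and> zero_mode_D \<alpha> c p q field_differentiable (at x) \<and>
    has_caputo \<alpha> (zero_mode \<alpha> c p q) x \<and> caputo \<alpha> (zero_mode \<alpha> c p q) x = zero_mode_D \<alpha> c p q x \<and>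
    has_caputo \<alpha> (zero_mode_D \<alpha> c p q) x \<and> caputo \<alpha> (zero_mode_D \<alpha> c p q) x = c\<^sup>2 * zero_mode \<alpha> c p q x"
  proof (cases "c = 0")
    case False
    then have c: "0 < \<bar>c\<bar>" by simp
    have D: "zero_mode_D \<alpha> c p q = modal_D \<alpha> \<bar>c\<bar> p q" using False by (simp add: zero_mode_D_def)
    show ?thesis
      unfolding zero_mode_eq_modal[OF False] D using modal_caputo[OF \<alpha> c x, of p q]
      by (auto simp: field_differentiable_def)
  next
    case True
    have e: "zero_mode \<alpha> c p q = (\<lambda>x. p * 1 + (q - p) * x powr \<alpha>)"
      using True by (auto simp: zero_mode_def algebra_simps)
    have D: "zero_mode_D \<alpha> c p q = (\<lambda>x. (q - p) * Gamma (\<alpha> + 1))" using True by (simp add: zero_mode_D_def)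
    have "has_caputo \<alpha> (zero_mode \<alpha> c p q) x" "caputo \<alpha> (zero_mode \<alpha> c p q) x = p * 0 + (q - p) * Gamma (\<alpha> + 1)"
      unfolding e using caputo_lincomb[OF caputo_const(1)[of \<alpha> 1 x] caputo_powr(1)[OF \<alpha> x], of p "q - p"]
        caputo_const(2)[of \<alpha> 1 x] caputo_powr(2)[OF \<alpha> x] by simp_all
    moreover have "zero_mode \<alpha> c p q field_differentiable (at x)"
      using zero_mode_deriv[OF \<alpha>(1) x True] by (auto simp: field_differentiable_def)
    ultimately show ?thesis unfolding D using True by (simp add: caputo_const)
  qed
  then show "zero_mode \<alpha> c p q field_differentiable (at x)" "zero_mode_D \<alpha> c p q field_differentiable (at x)"
    "has_caputo \<alpha> (zero_mode \<alpha> c p q) x" "caputo \<alpha> (zero_mode \<alpha> c p q) x = zero_mode_D \<alpha> c p q x"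
    "has_caputo \<alpha> (zero_mode_D \<alpha> c p q) x" "caputo \<alpha> (zero_mode_D \<alpha> c p q) x = c\<^sup>2 * zero_mode \<alpha> c p q x"
    by auto
qed

text \<open>The shape required by \<open>series_solution\<close> for n = 0. As freq 0 = 0, the bound
  on the second y-derivative reduces to the conjunct 0 <= A * x powr (- \<alpha> / 2).\<close>

lemma zero_mode_bounds:
  assumes \<alpha>: "0 < \<alpha>" "\<alpha> \<le> 1" and r: "0 < r" "r < 1"
  shows "\<exists>A. \<forall>x. 0 < x \<longrightarrow> x \<le> r \<longrightarrow> 0 \<le> A * x powr (- \<alpha> / 2) \<and> c\<^sup>2 * \<bar>zero_mode \<alpha> c p q x\<bar> \<le> A * x powr (- \<alpha> / 2) \<and>
    \<bar>deriv (zero_mode \<alpha> c p q) x\<bar> \<le> A * x powr (\<alpha> / 2 - 1) \<and>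
    \<bar>zero_mode_D \<alpha> c p q x\<bar> \<le> A \<and> \<bar>deriv (zero_mode_D \<alpha> c p q) x\<bar> \<le> A * x powr (\<alpha> / 2 - 1)"
proof (cases "c = 0")
  case False
  then have c: "0 < \<bar>c\<bar>" by simp
  have D: "zero_mode_D \<alpha> c p q = modal_D \<alpha> \<bar>c\<bar> p q" using False by (simp add: zero_mode_D_def)
  obtain C where C: "\<And>\<mu> p q x. \<bar>c\<bar> \<le> \<mu> \<Longrightarrow> 0 < x \<Longrightarrow> x \<le> r \<Longrightarrow>
      \<mu>\<^sup>2 * \<bar>modal \<alpha> \<mu> p q x\<bar> \<le> C * (\<bar>q\<bar> + \<bar>p\<bar> * (1 + \<mu> powr (3/2))) * x powr (- \<alpha> / 2) \<and>
      \<bar>deriv (modal \<alpha> \<mu> p q) x\<bar> \<le> C * (\<bar>q\<bar> + \<bar>p\<bar> * (1 + \<mu> powr (3/2))) * x powr (\<alpha> / 2 - 1) \<and>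
      \<bar>modal_D \<alpha> \<mu> p q x\<bar> \<le> C * (\<bar>q\<bar> + \<bar>p\<bar> * (1 + \<mu> powr (3/2))) \<and>
      \<bar>deriv (modal_D \<alpha> \<mu> p q) x\<bar> \<le> C * (\<bar>q\<bar> + \<bar>p\<bar> * (1 + \<mu> powr (3/2))) * x powr (\<alpha> / 2 - 1)"
    using modal_bounds[OF \<alpha> c r] by blast
  have "0 \<le> C * (\<bar>q\<bar> + \<bar>p\<bar> * (1 + \<bar>c\<bar> powr (3/2))) * x powr (- \<alpha> / 2)" if "0 < x" "x \<le> r" for x
  proof -
    have "\<bar>modal_D \<alpha> \<bar>c\<bar> p q x\<bar> \<le> C * (\<bar>q\<bar> + \<bar>p\<bar> * (1 + \<bar>c\<bar> powr (3/2)))"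
      using C[of "\<bar>c\<bar>" x p q] that by blast
    then have "0 \<le> C * (\<bar>q\<bar> + \<bar>p\<bar> * (1 + \<bar>c\<bar> powr (3/2)))" by linarith
    then show ?thesis by (rule mult_nonneg_nonneg) simp
  qed
  then show ?thesis
    unfolding zero_mode_eq_modal[OF False] D using C[of "\<bar>c\<bar>" _ p q]
    by (intro exI[of _ "C * (\<bar>q\<bar> + \<bar>p\<bar> * (1 + \<bar>c\<bar> powr (3/2)))"]) auto
next
  case True
  define G where "G = Gamma (\<alpha> + 1)"
  have G: "0 < G" using \<alpha> by (simp add: G_def add_pos_pos)
  have D: "zero_mode_D \<alpha> c p q = (\<lambda>x. (q - p) * G)" using True by (simp add: zero_mode_D_def G_def)
  show ?thesis
  proof (intro exI[of _ "\<bar>q - p\<bar> * (1 + G)"] allI impI conjI)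
    fix x assume x: "0 < x" "x \<le> r"
    show "0 \<le> \<bar>q - p\<bar> * (1 + G) * x powr (- \<alpha> / 2)" "c\<^sup>2 * \<bar>zero_mode \<alpha> c p q x\<bar> \<le> \<bar>q - p\<bar> * (1 + G) * x powr (- \<alpha> / 2)"
      "\<bar>deriv (zero_mode_D \<alpha> c p q) x\<bar> \<le> \<bar>q - p\<bar> * (1 + G) * x powr (\<alpha> / 2 - 1)"
      unfolding D using G True by simp_all
    show "\<bar>zero_mode_D \<alpha> c p q x\<bar> \<le> \<bar>q - p\<bar> * (1 + G)"
      using G by (simp add: D abs_mult mult_left_mono)
    have "\<bar>deriv (zero_mode \<alpha> c p q) x\<bar> = \<bar>q - p\<bar> * (\<alpha> * x powr (\<alpha> - 1))"
      using DERIV_imp_deriv[OF zero_mode_deriv[OF \<alpha>(1) x(1) True]] \<alpha> by (simp add: abs_mult)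
    also have "\<dots> \<le> \<bar>q - p\<bar> * ((1 + G) * x powr (\<alpha> / 2 - 1))"
      using x r \<alpha> G by (intro mult_left_mono mult_mono powr_mono') auto
    finally show "\<bar>deriv (zero_mode \<alpha> c p q) x\<bar> \<le> \<bar>q - p\<bar> * (1 + G) * x powr (\<alpha> / 2 - 1)"
      by (simp add: mult_ac)
  qed
qed

text \<open>The condition |\<epsilon>| < 1 makes \<open>lam\<close> comparable with freq^2 for both
  parities, so \<open>mu\<close> stays away from 0 and its square controls two derivatives in
  y.\<close>

lemma lam_bounds:
  assumes "\<bar>\<epsilon>\<bar> < 1" "1 \<le> n"
  shows "(1 - \<bar>\<epsilon>\<bar>) * (freq n)\<^sup>2 \<le> lam \<epsilon> n" "lam \<epsilon> n \<le> 2 * (freq n)\<^sup>2"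
    and "0 < mu c \<epsilon> n" "(mu c \<epsilon> n)\<^sup>2 = lam \<epsilon> n + c\<^sup>2" "sqrt (1 - \<bar>\<epsilon>\<bar>) \<le> mu c \<epsilon> n" "mu c \<epsilon> n \<le> sqrt (2 + c\<^sup>2) * freq n"
    and "(freq n)\<^sup>2 \<le> (mu c \<epsilon> n)\<^sup>2 / (1 - \<bar>\<epsilon>\<bar>)"
proof -
  have f: "1 \<le> freq n" using freq_ge(1)[OF assms(2)] .
  then have f2: "1 \<le> (freq n)\<^sup>2" by (simp add: one_le_power)
  show l: "(1 - \<bar>\<epsilon>\<bar>) * (freq n)\<^sup>2 \<le> lam \<epsilon> n"
    unfolding lam_eq by (intro mult_right_mono) auto
  show u: "lam \<epsilon> n \<le> 2 * (freq n)\<^sup>2"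
    unfolding lam_eq using assms by (intro mult_right_mono) auto
  have e: "0 < 1 - \<bar>\<epsilon>\<bar>" using assms by simp
  have "1 - \<bar>\<epsilon>\<bar> \<le> (1 - \<bar>\<epsilon>\<bar>) * (freq n)\<^sup>2" using mult_left_mono[OF f2, of "1 - \<bar>\<epsilon>\<bar>"] e by simp
  then have le: "1 - \<bar>\<epsilon>\<bar> \<le> lam \<epsilon> n + c\<^sup>2" using l by (simp add: add_increasing2)
  then show "sqrt (1 - \<bar>\<epsilon>\<bar>) \<le> mu c \<epsilon> n" by (simp add: mu_def)
  have pos: "0 < lam \<epsilon> n + c\<^sup>2" using le e by linarith
  then show "0 < mu c \<epsilon> n" "(mu c \<epsilon> n)\<^sup>2 = lam \<epsilon> n + c\<^sup>2" by (simp_all add: mu_def)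
  have "lam \<epsilon> n + c\<^sup>2 \<le> (2 + c\<^sup>2) * (freq n)\<^sup>2"
    using u mult_left_mono[OF f2, of "c\<^sup>2"] by (simp add: algebra_simps)
  then have "mu c \<epsilon> n \<le> sqrt ((2 + c\<^sup>2) * (freq n)\<^sup>2)" unfolding mu_def by (rule real_sqrt_le_mono)
  also have "\<dots> = sqrt (2 + c\<^sup>2) * freq n" using f by (simp add: real_sqrt_mult)
  finally show "mu c \<epsilon> n \<le> sqrt (2 + c\<^sup>2) * freq n" .
  have "(1 - \<bar>\<epsilon>\<bar>) * (freq n)\<^sup>2 \<le> lam \<epsilon> n + c\<^sup>2" using l by (simp add: add_increasing2)
  then show "(freq n)\<^sup>2 \<le> (mu c \<epsilon> n)\<^sup>2 / (1 - \<bar>\<epsilon>\<bar>)"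
    using e \<open>(mu c \<epsilon> n)\<^sup>2 = lam \<epsilon> n + c\<^sup>2\<close> by (simp add: pos_le_divide_eq mult.commute)
qed

section \<open>Assembly of the series solution\<close>

lemma suminf_split_parity:
  fixes f :: "nat \<Rightarrow> real"
  assumes "summable (\<lambda>n. \<bar>f n\<bar>)"
  shows "summable (\<lambda>k. f (2 * (k + 1)))" "summable (\<lambda>k. f (2 * (k + 1) - 1))"
    and "suminf f = f 0 + (\<Sum>k. f (2 * (k + 1))) + (\<Sum>k. f (2 * (k + 1) - 1))"
proof -
  have sf: "summable f" using assms by (rule summable_rabs_cancel)
  define e o' where "e n = (if even n then f n else 0)" and "o' n = (if odd n then f n else 0)" for n
  have se: "summable e" by (rule summable_comparison_test'[OF assms]) (auto simp: e_def)
  have so: "summable o'" by (rule summable_comparison_test'[OF assms]) (auto simp: o'_def)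
  have m1: "strict_mono (\<lambda>k::nat. 2 * k)" and m2: "strict_mono (\<lambda>k::nat. 2 * k + 1)" by (auto simp: strict_mono_def)
  have "e n = 0" if "n \<notin> range (\<lambda>k::nat. 2 * k)" for n
    using that by (auto simp: e_def elim!: evenE)
  then have e: "(\<lambda>k. e (2 * k)) sums suminf e"
    using sums_mono_reindex[where f = e, OF m1] summable_sums[OF se] by blast
  have "o' n = 0" if "n \<notin> range (\<lambda>k::nat. 2 * k + 1)" for n
    using that by (auto simp: o'_def elim!: oddE)
  then have o: "(\<lambda>k. o' (2 * k + 1)) sums suminf o'"
    using sums_mono_reindex[where f = o', OF m2] summable_sums[OF so] by blast
  have e1: "(\<lambda>k. f (2 * k)) sums suminf e" using e by (simp add: e_def)
  have o1: "(\<lambda>k. f (2 * (k + 1) - 1)) sums suminf o'" using o by (simp add: o'_def)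
  show "summable (\<lambda>k. f (2 * (k + 1) - 1))" using o1 by (rule sums_summable)
  have e2: "(\<lambda>k. f (2 * (k + 1))) sums (suminf e - f 0)"
    using e1 by (subst (asm) sums_Suc_iff[symmetric, of "\<lambda>k. f (2 * k)" "suminf e - f 0", simplified]) simp
  then show "summable (\<lambda>k. f (2 * (k + 1)))" by (rule sums_summable)
  have "suminf f = suminf (\<lambda>n. e n + o' n)" by (intro suminf_cong) (auto simp: e_def o'_def)
  also have "\<dots> = suminf e + suminf o'" by (rule suminf_add[symmetric, OF se so])
  finally show "suminf f = f 0 + (\<Sum>k. f (2 * (k + 1))) + (\<Sum>k. f (2 * (k + 1) - 1))"
    using sums_unique[OF e2] sums_unique[OF o1] by simp
qed

lemma existence:
  fixes \<phi> \<psi> :: "real \<Rightarrow> real"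
  assumes \<alpha>: "0 < \<alpha>" "\<alpha> \<le> 1" and \<epsilon>: "\<bar>\<epsilon>\<bar> < 1" and \<delta>: "0 < \<delta>" "\<delta> < 1"
    and h: "holder_space 3 \<delta> {-pi..pi} \<phi>" "holder_space 2 \<delta> {-pi..pi} \<psi>"
    and per\<phi>: "\<phi> (-pi) = \<phi> pi" "deriv_on {-pi..pi} \<phi> (-pi) = deriv_on {-pi..pi} \<phi> pi"
    and per\<psi>: "\<psi> (-pi) = \<psi> pi" "deriv_on {-pi..pi} \<psi> (-pi) = deriv_on {-pi..pi} \<psi> pi"
  obtains u where "bvp_solution \<alpha> c \<epsilon> \<phi> \<psi> u"
    "\<forall>(x, y)\<in>Omega_bar.
        summable (\<lambda>k. mode \<alpha> c \<epsilon> \<phi> \<psi> (2 * (k + 1)) x y) \<and>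
        summable (\<lambda>k. mode \<alpha> c \<epsilon> \<phi> \<psi> (2 * (k + 1) - 1) x y) \<and>
        u x y = zero_mode \<alpha> c (fourier_coeff \<phi> 0) (fourier_coeff \<psi> 0) x
          + (\<Sum>k. mode \<alpha> c \<epsilon> \<phi> \<psi> (2 * (k + 1)) x y)
          + (\<Sum>k. mode \<alpha> c \<epsilon> \<phi> \<psi> (2 * (k + 1) - 1) x y)"
proof -
  define p q where "p = fourier_coeff \<phi>" and "q = fourier_coeff \<psi>"
  obtain Cp where Cp: "\<And>n. 1 \<le> n \<Longrightarrow> \<bar>p n\<bar> \<le> Cp * freq n powr (-3)"
    using fourier_coeff_C3_bound[OF h(1) \<delta>(1) per\<phi>] unfolding p_def by blast
  obtain Cq where Cq: "\<And>n. 1 \<le> n \<Longrightarrow> \<bar>q n\<bar> \<le> Cq * freq n powr (-2 - \<delta>)"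
    using fourier_coeff_C2_bound[OF h(2) \<delta> per\<psi>] unfolding q_def by blast
  define X where "X n = (if n = 0 then zero_mode \<alpha> c (p 0) (q 0) else modal \<alpha> (mu c \<epsilon> n) (p n) (q n))" for n
  define P where "P n = (if n = 0 then zero_mode_D \<alpha> c (p 0) (q 0) else modal_D \<alpha> (mu c \<epsilon> n) (p n) (q n))" for n
  define B where "B n = 2 * \<bar>p n\<bar> + \<bar>q n\<bar>" for n
  have mu: "0 < mu c \<epsilon> n" "(mu c \<epsilon> n)\<^sup>2 = lam \<epsilon> n + c\<^sup>2" if "n \<noteq> 0" for n
    using lam_bounds(3,4)[OF \<epsilon>, of n c] that by auto
  have lam0: "lam \<epsilon> 0 = 0" by (simp add: lam_def)
  \<comment> \<open>The weight 3/2 is the one demanded by \<open>modal_bounds\<close>; up to it the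
    exponent s - 3 stays below -1.\<close>
  have sp: "summable (\<lambda>n. \<bar>p n\<bar> * freq n powr s)" if "s \<le> 3/2" for s
  proof (rule summable_comparison_test'[of _ 1])
    show "summable (\<lambda>n. Cp * freq n powr (s - 3))" using that by (intro summable_mult summable_freq_powr) auto
    fix n :: nat assume n: "1 \<le> n"
    have "\<bar>p n\<bar> * freq n powr s \<le> Cp * freq n powr (-3) * freq n powr s"
      by (intro mult_right_mono Cp n) auto
    then show "norm (\<bar>p n\<bar> * freq n powr s) \<le> Cp * freq n powr (s - 3)"
      by (simp add: mult.assoc powr_add[symmetric] abs_mult)
  qed
  have sq: "summable (\<lambda>n. \<bar>q n\<bar> * freq n powr s)" if "s \<le> 1" for s
  proof (rule summable_comparison_test'[of _ 1])
    show "summable (\<lambda>n. Cq * freq n powr (-2 - \<delta> + s))" using that \<delta> by (intro summable_mult summable_freq_powr) auto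
    fix n :: nat assume n: "1 \<le> n"
    have "\<bar>q n\<bar> * freq n powr s \<le> Cq * freq n powr (-2 - \<delta>) * freq n powr s"
      by (intro mult_right_mono Cq n) auto
    then show "norm (\<bar>q n\<bar> * freq n powr s) \<le> Cq * freq n powr (-2 - \<delta> + s)"
      by (simp add: mult.assoc powr_add[symmetric] abs_mult)
  qed
  \<comment> \<open>As freq 0 = 0 and 0 powr 0 = 0, the weight freq n powr 0 is 1 except at n = 0,
    where it deletes the term.\<close>
  have drop0: "summable f" if "summable (\<lambda>n. f n * freq n powr 0)" for f
  proof -
    have "summable (\<lambda>n. f (Suc n) * freq (Suc n) powr 0)" using that by (subst summable_Suc_iff)
    moreover have "freq (Suc n) powr 0 = 1" for n using freq_ge(1)[of "Suc n"] by simp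
    ultimately have "summable (\<lambda>n. f (Suc n))" by simp
    then show ?thesis by (subst (asm) summable_Suc_iff)
  qed
  have spq: "summable (\<lambda>n. \<bar>p n\<bar>)" "summable (\<lambda>n. \<bar>q n\<bar>)"
    using sp[of 0] sq[of 0] by (auto intro: drop0)
  have B: "summable B" "summable (\<lambda>n. freq n * B n)"
  proof -
    show "summable B" unfolding B_def by (intro summable_add summable_mult spq)
    have "summable (\<lambda>n. 2 * (\<bar>p n\<bar> * freq n powr 1) + \<bar>q n\<bar> * freq n powr 1)"
      by (intro summable_add summable_mult sp sq) auto
    then show "summable (\<lambda>n. freq n * B n)" by (simp add: B_def freq_ge(3) algebra_simps)
  qed
  have X0: "X n 0 = p n" "X n 1 = q n" "continuous_on {0..1} (X n)" for n
    using modal_boundary[OF \<alpha> mu(1)] zero_mode_boundary[OF \<alpha>] by (auto simp: X_def)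
  have XB: "\<bar>X n x\<bar> \<le> B n" if "0 \<le> x" "x \<le> 1" for n x
    using modal_boundary(4)[OF \<alpha> mu(1)] zero_mode_boundary(4)[OF \<alpha>] that by (auto simp: X_def B_def)
  have fd: "f field_differentiable (at x)" if "(f has_field_derivative d) (at x)" for f :: "real \<Rightarrow> real" and d x
    using that by (auto simp: field_differentiable_def)
  have bounds: "\<exists>A. summable A \<and> (\<forall>n x. 0 < x \<longrightarrow> x \<le> r \<longrightarrow>
        (freq n)\<^sup>2 * \<bar>X n x\<bar> \<le> A n * x powr (- \<alpha> / 2) \<and> \<bar>lam \<epsilon> n + c\<^sup>2\<bar> * \<bar>X n x\<bar> \<le> A n * x powr (- \<alpha> / 2) \<and>
        \<bar>deriv (X n) x\<bar> \<le> A n * x powr (\<alpha> / 2 - 1) \<and>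
        \<bar>P n x\<bar> \<le> A n \<and> \<bar>deriv (P n) x\<bar> \<le> A n * x powr (\<alpha> / 2 - 1))" if r: "0 < r" "r < 1" for r
  proof -
    obtain A0 where A0: "\<forall>x. 0 < x \<longrightarrow> x \<le> r \<longrightarrow> 0 \<le> A0 * x powr (- \<alpha> / 2) \<and> c\<^sup>2 * \<bar>X 0 x\<bar> \<le> A0 * x powr (- \<alpha> / 2) \<and>
        \<bar>deriv (X 0) x\<bar> \<le> A0 * x powr (\<alpha> / 2 - 1) \<and> \<bar>P 0 x\<bar> \<le> A0 \<and> \<bar>deriv (P 0) x\<bar> \<le> A0 * x powr (\<alpha> / 2 - 1)"
      using zero_mode_bounds[OF \<alpha> r, of c "p 0" "q 0"] by (auto simp: X_def P_def)
    have m: "0 < sqrt (1 - \<bar>\<epsilon>\<bar>)" using \<epsilon> by simp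
    obtain C where C: "\<And>\<mu> p q x. sqrt (1 - \<bar>\<epsilon>\<bar>) \<le> \<mu> \<Longrightarrow> 0 < x \<Longrightarrow> x \<le> r \<Longrightarrow>
      \<mu>\<^sup>2 * \<bar>modal \<alpha> \<mu> p q x\<bar> \<le> C * (\<bar>q\<bar> + \<bar>p\<bar> * (1 + \<mu> powr (3/2))) * x powr (- \<alpha> / 2) \<and>
      \<bar>deriv (modal \<alpha> \<mu> p q) x\<bar> \<le> C * (\<bar>q\<bar> + \<bar>p\<bar> * (1 + \<mu> powr (3/2))) * x powr (\<alpha> / 2 - 1) \<and>
      \<bar>modal_D \<alpha> \<mu> p q x\<bar> \<le> C * (\<bar>q\<bar> + \<bar>p\<bar> * (1 + \<mu> powr (3/2))) \<and>
      \<bar>deriv (modal_D \<alpha> \<mu> p q) x\<bar> \<le> C * (\<bar>q\<bar> + \<bar>p\<bar> * (1 + \<mu> powr (3/2))) * x powr (\<alpha> / 2 - 1)"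
      using modal_bounds[OF \<alpha> m r] by blast
    define D where "D n = C * (\<bar>q n\<bar> + \<bar>p n\<bar> * (1 + mu c \<epsilon> n powr (3/2)))" for n
    define e where "e = 1 - \<bar>\<epsilon>\<bar>"
    have e: "0 < e" "e \<le> 1" using \<epsilon> by (auto simp: e_def)
    \<comment> \<open>Division by e = 1 - |\<epsilon>| pays for the step from \<mu>^2 to freq^2;
      since e <= 1, the other bounds are only weakened.\<close>
    define A where "A n = (if n = 0 then A0 else D n / e)" for n
    have mu32: "mu c \<epsilon> n powr (3/2) \<le> sqrt (2 + c\<^sup>2) powr (3/2) * freq n powr (3/2)" if "1 \<le> n" for n
    proof -
      have "mu c \<epsilon> n powr (3/2) \<le> (sqrt (2 + c\<^sup>2) * freq n) powr (3/2)"
        using lam_bounds(3,6)[OF \<epsilon> that, of c] by (intro powr_mono2) auto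
      then show ?thesis using freq_ge(3)[of n] by (simp add: powr_mult)
    qed
    have D0: "0 \<le> D n" if "n \<noteq> 0" for n
    proof -
      have "\<bar>modal_D \<alpha> (mu c \<epsilon> n) (p n) (q n) r\<bar> \<le> D n"
        unfolding D_def using C[of "mu c \<epsilon> n" r "p n" "q n"] lam_bounds(5)[OF \<epsilon>, of n c] that r by auto
      then show ?thesis by linarith
    qed
    have "summable D"
      unfolding D_def
    proof (intro summable_mult summable_add spq)
      show "summable (\<lambda>n. \<bar>p n\<bar> * (1 + mu c \<epsilon> n powr (3/2)))"
      proof (rule summable_comparison_test'[of _ 1])
        show "summable (\<lambda>n. \<bar>p n\<bar> + sqrt (2 + c\<^sup>2) powr (3/2) * (\<bar>p n\<bar> * freq n powr (3/2)))"
          by (intro summable_add summable_mult spq sp) auto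
        fix n :: nat assume n: "1 \<le> n"
        have "0 \<le> 1 + mu c \<epsilon> n powr (3/2)" by (simp add: add_nonneg_nonneg)
        then show "norm (\<bar>p n\<bar> * (1 + mu c \<epsilon> n powr (3/2))) \<le> \<bar>p n\<bar> + sqrt (2 + c\<^sup>2) powr (3/2) * (\<bar>p n\<bar> * freq n powr (3/2))"
          using mult_left_mono[OF mu32[OF n], of "\<bar>p n\<bar>"] by (simp add: abs_mult algebra_simps)
      qed
    qed
    then have "summable (\<lambda>n. D n / e)" by (rule summable_divide)
    then have "summable (\<lambda>n. D (Suc n) / e)" by (subst summable_Suc_iff)
    then have "summable (\<lambda>n. A (Suc n))" by (simp add: A_def)
    then have sA: "summable A" by (subst (asm) summable_Suc_iff)
    have D1: "D n \<le> D n / e" if "n \<noteq> 0" for n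
      using D0[OF that] e mult_left_mono[of e 1 "D n"] by (simp add: pos_le_divide_eq)
    have "(freq n)\<^sup>2 * \<bar>X n x\<bar> \<le> A n * x powr (- \<alpha> / 2) \<and> \<bar>lam \<epsilon> n + c\<^sup>2\<bar> * \<bar>X n x\<bar> \<le> A n * x powr (- \<alpha> / 2) \<and>
        \<bar>deriv (X n) x\<bar> \<le> A n * x powr (\<alpha> / 2 - 1) \<and> \<bar>P n x\<bar> \<le> A n \<and> \<bar>deriv (P n) x\<bar> \<le> A n * x powr (\<alpha> / 2 - 1)"
      if x: "0 < x" "x \<le> r" for n x
    proof (cases "n = 0")
      case True
      then show ?thesis using A0 x by (simp add: A_def lam0)
    next
      case False
      then have n: "1 \<le> n" by simp
      have Xn: "X n = modal \<alpha> (mu c \<epsilon> n) (p n) (q n)" "P n = modal_D \<alpha> (mu c \<epsilon> n) (p n) (q n)" "A n = D n / e"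
        using False by (simp_all add: X_def P_def A_def)
      have c4: "(mu c \<epsilon> n)\<^sup>2 * \<bar>X n x\<bar> \<le> D n * x powr (- \<alpha> / 2)" "\<bar>deriv (X n) x\<bar> \<le> D n * x powr (\<alpha> / 2 - 1)"
         "\<bar>P n x\<bar> \<le> D n" "\<bar>deriv (P n) x\<bar> \<le> D n * x powr (\<alpha> / 2 - 1)"
        unfolding Xn D_def using C[of "mu c \<epsilon> n" x "p n" "q n"] lam_bounds(5)[OF \<epsilon> n, of c] x by blast+
      have up: "D n * x powr s \<le> A n * x powr s" for s
        unfolding Xn using D1[OF False] by (intro mult_right_mono) auto
      have "(freq n)\<^sup>2 * \<bar>X n x\<bar> \<le> (mu c \<epsilon> n)\<^sup>2 / e * \<bar>X n x\<bar>"
        using lam_bounds(7)[OF \<epsilon> n, of c] unfolding e_def by (intro mult_right_mono) auto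
      also have "\<dots> = ((mu c \<epsilon> n)\<^sup>2 * \<bar>X n x\<bar>) / e" by simp
      also have "\<dots> \<le> (D n * x powr (- \<alpha> / 2)) / e" using c4(1) e by (intro divide_right_mono) auto
      finally have "(freq n)\<^sup>2 * \<bar>X n x\<bar> \<le> A n * x powr (- \<alpha> / 2)" by (simp add: Xn(3))
      moreover have "\<bar>lam \<epsilon> n + c\<^sup>2\<bar> * \<bar>X n x\<bar> \<le> A n * x powr (- \<alpha> / 2)"
        using c4(1) up[of "- \<alpha> / 2"] unfolding mu(2)[OF False, symmetric] by simp
      ultimately show ?thesis
        using c4(2-4) up[of "\<alpha> / 2 - 1"] D1[OF False] unfolding Xn(3) by linarith
    qed
    then show ?thesis using sA by blast
  qed
  define u where "u x y = (\<Sum>n. X n x * Y n y)" for x y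
  have c\<phi>: "continuous_on {-pi..pi} \<phi>" and c\<psi>: "continuous_on {-pi..pi} \<psi>"
    using holder_space_derivs(2)[OF h(1) \<delta>(1), of 0] holder_space_derivs(2)[OF h(2) \<delta>(1), of 0] by simp_all
  have "bvp_solution \<alpha> c \<epsilon> \<phi> \<psi> (\<lambda>x y. \<Sum>n. X n x * Y n y)"
  proof (rule series_solution[OF \<alpha> B XB X0(3), where P = P])
    show "X n field_differentiable (at x)" "P n field_differentiable (at x)" "has_caputo \<alpha> (X n) x"
      "caputo \<alpha> (X n) x = P n x" "has_caputo \<alpha> (P n) x" "caputo \<alpha> (P n) x = (lam \<epsilon> n + c\<^sup>2) * X n x" if x: "0 < x" for n x
      using zero_mode_caputo[OF \<alpha> x, of c "p 0" "q 0"] modal_caputo[OF \<alpha> mu(1) x, of n "p n" "q n"] mu(2)[of n]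
      by (auto simp: X_def P_def lam0 intro: fd)
    show "\<phi> y = (\<Sum>n. X n 0 * Y n y)" if "y \<in> {-pi..pi}" for y
      using fourier_series[OF c\<phi> per\<phi>(1) _ that] spq(1) by (simp add: X0 p_def)
    show "\<psi> y = (\<Sum>n. X n 1 * Y n y)" if "y \<in> {-pi..pi}" for y
      using fourier_series[OF c\<psi> per\<psi>(1) _ that] spq(2) by (simp add: X0 q_def)
  qed (use bounds in auto)
  then have "bvp_solution \<alpha> c \<epsilon> \<phi> \<psi> u" by (simp add: u_def[abs_def])
  moreover have "summable (\<lambda>k. mode \<alpha> c \<epsilon> \<phi> \<psi> (2 * (k + 1)) x y) \<and>
        summable (\<lambda>k. mode \<alpha> c \<epsilon> \<phi> \<psi> (2 * (k + 1) - 1) x y) \<and>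
        u x y = zero_mode \<alpha> c (fourier_coeff \<phi> 0) (fourier_coeff \<psi> 0) x
          + (\<Sum>k. mode \<alpha> c \<epsilon> \<phi> \<psi> (2 * (k + 1)) x y)
          + (\<Sum>k. mode \<alpha> c \<epsilon> \<phi> \<psi> (2 * (k + 1) - 1) x y)" if xy: "(x, y) \<in> Omega_bar" for x y
  proof -
    have x: "0 \<le> x" "x \<le> 1" using xy by (auto simp: Omega_bar_def)
    have s: "summable (\<lambda>n. \<bar>X n x * Y n y\<bar>)"
    proof (rule summable_comparison_test'[OF B(1)])
      fix n
      have "\<bar>X n x\<bar> * \<bar>Y n y\<bar> \<le> B n * 1"
        using XB[OF x, of n] Y_abs_le[of n y] order_trans[OF abs_ge_zero XB[OF x, of n]] by (intro mult_mono) auto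
      then show "norm \<bar>X n x * Y n y\<bar> \<le> B n" by (simp add: abs_mult)
    qed
    have m: "X n x * Y n y = mode \<alpha> c \<epsilon> \<phi> \<psi> n x y" if "n \<noteq> 0" for n
      using that by (simp add: X_def mode_def modal_def p_def q_def)
    have "X 0 x * Y 0 y = zero_mode \<alpha> c (fourier_coeff \<phi> 0) (fourier_coeff \<psi> 0) x"
      by (simp add: X_def Y_def p_def q_def)
    then show ?thesis
      using suminf_split_parity[OF s] by (simp add: m u_def)
  qed
  ultimately show ?thesis by (intro that[of u]) blast+
qed

section \<open>Fractional integrals\<close>

text \<open>For \<open>\<beta> > 0\<close> the Riemann--Liouville integral; the value at \<open>\<beta> = 0\<close> makes \<open>frac_int (2 - 2 * \<alpha>)\<close>
  meaningful for all \<open>\<alpha> \<le> 1\<close>.\<close>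

definition frac_int :: "real \<Rightarrow> (real \<Rightarrow> real) \<Rightarrow> real \<Rightarrow> real" where
  "frac_int \<beta> f x = (if \<beta> = 0 then f x
     else 1 / Gamma \<beta> * (LINT s:{0<..<x}|lborel. (x - s) powr (\<beta> - 1) * f s))"

lemma frac_int_cong:
  assumes "\<And>s. s \<in> {0<..<x} \<Longrightarrow> f s = g s" "\<beta> \<noteq> 0"
  shows "frac_int \<beta> f x = frac_int \<beta> g x"
proof -
  have "(LINT s:{0<..<x}|lborel. (x - s) powr (\<beta> - 1) * f s) = (LINT s:{0<..<x}|lborel. (x - s) powr (\<beta> - 1) * g s)"
    using assms(1) by (intro set_lebesgue_integral_cong) auto
  then show ?thesis using assms(2) by (simp add: frac_int_def)
qed

lemma Beta_kernel_shift:
  fixes b d x r :: real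
  assumes "0 < b" "0 < d" "r < x"
  shows "integrable lborel (\<lambda>s. indicator {r<..<x} s * ((x - s) powr (b - 1) * (s - r) powr (d - 1)))"
    and "(\<integral>s. indicator {r<..<x} s * ((x - s) powr (b - 1) * (s - r) powr (d - 1)) \<partial>lborel) = Beta b d * (x - r) powr (b + d - 1)"
proof -
  let ?f = "\<lambda>s. indicator {r<..<x} s * ((x - s) powr (b - 1) * (s - r) powr (d - 1))"
  have e: "?f (r + 1 * s) = indicator {0<..<x - r} s * ((x - r - s) powr (b - 1) * s powr (d - 1))" for s
    by (auto simp: indicator_def algebra_simps)
  note B = Beta_kernel[of b d "x - r"]
  have i: "integrable lborel (\<lambda>s. ?f (r + 1 * s))"
    unfolding e using B(1) assms by (simp add: set_integrable_def)
  then show "integrable lborel ?f"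
    using lborel_integrable_real_affine_iff[of 1 ?f r] by simp
  have "(\<integral>s. ?f s \<partial>lborel) = (\<integral>s. ?f (r + 1 * s) \<partial>lborel)"
    using lborel_integral_real_affine[of 1 ?f r] by simp
  also have "\<dots> = Beta b d * (x - r) powr (b + d - 1)"
    unfolding e using B(2) assms by (simp add: set_lebesgue_integral_def)
  finally show "(\<integral>s. ?f s \<partial>lborel) = Beta b d * (x - r) powr (b + d - 1)" .
qed

text \<open>Fubini on the triangle 0 < r < s < x, where the integral over s is
  \<open>Beta a b * (x - r) powr (a + b - 1)\<close>. Integrability of f is asked only against this
  resulting kernel, because the same computation for |f| evaluates the double integral of the
  absolute value.\<close>

lemma frac_int_semigroup:
  fixes a b x :: real
  assumes ab: "0 < a" "0 < b"
    and f: "set_integrable lborel {0<..<x} (\<lambda>s. (x - s) powr (a + b - 1) * f s)"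
  shows "set_integrable lborel {0<..<x} (\<lambda>s. (x - s) powr (a - 1) * frac_int b f s)"
    and "frac_int a (frac_int b f) x = frac_int (a + b) f x"
proof -
  have Gn: "Gamma a \<noteq> 0" "Gamma b \<noteq> 0" "Gamma (a + b) \<noteq> 0"
    using Gamma_real_pos[of a] Gamma_real_pos[of b] Gamma_real_pos[of "a + b"] ab by linarith+
  define F where "F r = indicator {0<..<x} r * f r" for r
  have fm: "(\<lambda>r. indicator {0<..<x} r * ((x - r) powr (a + b - 1) * f r)) \<in> borel_measurable lborel"
    using borel_measurable_integrable[OF f[unfolded set_integrable_def]] by simp
  \<comment> \<open>Measurability of f on (0, x) is recovered by dividing out the positive
    kernel.\<close>
  have "(\<lambda>r. (x - r) powr (1 - a - b) * (indicator {0<..<x} r * ((x - r) powr (a + b - 1) * f r))) \<in> borel_measurable lborel"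
    by (rule borel_measurable_times[OF _ fm]) measurable
  moreover have "(x - r) powr (1 - a - b) * (indicator {0<..<x} r * ((x - r) powr (a + b - 1) * f r)) = F r" for r
  proof (cases "r \<in> {0<..<x}")
    case True
    then have "(x - r) powr (1 - a - b) * (x - r) powr (a + b - 1) = 1"
      by (subst powr_add[symmetric]) simp
    then show ?thesis using True by (simp add: F_def)
  qed (simp add: F_def)
  ultimately have Fm [measurable]: "F \<in> borel_measurable lborel" by simp
  define k where "k r s = indicator {r<..<x} s * ((x - s) powr (a - 1) * (s - r) powr (b - 1))" for r s :: real
  define h where "h = (\<lambda>(r, s). F r * k r s)"
  have k0: "0 \<le> k r s" for r s by (simp add: k_def)
  have kB: "integrable lborel (k r)" "(\<integral>s. k r s \<partial>lborel) = Beta a b * (x - r) powr (a + b - 1)" if "r < x" for r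
    unfolding k_def using Beta_kernel_shift[OF ab that] by auto
  have km: "(\<lambda>(r, s). k r s) \<in> borel_measurable (lborel \<Otimes>\<^sub>M lborel)"
  proof -
    have "(\<lambda>p. (if fst p < snd p \<and> snd p < x then (x - snd p) powr (a - 1) * (snd p - fst p) powr (b - 1) else 0 :: real))
        \<in> borel_measurable (lborel \<Otimes>\<^sub>M lborel)" by measurable
    moreover have "(\<lambda>(r, s). k r s) = (\<lambda>p. if fst p < snd p \<and> snd p < x then (x - snd p) powr (a - 1) * (snd p - fst p) powr (b - 1) else 0)"
      by (auto simp: k_def indicator_def)
    ultimately show ?thesis by simp
  qed
  have hm: "h \<in> borel_measurable (lborel \<Otimes>\<^sub>M lborel)"
  proof -
    have "h = (\<lambda>p. F (fst p) * (\<lambda>(r, s). k r s) p)" by (auto simp: h_def)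
    moreover have "(\<lambda>p. F (fst p)) \<in> borel_measurable (lborel \<Otimes>\<^sub>M lborel)" by measurable
    ultimately show ?thesis using km by simp
  qed
  have Fz: "F r = 0" if "\<not> r < x" for r using that by (simp add: F_def)
  have hn: "(\<integral>s. norm (h (r, s)) \<partial>lborel) = Beta a b * norm (indicator {0<..<x} r *\<^sub>R ((x - r) powr (a + b - 1) * f r))" for r
  proof (cases "r \<in> {0<..<x}")
    case True
    have "(\<integral>s. norm (h (r, s)) \<partial>lborel) = \<bar>F r\<bar> * (\<integral>s. k r s \<partial>lborel)"
      using k0 by (simp add: h_def abs_mult)
    then show ?thesis using True kB(2)[of r] by (simp add: F_def abs_mult mult_ac)
  qed (simp add: h_def F_def)
  have hI: "integrable (lborel \<Otimes>\<^sub>M lborel) h"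
  proof (rule lborel_pair.Fubini_integrable[OF hm])
    show "integrable lborel (\<lambda>r. \<integral>s. norm (h (r, s)) \<partial>lborel)"
      unfolding hn using f by (intro integrable_mult_right integrable_norm) (simp add: set_integrable_def)
    show "AE r in lborel. integrable lborel (\<lambda>s. h (r, s))"
    proof (rule AE_I2)
      fix r show "integrable lborel (\<lambda>s. h (r, s))"
        using kB(1)[of r] Fz[of r] by (cases "r < x") (simp_all add: h_def)
    qed
  qed
  have inner: "(\<integral>r. h (r, s) \<partial>lborel) = Gamma b * (indicator {0<..<x} s *\<^sub>R ((x - s) powr (a - 1) * frac_int b f s))" for s
  proof (cases "s \<in> {0<..<x}")
    case True
    have "(\<integral>r. h (r, s) \<partial>lborel) = (\<integral>r. (x - s) powr (a - 1) * (indicator {0<..<s} r *\<^sub>R ((s - r) powr (b - 1) * f r)) \<partial>lborel)"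
      using True by (intro Bochner_Integration.integral_cong) (auto simp: h_def F_def k_def indicator_def)
    also have "\<dots> = (x - s) powr (a - 1) * (LINT r:{0<..<s}|lborel. (s - r) powr (b - 1) * f r)"
      by (simp add: set_lebesgue_integral_def)
    also have "(LINT r:{0<..<s}|lborel. (s - r) powr (b - 1) * f r) = Gamma b * frac_int b f s"
      using ab Gn by (simp add: frac_int_def)
    finally show ?thesis using True by simp
  next
    case False
    then have "h (r, s) = 0" for r by (auto simp: h_def F_def k_def indicator_def)
    then show ?thesis using False by simp
  qed
  have outer: "(\<integral>s. h (r, s) \<partial>lborel) = Beta a b * (indicator {0<..<x} r *\<^sub>R ((x - r) powr (a + b - 1) * f r))" for r
    using kB(2)[of r] by (cases "r \<in> {0<..<x}") (auto simp: h_def F_def)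
  have "integrable lborel (\<lambda>s. \<integral>r. h (r, s) \<partial>lborel)"
    using lborel_pair.integrable_snd[of "\<lambda>r s. h (r, s)"] hI by simp
  then have i1: "integrable lborel (\<lambda>s. Gamma b * (indicator {0<..<x} s *\<^sub>R ((x - s) powr (a - 1) * frac_int b f s)))"
    unfolding inner .
  then show "set_integrable lborel {0<..<x} (\<lambda>s. (x - s) powr (a - 1) * frac_int b f s)"
    using Gn by (simp add: set_integrable_def)
  have "(\<integral>s. (\<integral>r. h (r, s) \<partial>lborel) \<partial>lborel) = (\<integral>r. (\<integral>s. h (r, s) \<partial>lborel) \<partial>lborel)"
    using lborel_pair.Fubini_integral[of "\<lambda>r s. h (r, s)"] hI by simp
  then have "Gamma b * (LINT s:{0<..<x}|lborel. (x - s) powr (a - 1) * frac_int b f s) =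
      Beta a b * (LINT r:{0<..<x}|lborel. (x - r) powr (a + b - 1) * f r)"
    unfolding inner outer by (simp only: set_lebesgue_integral_def integral_mult_right_zero)
  then show "frac_int a (frac_int b f) x = frac_int (a + b) f x"
    using ab Gn by (simp add: frac_int_def[of a] frac_int_def[of "a + b"] Beta_def field_simps)
qed

lemma set_integrable_kernel_mult:
  fixes f :: "real \<Rightarrow> real"
  assumes f: "set_integrable lborel {0<..<x} f" and \<beta>: "0 \<le> \<beta>"
  shows "set_integrable lborel {0<..<x} (\<lambda>s. (x - s) powr \<beta> * f s)"
proof (rule set_integrable_bound)
  show "set_integrable lborel {0<..<x} (\<lambda>s. x powr \<beta> * f s)" using f by simp
  have fm: "(\<lambda>s. indicator {0<..<x} s * f s) \<in> borel_measurable lborel"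
    using borel_measurable_integrable[OF f[unfolded set_integrable_def]] by simp
  have "(\<lambda>s. (x - s) powr \<beta> * (indicator {0<..<x} s * f s)) \<in> borel_measurable lborel"
    by (rule borel_measurable_times[OF _ fm]) measurable
  then show "set_borel_measurable lborel {0<..<x} (\<lambda>s. (x - s) powr \<beta> * f s)"
    by (simp add: set_borel_measurable_def mult_ac)
  have "norm ((x - s) powr \<beta> * f s) \<le> norm (x powr \<beta> * f s)" if "s \<in> {0<..<x}" for s
    unfolding norm_mult using that \<beta> by (intro mult_right_mono) (auto intro!: powr_mono2)
  then show "AE s in lborel. s \<in> {0<..<x} \<longrightarrow> norm ((x - s) powr \<beta> * f s) \<le> norm (x powr \<beta> * f s)"
    by auto
qed

text \<open>Leads from integrability against the singular Caputo kernel to integrability of the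
  derivative itself, by multiplication with a bounded power.\<close>

lemma set_integrable_kernel_cancel:
  fixes f :: "real \<Rightarrow> real"
  assumes f: "set_integrable lborel {0<..<x} (\<lambda>s. (x - s) powr (- \<beta>) * f s)" and \<beta>: "0 \<le> \<beta>"
  shows "set_integrable lborel {0<..<x} f"
proof -
  have "set_integrable lborel {0<..<x} (\<lambda>s. (x - s) powr \<beta> * ((x - s) powr (- \<beta>) * f s))"
    by (rule set_integrable_kernel_mult[OF f \<beta>])
  also have "?this \<longleftrightarrow> set_integrable lborel {0<..<x} f"
  proof (rule set_integrable_cong)
    fix s assume s: "s \<in> {0<..<x}"
    have "(x - s) powr \<beta> * (x - s) powr (- \<beta>) = 1" using s by (subst powr_add[symmetric]) simp
    then show "(x - s) powr \<beta> * ((x - s) powr (- \<beta>) * f s) = f s" by (simp add: mult.assoc[symmetric])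
  qed auto
  finally show ?thesis .
qed

lemma frac_int_1: "frac_int 1 f x = (LINT s:{0<..<x}|lborel. f s)"
proof -
  have "(LINT s:{0<..<x}|lborel. (x - s) powr (1 - 1) * f s) = (LINT s:{0<..<x}|lborel. f s)"
    by (intro set_lebesgue_integral_cong) auto
  then show ?thesis by (simp add: frac_int_def)
qed

lemma frac_int_1_integral:
  fixes f :: "real \<Rightarrow> real"
  assumes "set_integrable lborel {0<..<x} f"
  shows "f integrable_on {0..x}" "frac_int 1 f x = integral {0..x} f"
proof -
  note * = set_borel_integral_eq_integral[OF assms]
  show "f integrable_on {0..x}" using *(1) by (simp add: integrable_on_Icc_iff_Ioo)
  show "frac_int 1 f x = integral {0..x} f" unfolding frac_int_1 *(2) by (simp add: integral_open_interval_real)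
qed

lemma frac_int_const:
  assumes "0 < \<beta>" "0 < x"
  shows "set_integrable lborel {0<..<x} (\<lambda>s. (x - s) powr (\<beta> - 1) * k)"
    and "frac_int \<beta> (\<lambda>s. k) x = k * x powr \<beta> / Gamma (\<beta> + 1)"
proof -
  note B = Beta_kernel[of \<beta> 1 x]
  have "set_integrable lborel {0<..<x} (\<lambda>s. (x - s) powr (\<beta> - 1) * s powr (1 - 1)) \<longleftrightarrow>
     set_integrable lborel {0<..<x} (\<lambda>s. (x - s) powr (\<beta> - 1))"
    by (intro set_integrable_cong) auto
  then show si: "set_integrable lborel {0<..<x} (\<lambda>s. (x - s) powr (\<beta> - 1) * k)"
    using B(1) assms by simp
  have "(LINT s:{0<..<x}|lborel. (x - s) powr (\<beta> - 1) * s powr (1 - 1)) = (LINT s:{0<..<x}|lborel. (x - s) powr (\<beta> - 1))"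
    by (intro set_lebesgue_integral_cong) auto
  then have "(LINT s:{0<..<x}|lborel. (x - s) powr (\<beta> - 1)) = Beta \<beta> 1 * x powr \<beta>"
    using B(2) assms by simp
  moreover have "\<beta> \<notin> \<int>\<^sub>\<le>\<^sub>0" using assms by (meson nonpos_Ints_nonpos not_le)
  moreover have "Gamma \<beta> \<noteq> 0" using Gamma_real_pos[OF assms(1)] by linarith
  ultimately show "frac_int \<beta> (\<lambda>s. k) x = k * x powr \<beta> / Gamma (\<beta> + 1)"
    using assms by (simp add: frac_int_def Beta_def)
qed

lemma frac_int_1_deriv:
  fixes k :: "real \<Rightarrow> real"
  assumes k: "\<And>x. 0 < x \<Longrightarrow> x < b \<Longrightarrow> set_integrable lborel {0<..<x} k"
    and c: "continuous_on {0<..<b} k" and x: "0 < x" "x < b"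
  shows "(frac_int 1 k has_field_derivative k x) (at x)"
    and "(frac_int 1 k \<longlongrightarrow> 0) (at_right 0)"
proof -
  define r where "r = (x + b) / 2"
  have r: "x < r" "r < b" "0 < r" using x by (auto simp: r_def)
  have ki: "k integrable_on {0..r}" by (rule frac_int_1_integral(1)[OF k]) (use r in auto)
  have eq: "frac_int 1 k s = integral {0..s} k" if "0 < s" "s < b" for s
    by (rule frac_int_1_integral(2)[OF k[OF that]])
  have "((\<lambda>s. integral {0..s} k) has_vector_derivative k x) (at x within {0..r})"
  proof -
    have "continuous (at x) k" using c x by (simp add: continuous_on_eq_continuous_at)
    then have "continuous (at x within {0..r}) k" by (rule continuous_at_imp_continuous_at_within)
    then show ?thesis
      using integral_has_vector_derivative_continuous_at[OF ki, of x "{}"] x r by simp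
  qed
  moreover have "at x within {0..r} = at x"
    using x r by (intro at_within_interior) auto
  ultimately have "((\<lambda>s. integral {0..s} k) has_field_derivative k x) (at x)"
    by (simp add: has_real_derivative_iff_has_vector_derivative)
  then show "(frac_int 1 k has_field_derivative k x) (at x)"
  proof (rule has_field_derivative_transform_within_open[where S = "{0<..<b}"])
    show "integral {0..s} k = frac_int 1 k s" if "s \<in> {0<..<b}" for s using eq that by auto
  qed (use x in auto)
  have "continuous_on {0..r} (\<lambda>s. integral {0..s} k)" by (rule indefinite_integral_continuous_1[OF ki])
  from bspec[OF this[unfolded continuous_on_def], of 0]
  have "((\<lambda>s. integral {0..s} k) \<longlongrightarrow> integral {0..0} k) (at 0 within {0..r})"
    using r by simp
  then have "((\<lambda>s. integral {0..s} k) \<longlongrightarrow> 0) (at_right 0)"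
    using r by (simp add: at_within_Icc_at_right)
  then show "(frac_int 1 k \<longlongrightarrow> 0) (at_right 0)"
  proof (rule Lim_transform_eventually)
    show "\<forall>\<^sub>F s in at_right 0. integral {0..s} k = frac_int 1 k s"
      using eventually_at_right_real[OF r(3)] by eventually_elim (use eq r in auto)
  qed
qed

text \<open>Two Caputo derivatives are turned into an ordinary differential equation \<open>Q'' = D\<^sup>\<alpha> D\<^sup>\<alpha> f\<close>
  by applying the fractional integral of order \<open>2 - 2\<alpha>\<close>. The constant \<open>w\<close> is the limit of
  \<open>D\<^sup>\<alpha> f\<close> at \<open>0\<close> divided by \<open>Gamma (3 - \<alpha>)\<close>.\<close>

lemma caputo_twice_structure:
  assumes \<alpha>: "0 < \<alpha>" "\<alpha> \<le> 1" and f: "continuous_on {0..1} f"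
    and c1: "\<And>x. 0 < x \<Longrightarrow> x < 1 \<Longrightarrow> has_caputo \<alpha> f x"
    and c2: "\<And>x. 0 < x \<Longrightarrow> x < 1 \<Longrightarrow> has_caputo \<alpha> (caputo \<alpha> f) x"
    and g: "continuous_on {0<..<1} (caputo \<alpha> (caputo \<alpha> f))"
  obtains w Q' where "\<alpha> = 1 \<Longrightarrow> w = 0"
    and "\<And>x. 0 < x \<Longrightarrow> x < 1 \<Longrightarrow>
      ((\<lambda>x. frac_int (2 - 2 * \<alpha>) (\<lambda>s. f s - f 0) x - w * x powr (2 - \<alpha>)) has_field_derivative Q' x) (at x)"
    and "\<And>x. 0 < x \<Longrightarrow> x < 1 \<Longrightarrow> (Q' has_field_derivative caputo \<alpha> (caputo \<alpha> f) x) (at x)"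
    and "\<alpha> < 1 \<Longrightarrow> ((\<lambda>x. (frac_int (2 - 2 * \<alpha>) (\<lambda>s. f s - f 0) x - w * x powr (2 - \<alpha>)) / x) \<longlongrightarrow> 0) (at_right 0)"
proof (cases "\<alpha> = 1")
  case True
  have d1: "(f has_field_derivative deriv f x) (at x)" if "0 < x" "x < 1" for x
    using c1[OF that] True by (simp add: has_caputo_def DERIV_deriv_iff_field_differentiable)
  have cf: "caputo \<alpha> f = deriv f" using True by (auto simp: caputo_def)
  have d2: "(deriv f has_field_derivative caputo \<alpha> (caputo \<alpha> f) x) (at x)" if "0 < x" "x < 1" for x
    using c2[OF that] True unfolding cf by (simp add: has_caputo_def caputo_def DERIV_deriv_iff_field_differentiable)
  show ?thesis
  proof (rule that[of 0 "deriv f"])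
    show "((\<lambda>x. frac_int (2 - 2 * \<alpha>) (\<lambda>s. f s - f 0) x - 0 * x powr (2 - \<alpha>)) has_field_derivative deriv f x) (at x)"
      if "0 < x" "x < 1" for x
      using True d1[OF that] by (auto simp: frac_int_def intro!: derivative_eq_intros)
  qed (use d2 True in auto)
next
  case False
  then have \<alpha>1: "\<alpha> < 1" using \<alpha> by simp
  define w where "w = caputo \<alpha> f"
  define g where "g = caputo \<alpha> w"
  have FTC: "set_integrable lborel {0<..<x} (deriv h)" "\<And>s. s \<in> {0<..<x} \<Longrightarrow> h field_differentiable (at s)"
    "caputo \<alpha> h x = frac_int (1 - \<alpha>) (deriv h) x"
    if "has_caputo \<alpha> h x" for h x
    using that set_integrable_kernel_cancel[of x \<alpha> "deriv h"] False \<alpha> by (auto simp: has_caputo_def caputo_def frac_int_def)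
  have ffd: "f field_differentiable (at s)" if "0 < s" "s < 1" for s
    using FTC(2)[OF c1[of "(s + 1) / 2"], of s] that by auto
  have wfd: "w field_differentiable (at s)" if "0 < s" "s < 1" for s
    using FTC(2)[OF c2[of "(s + 1) / 2"], of s] that by (auto simp: w_def)
  have fi: "set_integrable lborel {0<..<x} (deriv f)" if "0 < x" "x < 1" for x by (rule FTC(1)[OF c1[OF that]])
  have wi: "set_integrable lborel {0<..<x} (deriv w)" if "0 < x" "x < 1" for x
    using FTC(1)[OF c2[OF that]] by (simp add: w_def)
  have weq: "w x = frac_int (1 - \<alpha>) (deriv f) x" if "0 < x" "x < 1" for x
    using FTC(3)[OF c1[OF that]] by (simp add: w_def)
  have geq: "g x = frac_int (1 - \<alpha>) (deriv w) x" if "0 < x" "x < 1" for x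
    using FTC(3)[OF c2[OF that]] by (simp add: w_def g_def)
  have f1: "f x - f 0 = frac_int 1 (deriv f) x" if x: "0 < x" "x < 1" for x
  proof -
    have "(deriv f has_integral (f x - f 0)) {0..x}"
    proof (rule fundamental_theorem_of_calculus_interior)
      show "continuous_on {0..x} f" using f x by (auto intro: continuous_on_subset)
      show "(f has_vector_derivative deriv f s) (at s)" if "s \<in> {0<..<x}" for s
        using ffd[of s] that x
        by (simp add: has_real_derivative_iff_has_vector_derivative[symmetric] DERIV_deriv_iff_field_differentiable)
    qed (use x in auto)
    then show ?thesis using frac_int_1_integral(2)[OF fi[OF x]] by (simp add: integral_unique)
  qed
  \<comment> \<open>The limit of w at 0: as \<open>deriv w\<close> is integrable near 0, w differs
    from its primitive by a constant, which is read off at the arbitrary point 1/2.\<close>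
  define w0 where "w0 = w (1/2) - frac_int 1 (deriv w) (1/2)"
  have wd: "(w has_vector_derivative deriv w s) (at s within S)" if "0 < s" "s < 1" for s S
    using wfd[OF that] has_vector_derivative_at_within
    by (simp add: has_real_derivative_iff_has_vector_derivative[symmetric] DERIV_deriv_iff_field_differentiable[symmetric]
        has_field_derivative_at_within)
  have w1: "w x = w0 + frac_int 1 (deriv w) x" if x: "0 < x" "x < 1" for x
  proof -
    have step: "w b - w a = frac_int 1 (deriv w) b - frac_int 1 (deriv w) a" if ab: "0 < a" "a \<le> b" "b < 1" for a b
    proof -
      have "(deriv w has_integral (w b - w a)) {a..b}"
        using ab by (intro fundamental_theorem_of_calculus wd) auto
      then have "integral {a..b} (deriv w) = w b - w a" by (rule integral_unique)
      moreover have "integral {0..a} (deriv w) + integral {a..b} (deriv w) = integral {0..b} (deriv w)"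
        using ab frac_int_1_integral(1)[OF wi[of b]] by (intro Henstock_Kurzweil_Integration.integral_combine) auto
      ultimately show ?thesis
        using frac_int_1_integral(2)[OF wi[of a]] frac_int_1_integral(2)[OF wi[of b]] ab by simp
    qed
    show ?thesis
      using step[of x "1/2"] step[of "1/2" x] x by (cases "x \<le> 1/2") (auto simp: w0_def)
  qed
  have gi: "set_integrable lborel {0<..<x} g" if x: "0 < x" "x < 1" for x
  proof -
    have "set_integrable lborel {0<..<x} (\<lambda>s. (x - s) powr (1 - 1) * frac_int (1 - \<alpha>) (deriv w) s)"
      using \<alpha>1 by (intro frac_int_semigroup set_integrable_kernel_mult wi x) auto
    also have "?this \<longleftrightarrow> set_integrable lborel {0<..<x} g"
      using x geq by (intro set_integrable_cong) auto
    finally show ?thesis .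
  qed
  have gc: "continuous_on {0<..<1} g" using g by (simp add: g_def w_def)
  define G1 where "G1 = frac_int 1 g"
  have G1d: "(G1 has_field_derivative g x) (at x)" "(G1 \<longlongrightarrow> 0) (at_right 0)" if "0 < x" "x < 1" for x
    unfolding G1_def using frac_int_1_deriv[OF gi gc that] by auto
  have G1c: "continuous_on {0<..<1} G1"
    using G1d(1) by (intro continuous_at_imp_continuous_on ballI DERIV_isCont) auto
  have G1i: "set_integrable lborel {0<..<x} G1" if x: "0 < x" "x < 1" for x
  proof -
    have "set_integrable lborel {0<..<x} (\<lambda>s. (x - s) powr (1 - 1) * frac_int 1 g s)"
      by (intro frac_int_semigroup set_integrable_kernel_mult gi x) auto
    also have "?this \<longleftrightarrow> set_integrable lborel {0<..<x} G1"
      by (intro set_integrable_cong) (auto simp: G1_def)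
    finally show ?thesis .
  qed
  define Q where "Q = frac_int 1 G1"
  have Qd: "(Q has_field_derivative G1 x) (at x)" if "0 < x" "x < 1" for x
    unfolding Q_def by (rule frac_int_1_deriv(1)[OF G1i G1c that])
  define W where "W = w0 / Gamma (3 - \<alpha>)"
  \<comment> \<open>The semigroup property regroups the orders: (2 - 2\<alpha>) + 1 = (2 - \<alpha>)
    + (1 - \<alpha>) uncovers the first Caputo derivative, and (2 - \<alpha>) + 1 = 2 + (1 -
    \<alpha>) the second one.\<close>
  have main: "frac_int (2 - 2 * \<alpha>) (\<lambda>s. f s - f 0) x - W * x powr (2 - \<alpha>) = Q x" if x: "0 < x" "x < 1" for x
  proof -
    have fk: "set_integrable lborel {0<..<x} (\<lambda>s. (x - s) powr \<beta> * deriv f s)"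
       "set_integrable lborel {0<..<x} (\<lambda>s. (x - s) powr \<beta> * deriv w s)"
       "set_integrable lborel {0<..<x} (\<lambda>s. (x - s) powr \<beta> * g s)" if "0 \<le> \<beta>" for \<beta>
      using that by (auto intro!: set_integrable_kernel_mult fi wi gi x)
    have "frac_int (2 - 2 * \<alpha>) (\<lambda>s. f s - f 0) x = frac_int (2 - 2 * \<alpha>) (frac_int 1 (deriv f)) x"
      using x f1 \<alpha>1 by (intro frac_int_cong) auto
    also have "\<dots> = frac_int ((2 - 2 * \<alpha>) + 1) (deriv f) x"
      using \<alpha>1 by (intro frac_int_semigroup fk) auto
    also have "(2 - 2 * \<alpha>) + 1 = (2 - \<alpha>) + (1 - \<alpha>)" by simp
    also have "frac_int \<dots> (deriv f) x = frac_int (2 - \<alpha>) (frac_int (1 - \<alpha>) (deriv f)) x"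
      using \<alpha>1 by (intro frac_int_semigroup(2)[symmetric] fk) auto
    also have "\<dots> = frac_int (2 - \<alpha>) (\<lambda>s. w0 + frac_int 1 (deriv w) s) x"
      using x weq w1 \<alpha>1 by (intro frac_int_cong) auto
    also have "\<dots> = frac_int (2 - \<alpha>) (\<lambda>s. w0) x + frac_int (2 - \<alpha>) (frac_int 1 (deriv w)) x"
    proof -
      have s1: "set_integrable lborel {0<..<x} (\<lambda>s. (x - s) powr (2 - \<alpha> - 1) * w0)"
        using \<alpha>1 x by (intro frac_int_const) auto
      have s2: "set_integrable lborel {0<..<x} (\<lambda>s. (x - s) powr (2 - \<alpha> - 1) * frac_int 1 (deriv w) s)"
        using \<alpha>1 by (intro frac_int_semigroup fk) auto
      show ?thesis
        using \<alpha>1 set_integral_add(2)[OF s1 s2] by (simp add: frac_int_def[of "2 - \<alpha>"] distrib_left algebra_simps)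
    qed
    also have "frac_int (2 - \<alpha>) (\<lambda>s. w0) x = W * x powr (2 - \<alpha>)"
      using \<alpha>1 x by (subst frac_int_const) (auto simp: W_def algebra_simps)
    also have "frac_int (2 - \<alpha>) (frac_int 1 (deriv w)) x = frac_int ((2 - \<alpha>) + 1) (deriv w) x"
      using \<alpha>1 by (intro frac_int_semigroup fk) auto
    also have "(2 - \<alpha>) + 1 = 2 + (1 - \<alpha>)" by simp
    also have "frac_int \<dots> (deriv w) x = frac_int 2 (frac_int (1 - \<alpha>) (deriv w)) x"
      using \<alpha>1 by (intro frac_int_semigroup(2)[symmetric] fk) auto
    also have "\<dots> = frac_int 2 g x" using x geq by (intro frac_int_cong) auto
    also have "\<dots> = frac_int (1 + 1) g x" by simp
    also have "\<dots> = frac_int 1 (frac_int 1 g) x"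
      by (intro frac_int_semigroup(2)[symmetric] fk) auto
    finally show ?thesis by (simp add: Q_def G1_def)
  qed
  \<comment> \<open>\<open>Q\<close> is the integral of \<open>G1\<close>, and \<open>G1\<close>
    tends to 0, so \<open>Q\<close> is o(x).\<close>
  have Qlim: "((\<lambda>x. Q x / x) \<longlongrightarrow> 0) (at_right 0)"
  proof (rule tendstoI)
    fix e :: real assume e: "0 < e"
    have "(G1 \<longlongrightarrow> 0) (at_right 0)" using G1d(2)[of "1/2"] by simp
    then have "eventually (\<lambda>x. dist (G1 x) 0 < e / 2) (at_right 0)" using e by (intro tendstoD) auto
    then obtain b where b: "0 < b" "\<And>s. 0 < s \<Longrightarrow> s < b \<Longrightarrow> \<bar>G1 s\<bar> < e / 2"
      by (auto simp: eventually_at_right_field)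
    have "dist (Q x / x) 0 < e" if x: "0 < x" "x < min b 1" for x
    proof -
      have "norm (integral {0<..<x} G1) \<le> integral {0<..<x} (\<lambda>s. e / 2)"
      proof (rule integral_norm_bound_integral)
        show "G1 integrable_on {0<..<x}" using set_borel_integral_eq_integral(1)[OF G1i[of x]] x by auto
        show "(\<lambda>s. e / 2) integrable_on {0<..<x}"
          by (simp add: integrable_on_Icc_iff_Ioo[symmetric] integrable_const_ivl)
        show "norm (G1 s) \<le> e / 2" if "s \<in> {0<..<x}" for s using b(2)[of s] that x by auto
      qed
      also have "integral {0<..<x} (\<lambda>s. e / 2) = x * (e / 2)"
        using x by (simp add: integral_open_interval_real[symmetric])
      finally have "\<bar>Q x\<bar> \<le> x * (e / 2)"
        using frac_int_1_integral(2)[OF G1i[of x]] x by (simp add: Q_def integral_open_interval_real)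
      also have "x * (e / 2) < e * x" using x e by simp
      finally show ?thesis using x by (simp add: abs_divide pos_divide_less_eq)
    qed
    then show "\<forall>\<^sub>F x in at_right 0. dist (Q x / x) 0 < e"
      using b(1) by (auto simp: eventually_at_right_field intro!: exI[of _ "min b 1"])
  qed
  show ?thesis
  proof (rule that[of W G1])
    fix x :: real assume x: "0 < x" "x < 1"
    show "((\<lambda>x. frac_int (2 - 2 * \<alpha>) (\<lambda>s. f s - f 0) x - W * x powr (2 - \<alpha>)) has_field_derivative G1 x) (at x)"
    proof (rule has_field_derivative_transform_within_open[OF Qd[OF x], where S = "{0<..<1}"])
      show "Q s = frac_int (2 - 2 * \<alpha>) (\<lambda>s. f s - f 0) s - W * s powr (2 - \<alpha>)" if "s \<in> {0<..<1}" for s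
        using main[of s] that by simp
    qed (use x in auto)
    show "(G1 has_field_derivative caputo \<alpha> (caputo \<alpha> f) x) (at x)"
      using G1d(1)[OF x] by (simp add: g_def w_def)
  next
    show "((\<lambda>x. (frac_int (2 - 2 * \<alpha>) (\<lambda>s. f s - f 0) x - W * x powr (2 - \<alpha>)) / x) \<longlongrightarrow> 0) (at_right 0)"
    proof (rule Lim_transform_eventually[OF Qlim])
      show "\<forall>\<^sub>F x in at_right 0. Q x / x = (frac_int (2 - 2 * \<alpha>) (\<lambda>s. f s - f 0) x - W * x powr (2 - \<alpha>)) / x"
        using eventually_at_right_real[of 0 1] by (auto elim!: eventually_mono simp: main)
    qed
  qed (use False in auto)
qed

section \<open>Continuity of fractional integrals and integration of the second-order
  equation\<close>

lemma frac_int_bounded: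
  assumes \<beta>: "0 < \<beta>" and f: "set_borel_measurable lborel {0<..<x} f" and M: "\<And>s. s \<in> {0<..<x} \<Longrightarrow> \<bar>f s\<bar> \<le> M" and x: "0 < x"
  shows "set_integrable lborel {0<..<x} (\<lambda>s. (x - s) powr (\<beta> - 1) * f s)"
    and "\<bar>frac_int \<beta> f x\<bar> \<le> M * x powr \<beta> / Gamma (\<beta> + 1)"
proof -
  note c = frac_int_const[OF \<beta> x, of M]
  have M0: "0 \<le> M" using order_trans[OF abs_ge_zero M[of "x / 2"]] x by auto
  have fm: "(\<lambda>s. indicator {0<..<x} s * f s) \<in> borel_measurable lborel"
    using f by (simp add: set_borel_measurable_def)
  have "(\<lambda>s. (x - s) powr (\<beta> - 1) * (indicator {0<..<x} s * f s)) \<in> borel_measurable lborel"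
    by (rule borel_measurable_times[OF _ fm]) measurable
  then have m: "set_borel_measurable lborel {0<..<x} (\<lambda>s. (x - s) powr (\<beta> - 1) * f s)"
    by (simp add: set_borel_measurable_def mult_ac)
  show si: "set_integrable lborel {0<..<x} (\<lambda>s. (x - s) powr (\<beta> - 1) * f s)"
  proof (rule set_integrable_bound[OF c(1) m])
    have "norm ((x - s) powr (\<beta> - 1) * f s) \<le> norm ((x - s) powr (\<beta> - 1) * M)" if "s \<in> {0<..<x}" for s
      unfolding norm_mult using M[OF that] M0 by (intro mult_left_mono) auto
    then show "AE s in lborel. s \<in> {0<..<x} \<longrightarrow> norm ((x - s) powr (\<beta> - 1) * f s) \<le> norm ((x - s) powr (\<beta> - 1) * M)" by auto
  qed
  have "\<bar>LINT s:{0<..<x}|lborel. (x - s) powr (\<beta> - 1) * f s\<bar> \<le> (LINT s:{0<..<x}|lborel. (x - s) powr (\<beta> - 1) * M)"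
  proof -
    have "\<bar>LINT s:{0<..<x}|lborel. (x - s) powr (\<beta> - 1) * f s\<bar> \<le> (LINT s:{0<..<x}|lborel. \<bar>(x - s) powr (\<beta> - 1) * f s\<bar>)"
      using set_integral_norm_bound[OF si] by simp
    also have "\<dots> \<le> (LINT s:{0<..<x}|lborel. (x - s) powr (\<beta> - 1) * M)"
    proof (rule set_integral_mono[OF set_integrable_abs[OF si] c(1)])
      show "\<bar>(x - s) powr (\<beta> - 1) * f s\<bar> \<le> (x - s) powr (\<beta> - 1) * M" if "s \<in> {0<..<x}" for s
        unfolding abs_mult using M[OF that] by (simp add: mult_left_mono)
    qed
    finally show ?thesis .
  qed
  then have "1 / Gamma \<beta> * \<bar>LINT s:{0<..<x}|lborel. (x - s) powr (\<beta> - 1) * f s\<bar> \<le> frac_int \<beta> (\<lambda>s. M) x"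
    unfolding frac_int_def using \<beta> by (simp add: divide_right_mono)
  then show "\<bar>frac_int \<beta> f x\<bar> \<le> M * x powr \<beta> / Gamma (\<beta> + 1)"
    using \<beta> c(2) less_imp_le[OF Gamma_real_pos[OF \<beta>]] by (simp add: frac_int_def abs_divide)
qed

lemma continuous_imp_set_borel:
  fixes f :: "real \<Rightarrow> real"
  assumes "continuous_on {0<..<1} f" "x \<le> 1"
  shows "set_borel_measurable lborel {0<..<x} f"
proof -
  have "continuous_on {0<..<x} f" using assms by (auto intro: continuous_on_subset)
  then show ?thesis
    using borel_measurable_continuous_on_indicator[of "{0<..<x}" f] by (simp add: set_borel_measurable_def)
qed

lemma frac_int_lincomb:
  assumes "\<beta> = 0 \<or> set_integrable lborel {0<..<x} (\<lambda>s. (x - s) powr (\<beta> - 1) * f s) \<and>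
      set_integrable lborel {0<..<x} (\<lambda>s. (x - s) powr (\<beta> - 1) * g s)"
  shows "frac_int \<beta> (\<lambda>s. a * f s + b * g s) x = a * frac_int \<beta> f x + b * frac_int \<beta> g x"
proof (cases "\<beta> = 0")
  case False
  then have i: "set_integrable lborel {0<..<x} (\<lambda>s. a * ((x - s) powr (\<beta> - 1) * f s))"
     "set_integrable lborel {0<..<x} (\<lambda>s. b * ((x - s) powr (\<beta> - 1) * g s))" using assms by auto
  have "(LINT s:{0<..<x}|lborel. (x - s) powr (\<beta> - 1) * (a * f s + b * g s)) =
     (LINT s:{0<..<x}|lborel. a * ((x - s) powr (\<beta> - 1) * f s) + b * ((x - s) powr (\<beta> - 1) * g s))"
    by (simp add: algebra_simps)
  then show ?thesis using False set_integral_add(2)[OF i] by (simp add: frac_int_def algebra_simps add_divide_distrib)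
qed (simp add: frac_int_def)

text \<open>Gives a fixed domain of integration with a kernel independent of x.\<close>

lemma frac_int_scale:
  assumes "0 < x" "\<beta> \<noteq> 0"
  shows "frac_int \<beta> f x = x powr \<beta> / Gamma \<beta> * (LINT t:{0<..<1}|lborel. (1 - t) powr (\<beta> - 1) * f (x * t))"
proof -
  have "(LINT s:{0<..<x}|lborel. (x - s) powr (\<beta> - 1) * f s) =
      x * (\<integral>t. indicator {0<..<x} (x * t) * ((x - x * t) powr (\<beta> - 1) * f (x * t)) \<partial>lborel)"
    using lborel_integral_real_affine[of x "\<lambda>s. indicator {0<..<x} s * ((x - s) powr (\<beta> - 1) * f s)" 0] assms
    by (simp add: set_lebesgue_integral_def)
  also have "(\<lambda>t. indicator {0<..<x} (x * t) * ((x - x * t) powr (\<beta> - 1) * f (x * t))) =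
      (\<lambda>t. x powr (\<beta> - 1) * (indicator {0<..<1} t * ((1 - t) powr (\<beta> - 1) * f (x * t))))"
  proof
    fix t
    have i: "indicator {0<..<x} (x * t) = (indicator {0<..<1} t :: real)"
      using assms by (auto simp: indicator_def zero_less_mult_iff)
    show "indicator {0<..<x} (x * t) * ((x - x * t) powr (\<beta> - 1) * f (x * t)) =
        x powr (\<beta> - 1) * (indicator {0<..<1} t * ((1 - t) powr (\<beta> - 1) * f (x * t)))"
    proof (cases "t \<in> {0<..<1}")
      case True
      have "x - x * t = x * (1 - t)" by (simp add: algebra_simps)
      then have "(x - x * t) powr (\<beta> - 1) = x powr (\<beta> - 1) * (1 - t) powr (\<beta> - 1)"
        using True assms by (simp add: powr_mult)
      then show ?thesis unfolding i by simp
    qed (simp add: i)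
  qed
  finally have "(LINT s:{0<..<x}|lborel. (x - s) powr (\<beta> - 1) * f s) =
      x * x powr (\<beta> - 1) * (LINT t:{0<..<1}|lborel. (1 - t) powr (\<beta> - 1) * f (x * t))"
    by (simp add: set_lebesgue_integral_def)
  also have "x * x powr (\<beta> - 1) = x powr \<beta>" using assms powr_mult_base[of x "\<beta> - 1"] by simp
  finally show ?thesis using assms by (simp add: frac_int_def)
qed

text \<open>After rescaling to (0, 1) the uniform continuity of v passes through the integral with
  the fixed kernel; the factor x powr \<beta> takes care of x = 0.\<close>

lemma continuous_on_frac_int:
  fixes v :: "real \<Rightarrow> real \<Rightarrow> real"
  assumes \<beta>: "0 \<le> \<beta>" and v: "continuous_on ({0..1} \<times> {a..b}) (\<lambda>(x, y). v x y)"
  shows "continuous_on ({0..1} \<times> {a..b}) (\<lambda>(x, y). frac_int \<beta> (\<lambda>s. v s y) x)"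
proof (cases "\<beta> = 0")
  case True
  then show ?thesis using v by (simp add: frac_int_def)
next
  case False
  then have \<beta>0: "0 < \<beta>" using \<beta> by simp
  define K where "K = (\<lambda>p. LINT t:{0<..<1}|lborel. (1 - t) powr (\<beta> - 1) * v (fst p * t) (snd p))"
  define c where "c = (LINT t:{0<..<1}|lborel. (1 - t) powr (\<beta> - 1) * 1)"
  have kern: "set_integrable lborel {0<..<1} (\<lambda>t. (1 - t) powr (\<beta> - 1) * (k::real))" for k
    using frac_int_const(1)[OF \<beta>0, of 1 k] by simp
  have uc: "uniformly_continuous_on ({0..1} \<times> {a..b}) (\<lambda>(x, y). v x y)"
    by (intro compact_uniformly_continuous v compact_Times) auto
  have si: "set_integrable lborel {0<..<1} (\<lambda>t. (1 - t) powr (\<beta> - 1) * v (x * t) y)" if xy: "(x, y) \<in> {0..1} \<times> {a..b}" for x y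
  proof -
    have "continuous_on {0..1} (\<lambda>t. (\<lambda>(x, y). v x y) (x * t, y))"
      using xy by (intro continuous_on_compose2[OF v] continuous_intros) (auto simp: mult_le_one)
    then have c: "continuous_on {0..1} (\<lambda>t. v (x * t) y)" by simp
    then have "bounded ((\<lambda>t. v (x * t) y) ` {0..1})" by (intro compact_imp_bounded compact_continuous_image) auto
    then obtain M where M: "\<And>t. t \<in> {0..1} \<Longrightarrow> \<bar>v (x * t) y\<bar> \<le> M" by (auto simp: bounded_iff simp del: atLeastAtMost_iff)
    have "continuous_on {0<..<1} (\<lambda>t. v (x * t) y)" using c by (rule continuous_on_subset) auto
    then show ?thesis
      by (intro frac_int_bounded[OF \<beta>0, where M = M] continuous_imp_set_borel) (use M in auto)
  qed
  have "continuous_on ({0..1} \<times> {a..b}) K"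
  proof (rule uniformly_continuous_imp_continuous, unfold uniformly_continuous_on_def, intro allI impI)
    fix e :: real assume e: "0 < e"
    have c0: "0 \<le> c"
      unfolding c_def set_lebesgue_integral_def by (intro integral_nonneg_AE) (auto simp: indicator_def)
    obtain d where d: "0 < d" "\<And>p p'. p \<in> {0..1} \<times> {a..b} \<Longrightarrow> p' \<in> {0..1} \<times> {a..b} \<Longrightarrow> dist p' p < d \<Longrightarrow>
        dist ((\<lambda>(x, y). v x y) p') ((\<lambda>(x, y). v x y) p) < e / (c + 1)"
      using uc e c0 unfolding uniformly_continuous_on_def by (metis add_nonneg_pos divide_pos_pos zero_less_one)
    have "dist (K p') (K p) < e" if p: "p \<in> {0..1} \<times> {a..b}" "p' \<in> {0..1} \<times> {a..b}" "dist p' p < d" for p p'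
    proof -
      obtain x y x' y' where xy: "p = (x, y)" "p' = (x', y')" by fastforce
      have i: "set_integrable lborel {0<..<1} (\<lambda>t. (1 - t) powr (\<beta> - 1) * v (x * t) y)"
        "set_integrable lborel {0<..<1} (\<lambda>t. (1 - t) powr (\<beta> - 1) * v (x' * t) y')"
        using si p xy by auto
      have bd: "\<bar>(1 - t) powr (\<beta> - 1) * v (x' * t) y' - (1 - t) powr (\<beta> - 1) * v (x * t) y\<bar> \<le> (1 - t) powr (\<beta> - 1) * (e / (c + 1))"
        if t: "t \<in> {0<..<1}" for t
      proof -
        have m: "(x * t, y) \<in> {0..1} \<times> {a..b}" "(x' * t, y') \<in> {0..1} \<times> {a..b}"
          using p xy t by (auto simp: mult_le_one)
        have "dist (x' * t, y') (x * t, y) \<le> dist (x', y') (x, y)"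
        proof -
          have "\<bar>x' * t - x * t\<bar> = \<bar>x' - x\<bar> * t" using t by (simp add: left_diff_distrib[symmetric] abs_mult)
          also have "\<dots> \<le> \<bar>x' - x\<bar> * 1" using t by (intro mult_left_mono) auto
          finally show ?thesis
            unfolding dist_Pair_Pair dist_real_def by (intro real_sqrt_le_mono add_right_mono power_mono) auto
        qed
        then have "dist (v (x' * t) y') (v (x * t) y) < e / (c + 1)"
          using d(2)[OF m] p xy by simp
        then have "(1 - t) powr (\<beta> - 1) * \<bar>v (x' * t) y' - v (x * t) y\<bar> \<le> (1 - t) powr (\<beta> - 1) * (e / (c + 1))"
          by (intro mult_left_mono) (auto simp: dist_real_def)
        then show ?thesis by (simp add: right_diff_distrib[symmetric] abs_mult)
      qed
      have "\<bar>K p' - K p\<bar> = \<bar>LINT t:{0<..<1}|lborel. (1 - t) powr (\<beta> - 1) * v (x' * t) y' - (1 - t) powr (\<beta> - 1) * v (x * t) y\<bar>"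
        using set_integral_diff(2)[OF i(2,1)] by (simp add: K_def xy)
      also have "\<dots> \<le> (LINT t:{0<..<1}|lborel. \<bar>(1 - t) powr (\<beta> - 1) * v (x' * t) y' - (1 - t) powr (\<beta> - 1) * v (x * t) y\<bar>)"
        using set_integral_norm_bound[OF set_integral_diff(1)[OF i(2,1)]] by simp
      also have "\<dots> \<le> (LINT t:{0<..<1}|lborel. (1 - t) powr (\<beta> - 1) * (e / (c + 1)))"
        by (rule set_integral_mono[OF set_integrable_abs[OF set_integral_diff(1)[OF i(2,1)]] kern bd])
      also have "\<dots> = c * (e / (c + 1))"
        unfolding c_def by simp
      also have "\<dots> < e" using c0 e by (simp add: field_simps)
      finally show ?thesis by (simp add: dist_real_def)
    qed
    then show "\<exists>d>0. \<forall>x\<in>{0..1} \<times> {a..b}. \<forall>x'\<in>{0..1} \<times> {a..b}. dist x' x < d \<longrightarrow> dist (K x') (K x) < e"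
      using d(1) by blast
  qed
  moreover have "continuous_on ({0..1} \<times> {a..b}) (\<lambda>p :: real \<times> real. fst p powr \<beta> / Gamma \<beta>)"
    using \<beta>0 less_imp_neq[OF Gamma_real_pos[OF \<beta>0]]
    by (intro continuous_on_divide continuous_on_powr' continuous_intros) auto
  ultimately have "continuous_on ({0..1} \<times> {a..b}) (\<lambda>p. fst p powr \<beta> / Gamma \<beta> * K p)"
    by (intro continuous_on_mult)
  then show ?thesis
  proof (rule continuous_on_eq)
    fix p :: "real \<times> real" assume p: "p \<in> {0..1} \<times> {a..b}"
    show "fst p powr \<beta> / Gamma \<beta> * K p = (case p of (x, y) \<Rightarrow> frac_int \<beta> (\<lambda>s. v s y) x)"
    proof (cases "fst p = 0")
      case True
      then show ?thesis using \<beta>0 by (auto simp: frac_int_def set_lebesgue_integral_def split: prod.split)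
    next
      case pos: False
      then show ?thesis using p frac_int_scale[of "fst p" \<beta> "\<lambda>s. v s (snd p)"] False
        by (auto simp: K_def split: prod.split)
    qed
  qed
qed

lemma continuous_on_frac_int_1:
  assumes "0 \<le> \<beta>" "continuous_on {0..1} f"
  shows "continuous_on {0..1} (frac_int \<beta> f)"
proof -
  have "continuous_on ({0..1} \<times> {0..0}) (\<lambda>(x, y::real). f x)"
    unfolding case_prod_beta' by (rule continuous_on_compose2[OF assms(2) continuous_on_fst]) auto
  from continuous_on_frac_int[OF assms(1) this]
  have "continuous_on {0..1} (\<lambda>x. (\<lambda>(x, y). frac_int \<beta> f x) (x, 0::real))"
    by (rule continuous_on_compose2) (auto intro!: continuous_intros)
  then show ?thesis by simp
qed

lemma frac_int_2_deriv:
  assumes g: "continuous_on {0<..<1} g" and M: "\<And>x. 0 < x \<Longrightarrow> x < 1 \<Longrightarrow> \<bar>g x\<bar> \<le> M" and x: "0 < x" "x < 1"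
  shows "(frac_int 1 g has_field_derivative g x) (at x)" "(frac_int 2 g has_field_derivative frac_int 1 g x) (at x)"
    and "\<bar>frac_int 2 g x\<bar> \<le> M * x\<^sup>2"
proof -
  have b: "set_integrable lborel {0<..<x} (\<lambda>s. (x - s) powr (\<beta> - 1) * g s)" "\<bar>frac_int \<beta> g x\<bar> \<le> M * x powr \<beta> / Gamma (\<beta> + 1)"
    if "0 < x" "x < 1" "0 < \<beta>" for x \<beta>
    using that M by (auto intro!: frac_int_bounded[where M = M] continuous_imp_set_borel[OF g])
  have gi: "set_integrable lborel {0<..<x} g" if "0 < x" "x < 1" for x
    using set_integrable_kernel_cancel[of x 0 g] b(1)[OF that, of 1]  that
    by (auto elim!: set_integrable_cong[THEN iffD1, rotated -1])
  show d1: "(frac_int 1 g has_field_derivative g x) (at x)"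
    by (rule frac_int_1_deriv(1)[OF gi g x])
  have d1': "(frac_int 1 g has_field_derivative g x) (at x)" if "0 < x" "x < 1" for x
    by (rule frac_int_1_deriv(1)[OF gi g that])
  have c1: "continuous_on {0<..<1} (frac_int 1 g)"
    using d1' by (intro continuous_at_imp_continuous_on ballI DERIV_isCont) auto
  have s: "frac_int 1 (frac_int 1 g) x = frac_int 2 g x" "set_integrable lborel {0<..<x} (\<lambda>s. (x - s) powr (1 - 1) * frac_int 1 g s)"
    if x: "0 < x" "x < 1" for x
    using frac_int_semigroup[of 1 1 x g] b(1)[OF x, of 2] by simp_all
  have gi1: "set_integrable lborel {0<..<x} (frac_int 1 g)" if "0 < x" "x < 1" for x
    using s(2)[OF that] by (auto elim!: set_integrable_cong[THEN iffD1, rotated -1])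
  have "(frac_int 1 (frac_int 1 g) has_field_derivative frac_int 1 g x) (at x)"
    by (rule frac_int_1_deriv(1)[OF gi1 c1 x])
  then show "(frac_int 2 g has_field_derivative frac_int 1 g x) (at x)"
    by (rule has_field_derivative_transform_within_open[where S = "{0<..<1}"]) (use s x in auto)
  have "0 \<le> M" using order_trans[OF abs_ge_zero M[OF x]] .
  have G3: "Gamma (3::real) = 2" using Gamma_fact[of 2, where 'a = real] by (simp add: fact_numeral)
  have "\<bar>frac_int 2 g x\<bar> \<le> M * x powr 2 / 2" using b(2)[OF x, of 2] by (simp add: G3)
  also have "\<dots> \<le> M * x\<^sup>2" using \<open>0 \<le> M\<close> x by simp
  finally show "\<bar>frac_int 2 g x\<bar> \<le> M * x\<^sup>2" .
qed

lemma ode_second_order: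
  assumes Q: "\<And>x. 0 < x \<Longrightarrow> x < 1 \<Longrightarrow> (Q has_field_derivative Q' x) (at x)"
    and Q': "\<And>x. 0 < x \<Longrightarrow> x < 1 \<Longrightarrow> (Q' has_field_derivative g x) (at x)"
    and g: "continuous_on {0<..<1} g" and M: "\<And>x. 0 < x \<Longrightarrow> x < 1 \<Longrightarrow> \<bar>g x\<bar> \<le> M"
  obtains A B where "\<And>x. 0 < x \<Longrightarrow> x < 1 \<Longrightarrow> Q x = A + B * x + frac_int 2 g x"
proof -
  note N = frac_int_2_deriv[OF g M]
  have "\<exists>B. \<forall>x\<in>{0<..<1}. Q' x - frac_int 1 g x = B"
  proof (rule has_field_derivative_zero_constant)
    show "((\<lambda>x. Q' x - frac_int 1 g x) has_field_derivative 0) (at x within {0<..<1})" if "x \<in> {0<..<1}" for x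
      using DERIV_diff[OF Q'[of x] N(1)[of x]] that by (auto intro: has_field_derivative_at_within)
  qed auto
  then obtain B where B: "\<And>x. x \<in> {0<..<1} \<Longrightarrow> Q' x - frac_int 1 g x = B" by blast
  have "\<exists>A. \<forall>x\<in>{0<..<1}. Q x - frac_int 2 g x - B * x = A"
  proof (rule has_field_derivative_zero_constant)
    fix x :: real assume x: "x \<in> {0<..<1}"
    have "((\<lambda>x. Q x - frac_int 2 g x - B * x) has_field_derivative Q' x - frac_int 1 g x - B * 1) (at x)"
      using x by (intro DERIV_diff Q N DERIV_cmult DERIV_ident) auto
    then show "((\<lambda>x. Q x - frac_int 2 g x - B * x) has_field_derivative 0) (at x within {0<..<1})"
      using B[OF x] by (auto intro: has_field_derivative_at_within)
  qed auto
  then obtain A where A: "\<And>x. x \<in> {0<..<1} \<Longrightarrow> Q x - frac_int 2 g x - B * x = A" by blast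
  show ?thesis using that[of A B] A by (auto simp: algebra_simps)
qed

lemma frac_int_2_limits:
  assumes g: "continuous_on {0<..<1} g" and M: "\<And>x. 0 < x \<Longrightarrow> x < 1 \<Longrightarrow> \<bar>g x\<bar> \<le> M"
  shows "(frac_int 2 g \<longlongrightarrow> 0) (at_right 0)" "((\<lambda>x. frac_int 2 g x / x) \<longlongrightarrow> 0) (at_right 0)"
proof -
  note N = frac_int_2_deriv(3)[OF g M]
  have ev: "eventually (\<lambda>x::real. x \<in> {0<..<1}) (at_right 0)" by (rule eventually_at_right_real) simp
  have "((\<lambda>x. M * x) \<longlongrightarrow> M * 0) (at_right 0)" by (intro tendsto_intros)
  then have l: "((\<lambda>x. M * x) \<longlongrightarrow> 0) (at_right 0)" by simp
  have 1: "\<bar>frac_int 2 g x / x\<bar> \<le> M * x" if "x \<in> {0<..<1}" for x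
    using N[of x] that by (simp add: abs_divide pos_divide_le_eq power2_eq_square mult_ac)
  show l2: "((\<lambda>x. frac_int 2 g x / x) \<longlongrightarrow> 0) (at_right 0)"
    by (rule Lim_null_comparison[OF _ l]) (use ev 1 in \<open>auto elim!: eventually_mono\<close>)
  have "((\<lambda>x. frac_int 2 g x / x * x) \<longlongrightarrow> 0 * 0) (at_right 0)"
    by (intro tendsto_mult l2) (auto intro: tendsto_ident_at)
  then have "((\<lambda>x. frac_int 2 g x / x * x) \<longlongrightarrow> 0) (at_right 0)" by simp
  then show "(frac_int 2 g \<longlongrightarrow> 0) (at_right 0)"
    by (rule Lim_transform_eventually) (rule eventually_mono[OF ev], simp)
qed

text \<open>Iterating the equation k times multiplies the bound by |\<kappa>| ^ k and by a
  fractional integral of order 2 * \<alpha> * k, which contributes 1 / Gamma (2 * \<alpha> * k + 1);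
  the product tends to 0.\<close>

lemma volterra_zero:
  assumes \<alpha>: "0 < \<alpha>" "\<alpha> \<le> 1" and f: "continuous_on {0<..<1} f" and K: "\<And>x. 0 < x \<Longrightarrow> x < 1 \<Longrightarrow> \<bar>f x\<bar> \<le> K"
    and eq: "\<And>x. 0 < x \<Longrightarrow> x < 1 \<Longrightarrow> f x = \<kappa> * frac_int (2 * \<alpha>) f x" and x: "0 < x" "x < 1"
  shows "f x = 0"
proof -
  define c where "c k = ml_coeff \<alpha> (2 * k)" for k
  have cG: "c k = 1 / Gamma (2 * \<alpha> * k + 1)" for k by (simp add: c_def ml_coeff_def mult_ac)
  have c0: "0 < c k" for k using ml_coeff_pos[of \<alpha>] \<alpha> by (simp add: c_def)
  have K0: "0 \<le> K" using order_trans[OF abs_ge_zero K[OF x]] .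
  have bound: "\<bar>f x\<bar> \<le> K * \<bar>\<kappa>\<bar> ^ k * c k * x powr (2 * \<alpha> * k)" if "0 < x" "x < 1" for k x
    using that
  proof (induction k arbitrary: x)
    case 0
    then show ?case using K[of x] by (simp add: c_def)
  next
    case (Suc k)
    define b where "b s = K * \<bar>\<kappa>\<bar> ^ k * c k * s powr (2 * \<alpha> * k)" for s
    have p: "0 < 2 * \<alpha>" using \<alpha> by simp
    have si: "set_integrable lborel {0<..<x} (\<lambda>s. (x - s) powr (2 * \<alpha> - 1) * f s)"
      by (intro frac_int_bounded[OF p, where M = K] continuous_imp_set_borel[OF f]) (use K Suc.prems in auto)
    have p1: "0 < 2 * \<alpha> * real k + 1" using \<alpha> by (intro add_nonneg_pos) auto
    note B = Beta_kernel[OF p p1 Suc.prems(1)]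
    have sb: "set_integrable lborel {0<..<x} (\<lambda>s. (K * \<bar>\<kappa>\<bar> ^ k * c k) * ((x - s) powr (2 * \<alpha> - 1) * s powr (2 * \<alpha> * k + 1 - 1)))"
      using B(1) by simp
    have "\<bar>LINT s:{0<..<x}|lborel. (x - s) powr (2 * \<alpha> - 1) * f s\<bar> \<le> (LINT s:{0<..<x}|lborel. \<bar>(x - s) powr (2 * \<alpha> - 1) * f s\<bar>)"
      using set_integral_norm_bound[OF si] by simp
    also have "\<dots> \<le> (LINT s:{0<..<x}|lborel. (K * \<bar>\<kappa>\<bar> ^ k * c k) * ((x - s) powr (2 * \<alpha> - 1) * s powr (2 * \<alpha> * k + 1 - 1)))"
    proof (rule set_integral_mono[OF set_integrable_abs[OF si] sb])
      fix s assume s: "s \<in> {0<..<x}"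
      have "(x - s) powr (2 * \<alpha> - 1) * \<bar>f s\<bar> \<le> (x - s) powr (2 * \<alpha> - 1) * (K * \<bar>\<kappa>\<bar> ^ k * c k * s powr (2 * \<alpha> * k))"
        using s Suc.prems by (intro mult_left_mono Suc.IH) auto
      then show "\<bar>(x - s) powr (2 * \<alpha> - 1) * f s\<bar> \<le> (K * \<bar>\<kappa>\<bar> ^ k * c k) * ((x - s) powr (2 * \<alpha> - 1) * s powr (2 * \<alpha> * k + 1 - 1))"
        by (simp add: abs_mult mult_ac)
    qed
    also have "\<dots> = (K * \<bar>\<kappa>\<bar> ^ k * c k) * (Beta (2 * \<alpha>) (2 * \<alpha> * k + 1) * x powr (2 * \<alpha> + (2 * \<alpha> * k + 1) - 1))"
      using B(2) by simp
    also have "2 * \<alpha> + (2 * \<alpha> * k + 1) - 1 = 2 * \<alpha> * Suc k" by (simp add: algebra_simps)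
    also have "Beta (2 * \<alpha>) (2 * \<alpha> * k + 1) = Gamma (2 * \<alpha>) * c (Suc k) / c k"
    proof -
      have "Gamma (2 * \<alpha> + (2 * \<alpha> * k + 1)) = Gamma (2 * \<alpha> * Suc k + 1)"
        by (rule arg_cong[of _ _ Gamma]) (simp add: algebra_simps)
      then show ?thesis unfolding Beta_def cG by (simp del: of_nat_Suc)
    qed
    finally have I: "\<bar>LINT s:{0<..<x}|lborel. (x - s) powr (2 * \<alpha> - 1) * f s\<bar> \<le> Gamma (2 * \<alpha>) * (K * \<bar>\<kappa>\<bar> ^ k * c (Suc k) * x powr (2 * \<alpha> * Suc k))"
      using c0[of k] by (simp add: mult_ac)
    have G: "0 < Gamma (2 * \<alpha>)" using p by (rule Gamma_real_pos)
    have "\<bar>frac_int (2 * \<alpha>) f x\<bar> = \<bar>LINT s:{0<..<x}|lborel. (x - s) powr (2 * \<alpha> - 1) * f s\<bar> / Gamma (2 * \<alpha>)"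
      using G p by (simp add: frac_int_def abs_divide)
    also have "\<dots> \<le> K * \<bar>\<kappa>\<bar> ^ k * c (Suc k) * x powr (2 * \<alpha> * Suc k)"
      using I G by (simp add: pos_divide_le_eq mult_ac)
    finally have "\<bar>\<kappa>\<bar> * \<bar>frac_int (2 * \<alpha>) f x\<bar> \<le> \<bar>\<kappa>\<bar> * (K * \<bar>\<kappa>\<bar> ^ k * c (Suc k) * x powr (2 * \<alpha> * Suc k))"
      by (intro mult_left_mono) auto
    then show ?case
      using eq[OF Suc.prems] by (simp add: abs_mult mult_ac del: of_nat_Suc)
  qed
  \<comment> \<open>c k * |\<kappa>| ^ k is the subsequence of even index of the terms of the
    convergent series for E(sqrt |\<kappa>|).\<close>
  have "(\<lambda>k. ml_coeff \<alpha> k * sqrt \<bar>\<kappa>\<bar> ^ k) \<longlonglongrightarrow> 0"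
    by (rule summable_LIMSEQ_zero[OF summable_ml_coeff[OF \<alpha>]])
  from LIMSEQ_subseq_LIMSEQ[OF this, of "\<lambda>k. 2 * k"]
  have "(\<lambda>k. c k * \<bar>\<kappa>\<bar> ^ k) \<longlonglongrightarrow> 0"
    by (simp add: o_def c_def power_mult strict_mono_def)
  then have lim: "(\<lambda>k. K * (c k * \<bar>\<kappa>\<bar> ^ k)) \<longlonglongrightarrow> K * 0" by (intro tendsto_intros)
  have "\<bar>f x\<bar> \<le> K * (c k * \<bar>\<kappa>\<bar> ^ k)" for k
  proof -
    have "x powr (2 * \<alpha> * k) \<le> 1 powr (2 * \<alpha> * k)" using x \<alpha> by (intro powr_mono2) auto
    then have "K * \<bar>\<kappa>\<bar> ^ k * c k * x powr (2 * \<alpha> * k) \<le> K * \<bar>\<kappa>\<bar> ^ k * c k * 1"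
      using K0 c0[of k] by (intro mult_left_mono) auto
    then show ?thesis using bound[OF x, of k] by (simp add: mult_ac)
  qed
  then have "\<bar>f x\<bar> \<le> K * 0" by (intro LIMSEQ_le_const[OF lim]) auto
  then show ?thesis by simp
qed

lemma continuous_on_Icc_bounded:
  fixes f :: "real \<Rightarrow> real"
  assumes "continuous_on {a..b} f"
  obtains M where "\<And>x. x \<in> {a..b} \<Longrightarrow> \<bar>f x\<bar> \<le> M"
proof -
  have "bounded (f ` {a..b})" using assms by (intro compact_imp_bounded compact_continuous_image) auto
  then obtain M where "\<forall>y\<in>f ` {a..b}. norm y \<le> M" unfolding bounded_iff by blast
  then show ?thesis by (intro that[of M]) auto
qed

lemma at_right_const_eq:
  fixes f :: "real \<Rightarrow> real"
  assumes "(f \<longlongrightarrow> l) (at_right 0)" "\<And>x. 0 < x \<Longrightarrow> x < 1 \<Longrightarrow> f x = k"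
  shows "k = l"
proof -
  have "eventually (\<lambda>x::real. x \<in> {0<..<1}) (at_right 0)" by (rule eventually_at_right_real) simp
  then have "eventually (\<lambda>x. f x = k) (at_right 0)" by (rule eventually_mono) (use assms(2) in auto)
  with assms(1) have "((\<lambda>x. k) \<longlongrightarrow> l) (at_right (0::real))" by (rule Lim_transform_eventually)
  then show ?thesis by (simp add: tendsto_const_iff)
qed

lemma frac_int_mult_right: "frac_int \<beta> (\<lambda>s. f s * k) x = frac_int \<beta> f x * k"
  unfolding frac_int_def by (simp add: mult.assoc[symmetric])

lemma frac_int_at_0: "\<beta> \<noteq> 0 \<Longrightarrow> frac_int \<beta> f 0 = 0"
  by (simp add: frac_int_def set_lebesgue_integral_def)

lemma frac_int_integral_swap:
  fixes f :: "real \<Rightarrow> real \<Rightarrow> real"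
  assumes \<beta>: "0 \<le> \<beta>" and f: "continuous_on ({0..1} \<times> {a..b}) (\<lambda>(x, y). f x y)" and x: "0 \<le> x" "x \<le> 1" and ab: "a \<le> b"
  shows "integral {a..b} (\<lambda>y. frac_int \<beta> (\<lambda>s. f s y) x) = frac_int \<beta> (\<lambda>s. integral {a..b} (f s)) x"
proof (cases "\<beta> = 0 \<or> x = 0")
  case True
  then show ?thesis by (cases "\<beta> = 0") (auto simp: frac_int_def set_lebesgue_integral_def)
next
  case False
  then have \<beta>0: "0 < \<beta>" and x0: "0 < x" using \<beta> x by auto
  \<comment> \<open>Clamping both arguments extends f continuously to the whole plane, which makes
    it Borel measurable there.\<close>
  define fc where "fc s y = f (max 0 (min 1 s)) (max a (min b y))" for s y
  have fcc: "continuous_on UNIV (\<lambda>p. fc (fst p) (snd p))"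
  proof -
    have "continuous_on UNIV (\<lambda>p. (\<lambda>(x, y). f x y) (max 0 (min 1 (fst p)), max a (min b (snd p))))"
      by (rule continuous_on_compose2[OF f]) (use ab in \<open>auto intro!: continuous_intros\<close>)
    then show ?thesis by (simp add: fc_def)
  qed
  have fceq: "fc s y = f s y" if "s \<in> {0..1}" "y \<in> {a..b}" for s y
    using that by (simp add: fc_def)
  have fcs: "continuous_on S (fc s)" for s S
  proof -
    have "continuous_on S (\<lambda>y. (\<lambda>p. fc (fst p) (snd p)) (s, y))"
      by (rule continuous_on_compose2[OF fcc]) (auto intro!: continuous_intros)
    then show ?thesis by simp
  qed
  have "bounded ((\<lambda>(x, y). f x y) ` ({0..1} \<times> {a..b}))"
    by (intro compact_imp_bounded compact_continuous_image f compact_Times) auto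
  then obtain M where M: "\<And>s y. s \<in> {0..1} \<Longrightarrow> y \<in> {a..b} \<Longrightarrow> \<bar>f s y\<bar> \<le> M"
    unfolding bounded_iff by fastforce
  have Mc: "\<bar>fc s y\<bar> \<le> M" for s y unfolding fc_def using ab by (intro M) auto
  define k where "k s = indicator {0<..<x} s * (x - s) powr (\<beta> - 1)" for s
  have k0: "0 \<le> k s" for s by (simp add: k_def)
  have ki: "integrable lborel k"
    using frac_int_const(1)[OF \<beta>0 x0, of 1] by (simp add: set_integrable_def k_def[abs_def])
  define H where "H = (\<lambda>(s, y). k s * (indicator {a..b} y * fc s y))"
  have fcm [measurable]: "(\<lambda>p. fc (fst p) (snd p)) \<in> borel_measurable (lborel \<Otimes>\<^sub>M lborel)"
    using borel_measurable_continuous_onI[OF fcc] by (simp add: lborel_prod)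
  have km [measurable]: "k \<in> borel_measurable lborel" using ki by (rule borel_measurable_integrable)
  have Hm: "H \<in> borel_measurable (lborel \<Otimes>\<^sub>M lborel)"
  proof -
    have "(\<lambda>p. k (fst p) * (indicator {a..b} (snd p) * fc (fst p) (snd p))) \<in> borel_measurable (lborel \<Otimes>\<^sub>M lborel)"
      by (intro borel_measurable_times fcm) measurable
    then show ?thesis by (simp add: H_def case_prod_beta')
  qed
  have yi: "integrable lborel (\<lambda>y. indicator {a..b} y * fc s y)" for s
    using borel_integrable_atLeastAtMost'[OF fcs[of "{a..b}" s]] by (simp add: set_integrable_def)
  have HI: "integrable (lborel \<Otimes>\<^sub>M lborel) H"
  proof (rule lborel_pair.Fubini_integrable[OF Hm])
    show "AE s in lborel. integrable lborel (\<lambda>y. H (s, y))"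
      using yi by (simp add: H_def)
    show "integrable lborel (\<lambda>s. \<integral>y. norm (H (s, y)) \<partial>lborel)"
    proof (rule Bochner_Integration.integrable_bound)
      show "integrable lborel (\<lambda>s. k s * (M * (b - a)))" using ki by simp
      show "(\<lambda>s. \<integral>y. norm (H (s, y)) \<partial>lborel) \<in> borel_measurable lborel"
        using lborel.borel_measurable_lebesgue_integral[of "\<lambda>s y. norm (H (s, y))" lborel] Hm by simp
      have "(\<integral>y. norm (H (s, y)) \<partial>lborel) \<le> k s * (M * (b - a))" for s
      proof -
        have "(\<integral>y. norm (H (s, y)) \<partial>lborel) = k s * (\<integral>y. norm (indicator {a..b} y * fc s y) \<partial>lborel)"
          using k0 by (simp add: H_def abs_mult)
        also have "(\<integral>y. norm (indicator {a..b} y * fc s y) \<partial>lborel) \<le> (\<integral>y. indicator {a..b} y * M \<partial>lborel)"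
        proof (rule integral_mono[OF integrable_norm[OF yi]])
          show "integrable lborel (\<lambda>y. indicator {a..b} y * M)" by (simp add: ab)
          show "norm (indicator {a..b} y * fc s y) \<le> indicator {a..b} y * M" for y
            using Mc[of s y] by (simp add: indicator_def)
        qed
        also have "\<dots> = M * (b - a)" using ab by simp
        finally show ?thesis using k0[of s] by (simp add: mult_left_mono)
      qed
      moreover have "0 \<le> (\<integral>y. norm (H (s, y)) \<partial>lborel)" for s by simp
      ultimately show "AE s in lborel. norm (\<integral>y. norm (H (s, y)) \<partial>lborel) \<le> norm (k s * (M * (b - a)))"
        by (intro AE_I2) (metis abs_of_nonneg order_trans real_norm_def)
    qed
  qed
  have e1: "(\<integral>s. H (s, y) \<partial>lborel) = indicator {a..b} y * (Gamma \<beta> * frac_int \<beta> (\<lambda>s. f s y) x)" for y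
  proof (cases "y \<in> {a..b}")
    case True
    have "(\<integral>s. H (s, y) \<partial>lborel) = (LINT s:{0<..<x}|lborel. (x - s) powr (\<beta> - 1) * f s y)"
      unfolding set_lebesgue_integral_def using True x
      by (intro Bochner_Integration.integral_cong) (auto simp: H_def k_def fceq indicator_def)
    then show ?thesis using True \<beta>0 less_imp_neq[OF Gamma_real_pos[OF \<beta>0]] by (simp add: frac_int_def)
  qed (simp add: H_def)
  have e2: "(\<integral>y. H (s, y) \<partial>lborel) = indicator {0<..<x} s *\<^sub>R ((x - s) powr (\<beta> - 1) * integral {a..b} (f s))" for s
  proof (cases "s \<in> {0<..<x}")
    case True
    then have s: "s \<in> {0..1}" using x by auto
    have "(\<integral>y. H (s, y) \<partial>lborel) = k s * (LINT y:{a..b}|lborel. fc s y)"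
      by (simp add: H_def set_lebesgue_integral_def)
    also have "(LINT y:{a..b}|lborel. fc s y) = integral {a..b} (fc s)"
      by (rule set_borel_integral_eq_integral(2)[OF borel_integrable_atLeastAtMost'[OF fcs]])
    also have "\<dots> = integral {a..b} (f s)"
      by (rule integral_cong) (use s fceq in auto)
    finally show ?thesis using True by (simp add: k_def)
  qed (simp add: H_def k_def)
  have cf: "continuous_on {a..b} (\<lambda>y. frac_int \<beta> (\<lambda>s. f s y) x)"
  proof -
    have "continuous_on {a..b} (\<lambda>y. (\<lambda>(x, y). frac_int \<beta> (\<lambda>s. f s y) x) (x, y))"
      by (rule continuous_on_compose2[OF continuous_on_frac_int[OF \<beta> f]]) (use x in \<open>auto intro!: continuous_intros\<close>)
    then show ?thesis by simp
  qed
  have "Gamma \<beta> * integral {a..b} (\<lambda>y. frac_int \<beta> (\<lambda>s. f s y) x) = Gamma \<beta> * (LINT y:{a..b}|lborel. frac_int \<beta> (\<lambda>s. f s y) x)"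
    by (simp add: set_borel_integral_eq_integral(2)[OF borel_integrable_atLeastAtMost'[OF cf]])
  also have "\<dots> = (\<integral>y. (\<integral>s. H (s, y) \<partial>lborel) \<partial>lborel)"
    by (simp add: e1 set_lebesgue_integral_def mult.left_commute[of _ "Gamma \<beta>"])
  also have "\<dots> = (\<integral>s. (\<integral>y. H (s, y) \<partial>lborel) \<partial>lborel)"
    using lborel_pair.Fubini_integral[of "\<lambda>s y. H (s, y)"] HI by simp
  also have "\<dots> = Gamma \<beta> * frac_int \<beta> (\<lambda>s. integral {a..b} (f s)) x"
    unfolding e2 using \<beta>0 less_imp_neq[OF Gamma_real_pos[OF \<beta>0]] by (simp add: frac_int_def set_lebesgue_integral_def)
  finally show ?thesis using less_imp_neq[OF Gamma_real_pos[OF \<beta>0]] by simp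
qed

section \<open>Uniqueness for the ordinary fractional equation\<close>

lemma frac_int_tendsto_0:
  assumes "0 \<le> \<beta>" "continuous_on {0..1} f" "f 0 = 0"
  shows "(frac_int \<beta> f \<longlongrightarrow> 0) (at_right 0)"
proof -
  have "frac_int \<beta> f 0 = 0" using assms(3) frac_int_at_0[of \<beta> f] by (cases "\<beta> = 0") (auto simp: frac_int_def)
  moreover have "(frac_int \<beta> f \<longlongrightarrow> frac_int \<beta> f 0) (at 0 within {0..1})"
    using continuous_on_frac_int_1[OF assms(1,2)] unfolding continuous_on_def by (rule bspec) simp
  ultimately show ?thesis by (simp add: at_within_Icc_at_right)
qed

lemma powr_tendsto_0: "0 < p \<Longrightarrow> ((\<lambda>x. w * x powr p) \<longlongrightarrow> 0) (at_right (0::real))"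
  by (rule tendsto_mult_right_zero, rule tendsto_eq_rhs[OF tendsto_powr'[OF tendsto_ident_at tendsto_const]])
    (auto simp: eventually_at_filter)

text \<open>An affine remainder is excluded by the behaviour at \<open>0\<close>; for \<open>\<alpha> = 1\<close> its linear part is the
  term \<open>A * x powr (2 - \<alpha>)\<close>.\<close>

lemma affine_remainder:
  assumes \<alpha>: "\<alpha> \<le> 1" and G: "continuous_on {0<..<1} G" "\<And>x. 0 < x \<Longrightarrow> x < 1 \<Longrightarrow> \<bar>G x\<bar> \<le> M"
    and eq: "\<And>x. 0 < x \<Longrightarrow> x < 1 \<Longrightarrow> Z x - w * x powr (2 - \<alpha>) = A + B * x + frac_int 2 G x"
    and Z: "(Z \<longlongrightarrow> 0) (at_right 0)"
    and small: "\<alpha> < 1 \<Longrightarrow> B = 0"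
  obtains C where "\<And>x. 0 < x \<Longrightarrow> x < 1 \<Longrightarrow> Z x = C * x powr (2 - \<alpha>) + frac_int 2 G x"
proof -
  have "((\<lambda>x. Z x - w * x powr (2 - \<alpha>) - B * x - frac_int 2 G x) \<longlongrightarrow> 0 - 0 - B * 0 - 0) (at_right 0)"
    using \<alpha> by (intro tendsto_diff Z powr_tendsto_0 frac_int_2_limits[OF G] tendsto_intros) auto
  from at_right_const_eq[OF this, of A] have A: "A = 0" using eq by simp
  show ?thesis
  proof (cases "\<alpha> = 1")
    case True
    then show ?thesis using eq A by (intro that[of "w + B"]) (auto simp: algebra_simps)
  next
    case False
    then show ?thesis using eq A small \<alpha> by (intro that[of w]) (force simp: algebra_simps)
  qed
qed

text \<open>Serves the explicit comparison solutions, whose Caputo derivatives are known. The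
  Fourier coefficients of a difference of solutions reach the same form by another route, in
  \<open>fourier_mode_equation\<close>.\<close>

lemma caputo_twice_closed:
  assumes \<alpha>: "0 < \<alpha>" "\<alpha> \<le> 1" and f: "continuous_on {0..1} f" "f 0 = 0"
    and c1: "\<And>x. 0 < x \<Longrightarrow> x < 1 \<Longrightarrow> has_caputo \<alpha> f x"
    and c2: "\<And>x. 0 < x \<Longrightarrow> x < 1 \<Longrightarrow> has_caputo \<alpha> (caputo \<alpha> f) x"
    and eq: "\<And>x. 0 < x \<Longrightarrow> x < 1 \<Longrightarrow> caputo \<alpha> (caputo \<alpha> f) x = G x"
    and G: "continuous_on {0<..<1} G" "\<And>x. 0 < x \<Longrightarrow> x < 1 \<Longrightarrow> \<bar>G x\<bar> \<le> M"
  obtains C where "\<And>x. 0 < x \<Longrightarrow> x < 1 \<Longrightarrow> frac_int (2 - 2 * \<alpha>) f x = C * x powr (2 - \<alpha>) + frac_int 2 G x"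
proof -
  have g: "continuous_on {0<..<1} (caputo \<alpha> (caputo \<alpha> f))"
    using G(1) eq by (auto intro: continuous_on_eq)
  obtain w Q' where w0: "\<alpha> = 1 \<Longrightarrow> w = 0" and w: "\<And>x. 0 < x \<Longrightarrow> x < 1 \<Longrightarrow>
      ((\<lambda>x. frac_int (2 - 2 * \<alpha>) (\<lambda>s. f s - f 0) x - w * x powr (2 - \<alpha>)) has_field_derivative Q' x) (at x)"
    "\<And>x. 0 < x \<Longrightarrow> x < 1 \<Longrightarrow> (Q' has_field_derivative caputo \<alpha> (caputo \<alpha> f) x) (at x)"
    "\<alpha> < 1 \<Longrightarrow> ((\<lambda>x. (frac_int (2 - 2 * \<alpha>) (\<lambda>s. f s - f 0) x - w * x powr (2 - \<alpha>)) / x) \<longlongrightarrow> 0) (at_right 0)"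
    using that by (rule caputo_twice_structure[OF \<alpha> f(1) c1 c2 g, rotated -1])
  define Z where "Z = frac_int (2 - 2 * \<alpha>) f"
  have Q1: "((\<lambda>x. Z x - w * x powr (2 - \<alpha>)) has_field_derivative Q' x) (at x)" "(Q' has_field_derivative G x) (at x)"
    if "0 < x" "x < 1" for x
    using w(1,2)[OF that] f(2) eq[OF that] by (simp_all add: Z_def)
  obtain A B where AB: "\<And>x. 0 < x \<Longrightarrow> x < 1 \<Longrightarrow> Z x - w * x powr (2 - \<alpha>) = A + B * x + frac_int 2 G x"
    using that by (rule ode_second_order[OF Q1 G, rotated -1])
  have Z0: "(Z \<longlongrightarrow> 0) (at_right 0)" unfolding Z_def using \<alpha> f by (intro frac_int_tendsto_0) auto
  have "((\<lambda>x. Z x - w * x powr (2 - \<alpha>) - frac_int 2 G x - B * x) \<longlongrightarrow> 0 - 0 - 0 - B * 0) (at_right 0)"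
    using \<alpha> by (intro tendsto_diff Z0 powr_tendsto_0 frac_int_2_limits[OF G] tendsto_intros) auto
  from at_right_const_eq[OF this, of A] have A0: "A = 0" using AB by simp
  have small: "B = 0" if "\<alpha> < 1"
  proof -
    have "((\<lambda>x. (Z x - w * x powr (2 - \<alpha>)) / x - frac_int 2 G x / x) \<longlongrightarrow> 0 - 0) (at_right 0)"
      using w(3)[OF that] f(2) by (intro tendsto_diff frac_int_2_limits[OF G]) (simp add: Z_def)
    from at_right_const_eq[OF this, of B] show ?thesis using AB A0 by (simp add: diff_divide_distrib[symmetric])
  qed
  obtain C where "\<And>x. 0 < x \<Longrightarrow> x < 1 \<Longrightarrow> Z x = C * x powr (2 - \<alpha>) + frac_int 2 G x"
    using that by (rule affine_remainder[OF \<alpha>(2) G AB Z0 small, rotated -1])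
  then show ?thesis by (intro that) (simp add: Z_def)
qed

text \<open>Write I for fractional integration. As I^2 is the composition of I^(2\<alpha>) and I^(2
  - 2\<alpha>), the function Z = I^(2 - 2\<alpha>) D solves the Volterra equation Z = \<kappa> *
  I^(2\<alpha>) Z and vanishes; then I^2 D = 0, and two differentiations give D = 0.\<close>

lemma mode_homogeneous:
  assumes \<alpha>: "0 < \<alpha>" "\<alpha> \<le> 1" and D: "continuous_on {0..1} D"
    and eq: "\<And>x. 0 < x \<Longrightarrow> x < 1 \<Longrightarrow> frac_int (2 - 2 * \<alpha>) D x = \<kappa> * frac_int 2 D x" and x: "0 \<le> x" "x \<le> 1"
  shows "D x = 0"
proof -
  define Z where "Z = frac_int (2 - 2 * \<alpha>) D"
  have Zc: "continuous_on {0..1} Z" unfolding Z_def using \<alpha> D by (intro continuous_on_frac_int_1) auto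
  obtain K where "\<And>x. x \<in> {0..1} \<Longrightarrow> \<bar>Z x\<bar> \<le> K" using that by (rule continuous_on_Icc_bounded[OF Zc])
  then have K: "\<And>x. 0 < x \<Longrightarrow> x < 1 \<Longrightarrow> \<bar>Z x\<bar> \<le> K" by simp
  obtain M where "\<And>x. x \<in> {0..1} \<Longrightarrow> \<bar>D x\<bar> \<le> M" using that by (rule continuous_on_Icc_bounded[OF D])
  then have M: "\<And>x. 0 < x \<Longrightarrow> x < 1 \<Longrightarrow> \<bar>D x\<bar> \<le> M" by simp
  have Do: "continuous_on {0<..<1} D" and Zo: "continuous_on {0<..<1} Z"
    using D Zc by (auto intro: continuous_on_subset)
  have sg: "frac_int 2 D x = frac_int (2 * \<alpha>) Z x" if x: "0 < x" "x < 1" for x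
  proof (cases "\<alpha> = 1")
    case True
    have "Z = D" unfolding Z_def frac_int_def[abs_def] using True by simp
    then show ?thesis using True by simp
  next
    case False
    have "set_integrable lborel {0<..<x} (\<lambda>s. (x - s) powr (2 - 1) * D s)"
      by (intro frac_int_bounded[where M = M] continuous_imp_set_borel[OF Do]) (use M x in auto)
    then have "frac_int (2 * \<alpha>) Z x = frac_int (2 * \<alpha> + (2 - 2 * \<alpha>)) D x"
      unfolding Z_def using \<alpha> False by (intro frac_int_semigroup) auto
    then show ?thesis by simp
  qed
  have Z0: "Z x = 0" if "0 < x" "x < 1" for x
    by (rule volterra_zero[OF \<alpha> Zo K _ that]) (use eq sg in \<open>auto simp: Z_def\<close>)
  have N0: "frac_int 2 D x = 0" if x: "0 < x" "x < 1" for x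
  proof -
    have "frac_int (2 * \<alpha>) Z x = frac_int (2 * \<alpha>) (\<lambda>s. 0) x"
      using \<alpha> x Z0 by (intro frac_int_cong) auto
    then show ?thesis using sg[OF x] by (simp add: frac_int_def set_lebesgue_integral_def)
  qed
  note N = frac_int_2_deriv[OF Do M]
  have N1: "frac_int 1 D x = 0" if x: "0 < x" "x < 1" for x
  proof -
    have "((\<lambda>_. 0) has_field_derivative frac_int 1 D x) (at x)"
      by (rule has_field_derivative_transform_within_open[OF N(2)[OF _ _ x], of "{0<..<1}"]) (use N0 x in auto)
    then show ?thesis using DERIV_unique[OF _ DERIV_const] by blast
  qed
  have D0: "D x = 0" if x: "x \<in> {0<..<1}" for x
  proof -
    have "((\<lambda>_. 0) has_field_derivative D x) (at x)"
      by (rule has_field_derivative_transform_within_open[OF N(1)[of x], of "{0<..<1}"]) (use N1 x in auto)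
    then show ?thesis using DERIV_unique[OF _ DERIV_const] by blast
  qed
  have "closure {0<..<1} = {0..1::real}" by simp
  then show ?thesis
    using continuous_constant_on_closure[of "{0<..<1}" D 0 x] D D0 x by auto
qed

lemma set_integrable_kernel_continuous:
  fixes f :: "real \<Rightarrow> real"
  assumes "0 \<le> \<beta>" "continuous_on {0..1} f" "0 < x" "x < 1"
  shows "\<beta> = 0 \<or> set_integrable lborel {0<..<x} (\<lambda>s. (x - s) powr (\<beta> - 1) * f s)"
proof -
  obtain M where "\<And>s. s \<in> {0..1} \<Longrightarrow> \<bar>f s\<bar> \<le> M"
    using that by (rule continuous_on_Icc_bounded[OF assms(2)])
  moreover have "continuous_on {0<..<1} f" using assms(2) by (rule continuous_on_subset) auto
  ultimately show ?thesis
    using assms by (cases "\<beta> = 0") (auto intro!: frac_int_bounded[where M = M] continuous_imp_set_borel)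
qed

text \<open>The comparison function S has B \<noteq> 0, for otherwise it would vanish by
  \<open>mode_homogeneous\<close>. Subtracting (A / B) * S removes the power 2 - \<alpha> from the
  equation of V; hence V = (A / B) * S, and the values at 1 give A = 0.\<close>

lemma mode_unique:
  assumes \<alpha>: "0 < \<alpha>" "\<alpha> \<le> 1" and V: "continuous_on {0..1} V" "V 1 = 0"
    and Veq: "\<And>x. 0 < x \<Longrightarrow> x < 1 \<Longrightarrow> frac_int (2 - 2 * \<alpha>) V x = A * x powr (2 - \<alpha>) + \<kappa> * frac_int 2 V x"
    and S: "continuous_on {0..1} S" "S 1 \<noteq> 0"
    and Seq: "\<And>x. 0 < x \<Longrightarrow> x < 1 \<Longrightarrow> frac_int (2 - 2 * \<alpha>) S x = B * x powr (2 - \<alpha>) + \<kappa> * frac_int 2 S x"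
    and x: "0 \<le> x" "x \<le> 1"
  shows "V x = 0"
proof -
  have B: "B \<noteq> 0"
  proof
    assume "B = 0"
    then have "S 1 = 0" by (intro mode_homogeneous[OF \<alpha> S(1)]) (use Seq in auto)
    then show False using S(2) by simp
  qed
  define D where "D = (\<lambda>x. 1 * V x + (- A / B) * S x)"
  have Dc: "continuous_on {0..1} D" unfolding D_def by (intro continuous_intros V S)
  have lin: "frac_int \<beta> D x = 1 * frac_int \<beta> V x + (- A / B) * frac_int \<beta> S x" if "0 \<le> \<beta>" "0 < x" "x < 1" for \<beta> x
    unfolding D_def using set_integrable_kernel_continuous[OF that(1) V(1) that(2,3)]
      set_integrable_kernel_continuous[OF that(1) S(1) that(2,3)] by (intro frac_int_lincomb) auto
  have D0: "D x = 0" if "0 \<le> x" "x \<le> 1" for x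
  proof (rule mode_homogeneous[OF \<alpha> Dc _ that])
    fix x :: real assume x: "0 < x" "x < 1"
    show "frac_int (2 - 2 * \<alpha>) D x = \<kappa> * frac_int 2 D x"
    proof -
      have e: "frac_int (2 - 2 * \<alpha>) D x = 1 * frac_int (2 - 2 * \<alpha>) V x + (- A / B) * frac_int (2 - 2 * \<alpha>) S x"
        "frac_int 2 D x = 1 * frac_int 2 V x + (- A / B) * frac_int 2 S x" using \<alpha> x by (intro lin; simp)+
      show ?thesis unfolding e Veq[OF x] Seq[OF x] using B by (simp add: algebra_simps)
    qed
  qed
  then have "A = 0" using D0[of 1] V(2) S(2) B by (simp add: D_def)
  then show ?thesis using D0[OF x] by (simp add: D_def)
qed

section \<open>Uniqueness for the boundary value problem\<close>

text \<open>Expansion at the interior point 1/2, since no information on Q' at the end points is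
  assumed. The remainder is an integral over the fixed interval [0, 1], which allows a further
  parameter to be integrated.\<close>

lemma taylor_second:
  fixes Q Q' g :: "real \<Rightarrow> real"
  assumes Q: "\<And>x. 0 < x \<Longrightarrow> x < 1 \<Longrightarrow> (Q has_field_derivative Q' x) (at x)"
    and Q': "\<And>x. 0 < x \<Longrightarrow> x < 1 \<Longrightarrow> (Q' has_field_derivative g x) (at x)"
    and x: "0 < x" "x < 1"
  shows "Q x = Q (1/2) + Q' (1/2) * (x - 1/2) + (x - 1/2)\<^sup>2 * integral {0..1} (\<lambda>t. (1 - t) * g (1/2 + t * (x - 1/2)))"
proof -
  define h where "h = x - 1/2"
  define F where "F t = Q (1/2 + t * h) + (1 - t) * h * Q' (1/2 + t * h)" for t
  have seg: "0 < 1/2 + t * h" "1/2 + t * h < 1" if "t \<in> {0..1}" for t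
  proof -
    have "1/2 + t * h = (1 - t) * (1/2) + t * x" by (simp add: h_def field_simps)
    moreover have "0 < (1 - t) * (1/2) + t * x \<and> (1 - t) * (1/2) + t * x < 1"
    proof (cases "t = 1")
      case False
      then have t: "0 < (1 - t) * (1/2)" "0 \<le> t * x" "(1 - t) * (1/2) < (1 - t)" "t * x \<le> t"
        using that x mult_left_mono[of x 1 t] by auto
      then show ?thesis by linarith
    qed (use x in auto)
    ultimately show "0 < 1/2 + t * h" "1/2 + t * h < 1" by auto
  qed
  have "((\<lambda>t. (1 - t) * h\<^sup>2 * g (1/2 + t * h)) has_integral (F 1 - F 0)) {0..1}"
  proof (rule fundamental_theorem_of_calculus)
    fix t :: real assume t: "t \<in> {0..1}"
    have i: "((\<lambda>t. 1/2 + t * h) has_field_derivative h) (at t)" by (auto intro!: derivative_eq_intros)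
    note d1 = DERIV_chain2[where g = "\<lambda>t. 1/2 + t * h", OF Q[OF seg[OF t]] i]
      and d2 = DERIV_chain2[where g = "\<lambda>t. 1/2 + t * h", OF Q'[OF seg[OF t]] i]
    have "(F has_field_derivative (1 - t) * h\<^sup>2 * g (1/2 + t * h)) (at t)"
    proof -
      have "((\<lambda>t. (1 - t) * h) has_field_derivative - h) (at t)" by (auto intro!: derivative_eq_intros)
      from DERIV_add[OF d1 DERIV_mult[OF this d2]] show ?thesis
        unfolding F_def[abs_def] by (rule DERIV_cong) (simp add: power2_eq_square algebra_simps)
    qed
    then show "(F has_vector_derivative (1 - t) * h\<^sup>2 * g (1/2 + t * h)) (at t within {0..1})"
      by (simp add: has_real_derivative_iff_has_vector_derivative has_vector_derivative_at_within)
  qed simp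
  then have "integral {0..1} (\<lambda>t. (1 - t) * h\<^sup>2 * g (1/2 + t * h)) = F 1 - F 0" by (rule integral_unique)
  moreover have "integral {0..1} (\<lambda>t. (1 - t) * h\<^sup>2 * g (1/2 + t * h)) = h\<^sup>2 * integral {0..1} (\<lambda>t. (1 - t) * g (1/2 + t * h))"
    by (simp add: mult_ac flip: integral_mult_right)
  ultimately show ?thesis by (simp add: F_def h_def mult.commute)
qed

text \<open>The value at t minus twice the value at t / 2 eliminates B and leaves W * t powr p * k,
  where k > 0 because p > 1.\<close>

lemma two_point_bound:
  fixes W B t E p :: real
  assumes p: "1 < p" and t: "0 < t" and b: "\<bar>W * t powr p + B * t\<bar> \<le> E" "\<bar>W * (t / 2) powr p + B * (t / 2)\<bar> \<le> E"
  defines "k \<equiv> 1 - 2 powr (1 - p)"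
  shows "\<bar>W\<bar> * t powr p \<le> 3 / k * E" "\<bar>B\<bar> * t \<le> (1 + 3 / k) * E"
proof -
  have "2 powr (1 - p) < 2 powr (0::real)" using p by (intro powr_less_mono) auto
  then have k: "0 < k" by (simp add: k_def)
  have "(t / 2) powr p = 2 powr (- p) * t powr p" using t by (simp add: powr_divide powr_minus_divide)
  moreover have "2 * 2 powr (- p) = 2 powr (1 - p)" using powr_mult_base[of 2 "- p"] by simp
  ultimately have e: "W * t powr p * k = (W * t powr p + B * t) - 2 * (W * (t / 2) powr p + B * (t / 2))"
    by (simp add: k_def algebra_simps)
  have "\<bar>W * t powr p\<bar> * k = \<bar>W * t powr p * k\<bar>" using k by (simp add: abs_mult)
  also have "\<dots> \<le> 3 * E"
  proof -
    have "\<bar>a - 2 * b\<bar> \<le> 3 * E" if "\<bar>a\<bar> \<le> E" "\<bar>b\<bar> \<le> E" for a b :: real using that by linarith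
    from this[OF b] show ?thesis unfolding e .
  qed
  finally show w: "\<bar>W\<bar> * t powr p \<le> 3 / k * E" using k by (simp add: abs_mult field_simps)
  have "\<bar>B * t\<bar> \<le> \<bar>W * t powr p\<bar> + E" using b(1) by linarith
  then show "\<bar>B\<bar> * t \<le> (1 + 3 / k) * E" using w t by (simp add: abs_mult algebra_simps)
qed

text \<open>Averages of a Lipschitz function over intervals of length \<open>h j\<close> approximate it with error
  \<open>h j * x powr (2 - 2\<alpha>)\<close>, while their equation has a right-hand side of size \<open>1 / h j\<close>.
  Both errors are \<open>O(x powr (2 - \<alpha>))\<close> when \<open>h j = x powr \<alpha>\<close>; comparing consecutive scales there shows that
  the coefficients of the linear term stay bounded.\<close>

lemma dyadic_bound:
  fixes \<alpha> C h0 M :: real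
  assumes \<alpha>: "0 < \<alpha>" "\<alpha> < 1" and C: "0 \<le> C" and h0: "0 < h0" "h0 < 1"
  defines "h \<equiv> \<lambda>j::nat. h0 / 2 ^ j"
  defines "t \<equiv> \<lambda>j. h j powr (1 / \<alpha>)"
  shows "\<exists>K. \<forall>Z W B. (\<forall>x. 0 < x \<longrightarrow> x < 1 \<longrightarrow> \<bar>Z x\<bar> \<le> M) \<longrightarrow>
    (\<forall>j x. 0 < x \<longrightarrow> x < 1 \<longrightarrow> \<bar>W j * x powr (2 - \<alpha>) + B j * x - Z x\<bar> \<le> C * (h j * x powr (2 - 2 * \<alpha>) + x\<^sup>2 / h j)) \<longrightarrow>
    (\<forall>j. \<bar>Z (t j)\<bar> \<le> K * t j)"
proof -
  define p where "p = 2 - \<alpha>"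
  have p: "1 < p" "p < 2" using \<alpha> by (auto simp: p_def)
  define k where "k = 1 - 2 powr (1 - p)"
  have "2 powr (1 - p) < 2 powr (0::real)" using p by (intro powr_less_mono) auto
  then have k: "0 < k" by (simp add: k_def)
  have h: "0 < h j" "h j < 1" "h (Suc j) = h j / 2" for j
  proof -
    show "0 < h j" using h0 by (simp add: h_def)
    have "h0 / 2 ^ j \<le> h0 / 1" using h0 by (intro divide_left_mono) auto
    then show "h j < 1" unfolding h_def using h0 by linarith
    show "h (Suc j) = h j / 2" by (simp add: h_def)
  qed
  have t: "0 < t j" "t j < 1" "t j powr \<alpha> = h j" for j
  proof -
    show "0 < t j" using h(1)[of j] by (simp add: t_def)
    have "h j powr (1 / \<alpha>) < 1 powr (1 / \<alpha>)" using h[of j] \<alpha> by (intro powr_less_mono2) auto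
    then show "t j < 1" by (simp add: t_def)
    show "t j powr \<alpha> = h j" using h[of j] \<alpha> by (simp add: t_def powr_powr)
  qed
  \<comment> \<open>t (j + 1) is t j times (1/2) powr (1 / \<alpha>), so the numbers t j powr (p -
    1) form a geometric sequence of ratio \<rho>.\<close>
  define \<rho> where "\<rho> = (1 / 2) powr ((p - 1) / \<alpha>)"
  have "(1 / 2) powr ((p - 1) / \<alpha>) < 1 powr ((p - 1) / \<alpha>)" using p \<alpha> by (intro powr_less_mono2) auto
  then have \<rho>: "0 < \<rho>" "\<rho> < 1" by (auto simp: \<rho>_def)
  have tp: "t j powr (p - 1) = t 0 powr (p - 1) * \<rho> ^ j" for j
  proof (induction j)
    case (Suc j)
    have "t (Suc j) powr (p - 1) = (h j * (1 / 2)) powr ((p - 1) / \<alpha>)"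
      by (simp add: t_def h(3) powr_powr)
    also have "\<dots> = t j powr (p - 1) * \<rho>"
      using h(1)[of j] by (subst powr_mult) (simp_all add: \<rho>_def t_def powr_powr)
    finally show ?case using Suc by (simp add: mult_ac)
  qed simp
  have tp1: "t j powr (p - 1) \<le> 1" for j
    using t[of j] p powr_mono2[of "p - 1" "t j" 1] by auto
  have "(\<lambda>n. real n * \<rho> ^ n) \<longlonglongrightarrow> 0" using powser_times_n_limit_0[of \<rho>] \<rho> by simp
  then have "Bseq (\<lambda>n. real n * \<rho> ^ n)" by (intro convergent_imp_Bseq) (auto simp: convergent_def)
  then obtain R where R: "0 < R" "\<And>n. norm (real n * \<rho> ^ n) \<le> R" by (auto simp: Bseq_def)
  \<comment> \<open>6 = 2 + 4, the errors at the scales j and j + 1 for points x <= t j.\<close>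
  define C4 where "C4 = 6 * C"
  define C5 where "C5 = 3 / k * C4"
  define C7 where "C7 = (1 + 3 / k) * C4"
  have C0: "0 \<le> C4" "0 \<le> C5" "0 \<le> C7" using C k by (auto simp: C4_def C5_def C7_def)
  \<comment> \<open>\<open>E0\<close> bounds the combination W 0 * x powr p + B 0 * x on (0, 1/2].
    All constants depend on \<alpha>, C, h0 and M only, so the same \<open>K\<close> later serves
    all y.\<close>
  define E0 where "E0 = M + C * (1 + 1 / h0)"
  define W0 where "W0 = 3 / k * E0 * 2 powr p"
  define B0 where "B0 = (1 + 3 / k) * E0 * 2"
  define K where "K = W0 + C5 * R + (B0 + C7 / (1 - \<rho>)) + 2 * C"
  show ?thesis
  proof (intro exI[of _ K] allI impI)
    fix Z :: "real \<Rightarrow> real" and W B :: "nat \<Rightarrow> real" and j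
    assume Z: "\<forall>x. 0 < x \<longrightarrow> x < 1 \<longrightarrow> \<bar>Z x\<bar> \<le> M"
      and ap: "\<forall>j x. 0 < x \<longrightarrow> x < 1 \<longrightarrow> \<bar>W j * x powr (2 - \<alpha>) + B j * x - Z x\<bar> \<le> C * (h j * x powr (2 - 2 * \<alpha>) + x\<^sup>2 / h j)"
    have M0: "0 \<le> M" using Z[rule_format, of "1/2"] by force
    have E: "\<bar>W j * x powr p + B j * x - Z x\<bar> \<le> C * (h j * x powr (2 - 2 * \<alpha>) + x\<^sup>2 / h j)" if "0 < x" "x < 1" for j x
      using ap that by (simp add: p_def)
    have scale: "h j * x powr (2 - 2 * \<alpha>) \<le> t j powr p" "x\<^sup>2 / h j \<le> t j powr p" if x: "0 < x" "x \<le> t j" for x j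
    proof -
      have "h j * x powr (2 - 2 * \<alpha>) \<le> h j * t j powr (2 - 2 * \<alpha>)"
        using x h(1)[of j] \<alpha> by (intro mult_left_mono powr_mono2) auto
      also have "\<dots> = t j powr p" unfolding t(3)[of j, symmetric] by (simp add: powr_add[symmetric] p_def)
      finally show "h j * x powr (2 - 2 * \<alpha>) \<le> t j powr p" .
      have "x\<^sup>2 / h j \<le> (t j)\<^sup>2 / h j" using x h(1)[of j] by (intro divide_right_mono power_mono) auto
      also have "\<dots> = t j powr 2 / t j powr \<alpha>" using t[of j] by (simp add: powr_numeral)
      also have "\<dots> = t j powr p" by (simp add: powr_diff[symmetric] p_def)
      finally show "x\<^sup>2 / h j \<le> t j powr p" .
    qed
    have Ej: "\<bar>W j * x powr p + B j * x - Z x\<bar> \<le> 2 * C * t j powr p" if x: "0 < x" "x \<le> t j" for x j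
    proof -
      have "C * (h j * x powr (2 - 2 * \<alpha>) + x\<^sup>2 / h j) \<le> C * (t j powr p + t j powr p)"
        using scale[OF x] C by (intro mult_left_mono add_mono) auto
      then show ?thesis using E[of x j] x t(2)[of j] by simp
    qed
    have Ej1: "\<bar>W (Suc j) * x powr p + B (Suc j) * x - Z x\<bar> \<le> 4 * C * t j powr p" if x: "0 < x" "x \<le> t j" for x j
    proof -
      have "x\<^sup>2 / h (Suc j) = 2 * (x\<^sup>2 / h j)" "h (Suc j) * x powr (2 - 2 * \<alpha>) \<le> h j * x powr (2 - 2 * \<alpha>)"
        using h(1)[of j] by (simp_all add: h(3))
      then have "h (Suc j) * x powr (2 - 2 * \<alpha>) + x\<^sup>2 / h (Suc j) \<le> 4 * t j powr p"
        using scale[OF x] powr_ge_zero[of "t j" p] by linarith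
      then have "C * (h (Suc j) * x powr (2 - 2 * \<alpha>) + x\<^sup>2 / h (Suc j)) \<le> C * (4 * t j powr p)"
        using C by (intro mult_left_mono) auto
      then show ?thesis using E[of x "Suc j"] x t(2)[of j] by simp
    qed
    have D: "\<bar>(W (Suc j) - W j) * x powr p + (B (Suc j) - B j) * x\<bar> \<le> C4 * t j powr p" if x: "0 < x" "x \<le> t j" for x j
    proof -
      have "(W (Suc j) - W j) * x powr p + (B (Suc j) - B j) * x =
          (W (Suc j) * x powr p + B (Suc j) * x - Z x) - (W j * x powr p + B j * x - Z x)" by (simp add: algebra_simps)
      then show ?thesis using Ej[OF x] Ej1[OF x] unfolding C4_def by linarith
    qed
    have tt: "t j powr p = t j powr (p - 1) * t j" for j
      using powr_mult_base[of "t j" "p - 1"] t(1)[of j] by (simp add: mult.commute)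
    \<comment> \<open>Consecutive scales approximate the same Z, so their coefficients nearly agree:
      the increments of W are bounded and those of B decay geometrically. Hence W j grows at most
      linearly in j, which the geometric decay of t j powr (p - 1) compensates, and B j stays
      bounded.\<close>
    have dWB: "\<bar>W (Suc j) - W j\<bar> \<le> C5" "\<bar>B (Suc j) - B j\<bar> \<le> C7 * \<rho> ^ j" for j
    proof -
      note tb = two_point_bound[OF p(1) t(1)[of j], of "W (Suc j) - W j" "B (Suc j) - B j" "C4 * t j powr p", folded k_def]
      have x2: "0 < t j / 2" "t j / 2 \<le> t j" using t(1)[of j] by auto
      have "\<bar>W (Suc j) - W j\<bar> * t j powr p \<le> 3 / k * (C4 * t j powr p)"
        using D[of "t j" j] D[OF x2] t(1)[of j] by (intro tb) auto
      then have "\<bar>W (Suc j) - W j\<bar> * t j powr p \<le> C5 * t j powr p" by (simp add: C5_def mult_ac)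
      then show "\<bar>W (Suc j) - W j\<bar> \<le> C5" using t(1)[of j] by simp
      have "\<bar>B (Suc j) - B j\<bar> * t j \<le> (1 + 3 / k) * (C4 * t j powr p)"
        using D[of "t j" j] D[OF x2] t(1)[of j] by (intro tb) auto
      then have "\<bar>B (Suc j) - B j\<bar> * t j \<le> (C7 * t j powr (p - 1)) * t j"
        unfolding tt[of j] by (simp add: C7_def mult_ac)
      then have "\<bar>B (Suc j) - B j\<bar> \<le> C7 * t j powr (p - 1)" using t(1)[of j] by simp
      also have "\<dots> = t 0 powr (p - 1) * (C7 * \<rho> ^ j)" unfolding tp[of j] by simp
      also have "\<dots> \<le> 1 * (C7 * \<rho> ^ j)" using tp1[of 0] C0 \<rho> by (intro mult_right_mono) auto
      finally show "\<bar>B (Suc j) - B j\<bar> \<le> C7 * \<rho> ^ j" by simp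
    qed
    have base: "\<bar>W 0 * x powr p + B 0 * x\<bar> \<le> E0" if x: "0 < x" "x \<le> 1/2" for x
    proof -
      have x1: "x powr (2 - 2 * \<alpha>) \<le> 1" using x \<alpha> powr_mono2[of "2 - 2 * \<alpha>" x 1] by auto
      have "h 0 * x powr (2 - 2 * \<alpha>) \<le> 1 * 1" using h[of 0] x1 by (intro mult_mono) auto
      moreover have "x\<^sup>2 \<le> 1" using x by (simp add: power_le_one)
      then have "x\<^sup>2 / h 0 \<le> 1 / h0" using h0 by (simp add: h_def divide_right_mono)
      ultimately have "C * (h 0 * x powr (2 - 2 * \<alpha>) + x\<^sup>2 / h 0) \<le> C * (1 + 1 / h0)"
        using C by (intro mult_left_mono) auto
      moreover have "\<bar>Z x\<bar> \<le> M" using Z x by auto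
      ultimately show ?thesis using E[of x 0] x unfolding E0_def by linarith
    qed
    have "0 \<le> E0" using base[of "1/2"] by (smt (verit) field_sum_of_halves)
    have "\<bar>W 0\<bar> * (1/2) powr p \<le> 3 / k * E0" "\<bar>B 0\<bar> * (1/2) \<le> (1 + 3 / k) * E0"
      using two_point_bound[OF p(1), of "1/2" "W 0" "B 0" E0, folded k_def] base[of "1/2"] base[of "1/4"] by auto
    then have WB0: "\<bar>W 0\<bar> \<le> W0" "\<bar>B 0\<bar> \<le> B0"
      by (simp_all add: W0_def B0_def powr_divide pos_divide_le_eq)
    have Wj: "\<bar>W j\<bar> \<le> W0 + C5 * real j" for j
    proof (induction j)
      case (Suc j)
      then show ?case using dWB(1)[of j] by (simp add: algebra_simps)
    qed (use WB0 in simp)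
    have Bs: "\<bar>B j\<bar> \<le> B0 + C7 * (\<Sum>i<j. \<rho> ^ i)" for j
    proof (induction j)
      case (Suc j)
      then show ?case using dWB(2)[of j] by (simp add: algebra_simps)
    qed (use WB0 in simp)
    have Bj: "\<bar>B j\<bar> \<le> B0 + C7 / (1 - \<rho>)" for j
    proof -
      have "(\<Sum>i<j. \<rho> ^ i) = (1 - \<rho> ^ j) / (1 - \<rho>)" using \<rho> by (intro sum_gp_strict[THEN trans]) auto
      also have "\<dots> \<le> 1 / (1 - \<rho>)" using \<rho> by (intro divide_right_mono) auto
      finally have "C7 * (\<Sum>i<j. \<rho> ^ i) \<le> C7 * (1 / (1 - \<rho>))" using C0(3) by (rule mult_left_mono)
      then show ?thesis using Bs[of j] by simp
    qed
    have W00: "0 \<le> W0" using WB0(1) by linarith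
    have Wt: "\<bar>W j\<bar> * t j powr (p - 1) \<le> W0 + C5 * R"
    proof -
      have "\<bar>W j\<bar> * t j powr (p - 1) \<le> (W0 + C5 * real j) * t j powr (p - 1)"
        using Wj by (intro mult_right_mono) auto
      also have "\<dots> = W0 * t j powr (p - 1) + C5 * (t 0 powr (p - 1) * (real j * \<rho> ^ j))"
        unfolding tp[of j] by (simp add: algebra_simps)
      also have "\<dots> \<le> W0 * 1 + C5 * (1 * R)"
        using W00 C0 tp1 R(2)[of j] \<rho> by (intro add_mono mult_left_mono mult_mono) auto
      finally show ?thesis by simp
    qed
    have "\<bar>Z (t j)\<bar> \<le> \<bar>W j\<bar> * t j powr p + \<bar>B j\<bar> * t j + 2 * C * t j powr p"
    proof -
      have "\<bar>W j * t j powr p + B j * t j\<bar> \<le> \<bar>W j\<bar> * t j powr p + \<bar>B j\<bar> * t j"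
        using t(1)[of j] by (intro order_trans[OF abs_triangle_ineq]) (simp add: abs_mult)
      then show ?thesis using Ej[of "t j" j] t(1)[of j] by linarith
    qed
    also have "\<dots> = (\<bar>W j\<bar> * t j powr (p - 1) + \<bar>B j\<bar> + 2 * C * t j powr (p - 1)) * t j"
      unfolding tt[of j] by (simp add: algebra_simps)
    also have "\<dots> \<le> ((W0 + C5 * R) + (B0 + C7 / (1 - \<rho>)) + 2 * C * 1) * t j"
      using Wt Bj tp1[of j] C t(1)[of j] by (intro mult_right_mono add_mono mult_left_mono) auto
    finally show "\<bar>Z (t j)\<bar> \<le> K * t j" by (simp add: K_def)
  qed
qed

section \<open>The difference of two solutions and its equation integrated in y\<close>

lemma compact_abs_bounded:
  fixes f :: "real \<Rightarrow> real \<Rightarrow> real"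
  assumes "continuous_on ({a..b} \<times> {c..d}) (\<lambda>(x, y). f x y)"
  obtains M where "0 \<le> M" "\<And>x y. x \<in> {a..b} \<Longrightarrow> y \<in> {c..d} \<Longrightarrow> \<bar>f x y\<bar> \<le> M"
proof -
  have "bounded ((\<lambda>(x, y). f x y) ` ({a..b} \<times> {c..d}))"
    using assms by (intro compact_imp_bounded compact_continuous_image compact_Times) auto
  then obtain M where M: "\<forall>z\<in>(\<lambda>(x, y). f x y) ` ({a..b} \<times> {c..d}). norm z \<le> M" unfolding bounded_iff by blast
  show ?thesis
  proof (rule that[of "\<bar>M\<bar>"])
    fix x y assume "x \<in> {a..b}" "y \<in> {c..d}"
    then have "norm (f x y) \<le> M" using M by (intro M[rule_format]) (auto simp del: atLeastAtMost_iff)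
    then show "\<bar>f x y\<bar> \<le> \<bar>M\<bar>" by simp
  qed simp
qed

text \<open>Models the difference of two solutions. Of its Caputo derivatives only the second-order
  structure \<open>str\<close> is kept; the w and Q' provided there may depend on y without any
  regularity.\<close>

locale homogeneous_problem =
  fixes \<alpha> c \<epsilon> :: real and v vy vyy :: "real \<Rightarrow> real \<Rightarrow> real"
  assumes \<alpha>: "0 < \<alpha>" "\<alpha> \<le> 1" and \<epsilon>: "\<bar>\<epsilon>\<bar> < 1"
    and v_cont: "continuous_on ({0..1} \<times> {-pi..pi}) (\<lambda>(x, y). v x y)"
    and vy_cont: "continuous_on ({0..1} \<times> {-pi..pi}) (\<lambda>(x, y). vy x y)"
    and vyy_cont: "continuous_on ({0<..<1} \<times> {-pi<..<pi}) (\<lambda>(x, y). vyy x y)"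
    and v_deriv: "0 < x \<Longrightarrow> x < 1 \<Longrightarrow> -pi < y \<Longrightarrow> y < pi \<Longrightarrow> (v x has_field_derivative vy x y) (at y)"
    and vy_deriv: "0 < x \<Longrightarrow> x < 1 \<Longrightarrow> -pi < y \<Longrightarrow> y < pi \<Longrightarrow> (vy x has_field_derivative vyy x y) (at y)"
    and v_0: "-pi \<le> y \<Longrightarrow> y \<le> pi \<Longrightarrow> v 0 y = 0" and v_1: "-pi \<le> y \<Longrightarrow> y \<le> pi \<Longrightarrow> v 1 y = 0"
    and v_per: "0 \<le> x \<Longrightarrow> x \<le> 1 \<Longrightarrow> v x (-pi) = v x pi" and vy_per: "0 \<le> x \<Longrightarrow> x \<le> 1 \<Longrightarrow> vy x (-pi) = vy x pi"
    and str: "-pi < y \<Longrightarrow> y < pi \<Longrightarrow> \<exists>w Q'. (\<alpha> = 1 \<longrightarrow> w = 0) \<and>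
      (\<forall>x. 0 < x \<and> x < 1 \<longrightarrow>
        ((\<lambda>x. frac_int (2 - 2 * \<alpha>) (\<lambda>s. v s y) x - w * x powr (2 - \<alpha>)) has_field_derivative Q' x) (at x) \<and>
        (Q' has_field_derivative c\<^sup>2 * v x y - vyy x y + \<epsilon> * vyy x (- y)) (at x)) \<and>
      (\<alpha> < 1 \<longrightarrow> ((\<lambda>x. (frac_int (2 - 2 * \<alpha>) (\<lambda>s. v s y) x - w * x powr (2 - \<alpha>)) / x) \<longlongrightarrow> 0) (at_right 0))"
begin

text \<open>The function differentiated in \<open>str\<close> without its term w * x powr (2 -
  \<alpha>); it is jointly continuous in x and y although nothing is known about w as a function of
  y.\<close>

definition Z :: "real \<Rightarrow> real \<Rightarrow> real" where
  "Z x y = frac_int (2 - 2 * \<alpha>) (\<lambda>s. v s y) x"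

text \<open>By \<open>str\<close> this is the second x-derivative of Z x y - w * x powr (2 -
  \<alpha>).\<close>

definition g :: "real \<Rightarrow> real \<Rightarrow> real" where
  "g x y = c\<^sup>2 * v x y - vyy x y + \<epsilon> * vyy x (- y)"

lemma continuous_on_v:
  "continuous_on S p \<Longrightarrow> continuous_on S q \<Longrightarrow> p ` S \<subseteq> {0..1} \<Longrightarrow> q ` S \<subseteq> {-pi..pi} \<Longrightarrow> continuous_on S (\<lambda>z. v (p z) (q z))"
  using continuous_on_compose2[OF v_cont continuous_on_Pair[of S p q]] by (auto simp: image_subset_iff)

lemma continuous_on_vy:
  "continuous_on S p \<Longrightarrow> continuous_on S q \<Longrightarrow> p ` S \<subseteq> {0..1} \<Longrightarrow> q ` S \<subseteq> {-pi..pi} \<Longrightarrow> continuous_on S (\<lambda>z. vy (p z) (q z))"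
  using continuous_on_compose2[OF vy_cont continuous_on_Pair[of S p q]] by (auto simp: image_subset_iff)

lemma continuous_on_vyy:
  "continuous_on S p \<Longrightarrow> continuous_on S q \<Longrightarrow> p ` S \<subseteq> {0<..<1} \<Longrightarrow> q ` S \<subseteq> {-pi<..<pi} \<Longrightarrow> continuous_on S (\<lambda>z. vyy (p z) (q z))"
  using continuous_on_compose2[OF vyy_cont continuous_on_Pair[of S p q]] by (auto simp: image_subset_iff)

lemma continuous_on_g:
  assumes "continuous_on S p" "continuous_on S q" "p ` S \<subseteq> {0<..<1}" "q ` S \<subseteq> {-pi<..<pi}"
  shows "continuous_on S (\<lambda>z. g (p z) (q z))"
proof -
  have "p ` S \<subseteq> {0..1}" "q ` S \<subseteq> {-pi..pi}" "(\<lambda>z. - q z) ` S \<subseteq> {-pi<..<pi}"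
    using assms(3,4) by (force simp: image_subset_iff)+
  then show ?thesis unfolding g_def
    using assms by (intro continuous_intros continuous_on_v continuous_on_vyy) auto
qed

lemma Z_cont: "continuous_on ({0..1} \<times> {-pi..pi}) (\<lambda>(x, y). Z x y)"
  unfolding Z_def[abs_def] using \<alpha> v_cont by (intro continuous_on_frac_int) auto

lemma continuous_on_Z:
  "continuous_on S p \<Longrightarrow> continuous_on S q \<Longrightarrow> p ` S \<subseteq> {0..1} \<Longrightarrow> q ` S \<subseteq> {-pi..pi} \<Longrightarrow> continuous_on S (\<lambda>z. Z (p z) (q z))"
  using continuous_on_compose2[OF Z_cont continuous_on_Pair[of S p q]] by (auto simp: image_subset_iff)

lemma continuous_on_integral_v:
  assumes ab: "-pi \<le> a" "a \<le> b" "b \<le> pi" and \<eta>: "continuous_on {a..b} \<eta>"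
  shows "continuous_on {0..1} (\<lambda>s. integral {a..b} (\<lambda>y. v s y * \<eta> y))"
proof -
  have "continuous_on ({0..1} \<times> {a..b}) (\<lambda>z. v (fst z) (snd z) * \<eta> (snd z))"
    using ab by (intro continuous_on_mult continuous_on_v continuous_on_compose2[OF \<eta>] continuous_intros) auto
  then show ?thesis
    using integral_continuous_on_param[of "{0..1}" a b "\<lambda>s y. v s y * \<eta> y"] by (simp add: case_prod_beta)
qed

lemma Z_integral:
  assumes ab: "-pi \<le> a" "a \<le> b" "b \<le> pi" and \<eta>: "continuous_on {a..b} \<eta>" and x: "0 \<le> x" "x \<le> 1"
  shows "integral {a..b} (\<lambda>y. Z x y * \<eta> y) = frac_int (2 - 2 * \<alpha>) (\<lambda>s. integral {a..b} (\<lambda>y. v s y * \<eta> y)) x"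
proof -
  have "continuous_on ({0..1} \<times> {a..b}) (\<lambda>z. v (fst z) (snd z) * \<eta> (snd z))"
    using ab by (intro continuous_on_mult continuous_on_v continuous_on_compose2[OF \<eta>] continuous_intros) auto
  then show ?thesis
    unfolding Z_def frac_int_mult_right[symmetric]
    using frac_int_integral_swap[of "2 - 2 * \<alpha>" a b "\<lambda>s y. v s y * \<eta> y" x] ab x \<alpha> by (simp add: case_prod_beta)
qed

text \<open>As \<open>str\<close> provides w and Q' for each y separately, their continuity in y has
  to be established before integrating. Subtracting the Taylor remainder at 1/2, which is continuous
  in y, leaves an element of the span of x powr p, 1 and x - 1/2; its coefficients can be recovered
  from values at a few points and inherit the continuity.\<close>

lemma weighted_equation:
  assumes ab: "-pi < a" "a \<le> b" "b < pi" and \<eta>: "continuous_on {a..b} \<eta>"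
    and G: "continuous_on {0<..<1} G" and M: "\<And>x. 0 < x \<Longrightarrow> x < 1 \<Longrightarrow> \<bar>G x\<bar> \<le> M"
    and Geq: "\<And>x. 0 < x \<Longrightarrow> x < 1 \<Longrightarrow> integral {a..b} (\<lambda>y. g x y * \<eta> y) = G x"
  obtains W B where
    "\<And>x. 0 < x \<Longrightarrow> x < 1 \<Longrightarrow> integral {a..b} (\<lambda>y. Z x y * \<eta> y) = W * x powr (2 - \<alpha>) + B * x + frac_int 2 G x"
proof -
  define p where "p = 2 - \<alpha>"
  have p: "1 \<le> p" "\<alpha> \<noteq> 1 \<Longrightarrow> 1 < p" using \<alpha> by (auto simp: p_def)
  have "\<forall>y\<in>{a..b}. \<exists>w Q'. (\<alpha> = 1 \<longrightarrow> w = 0) \<and> (\<forall>x. 0 < x \<and> x < 1 \<longrightarrow>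
      ((\<lambda>x. Z x y - w * x powr p) has_field_derivative Q' x) (at x) \<and> (Q' has_field_derivative g x y) (at x))"
  proof
    fix y assume "y \<in> {a..b}"
    then have "-pi < y" "y < pi" using ab by auto
    from str[OF this] show "\<exists>w Q'. (\<alpha> = 1 \<longrightarrow> w = 0) \<and> (\<forall>x. 0 < x \<and> x < 1 \<longrightarrow>
      ((\<lambda>x. Z x y - w * x powr p) has_field_derivative Q' x) (at x) \<and> (Q' has_field_derivative g x y) (at x))"
      unfolding Z_def g_def p_def by (elim exE conjE) (intro exI conjI)
  qed
  from bchoice[OF this] obtain w where "\<forall>y\<in>{a..b}. \<exists>Q'. (\<alpha> = 1 \<longrightarrow> w y = 0) \<and> (\<forall>x. 0 < x \<and> x < 1 \<longrightarrow>
      ((\<lambda>x. Z x y - w y * x powr p) has_field_derivative Q' x) (at x) \<and> (Q' has_field_derivative g x y) (at x))" ..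
  from bchoice[OF this] obtain Q' where wQ: "\<forall>y\<in>{a..b}. (\<alpha> = 1 \<longrightarrow> w y = 0) \<and> (\<forall>x. 0 < x \<and> x < 1 \<longrightarrow>
      ((\<lambda>x. Z x y - w y * x powr p) has_field_derivative Q' y x) (at x) \<and> (Q' y has_field_derivative g x y) (at x))" ..
  define \<xi> where "\<xi> x t = 1/2 + t * (x - 1/2)" for x t :: real
  have \<xi>: "0 < \<xi> x t" "\<xi> x t < 1" if "0 < x" "x < 1" "t \<in> {0..1}" for x t
  proof -
    have "\<xi> x t = (1 - t) * (1/2) + t * x" by (simp add: \<xi>_def field_simps)
    moreover have "0 < (1 - t) * (1/2) + t * x \<and> (1 - t) * (1/2) + t * x < 1"
    proof (cases "t = 1")
      case False
      then have t: "0 < (1 - t) * (1/2)" "0 \<le> t * x" "(1 - t) * (1/2) < (1 - t)" "t * x \<le> t"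
        using that mult_left_mono[of x 1 t] by auto
      then show ?thesis by linarith
    qed (use that in auto)
    ultimately show "0 < \<xi> x t" "\<xi> x t < 1" by auto
  qed
  define T where "T x y = integral {0..1} (\<lambda>t. (1 - t) * g (\<xi> x t) y)" for x y
  define L where "L x y = Z x y - (x - 1/2)\<^sup>2 * T x y" for x y
  define q0 where "q0 y = Z (1/2) y - w y * (1/2) powr p" for y
  define q1 where "q1 y = Q' y (1/2)" for y
  have L: "L x y = w y * x powr p + q0 y + q1 y * (x - 1/2)" if x: "0 < x" "x < 1" and y: "y \<in> {a..b}" for x y
  proof -
    have "Z x y - w y * x powr p = (Z (1/2) y - w y * (1/2) powr p) + Q' y (1/2) * (x - 1/2) +
        (x - 1/2)\<^sup>2 * integral {0..1} (\<lambda>t. (1 - t) * g (1/2 + t * (x - 1/2)) y)"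
      by (rule taylor_second[where Q = "\<lambda>x. Z x y - w y * x powr p" and Q' = "Q' y" and g = "\<lambda>x. g x y"])
        (use wQ y x in auto)
    then show ?thesis by (simp add: L_def q0_def q1_def T_def \<xi>_def)
  qed
  have gc: "continuous_on ({a..b} \<times> {0..1}) (\<lambda>z. (1 - snd z) * g (\<xi> x (snd z)) (fst z))" if x: "0 < x" "x < 1" for x
  proof (intro continuous_on_mult continuous_on_g)
    show "continuous_on ({a..b} \<times> {0..1}) (\<lambda>z. \<xi> x (snd z))" unfolding \<xi>_def by (intro continuous_intros)
    show "(\<lambda>z. \<xi> x (snd z)) ` ({a..b} \<times> {0..1}) \<subseteq> {0<..<1}"
      using \<xi>[OF x] by (auto simp del: atLeastAtMost_iff)
  qed (use ab in \<open>auto intro!: continuous_intros\<close>)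
  have Tc: "continuous_on {a..b} (T x)" if x: "0 < x" "x < 1" for x
    using integral_continuous_on_param[of "{a..b}" 0 1 "\<lambda>y t. (1 - t) * g (\<xi> x t) y"] gc[OF x]
    by (simp add: case_prod_beta T_def[abs_def])
  have Zc: "continuous_on {a..b} (Z x)" if "0 < x" "x < 1" for x
    using ab that by (intro continuous_on_Z[where p = "\<lambda>_. x" and q = "\<lambda>y. y"] continuous_intros) auto
  have Lc: "continuous_on {a..b} (L x)" if x: "0 < x" "x < 1" for x
    unfolding L_def using Zc[OF x] Tc[OF x] by (intro continuous_intros)
  have wc: "continuous_on {a..b} w"
  proof (cases "\<alpha> = 1")
    case True
    then show ?thesis using wQ by (subst continuous_on_cong[OF refl, of _ _ "\<lambda>_. 0"]) auto
  next
    case False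
    \<comment> \<open>The weights 1, -3, 2 at the points 1/2, 1/4, 1/8 annihilate affine functions.
      On x powr p they give k = r * (1 - r) * (1 - 2 * r), which is nonzero as p > 1.\<close>
    define k where "k = (1/2) powr p - 3 * (1/4) powr p + 2 * (1/8) powr p"
    define r where "r = (1/2) powr p"
    have r: "0 < r" "r < 1/2"
      using p(2)[OF False] powr_less_mono'[of "1/2" 1 p] by (auto simp: r_def)
    have "(1/2 * (1/2)) powr p = r * r" unfolding r_def by (subst powr_mult) simp_all
    moreover have "(1/4 * (1/2)) powr p = (1/4) powr p * r" unfolding r_def by (subst powr_mult) simp_all
    ultimately have "(1/4) powr p = r * r" "(1/8) powr p = r * r * r" by simp_all
    then have "k = r * (1 - r) * (1 - 2 * r)" by (simp add: k_def r_def[symmetric] algebra_simps)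
    then have k: "k \<noteq> 0" using r by simp
    have "w y = (L (1/2) y - 3 * L (1/4) y + 2 * L (1/8) y) / k" if "y \<in> {a..b}" for y
    proof -
      have "L (1/2) y - 3 * L (1/4) y + 2 * L (1/8) y = w y * k"
        using that by (simp add: L k_def algebra_simps del: atLeastAtMost_iff)
      then show ?thesis using k by simp
    qed
    then show ?thesis
      using Lc[of "1/2"] Lc[of "1/4"] Lc[of "1/8"] k
      by (subst continuous_on_cong[OF refl, of _ _ "\<lambda>y. (L (1/2) y - 3 * L (1/4) y + 2 * L (1/8) y) / k"])
        (auto intro!: continuous_intros)
  qed
  have q0c: "continuous_on {a..b} q0" unfolding q0_def using Zc[of "1/2"] wc by (intro continuous_intros) auto
  have q1c: "continuous_on {a..b} q1"
  proof -
    have "q1 y = 4 * (q0 y + w y * (1/4) powr p - L (1/4) y)" if "y \<in> {a..b}" for y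
      using that by (simp add: L del: atLeastAtMost_iff)
    then show ?thesis
      using Lc[of "1/4"] q0c wc
      by (subst continuous_on_cong[OF refl, of _ _ "\<lambda>y. 4 * (q0 y + w y * (1/4) powr p - L (1/4) y)"])
        (auto intro!: continuous_intros)
  qed
  \<comment> \<open>The double integral of G has the same Taylor remainder as the integrated
    equation, so the two differ by a multiple of x powr p and an affine function; the constant of
    the latter is excluded by the limit at 0.\<close>
  define F where "F = frac_int 2 G"
  define F' where "F' = frac_int 1 G"
  have F: "F x = F (1/2) + F' (1/2) * (x - 1/2) + (x - 1/2)\<^sup>2 * integral {0..1} (\<lambda>t. (1 - t) * G (\<xi> x t))"
    if "0 < x" "x < 1" for x
    unfolding \<xi>_def F_def F'_def
    by (rule taylor_second[OF _ _ that, of _ _ G]) (use frac_int_2_deriv[OF G M] in auto)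
  have I: "integral {a..b} (\<lambda>y. T x y * \<eta> y) = integral {0..1} (\<lambda>t. (1 - t) * G (\<xi> x t))" if x: "0 < x" "x < 1" for x
  proof -
    have c: "continuous_on ({a..b} \<times> {0..1}) (\<lambda>z. (1 - snd z) * g (\<xi> x (snd z)) (fst z) * \<eta> (fst z))"
      by (intro continuous_on_mult[OF gc[OF x]] continuous_on_compose2[OF \<eta>] continuous_intros) auto
    have "integral {a..b} (\<lambda>y. T x y * \<eta> y) = integral {a..b} (\<lambda>y. integral {0..1} (\<lambda>t. (1 - t) * g (\<xi> x t) y * \<eta> y))"
      by (simp add: T_def)
    also have "\<dots> = integral {0..1} (\<lambda>t. integral {a..b} (\<lambda>y. (1 - t) * g (\<xi> x t) y * \<eta> y))"
      using integral_swap_continuous[of a 0 b 1 "\<lambda>y t. (1 - t) * g (\<xi> x t) y * \<eta> y"] c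
      by (simp add: case_prod_beta cbox_Pair_eq)
    also have "\<dots> = integral {0..1} (\<lambda>t. (1 - t) * G (\<xi> x t))"
      using Geq[OF \<xi>[OF x]] by (intro integral_cong) (simp add: mult.assoc)
    finally show ?thesis .
  qed
  define W Q0 Q1 where "W = integral {a..b} (\<lambda>y. w y * \<eta> y)" and "Q0 = integral {a..b} (\<lambda>y. q0 y * \<eta> y)"
    and "Q1 = integral {a..b} (\<lambda>y. q1 y * \<eta> y)"
  have main: "integral {a..b} (\<lambda>y. Z x y * \<eta> y) =
      W * x powr p + Q0 + Q1 * (x - 1/2) + (x - 1/2)\<^sup>2 * integral {0..1} (\<lambda>t. (1 - t) * G (\<xi> x t))" if x: "0 < x" "x < 1" for x
  proof -
    have hi: "((\<lambda>y. f y * \<eta> y) has_integral integral {a..b} (\<lambda>y. f y * \<eta> y)) {a..b}" if "continuous_on {a..b} f" for f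
      using that \<eta> by (intro integrable_integral integrable_continuous_interval continuous_on_mult)
    have "((\<lambda>y. w y * \<eta> y * x powr p + q0 y * \<eta> y + q1 y * \<eta> y * (x - 1/2) + (x - 1/2)\<^sup>2 * (T x y * \<eta> y)) has_integral
        (W * x powr p + Q0 + Q1 * (x - 1/2) + (x - 1/2)\<^sup>2 * integral {a..b} (\<lambda>y. T x y * \<eta> y))) {a..b}"
      unfolding W_def Q0_def Q1_def
      by (intro has_integral_add has_integral_mult_left has_integral_mult_right hi wc q0c q1c Tc x)
    moreover have "w y * \<eta> y * x powr p + q0 y * \<eta> y + q1 y * \<eta> y * (x - 1/2) + (x - 1/2)\<^sup>2 * (T x y * \<eta> y) = Z x y * \<eta> y"
      if "y \<in> {a..b}" for y
    proof -
      have e: "Z x y = w y * x powr p + q0 y + q1 y * (x - 1/2) + (x - 1/2)\<^sup>2 * T x y"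
        using L[OF x that] unfolding L_def by linarith
      show ?thesis unfolding e by (simp add: algebra_simps)
    qed
    ultimately have "((\<lambda>y. Z x y * \<eta> y) has_integral
        (W * x powr p + Q0 + Q1 * (x - 1/2) + (x - 1/2)\<^sup>2 * integral {a..b} (\<lambda>y. T x y * \<eta> y))) {a..b}"
      by (rule has_integral_eq[rotated])
    then show ?thesis unfolding I[OF x] by (rule integral_unique)
  qed
  define B where "B = Q1 - F' (1/2)"
  define A where "A = Q0 - F (1/2) - B / 2"
  have eq: "integral {a..b} (\<lambda>y. Z x y * \<eta> y) = W * x powr p + B * x + F x + A" if "0 < x" "x < 1" for x
    unfolding main[OF that] F[OF that] A_def B_def by (simp add: field_simps)
  define V where "V s = integral {a..b} (\<lambda>y. v s y * \<eta> y)" for s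
  have Vc: "continuous_on {0..1} V" unfolding V_def using ab \<eta> by (intro continuous_on_integral_v) auto
  have V0: "V 0 = 0"
  proof -
    have "V 0 = integral {a..b} (\<lambda>y. 0)" unfolding V_def using v_0 ab by (intro integral_cong) auto
    then show ?thesis by simp
  qed
  have lim: "(frac_int (2 - 2 * \<alpha>) V \<longlongrightarrow> 0) (at_right 0)" using \<alpha> Vc V0 by (intro frac_int_tendsto_0) auto
  have "((\<lambda>x. frac_int (2 - 2 * \<alpha>) V x - W * x powr p - B * x - F x) \<longlongrightarrow> 0 - 0 - B * 0 - 0) (at_right 0)"
    unfolding F_def using p by (intro tendsto_diff lim powr_tendsto_0 frac_int_2_limits(1)[OF G M] tendsto_intros) auto
  from at_right_const_eq[OF this, of A] have A0: "A = 0"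
  proof (simp, elim meta_mp)
    fix x :: real assume x: "0 < x" "x < 1"
    have "integral {a..b} (\<lambda>y. Z x y * \<eta> y) = frac_int (2 - 2 * \<alpha>) V x"
      unfolding V_def using ab \<eta> x by (intro Z_integral) auto
    then show "frac_int (2 - 2 * \<alpha>) V x - W * x powr p - B * x - F x = A" using eq[OF x] by simp
  qed
  show ?thesis using eq by (intro that[of W B]) (simp add: A0 p_def F_def)
qed

end

section \<open>Exclusion of the linear term by comparing scales\<close>

context homogeneous_problem
begin

text \<open>The term w * x powr (2 - \<alpha>) is o(x) for \<alpha> < 1. The limit is pointwise in
  y; a bound uniform in y comes from \<open>Z_dyadic_bound\<close>.\<close>

lemma Z_over_x:
  assumes \<alpha>1: "\<alpha> < 1" and y: "-pi < y" "y < pi"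
  shows "((\<lambda>x. Z x y / x) \<longlongrightarrow> 0) (at_right 0)"
proof -
  obtain w where "((\<lambda>x. (Z x y - w * x powr (2 - \<alpha>)) / x) \<longlongrightarrow> 0) (at_right 0)"
    using str[OF y] \<alpha>1 unfolding Z_def by blast
  then have "((\<lambda>x. (Z x y - w * x powr (2 - \<alpha>)) / x + w * x powr (1 - \<alpha>)) \<longlongrightarrow> 0 + 0) (at_right 0)"
    using \<alpha>1 by (intro tendsto_add powr_tendsto_0) auto
  moreover have "eventually (\<lambda>x. (Z x y - w * x powr (2 - \<alpha>)) / x + w * x powr (1 - \<alpha>) = Z x y / x) (at_right 0)"
    unfolding eventually_at_filter
  proof (intro always_eventually allI impI)
    fix x :: real assume "x \<noteq> 0" "x \<in> {0<..}"
    then have x: "0 < x" by simp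
    have "x powr (2 - \<alpha>) = x * x powr (1 - \<alpha>)" using powr_mult_base[of x "1 - \<alpha>"] x by simp
    then show "(Z x y - w * x powr (2 - \<alpha>)) / x + w * x powr (1 - \<alpha>) = Z x y / x" using x by (simp add: field_simps)
  qed
  ultimately show ?thesis using tendsto_cong by force
qed

text \<open>v is Lipschitz in y because its y-derivative is bounded, and the fractional integral of
  order 2 - 2\<alpha> of a constant supplies the power of x.\<close>

lemma Z_lipschitz:
  assumes \<alpha>1: "\<alpha> < 1"
  obtains K where "0 \<le> K"
    and "\<And>x y y'. 0 < x \<Longrightarrow> x < 1 \<Longrightarrow> y \<in> {-pi<..<pi} \<Longrightarrow> y' \<in> {-pi<..<pi} \<Longrightarrow> \<bar>Z x y' - Z x y\<bar> \<le> K * \<bar>y' - y\<bar> * x powr (2 - 2 * \<alpha>)"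
proof -
  obtain M where M: "0 \<le> M" "\<And>x y. x \<in> {0..1} \<Longrightarrow> y \<in> {-pi..pi} \<Longrightarrow> \<bar>vy x y\<bar> \<le> M"
    using that by (rule compact_abs_bounded[OF vy_cont])
  show ?thesis
  proof (rule that[of "M / Gamma (3 - 2 * \<alpha>)"])
    show "0 \<le> M / Gamma (3 - 2 * \<alpha>)" using M(1) \<alpha>1 Gamma_real_pos[of "3 - 2 * \<alpha>"] by simp
    fix x y y' :: real assume x: "0 < x" "x < 1" and y: "y \<in> {-pi<..<pi}" "y' \<in> {-pi<..<pi}"
    have lip: "\<bar>v s y' - v s y\<bar> \<le> M * \<bar>y' - y\<bar>" if s: "0 < s" "s < 1" for s
    proof -
      have "norm (v s y' - v s y) \<le> M * norm (y' - y)"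
      proof (rule field_differentiable_bound[where S = "{-pi<..<pi}" and f' = "vy s"])
        fix z assume z: "z \<in> {-pi<..<pi}"
        then show "(v s has_field_derivative vy s z) (at z within {-pi<..<pi})"
          using v_deriv[OF s, of z] by (auto intro: has_field_derivative_at_within)
        show "norm (vy s z) \<le> M" using M(2)[of s z] s z by auto
      qed (use y in auto)
      then show ?thesis by simp
    qed
    have c: "continuous_on {0..1} (\<lambda>s. v s z)" if "z \<in> {-pi<..<pi}" for z
      using that by (intro continuous_on_v continuous_intros) auto
    have si: "2 - 2 * \<alpha> = 0 \<or> set_integrable lborel {0<..<x} (\<lambda>s. (x - s) powr (2 - 2 * \<alpha> - 1) * v s z)"
      if "z \<in> {-pi<..<pi}" for z using set_integrable_kernel_continuous[OF _ c[OF that] x, of "2 - 2 * \<alpha>"] \<alpha> by simp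
    have "Z x y' - Z x y = frac_int (2 - 2 * \<alpha>) (\<lambda>s. 1 * v s y' + (-1) * v s y) x"
      unfolding Z_def using si[OF y(1)] si[OF y(2)] by (subst frac_int_lincomb) auto
    also have "\<bar>\<dots>\<bar> \<le> (M * \<bar>y' - y\<bar>) * x powr (2 - 2 * \<alpha>) / Gamma (2 - 2 * \<alpha> + 1)"
    proof (rule frac_int_bounded(2))
      have "continuous_on {0<..<1} (\<lambda>s. 1 * v s y' + (-1) * v s y)"
        by (intro continuous_intros continuous_on_subset[OF c] y) auto
      then show "set_borel_measurable lborel {0<..<x} (\<lambda>s. 1 * v s y' + (-1) * v s y)"
        using x by (intro continuous_imp_set_borel) auto
      show "\<bar>1 * v s y' + - 1 * v s y\<bar> \<le> M * \<bar>y' - y\<bar>" if "s \<in> {0<..<x}" for s using lip[of s] that x by auto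
    qed (use \<alpha>1 x in auto)
    finally show "\<bar>Z x y' - Z x y\<bar> \<le> M / Gamma (3 - 2 * \<alpha>) * \<bar>y' - y\<bar> * x powr (2 - 2 * \<alpha>)"
      by (simp add: algebra_simps)
  qed
qed

lemma vyy_integrals:
  assumes x: "0 < x" "x < 1" and ab: "-pi < a" "a \<le> b" "b < pi"
  shows "(vyy x has_integral (vy x b - vy x a)) {a..b}"
    and "((\<lambda>y. vyy x (- y)) has_integral (vy x (- a) - vy x (- b))) {a..b}"
proof -
  show "(vyy x has_integral (vy x b - vy x a)) {a..b}"
    using vy_deriv[OF x] ab
    by (intro fundamental_theorem_of_calculus)
      (auto simp: has_real_derivative_iff_has_vector_derivative[symmetric] intro: has_field_derivative_at_within)
  have d: "((\<lambda>y. - vy x (- y)) has_field_derivative vyy x (- y)) (at y)" if "y \<in> {a..b}" for y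
  proof -
    have "(vy x has_field_derivative vyy x (- y)) (at (- y))" using vy_deriv[OF x, of "- y"] that ab by auto
    moreover have "(uminus has_field_derivative - 1) (at y)" by (auto intro!: derivative_eq_intros)
    ultimately have "((\<lambda>y. vy x (- y)) has_field_derivative vyy x (- y) * (- 1)) (at y)" by (rule DERIV_chain2)
    from DERIV_minus[OF this] show ?thesis by simp
  qed
  have "((\<lambda>y. vyy x (- y)) has_integral (- vy x (- b) - - vy x (- a))) {a..b}"
    using d ab by (intro fundamental_theorem_of_calculus)
      (auto simp: has_real_derivative_iff_has_vector_derivative[symmetric] intro: has_field_derivative_at_within)
  then show "((\<lambda>y. vyy x (- y)) has_integral (vy x (- a) - vy x (- b))) {a..b}" by simp
qed

text \<open>Over a box the second y-derivative integrates to a difference of values of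
  \<open>vy\<close>, hence stays bounded even if \<open>vyy\<close> is not. That C does not depend
  on y and h makes the averages over shrinking boxes comparable.\<close>

lemma box_equation:
  obtains C where "0 \<le> C"
    and "\<And>y h. -pi < y \<Longrightarrow> 0 < h \<Longrightarrow> h < 1 \<Longrightarrow> y + h < pi \<Longrightarrow>
      \<exists>W B. \<forall>x. 0 < x \<and> x < 1 \<longrightarrow> \<bar>integral {y..y+h} (Z x) - (W * x powr (2 - \<alpha>) + B * x)\<bar> \<le> C * x\<^sup>2"
proof -
  obtain M where M: "0 \<le> M" "\<And>x y. x \<in> {0..1} \<Longrightarrow> y \<in> {-pi..pi} \<Longrightarrow> \<bar>v x y\<bar> \<le> M"
    using that by (rule compact_abs_bounded[OF v_cont])
  obtain N where N: "0 \<le> N" "\<And>x y. x \<in> {0..1} \<Longrightarrow> y \<in> {-pi..pi} \<Longrightarrow> \<bar>vy x y\<bar> \<le> N"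
    using that by (rule compact_abs_bounded[OF vy_cont])
  \<comment> \<open>4 * N: two values of \<open>vy\<close> from the box and two from its reflection,
    the latter with the factor |\<epsilon>| < 1.\<close>
  define C where "C = c\<^sup>2 * M + 4 * N"
  show ?thesis
  proof (rule that[of C])
    show "0 \<le> C" using M(1) N(1) by (simp add: C_def)
    fix y h assume y: "-pi < y" and h: "0 < h" "h < 1" and yh: "y + h < pi"
    define G where "G x = c\<^sup>2 * integral {y..y+h} (v x) - (vy x (y + h) - vy x y) + \<epsilon> * (vy x (- y) - vy x (- (y + h)))" for x
    have vc: "continuous_on {y..y+h} (v x)" if "0 < x" "x < 1" for x
      using that y yh by (intro continuous_on_v[where p = "\<lambda>_. x" and q = "\<lambda>y. y"] continuous_intros) auto
    have Geq: "integral {y..y+h} (\<lambda>z. g x z * 1) = G x" if x: "0 < x" "x < 1" for x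
    proof -
      have "((\<lambda>z. c\<^sup>2 * v x z - vyy x z + \<epsilon> * vyy x (- z)) has_integral G x) {y..y+h}"
        unfolding G_def using vyy_integrals[OF x, of y "y + h"] y h yh vc[OF x]
        by (intro has_integral_add has_integral_diff has_integral_mult_right integrable_integral integrable_continuous_interval) auto
      then show ?thesis unfolding g_def mult_1_right by (rule integral_unique)
    qed
    have "continuous_on {0<..<1} (\<lambda>s. integral {y..y+h} (\<lambda>z. v s z * 1))"
      using y h yh by (intro continuous_on_subset[OF continuous_on_integral_v]) auto
    then have Gc: "continuous_on {0<..<1} G"
      unfolding G_def[abs_def] using y h yh by (intro continuous_intros continuous_on_vy) auto
    have GC: "\<bar>G x\<bar> \<le> C" if x: "0 < x" "x < 1" for x
    proof -
      have "norm (integral {y..y+h} (v x)) \<le> M * (y + h - y)"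
        using M(2)[of x] x y h yh by (intro integral_bound vc) auto
      also have "\<dots> \<le> M * 1" using M(1) h by (intro mult_left_mono) auto
      finally have "c\<^sup>2 * \<bar>integral {y..y+h} (v x)\<bar> \<le> c\<^sup>2 * M" by (intro mult_left_mono) auto
      then have 1: "\<bar>c\<^sup>2 * integral {y..y+h} (v x)\<bar> \<le> c\<^sup>2 * M" by (simp add: abs_mult)
      have n: "\<bar>vy x z\<bar> \<le> N" if "-pi \<le> z" "z \<le> pi" for z using N(2)[of x z] x that by auto
      have "\<bar>\<epsilon> * (vy x (- y) - vy x (- (y + h)))\<bar> \<le> 1 * (2 * N)"
        unfolding abs_mult using \<epsilon> n[of "- y"] n[of "- (y + h)"] y h yh by (intro mult_mono) auto
      then show ?thesis unfolding G_def C_def using 1 n[of y] n[of "y + h"] y h yh by linarith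
    qed
    have ab: "y \<le> y + h" using h by simp
    obtain W B where WB: "\<And>x. 0 < x \<Longrightarrow> x < 1 \<Longrightarrow> integral {y..y+h} (\<lambda>z. Z x z * 1) = W * x powr (2 - \<alpha>) + B * x + frac_int 2 G x"
      using that by (rule weighted_equation[OF y ab yh continuous_on_const Gc GC Geq, rotated -1])
    have "\<bar>integral {y..y+h} (Z x) - (W * x powr (2 - \<alpha>) + B * x)\<bar> \<le> C * x\<^sup>2" if x: "0 < x" "x < 1" for x
      using frac_int_2_deriv(3)[OF Gc GC x] WB[OF x] by simp
    then show "\<exists>W B. \<forall>x. 0 < x \<and> x < 1 \<longrightarrow> \<bar>integral {y..y+h} (Z x) - (W * x powr (2 - \<alpha>) + B * x)\<bar> \<le> C * x\<^sup>2"
      by blast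
  qed
qed

text \<open>Averages over boxes of width h j satisfy the hypothesis of \<open>dyadic_bound\<close>:
  the Lipschitz estimate gives the error h j * x powr (2 - 2 * \<alpha>), and dividing the box
  equation by h j gives the error x^2 / h j.\<close>

lemma Z_dyadic_bound:
  assumes \<alpha>1: "\<alpha> < 1" and ab: "-pi < a" "a \<le> b" "b < pi"
  obtains t :: "nat \<Rightarrow> real" and K where "\<And>j. 0 < t j" "\<And>j. t j < 1" "t \<longlonglongrightarrow> 0"
    and "\<And>j y. y \<in> {a..b} \<Longrightarrow> \<bar>Z (t j) y\<bar> \<le> K * t j"
proof -
  obtain M where M: "0 \<le> M" "\<And>x y. x \<in> {0..1} \<Longrightarrow> y \<in> {-pi..pi} \<Longrightarrow> \<bar>Z x y\<bar> \<le> M"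
    using that by (rule compact_abs_bounded[OF Z_cont])
  obtain C1 where C1: "0 \<le> C1" "\<And>y h. -pi < y \<Longrightarrow> 0 < h \<Longrightarrow> h < 1 \<Longrightarrow> y + h < pi \<Longrightarrow>
      \<exists>W B. \<forall>x. 0 < x \<and> x < 1 \<longrightarrow> \<bar>integral {y..y+h} (Z x) - (W * x powr (2 - \<alpha>) + B * x)\<bar> \<le> C1 * x\<^sup>2"
    using that by (rule box_equation)
  obtain C2 where C2: "0 \<le> C2" "\<And>x y y'. 0 < x \<Longrightarrow> x < 1 \<Longrightarrow> y \<in> {-pi<..<pi} \<Longrightarrow> y' \<in> {-pi<..<pi} \<Longrightarrow>
      \<bar>Z x y' - Z x y\<bar> \<le> C2 * \<bar>y' - y\<bar> * x powr (2 - 2 * \<alpha>)"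
    using that by (rule Z_lipschitz[OF \<alpha>1])
  define C where "C = C1 + C2"
  have C: "0 \<le> C" using C1 C2 by (simp add: C_def)
  \<comment> \<open>Boxes start at a point of [a, b] and extend to the right, so their width has to
    stay below pi - b; \<open>box_equation\<close> also asks for a width below 1.\<close>
  define h0 where "h0 = min (1/2) ((pi - b) / 2)"
  have h0: "0 < h0" "h0 < 1" "b + h0 < pi" using ab by (auto simp: h0_def min_def field_simps)
  define h where "h j = h0 / 2 ^ j" for j :: nat
  define t where "t j = h j powr (1 / \<alpha>)" for j
  have h: "0 < h j" "h j \<le> h0" for j
  proof -
    show "0 < h j" using h0 by (simp add: h_def)
    have "h0 / 2 ^ j \<le> h0 / 1" using h0 by (intro divide_left_mono) auto
    then show "h j \<le> h0" by (simp add: h_def)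
  qed
  obtain K where K: "\<forall>Z W B. (\<forall>x. 0 < x \<longrightarrow> x < 1 \<longrightarrow> \<bar>Z x\<bar> \<le> M) \<longrightarrow>
    (\<forall>j x. 0 < x \<longrightarrow> x < 1 \<longrightarrow> \<bar>W j * x powr (2 - \<alpha>) + B j * x - Z x\<bar> \<le> C * (h j * x powr (2 - 2 * \<alpha>) + x\<^sup>2 / h j)) \<longrightarrow>
    (\<forall>j. \<bar>Z (t j)\<bar> \<le> K * t j)"
    using dyadic_bound[OF \<alpha>(1) \<alpha>1 C h0(1,2), of M] unfolding h_def t_def by (rule exE)
  show ?thesis
  proof (rule that[of t K])
    show "0 < t j" for j using h(1)[of j] by (simp add: t_def)
    show "t j < 1" for j
    proof -
      have "h j powr (1 / \<alpha>) < 1 powr (1 / \<alpha>)" using h[of j] h0 \<alpha> by (intro powr_less_mono2) auto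
      then show ?thesis by (simp add: t_def)
    qed
    have "h \<longlonglongrightarrow> 0" unfolding h_def using LIMSEQ_divide_realpow_zero[of 2 h0] by simp
    then have "(\<lambda>j. h j powr (1 / \<alpha>)) \<longlonglongrightarrow> 0 powr (1 / \<alpha>)"
      using \<alpha> h(1) by (intro tendsto_powr') (auto intro!: always_eventually less_imp_le)
    then show "t \<longlonglongrightarrow> 0" by (simp add: t_def[abs_def])
    fix j y assume y: "y \<in> {a..b}"
    have "\<exists>W B. \<forall>x. 0 < x \<longrightarrow> x < 1 \<longrightarrow>
        \<bar>W * x powr (2 - \<alpha>) + B * x - Z x y\<bar> \<le> C * (h j * x powr (2 - 2 * \<alpha>) + x\<^sup>2 / h j)" for j
    proof -
      have yh: "-pi < y" "0 < h j" "h j < 1" "y + h j < pi" using y ab h[of j] h0 by auto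
      obtain W B where WB: "\<forall>x. 0 < x \<and> x < 1 \<longrightarrow> \<bar>integral {y..y+h j} (Z x) - (W * x powr (2 - \<alpha>) + B * x)\<bar> \<le> C1 * x\<^sup>2"
        using C1(2)[OF yh] by blast
      have "\<bar>W / h j * x powr (2 - \<alpha>) + B / h j * x - Z x y\<bar> \<le> C * (h j * x powr (2 - 2 * \<alpha>) + x\<^sup>2 / h j)"
        if x: "0 < x" "x < 1" for x
      proof -
        have Zc: "continuous_on {y..y+h j} (Z x)"
          using x yh by (intro continuous_on_Z[where p = "\<lambda>_. x" and q = "\<lambda>y. y"] continuous_intros) auto
        have "norm (integral {y..y+h j} (\<lambda>z. Z x z - Z x y)) \<le> (C2 * h j * x powr (2 - 2 * \<alpha>)) * (y + h j - y)"
        proof (rule integral_bound)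
          fix z assume z: "z \<in> {y..y+h j}"
          have "\<bar>Z x z - Z x y\<bar> \<le> C2 * \<bar>z - y\<bar> * x powr (2 - 2 * \<alpha>)" using C2(2)[OF x, of y z] z yh by auto
          also have "\<dots> \<le> C2 * h j * x powr (2 - 2 * \<alpha>)" using z C2(1) by (intro mult_right_mono mult_left_mono) auto
          finally show "norm (Z x z - Z x y) \<le> C2 * h j * x powr (2 - 2 * \<alpha>)" by simp
        qed (use Zc yh in \<open>auto intro!: continuous_intros\<close>)
        moreover have "integral {y..y+h j} (\<lambda>z. Z x z - Z x y) = integral {y..y+h j} (Z x) - h j * Z x y"
          using Zc yh by (subst integral_diff) (auto intro: integrable_continuous_interval)
        moreover have "\<bar>integral {y..y+h j} (Z x) - (W * x powr (2 - \<alpha>) + B * x)\<bar> \<le> C1 * x\<^sup>2" using WB x by blast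
        ultimately have "\<bar>W * x powr (2 - \<alpha>) + B * x - h j * Z x y\<bar> \<le> C1 * x\<^sup>2 + C2 * h j * x powr (2 - 2 * \<alpha>) * h j"
          by simp
        then have "\<bar>W * x powr (2 - \<alpha>) + B * x - h j * Z x y\<bar> / h j \<le> (C1 * x\<^sup>2 + C2 * h j * x powr (2 - 2 * \<alpha>) * h j) / h j"
          using yh by (intro divide_right_mono) auto
        moreover have "\<bar>W * x powr (2 - \<alpha>) + B * x - h j * Z x y\<bar> / h j = \<bar>W / h j * x powr (2 - \<alpha>) + B / h j * x - Z x y\<bar>"
        proof -
          have "(W * x powr (2 - \<alpha>) + B * x - h j * Z x y) / h j = W / h j * x powr (2 - \<alpha>) + B / h j * x - Z x y"
            using yh by (simp add: field_simps)
          then show ?thesis using yh by (metis abs_divide abs_of_pos)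
        qed
        moreover have "(C1 * x\<^sup>2 + C2 * h j * x powr (2 - 2 * \<alpha>) * h j) / h j = C1 * (x\<^sup>2 / h j) + C2 * (h j * x powr (2 - 2 * \<alpha>))"
          using yh by (simp add: field_simps)
        moreover have "0 \<le> C2 * (x\<^sup>2 / h j)" "0 \<le> C1 * (h j * x powr (2 - 2 * \<alpha>))"
          using C1(1) C2(1) yh by auto
        ultimately show ?thesis unfolding C_def distrib_left distrib_right by linarith
      qed
      then show ?thesis by blast
    qed
    then have "\<forall>j. \<exists>W. \<exists>B. \<forall>x. 0 < x \<longrightarrow> x < 1 \<longrightarrow>
        \<bar>W * x powr (2 - \<alpha>) + B * x - Z x y\<bar> \<le> C * (h j * x powr (2 - 2 * \<alpha>) + x\<^sup>2 / h j)" by (rule allI)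
    from choice[OF this] obtain W where "\<forall>j. \<exists>B. \<forall>x. 0 < x \<longrightarrow> x < 1 \<longrightarrow>
        \<bar>W j * x powr (2 - \<alpha>) + B * x - Z x y\<bar> \<le> C * (h j * x powr (2 - 2 * \<alpha>) + x\<^sup>2 / h j)" ..
    from choice[OF this] obtain B where WB: "\<forall>j. \<forall>x. 0 < x \<longrightarrow> x < 1 \<longrightarrow>
        \<bar>W j * x powr (2 - \<alpha>) + B j * x - Z x y\<bar> \<le> C * (h j * x powr (2 - 2 * \<alpha>) + x\<^sup>2 / h j)" ..
    have "\<forall>x. 0 < x \<longrightarrow> x < 1 \<longrightarrow> \<bar>Z x y\<bar> \<le> M" using M(2)[of _ y] y ab by auto
    from K[rule_format (no_asm), of "\<lambda>x. Z x y" W B, OF this WB] show "\<bar>Z (t j) y\<bar> \<le> K * t j" by simp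
  qed
qed

text \<open>For \<alpha> < 1 the coefficient B vanishes by dominated convergence along t j: Z (t j)
  y / t j tends to 0 for each y and is bounded uniformly in y. For \<alpha> = 1 the linear term is
  itself a multiple of x powr (2 - \<alpha>).\<close>

lemma weighted_homogeneous:
  assumes ab: "-pi < a" "a \<le> b" "b < pi" and \<eta>: "continuous_on {a..b} \<eta>"
    and G: "continuous_on {0<..<1} G" and M: "\<And>x. 0 < x \<Longrightarrow> x < 1 \<Longrightarrow> \<bar>G x\<bar> \<le> M"
    and Geq: "\<And>x. 0 < x \<Longrightarrow> x < 1 \<Longrightarrow> integral {a..b} (\<lambda>y. g x y * \<eta> y) = G x"
  obtains W where "\<And>x. 0 < x \<Longrightarrow> x < 1 \<Longrightarrow> integral {a..b} (\<lambda>y. Z x y * \<eta> y) = W * x powr (2 - \<alpha>) + frac_int 2 G x"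
proof -
  obtain W B where WB: "\<And>x. 0 < x \<Longrightarrow> x < 1 \<Longrightarrow> integral {a..b} (\<lambda>y. Z x y * \<eta> y) = W * x powr (2 - \<alpha>) + B * x + frac_int 2 G x"
    using that by (rule weighted_equation[OF ab \<eta> G M Geq, rotated -1])
  show ?thesis
  proof (cases "\<alpha> = 1")
    case True
    then show ?thesis using WB by (intro that[of "W + B"]) (auto simp: algebra_simps)
  next
    case False
    then have \<alpha>1: "\<alpha> < 1" using \<alpha> by simp
    obtain t :: "nat \<Rightarrow> real" and K where t: "\<And>j. 0 < t j" "\<And>j. t j < 1" "t \<longlonglongrightarrow> 0"
      and K: "\<And>j y. y \<in> {a..b} \<Longrightarrow> \<bar>Z (t j) y\<bar> \<le> K * t j"
      using that by (rule Z_dyadic_bound[OF \<alpha>1 ab])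
    have tr: "filterlim t (at_right 0) sequentially"
      using t(1,3) by (auto simp: filterlim_at less_imp_neq[THEN not_sym])
    have "(\<lambda>j. integral {a..b} (\<lambda>y. Z (t j) y / t j * \<eta> y)) \<longlonglongrightarrow> integral {a..b} (\<lambda>y. 0)"
    proof (rule dominated_convergence(2)[where h = "\<lambda>y. K * \<bar>\<eta> y\<bar>"])
      fix j
      have "continuous_on {a..b} (Z (t j))"
        using t(1)[of j] t(2)[of j] ab by (intro continuous_on_Z[where p = "\<lambda>_. t j" and q = "\<lambda>y. y"] continuous_intros) auto
      then show "(\<lambda>y. Z (t j) y / t j * \<eta> y) integrable_on {a..b}"
        using t(1)[of j] \<eta> by (intro integrable_continuous_interval continuous_intros) auto
      show "(\<lambda>y. K * \<bar>\<eta> y\<bar>) integrable_on {a..b}" using \<eta> by (intro integrable_continuous_interval continuous_intros)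
      fix y assume y: "y \<in> {a..b}"
      have "\<bar>Z (t j) y / t j\<bar> \<le> K" using K[OF y, of j] t(1)[of j] by (simp add: field_simps)
      then have "\<bar>Z (t j) y / t j\<bar> * \<bar>\<eta> y\<bar> \<le> K * \<bar>\<eta> y\<bar>" by (intro mult_right_mono) auto
      then show "norm (Z (t j) y / t j * \<eta> y) \<le> K * \<bar>\<eta> y\<bar>" by (simp add: abs_mult)
    next
      fix y assume y: "y \<in> {a..b}"
      have "(\<lambda>j. Z (t j) y / t j) \<longlonglongrightarrow> 0"
        using filterlim_compose[OF Z_over_x[OF \<alpha>1] tr] y ab by auto
      then show "(\<lambda>j. Z (t j) y / t j * \<eta> y) \<longlonglongrightarrow> 0" by (rule tendsto_mult_left_zero)
    qed
    then have l1: "(\<lambda>j. integral {a..b} (\<lambda>y. Z (t j) y / t j * \<eta> y)) \<longlonglongrightarrow> 0" by simp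
    have e: "integral {a..b} (\<lambda>y. Z (t j) y / t j * \<eta> y) = W * t j powr (1 - \<alpha>) + B + frac_int 2 G (t j) / t j" for j
    proof -
      have "integral {a..b} (\<lambda>y. Z (t j) y / t j * \<eta> y) = integral {a..b} (\<lambda>y. Z (t j) y * \<eta> y) / t j"
        by (simp flip: integral_divide)
      moreover have "t j powr (2 - \<alpha>) = t j * t j powr (1 - \<alpha>)" using powr_mult_base[of "t j" "1 - \<alpha>"] t(1)[of j] by simp
      ultimately show ?thesis using WB[OF t(1) t(2), of j] t(1)[of j] by (simp add: field_simps)
    qed
    have "(\<lambda>j. W * t j powr (1 - \<alpha>) + B + frac_int 2 G (t j) / t j) \<longlonglongrightarrow> 0 + B + 0"
      using \<alpha>1 by (intro tendsto_add tendsto_const filterlim_compose[OF powr_tendsto_0 tr] filterlim_compose[OF frac_int_2_limits(2)[OF G M] tr]) auto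
    then have "B = 0" using LIMSEQ_unique[OF l1] unfolding e by simp
    then show ?thesis using WB by (intro that[of W]) auto
  qed
qed

end

lemma caputo_eigenfunction_closed:
  assumes \<alpha>: "0 < \<alpha>" "\<alpha> \<le> 1" and S: "continuous_on {0..1} S" "S 0 = 0"
    and S1: "\<And>x. 0 < x \<Longrightarrow> has_caputo \<alpha> S x" "\<And>x. 0 < x \<Longrightarrow> caputo \<alpha> S x = D x"
    and D: "\<And>x. 0 < x \<Longrightarrow> has_caputo \<alpha> D x" "\<And>x. 0 < x \<Longrightarrow> caputo \<alpha> D x = k * S x"
  obtains B where "\<And>x. 0 < x \<Longrightarrow> x < 1 \<Longrightarrow> frac_int (2 - 2 * \<alpha>) S x = B * x powr (2 - \<alpha>) + k * frac_int 2 S x"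
proof -
  have e: "has_caputo \<alpha> (caputo \<alpha> S) x" "caputo \<alpha> (caputo \<alpha> S) x = S x * k" if "0 < x" "x < 1" for x
    using caputo_cong[OF that(2) _ that(1), of "caputo \<alpha> S" D] S1(2) D that by (simp_all add: mult.commute)
  have c: "continuous_on {0..1} (\<lambda>x. S x * k)" using S by (intro continuous_intros)
  obtain M where M: "\<And>x. x \<in> {0..1} \<Longrightarrow> \<bar>S x * k\<bar> \<le> M" using that by (rule continuous_on_Icc_bounded[OF c])
  have co: "continuous_on {0<..<1} (\<lambda>x. S x * k)" using c by (rule continuous_on_subset) auto
  obtain B where "\<And>x. 0 < x \<Longrightarrow> x < 1 \<Longrightarrow>
      frac_int (2 - 2 * \<alpha>) S x = B * x powr (2 - \<alpha>) + frac_int 2 (\<lambda>x. S x * k) x"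
    using that
  proof (rule caputo_twice_closed[OF \<alpha> S _ _ _ co, rotated -1])
    show "\<bar>S x * k\<bar> \<le> M" if "0 < x" "x < 1" for x using M that by simp
  qed (use S1 e in auto)
  then show ?thesis unfolding frac_int_mult_right by (intro that[of B]) (simp add: mult.commute)
qed

text \<open>The comparison function for \<open>mode_unique\<close> is the mode with the value 0 at x
  = 0 and the value 1 at x = 1.\<close>

lemma mode_comparison:
  assumes \<alpha>: "0 < \<alpha>" "\<alpha> \<le> 1" and \<epsilon>: "\<bar>\<epsilon>\<bar> < 1"
  obtains S B where "continuous_on {0..1} S" "S 1 = 1"
    "\<And>x. 0 < x \<Longrightarrow> x < 1 \<Longrightarrow> frac_int (2 - 2 * \<alpha>) S x = B * x powr (2 - \<alpha>) + (lam \<epsilon> n + c\<^sup>2) * frac_int 2 S x"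
proof (cases "n = 0")
  case True
  obtain B where "\<And>x. 0 < x \<Longrightarrow> x < 1 \<Longrightarrow> frac_int (2 - 2 * \<alpha>) (zero_mode \<alpha> c 0 1) x =
      B * x powr (2 - \<alpha>) + c\<^sup>2 * frac_int 2 (zero_mode \<alpha> c 0 1) x"
    using that
    by (rule caputo_eigenfunction_closed[OF \<alpha> zero_mode_boundary(3,1)[OF \<alpha>] zero_mode_caputo(3-6)[OF \<alpha>], rotated -1])
  then show ?thesis
    using zero_mode_boundary[OF \<alpha>, of c 0 1] True by (intro that[of "zero_mode \<alpha> c 0 1" B]) (auto simp: lam_def)
next
  case False
  then have n: "1 \<le> n" by simp
  note \<mu> = lam_bounds(3,4)[OF \<epsilon> n, of c]
  obtain B where "\<And>x. 0 < x \<Longrightarrow> x < 1 \<Longrightarrow> frac_int (2 - 2 * \<alpha>) (modal \<alpha> (mu c \<epsilon> n) 0 1) x =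
      B * x powr (2 - \<alpha>) + (mu c \<epsilon> n)\<^sup>2 * frac_int 2 (modal \<alpha> (mu c \<epsilon> n) 0 1) x"
    using that
    by (rule caputo_eigenfunction_closed[OF \<alpha> modal_boundary(3,1)[OF \<alpha> \<mu>(1)] modal_caputo(3-6)[OF \<alpha> \<mu>(1)], rotated -1])
  then show ?thesis
    using modal_boundary[OF \<alpha> \<mu>(1), of 0 1] \<mu>(2) by (intro that[of "modal \<alpha> (mu c \<epsilon> n) 0 1" B]) auto
qed

section \<open>Fourier modes of the difference\<close>

context homogeneous_problem
begin

text \<open>Windows are symmetric because the equation contains the reflection of y. They are first
  taken with a < pi, since \<open>vyy\<close> is known only inside the interval; a = pi, which gives
  a Fourier coefficient, is reached by continuity.\<close>

definition window_integral :: "nat \<Rightarrow> real \<Rightarrow> real \<Rightarrow> real" where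
  "window_integral n x a = integral {-a..a} (\<lambda>y. v x y * Y n y)"

text \<open>The boundary term of Green's second identity for v and \<open>Y n\<close> on
  [-a, a].\<close>

definition window_boundary :: "nat \<Rightarrow> real \<Rightarrow> real \<Rightarrow> real" where
  "window_boundary n x a = (vy x a * Y n a - v x a * Y1 n a) - (vy x (- a) * Y n (- a) - v x (- a) * Y1 n (- a))"

text \<open>What the integral of g * Y n becomes once \<open>vyy\<close> is removed by Green's
  identity. Unlike \<open>vyy\<close> it makes sense at a = pi.\<close>

definition window_source :: "nat \<Rightarrow> real \<Rightarrow> real \<Rightarrow> real" where
  "window_source n x a = (lam \<epsilon> n + c\<^sup>2) * window_integral n x a
     - (if odd n then 1 + \<epsilon> else 1 - \<epsilon>) * window_boundary n x a"

lemma integral_g_Y: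
  assumes x: "0 < x" "x < 1" and a: "0 < a" "a < pi"
  shows "integral {-a..a} (\<lambda>y. g x y * Y n y) = window_source n x a"
proof -
  \<comment> \<open>The parity of \<open>Y n\<close>: reflecting the symmetric window shows that the
    term with vyy x (- y) contributes s times the unreflected one.\<close>
  define s :: real where "s = (if odd n then - 1 else 1)"
  have s: "s * s = 1" "Y n (- y) = s * Y n y" for y by (auto simp: s_def Y_minus)
  define J where "J = window_boundary n x a - (freq n)\<^sup>2 * window_integral n x a"
  have vc: "continuous_on {-a..a} (v x)"
    using x a by (intro continuous_on_v[where p = "\<lambda>_. x" and q = "\<lambda>y. y"] continuous_intros) auto
  have vI: "((\<lambda>y. v x y * Y n y) has_integral window_integral n x a) {-a..a}"
    unfolding window_integral_def using vc by (intro integrable_integral integrable_continuous_interval continuous_intros)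
  have "((\<lambda>y. vyy x y * Y n y + (freq n)\<^sup>2 * (v x y * Y n y)) has_integral window_boundary n x a) {-a..a}"
    unfolding window_boundary_def
  proof (rule fundamental_theorem_of_calculus)
    fix y assume "y \<in> {-a..a}"
    then have y: "-pi < y" "y < pi" using a by auto
    have "((\<lambda>y. vy x y * Y n y - v x y * Y1 n y) has_field_derivative
        (vyy x y * Y n y + Y1 n y * vy x y) - (vy x y * Y1 n y + - ((freq n)\<^sup>2 * Y n y) * v x y)) (at y)"
      by (intro DERIV_diff DERIV_mult vy_deriv v_deriv has_deriv_Y has_deriv_Y1 x y)
    then have "((\<lambda>y. vy x y * Y n y - v x y * Y1 n y) has_field_derivative
        vyy x y * Y n y + (freq n)\<^sup>2 * (v x y * Y n y)) (at y)"
      by (rule DERIV_cong) (simp add: algebra_simps)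
    then show "((\<lambda>y. vy x y * Y n y - v x y * Y1 n y) has_vector_derivative
        vyy x y * Y n y + (freq n)\<^sup>2 * (v x y * Y n y)) (at y within {-a..a})"
      by (simp add: has_real_derivative_iff_has_vector_derivative has_vector_derivative_at_within)
  qed (use a in simp)
  from has_integral_diff[OF this has_integral_mult_right[OF vI, of "(freq n)\<^sup>2"]]
  have J: "((\<lambda>y. vyy x y * Y n y) has_integral J) {-a..a}" by (simp add: J_def)
  then have "((\<lambda>y. vyy x (- y) * Y n (- y)) has_integral J) {-a..- (- a)}"
    using has_integral_reflect_real[of "\<lambda>y. vyy x y * Y n y" J a "- a"] by simp
  then have R: "((\<lambda>y. s * (vyy x (- y) * (s * Y n y))) has_integral s * J) {-a..a}"
    unfolding s(2) by (intro has_integral_mult_right) simp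
  have "((\<lambda>y. c\<^sup>2 * (v x y * Y n y) - vyy x y * Y n y + \<epsilon> * (s * (vyy x (- y) * (s * Y n y)))) has_integral
      c\<^sup>2 * window_integral n x a - J + \<epsilon> * (s * J)) {-a..a}"
    by (intro has_integral_add has_integral_diff has_integral_mult_right vI J R)
  moreover have "c\<^sup>2 * (v x y * Y n y) - vyy x y * Y n y + \<epsilon> * (s * (vyy x (- y) * (s * Y n y))) = g x y * Y n y" for y
  proof -
    have "s * (vyy x (- y) * (s * Y n y)) = (s * s) * (vyy x (- y) * Y n y)" by (simp only: mult_ac)
    then show ?thesis unfolding s(1) by (simp add: g_def algebra_simps)
  qed
  ultimately have "integral {-a..a} (\<lambda>y. g x y * Y n y) = c\<^sup>2 * window_integral n x a - J + \<epsilon> * (s * J)"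
    by (simp add: integral_unique)
  also have "\<dots> = window_source n x a"
    by (auto simp: window_source_def J_def s_def lam_eq algebra_simps)
  finally show ?thesis .
qed

text \<open>Substituting y = a * t makes the domain of integration independent of a; the boundary
  term is continuous up to a = pi because \<open>vy\<close> is.\<close>

lemma continuous_on_window:
  "continuous_on ({0..1} \<times> {0..pi}) (\<lambda>(x, a). window_integral n x a)"
  "continuous_on ({0..1} \<times> {0..pi}) (\<lambda>(x, a). window_source n x a)"
proof -
  have b: "- pi \<le> a * t" "a * t \<le> pi" if "0 \<le> a" "a \<le> pi" "-1 \<le> t" "t \<le> 1" for a t :: real
  proof -
    have "\<bar>a * t\<bar> \<le> pi * 1" unfolding abs_mult using that by (intro mult_mono) auto
    then show "- pi \<le> a * t" "a * t \<le> pi" by auto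
  qed
  have "continuous_on (({0..1} \<times> {0..pi}) \<times> {-1..1})
      (\<lambda>z. v (fst (fst z)) (snd (fst z) * snd z) * Y n (snd (fst z) * snd z))"
    using b by (intro continuous_on_mult continuous_on_v continuous_on_compose2[OF continuous_on_Y[of UNIV]] continuous_intros) auto
  then have c: "continuous_on ({0..1} \<times> {0..pi}) (\<lambda>z. integral {-1..1} (\<lambda>t. v (fst z) (snd z * t) * Y n (snd z * t)))"
    using integral_continuous_on_param[of "{0..1} \<times> {0..pi}" "-1" 1 "\<lambda>z t. v (fst z) (snd z * t) * Y n (snd z * t)"]
    by (simp add: case_prod_beta)
  have e: "window_integral n x a = a * integral {-1..1} (\<lambda>t. v x (a * t) * Y n (a * t))" if "0 \<le> a" for x a
  proof (cases "a = 0")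
    case False
    then have "(\<lambda>t. t / a) ` {-a..a} = {-1..1}" using that by simp
    then show ?thesis
      unfolding window_integral_def
      using integral_stretch_real[of a "-a" a "\<lambda>y. v x y * Y n y"] False that by simp
  qed (simp add: window_integral_def)
  have "continuous_on ({0..1} \<times> {0..pi}) (\<lambda>z. snd z * integral {-1..1} (\<lambda>t. v (fst z) (snd z * t) * Y n (snd z * t)))"
    using c by (intro continuous_intros)
  then show I: "continuous_on ({0..1} \<times> {0..pi}) (\<lambda>(x, a). window_integral n x a)"
    by (rule continuous_on_eq) (auto simp: e)
  have "continuous_on ({0..1} \<times> {0..pi}) (\<lambda>z. window_boundary n (fst z) (snd z))"
    unfolding window_boundary_def
    by (intro continuous_on_diff continuous_on_mult continuous_on_v continuous_on_vy
          continuous_on_compose2[OF continuous_on_Y[of UNIV]] continuous_on_compose2[OF continuous_on_Y1[of UNIV]] continuous_intros) auto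
  then show "continuous_on ({0..1} \<times> {0..pi}) (\<lambda>(x, a). window_source n x a)"
    unfolding window_source_def case_prod_beta using I by (intro continuous_intros) (simp add: case_prod_beta)
qed

lemma window_slice:
  assumes F: "continuous_on ({0..1} \<times> {0..pi}) (\<lambda>(x, a). F x a)"
  shows "a \<in> {0..pi} \<Longrightarrow> continuous_on {0..1} (\<lambda>x. F x a)" "x \<in> {0..1} \<Longrightarrow> continuous_on {0..pi} (F x)"
proof -
  show "continuous_on {0..1} (\<lambda>x. F x a)" if "a \<in> {0..pi}"
    using continuous_on_compose2[OF F continuous_on_Pair[of "{0..1}" "\<lambda>x. x" "\<lambda>x. a"]] that by (simp add: image_subset_iff)
  show "continuous_on {0..pi} (F x)" if "x \<in> {0..1}"
    using continuous_on_compose2[OF F continuous_on_Pair[of "{0..pi}" "\<lambda>a. x" "\<lambda>a. a"]] that by (simp add: image_subset_iff)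
qed

text \<open>For a < pi the remainder is W * x powr (2 - \<alpha>) with W depending on a in an
  uncontrolled way. The proportionality between its values at x and at 1/2 does not mention W and
  passes to the limit a = pi, where the boundary term vanishes by periodicity.\<close>

lemma fourier_mode_equation:
  obtains A where "\<And>x. 0 < x \<Longrightarrow> x < 1 \<Longrightarrow> frac_int (2 - 2 * \<alpha>) (\<lambda>s. window_integral n s pi) x =
    A * x powr (2 - \<alpha>) + (lam \<epsilon> n + c\<^sup>2) * frac_int 2 (\<lambda>s. window_integral n s pi) x"
proof -
  define p where "p = 2 - \<alpha>"
  define \<Phi> where "\<Phi> x a = frac_int (2 - 2 * \<alpha>) (\<lambda>s. window_integral n s a) x - frac_int 2 (\<lambda>s. window_source n s a) x" for x a
  have \<Phi>c: "continuous_on {0..pi} (\<Phi> x)" if "x \<in> {0..1}" for x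
    unfolding \<Phi>_def
    using window_slice(2)[OF continuous_on_frac_int[OF _ continuous_on_window(1)] that, of "2 - 2 * \<alpha>"]
      window_slice(2)[OF continuous_on_frac_int[OF _ continuous_on_window(2)] that, of 2] \<alpha>
    by (intro continuous_on_diff) auto
  have \<Phi>W: "\<exists>W. \<forall>x. 0 < x \<and> x < 1 \<longrightarrow> \<Phi> x a = W * x powr p" if a: "0 < a" "a < pi" for a
  proof -
    have c: "continuous_on {0..1} (\<lambda>s. window_source n s a)"
      using a by (intro window_slice(1)[OF continuous_on_window(2)]) auto
    obtain M where M: "\<And>s. s \<in> {0..1} \<Longrightarrow> \<bar>window_source n s a\<bar> \<le> M" using that by (rule continuous_on_Icc_bounded[OF c])
    have co: "continuous_on {0<..<1} (\<lambda>s. window_source n s a)" using c by (rule continuous_on_subset) auto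
    have M': "\<And>s. 0 < s \<Longrightarrow> s < 1 \<Longrightarrow> \<bar>window_source n s a\<bar> \<le> M" using M by simp
    have ab: "- pi < - a" "- a \<le> a" using a by auto
    obtain W where W: "\<And>x. 0 < x \<Longrightarrow> x < 1 \<Longrightarrow> integral {-a..a} (\<lambda>y. Z x y * Y n y) =
        W * x powr (2 - \<alpha>) + frac_int 2 (\<lambda>s. window_source n s a) x"
      using that by (rule weighted_homogeneous[OF ab a(2) continuous_on_Y co M' integral_g_Y[OF _ _ a], rotated -1])
    have "\<Phi> x a = W * x powr p" if "0 < x" "x < 1" for x
      using W[OF that] Z_integral[of "-a" a "Y n" x] continuous_on_Y[of "{-a..a}" n] a that
      by (simp add: \<Phi>_def p_def window_integral_def)
    then show ?thesis by blast
  qed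
  define A where "A = \<Phi> (1/2) pi / (1/2) powr p"
  have A: "\<Phi> x pi = A * x powr p" if x: "0 < x" "x < 1" for x
  proof -
    have "\<Phi> x pi * (1/2) powr p - \<Phi> (1/2) pi * x powr p = 0"
    proof (rule continuous_constant_on_closure[where S = "{0<..<pi}" and f = "\<lambda>a. \<Phi> x a * (1/2) powr p - \<Phi> (1/2) a * x powr p"])
      show "continuous_on (closure {0<..<pi}) (\<lambda>a. \<Phi> x a * (1/2) powr p - \<Phi> (1/2) a * x powr p)"
        using \<Phi>c[of x] \<Phi>c[of "1/2"] x by (auto intro!: continuous_intros)
      fix a assume "a \<in> {0<..<pi}"
      then obtain W where "\<forall>x. 0 < x \<and> x < 1 \<longrightarrow> \<Phi> x a = W * x powr p" using \<Phi>W[of a] by auto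
      then show "\<Phi> x a * (1/2) powr p - \<Phi> (1/2) a * x powr p = 0" using x by simp
    qed simp
    then show ?thesis by (simp add: A_def field_simps)
  qed
  have src: "window_source n s pi = window_integral n s pi * (lam \<epsilon> n + c\<^sup>2)" if "0 < s" "s < 1" for s
  proof -
    have "window_boundary n s pi = 0"
      unfolding window_boundary_def using v_per[of s] vy_per[of s] that by (simp add: Y_periodic Y1_periodic)
    then show ?thesis by (simp add: window_source_def)
  qed
  show ?thesis
  proof (rule that[of A])
    fix x :: real assume x: "0 < x" "x < 1"
    have "frac_int 2 (\<lambda>s. window_source n s pi) x = frac_int 2 (\<lambda>s. window_integral n s pi * (lam \<epsilon> n + c\<^sup>2)) x"
      using src x by (intro frac_int_cong) auto
    also have "\<dots> = frac_int 2 (\<lambda>s. window_integral n s pi) x * (lam \<epsilon> n + c\<^sup>2)" by (rule frac_int_mult_right)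
    finally show "frac_int (2 - 2 * \<alpha>) (\<lambda>s. window_integral n s pi) x =
      A * x powr (2 - \<alpha>) + (lam \<epsilon> n + c\<^sup>2) * frac_int 2 (\<lambda>s. window_integral n s pi) x"
      using A[OF x] by (simp add: \<Phi>_def p_def algebra_simps)
  qed
qed

theorem vanishes:
  assumes x: "0 \<le> x" "x \<le> 1" and y: "y \<in> {-pi..pi}"
  shows "v x y = 0"
proof -
  have "integral {-pi..pi} (\<lambda>y. v x y * Y n y) = 0" for n
  proof -
    obtain A where A: "\<And>x. 0 < x \<Longrightarrow> x < 1 \<Longrightarrow> frac_int (2 - 2 * \<alpha>) (\<lambda>s. window_integral n s pi) x =
        A * x powr (2 - \<alpha>) + (lam \<epsilon> n + c\<^sup>2) * frac_int 2 (\<lambda>s. window_integral n s pi) x"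
      using that by (rule fourier_mode_equation)
    obtain S B where S: "continuous_on {0..1} S" "S 1 = 1"
      "\<And>x. 0 < x \<Longrightarrow> x < 1 \<Longrightarrow> frac_int (2 - 2 * \<alpha>) S x = B * x powr (2 - \<alpha>) + (lam \<epsilon> n + c\<^sup>2) * frac_int 2 S x"
      using that by (rule mode_comparison[OF \<alpha> \<epsilon>])
    have V: "continuous_on {0..1} (\<lambda>s. window_integral n s pi)"
      by (intro window_slice(1)[OF continuous_on_window(1)]) auto
    have "window_integral n 1 pi = integral {-pi..pi} (\<lambda>y. 0)"
      unfolding window_integral_def using v_1 by (intro integral_cong) auto
    then have V1: "window_integral n 1 pi = 0" by simp
    have "window_integral n x pi = 0"
      by (rule mode_unique[OF \<alpha> V V1 A S(1) _ S(3) x]) (use S(2) in auto)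
    then show ?thesis by (simp add: window_integral_def)
  qed
  moreover have "continuous_on {-pi..pi} (v x)"
    using x by (intro continuous_on_v[where p = "\<lambda>_. x" and q = "\<lambda>y. y"] continuous_intros) auto
  ultimately show ?thesis using v_per[OF x] y by (intro trig_complete[of "v x"]) auto
qed

end

section \<open>Reduction of two solutions to the homogeneous problem\<close>

lemma bvp_solution_continuous:
  assumes "bvp_solution \<alpha> c \<epsilon> \<phi> \<psi> u"
  shows "continuous_on ({0..1} \<times> {-pi..pi}) (\<lambda>(x, y). u x y)"
    "continuous_on ({0..1} \<times> {-pi..pi}) (\<lambda>(x, y). Dy u x y)"
    "continuous_on ({0<..<1} \<times> {-pi<..<pi}) (\<lambda>(x, y). Dyy u x y)"
  using assms
  by (auto simp: bvp_solution_def regular_solution_def Dy_continuous_on_closure_def Omega_bar_def Omega_def)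

lemma bvp_solution_deriv:
  assumes u: "bvp_solution \<alpha> c \<epsilon> \<phi> \<psi> u" and x: "0 < x" "x < 1" and y: "-pi < y" "y < pi"
  shows "(u x has_field_derivative Dy u x y) (at y)" "(Dy u x has_field_derivative Dyy u x y) (at y)"
proof -
  have d: "u x field_differentiable (at z)" "deriv (u x) field_differentiable (at z)" if "-pi < z" "z < pi" for z
    using u x that by (auto simp: bvp_solution_def regular_solution_def Omega_def)
  have d1: "(u x has_field_derivative deriv (u x) z) (at z)" if "-pi < z" "z < pi" for z
    using d(1)[OF that] by (simp add: DERIV_deriv_iff_field_differentiable)
  have e: "Dy u x z = deriv (u x) z" if z: "-pi < z" "z < pi" for z
    unfolding Dy_def deriv_on_def at_within_Icc_at[OF z]
    using d1[OF z] by (intro vector_derivative_at) (simp add: has_real_derivative_iff_has_vector_derivative)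
  show "(u x has_field_derivative Dy u x y) (at y)" using d1[OF y] e[OF y] by simp
  have "(deriv (u x) has_field_derivative Dyy u x y) (at y)"
    unfolding Dyy_def using d(2)[OF y] by (simp add: DERIV_deriv_iff_field_differentiable)
  then show "(Dy u x has_field_derivative Dyy u x y) (at y)"
    by (rule has_field_derivative_transform_within_open[of _ _ _ "{-pi<..<pi}"]) (use y e in auto)
qed

lemma bvp_solution_structure:
  assumes \<alpha>: "0 < \<alpha>" "\<alpha> \<le> 1" and u: "bvp_solution \<alpha> c \<epsilon> \<phi> \<psi> u" and y: "-pi < y" "y < pi"
  obtains w Q' where "\<alpha> = 1 \<Longrightarrow> w = 0"
    and "\<And>x. 0 < x \<Longrightarrow> x < 1 \<Longrightarrow>
      ((\<lambda>x. frac_int (2 - 2 * \<alpha>) (\<lambda>s. u s y - \<phi> y) x - w * x powr (2 - \<alpha>)) has_field_derivative Q' x) (at x)"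
    and "\<And>x. 0 < x \<Longrightarrow> x < 1 \<Longrightarrow> (Q' has_field_derivative c\<^sup>2 * u x y - Dyy u x y + \<epsilon> * Dyy u x (- y)) (at x)"
    and "\<alpha> < 1 \<Longrightarrow>
      ((\<lambda>x. (frac_int (2 - 2 * \<alpha>) (\<lambda>s. u s y - \<phi> y) x - w * x powr (2 - \<alpha>)) / x) \<longlongrightarrow> 0) (at_right 0)"
proof -
  have in\<Omega>: "(x, y) \<in> Omega" if "0 < x" "x < 1" for x using y that by (simp add: Omega_def)
  have reg: "regular_solution \<alpha> c \<epsilon> u" and u0: "u 0 y = \<phi> y"
    using u y by (auto simp: bvp_solution_def boundary_conditions_def)
  have f: "continuous_on {0..1} (\<lambda>s. u s y)"
    using continuous_on_compose2[OF bvp_solution_continuous(1)[OF u] continuous_on_Pair[of "{0..1}" "\<lambda>s. s" "\<lambda>_. y"]] y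
    by (auto simp: image_subset_iff)
  have c1: "has_caputo \<alpha> (\<lambda>s. u s y) x" if "0 < x" "x < 1" for x
    using reg in\<Omega>[OF that] by (auto simp: regular_solution_def has_Dx_def)
  have c2: "has_caputo \<alpha> (caputo \<alpha> (\<lambda>s. u s y)) x" if "0 < x" "x < 1" for x
    using reg in\<Omega>[OF that] unfolding regular_solution_def has_Dx_def Dx_def by auto
  have DD: "caputo \<alpha> (caputo \<alpha> (\<lambda>s. u s y)) x = Dx \<alpha> (Dx \<alpha> u) x y" for x by (simp add: Dx_def)
  have "continuous_on {0<..<1} (\<lambda>x. Dx \<alpha> (Dx \<alpha> u) x y)"
    using continuous_on_compose2[of Omega "\<lambda>(x, y). Dx \<alpha> (Dx \<alpha> u) x y", OF _ continuous_on_Pair[of "{0<..<1}" "\<lambda>s. s" "\<lambda>_. y"]]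
      reg y by (auto simp: regular_solution_def Omega_def image_subset_iff)
  then have g: "continuous_on {0<..<1} (caputo \<alpha> (caputo \<alpha> (\<lambda>s. u s y)))" unfolding DD[symmetric] .
  obtain w Q' where w: "\<alpha> = 1 \<Longrightarrow> w = 0"
    "\<And>x. 0 < x \<Longrightarrow> x < 1 \<Longrightarrow>
      ((\<lambda>x. frac_int (2 - 2 * \<alpha>) (\<lambda>s. u s y - u 0 y) x - w * x powr (2 - \<alpha>)) has_field_derivative Q' x) (at x)"
    "\<And>x. 0 < x \<Longrightarrow> x < 1 \<Longrightarrow> (Q' has_field_derivative caputo \<alpha> (caputo \<alpha> (\<lambda>s. u s y)) x) (at x)"
    "\<alpha> < 1 \<Longrightarrow>
      ((\<lambda>x. (frac_int (2 - 2 * \<alpha>) (\<lambda>s. u s y - u 0 y) x - w * x powr (2 - \<alpha>)) / x) \<longlongrightarrow> 0) (at_right 0)"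
    using that by (rule caputo_twice_structure[OF \<alpha> f c1 c2 g, rotated -1])
  have eq: "caputo \<alpha> (caputo \<alpha> (\<lambda>s. u s y)) x = c\<^sup>2 * u x y - Dyy u x y + \<epsilon> * Dyy u x (- y)" if "0 < x" "x < 1" for x
    using reg in\<Omega>[OF that] unfolding DD regular_solution_def by force
  show ?thesis using w(1) w(2)[unfolded u0] w(3)[unfolded eq] w(4)[unfolded u0] eq by (intro that[of w Q']) auto
qed

lemma bvp_solution_unique:
  assumes \<alpha>: "0 < \<alpha>" "\<alpha> \<le> 1" and \<epsilon>: "\<bar>\<epsilon>\<bar> < 1"
    and u1: "bvp_solution \<alpha> c \<epsilon> \<phi> \<psi> u1" and u2: "bvp_solution \<alpha> c \<epsilon> \<phi> \<psi> u2" and xy: "(x, y) \<in> Omega_bar"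
  shows "u1 x y = u2 x y"
proof -
  note cont = bvp_solution_continuous[OF u1] bvp_solution_continuous[OF u2]
  interpret homogeneous_problem \<alpha> c \<epsilon> "\<lambda>x y. u1 x y - u2 x y" "\<lambda>x y. Dy u1 x y - Dy u2 x y" "\<lambda>x y. Dyy u1 x y - Dyy u2 x y"
  proof
    show "continuous_on ({0..1} \<times> {-pi..pi}) (\<lambda>(x, y). u1 x y - u2 x y)"
      "continuous_on ({0..1} \<times> {-pi..pi}) (\<lambda>(x, y). Dy u1 x y - Dy u2 x y)"
      "continuous_on ({0<..<1} \<times> {-pi<..<pi}) (\<lambda>(x, y). Dyy u1 x y - Dyy u2 x y)"
      using continuous_on_diff[OF cont(1,4)] continuous_on_diff[OF cont(2,5)] continuous_on_diff[OF cont(3,6)]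
      by (simp_all add: case_prod_beta)
    show "((\<lambda>y. u1 x y - u2 x y) has_field_derivative Dy u1 x y - Dy u2 x y) (at y)"
      "((\<lambda>y. Dy u1 x y - Dy u2 x y) has_field_derivative Dyy u1 x y - Dyy u2 x y) (at y)"
      if "0 < x" "x < 1" "-pi < y" "y < pi" for x y
      using bvp_solution_deriv[OF u1 that] bvp_solution_deriv[OF u2 that] by (intro DERIV_diff; simp)+
    show "u1 0 y - u2 0 y = 0" "u1 1 y - u2 1 y = 0" if "-pi \<le> y" "y \<le> pi" for y
      using u1 u2 that by (simp_all add: bvp_solution_def boundary_conditions_def)
    show "u1 x (-pi) - u2 x (-pi) = u1 x pi - u2 x pi" "Dy u1 x (-pi) - Dy u2 x (-pi) = Dy u1 x pi - Dy u2 x pi"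
      if "0 \<le> x" "x \<le> 1" for x
      using u1 u2 that by (simp_all add: bvp_solution_def boundary_conditions_def)
    fix y :: real assume y: "-pi < y" "y < pi"
    have ci: "continuous_on {0..1} (\<lambda>s. u s y - \<phi> y)" if "bvp_solution \<alpha> c \<epsilon> \<phi> \<psi> u" for u
    proof -
      have "continuous_on {0..1} (\<lambda>s. u s y)"
        using continuous_on_compose2[OF bvp_solution_continuous(1)[OF that] continuous_on_Pair[of "{0..1}" "\<lambda>s. s" "\<lambda>_. y"]] y
        by (auto simp: image_subset_iff)
      then show ?thesis by (intro continuous_intros)
    qed
    have lin: "frac_int (2 - 2 * \<alpha>) (\<lambda>s. u1 s y - u2 s y) x =
        frac_int (2 - 2 * \<alpha>) (\<lambda>s. u1 s y - \<phi> y) x - frac_int (2 - 2 * \<alpha>) (\<lambda>s. u2 s y - \<phi> y) x" if x: "0 < x" "x < 1" for x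
    proof -
      have "frac_int (2 - 2 * \<alpha>) (\<lambda>s. 1 * (u1 s y - \<phi> y) + (-1) * (u2 s y - \<phi> y)) x =
          1 * frac_int (2 - 2 * \<alpha>) (\<lambda>s. u1 s y - \<phi> y) x + (-1) * frac_int (2 - 2 * \<alpha>) (\<lambda>s. u2 s y - \<phi> y) x"
        using set_integrable_kernel_continuous[OF _ ci[OF u1] x, of "2 - 2 * \<alpha>"]
          set_integrable_kernel_continuous[OF _ ci[OF u2] x, of "2 - 2 * \<alpha>"] \<alpha>
        by (intro frac_int_lincomb) auto
      then show ?thesis by (simp add: algebra_simps)
    qed
    let ?F = "\<lambda>u w x. frac_int (2 - 2 * \<alpha>) (\<lambda>s. u s y - \<phi> y) x - w * x powr (2 - \<alpha>)"
    let ?D = "\<lambda>w x. frac_int (2 - 2 * \<alpha>) (\<lambda>s. u1 s y - u2 s y) x - w * x powr (2 - \<alpha>)"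
    obtain w1 Q1 where 1: "\<alpha> = 1 \<Longrightarrow> w1 = 0"
      "\<And>x. 0 < x \<Longrightarrow> x < 1 \<Longrightarrow> (?F u1 w1 has_field_derivative Q1 x) (at x)"
      "\<And>x. 0 < x \<Longrightarrow> x < 1 \<Longrightarrow> (Q1 has_field_derivative c\<^sup>2 * u1 x y - Dyy u1 x y + \<epsilon> * Dyy u1 x (- y)) (at x)"
      "\<alpha> < 1 \<Longrightarrow> ((\<lambda>x. ?F u1 w1 x / x) \<longlongrightarrow> 0) (at_right 0)"
      using that by (rule bvp_solution_structure[OF \<alpha> u1 y])
    obtain w2 Q2 where 2: "\<alpha> = 1 \<Longrightarrow> w2 = 0"
      "\<And>x. 0 < x \<Longrightarrow> x < 1 \<Longrightarrow> (?F u2 w2 has_field_derivative Q2 x) (at x)"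
      "\<And>x. 0 < x \<Longrightarrow> x < 1 \<Longrightarrow> (Q2 has_field_derivative c\<^sup>2 * u2 x y - Dyy u2 x y + \<epsilon> * Dyy u2 x (- y)) (at x)"
      "\<alpha> < 1 \<Longrightarrow> ((\<lambda>x. ?F u2 w2 x / x) \<longlongrightarrow> 0) (at_right 0)"
      using that by (rule bvp_solution_structure[OF \<alpha> u2 y])
    \<comment> \<open>The contributions of \<phi> y cancel, and w1 - w2 takes the place of w in
      \<open>str\<close>.\<close>
    have eq: "?F u1 w1 x - ?F u2 w2 x = ?D (w1 - w2) x" if "0 < x" "x < 1" for x
      unfolding lin[OF that] by (simp add: algebra_simps)
    have "(?D (w1 - w2) has_field_derivative Q1 x - Q2 x) (at x)" if x: "0 < x" "x < 1" for x
      by (rule has_field_derivative_transform_within_open[OF DERIV_diff[OF 1(2)[OF x] 2(2)[OF x]], of "{0<..<1}"])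
        (use eq x in auto)
    moreover have "((\<lambda>x. Q1 x - Q2 x) has_field_derivative
        c\<^sup>2 * (u1 x y - u2 x y) - (Dyy u1 x y - Dyy u2 x y) + \<epsilon> * (Dyy u1 x (- y) - Dyy u2 x (- y))) (at x)" if x: "0 < x" "x < 1" for x
      by (rule DERIV_cong[OF DERIV_diff[OF 1(3)[OF x] 2(3)[OF x]]]) (simp add: algebra_simps)
    moreover have "((\<lambda>x. ?D (w1 - w2) x / x) \<longlongrightarrow> 0) (at_right 0)" if "\<alpha> < 1"
    proof -
      have "((\<lambda>x. ?F u1 w1 x / x - ?F u2 w2 x / x) \<longlongrightarrow> 0 - 0) (at_right 0)" using that by (intro tendsto_diff 1 2)
      moreover have "eventually (\<lambda>x. ?F u1 w1 x / x - ?F u2 w2 x / x = ?D (w1 - w2) x / x) (at_right 0)"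
      proof (rule eventually_at_rightI[of 0 1])
        fix x :: real assume "x \<in> {0<..<1}"
        then show "?F u1 w1 x / x - ?F u2 w2 x / x = ?D (w1 - w2) x / x"
          using eq[of x] by (simp only: diff_divide_distrib[symmetric] greaterThanLessThan_iff)
      qed simp
      ultimately show ?thesis using tendsto_cong by force
    qed
    ultimately show "\<exists>w Q'. (\<alpha> = 1 \<longrightarrow> w = 0) \<and>
      (\<forall>x. 0 < x \<and> x < 1 \<longrightarrow> (?D w has_field_derivative Q' x) (at x) \<and>
        (Q' has_field_derivative c\<^sup>2 * (u1 x y - u2 x y) - (Dyy u1 x y - Dyy u2 x y) + \<epsilon> * (Dyy u1 x (- y) - Dyy u2 x (- y))) (at x)) \<and>
      (\<alpha> < 1 \<longrightarrow> ((\<lambda>x. ?D w x / x) \<longlongrightarrow> 0) (at_right 0))"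
      using 1(1) 2(1) by (intro exI[of _ "w1 - w2"] exI[of _ "\<lambda>x. Q1 x - Q2 x"]) auto
  qed (fact \<alpha> \<epsilon>)+
  show ?thesis using vanishes[of x y] xy by (simp add: Omega_bar_def)
qed

theorem theorem3:
  fixes \<alpha> c \<epsilon> \<delta> :: real and \<phi> \<psi> :: "real \<Rightarrow> real"
  assumes "0 < \<alpha>" and "\<alpha> \<le> 1"
    and "\<bar>\<epsilon>\<bar> < 1"
    and "0 < \<delta>" and "\<delta> < 1"
    and "holder_space 3 \<delta> {-pi..pi} \<phi>" and "holder_space 2 \<delta> {-pi..pi} \<psi>"
    and "\<phi> (-pi) = \<phi> pi" and "deriv_on {-pi..pi} \<phi> (-pi) = deriv_on {-pi..pi} \<phi> pi"
    and "\<psi> (-pi) = \<psi> pi" and "deriv_on {-pi..pi} \<psi> (-pi) = deriv_on {-pi..pi} \<psi> pi"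
  shows "\<exists>u. bvp_solution \<alpha> c \<epsilon> \<phi> \<psi> u \<and>
     (\<forall>v. bvp_solution \<alpha> c \<epsilon> \<phi> \<psi> v \<longrightarrow> (\<forall>(x, y)\<in>Omega_bar. v x y = u x y)) \<and>
     (\<forall>(x, y)\<in>Omega_bar.
        summable (\<lambda>k. mode \<alpha> c \<epsilon> \<phi> \<psi> (2 * (k + 1)) x y) \<and>
        summable (\<lambda>k. mode \<alpha> c \<epsilon> \<phi> \<psi> (2 * (k + 1) - 1) x y) \<and>
        u x y = zero_mode \<alpha> c (fourier_coeff \<phi> 0) (fourier_coeff \<psi> 0) x
          + (\<Sum>k. mode \<alpha> c \<epsilon> \<phi> \<psi> (2 * (k + 1)) x y)
          + (\<Sum>k. mode \<alpha> c \<epsilon> \<phi> \<psi> (2 * (k + 1) - 1) x y))"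
proof -
  obtain u where u: "bvp_solution \<alpha> c \<epsilon> \<phi> \<psi> u"
    and repr: "\<forall>(x, y)\<in>Omega_bar.
        summable (\<lambda>k. mode \<alpha> c \<epsilon> \<phi> \<psi> (2 * (k + 1)) x y) \<and>
        summable (\<lambda>k. mode \<alpha> c \<epsilon> \<phi> \<psi> (2 * (k + 1) - 1) x y) \<and>
        u x y = zero_mode \<alpha> c (fourier_coeff \<phi> 0) (fourier_coeff \<psi> 0) x
          + (\<Sum>k. mode \<alpha> c \<epsilon> \<phi> \<psi> (2 * (k + 1)) x y)
          + (\<Sum>k. mode \<alpha> c \<epsilon> \<phi> \<psi> (2 * (k + 1) - 1) x y)"
    using that by (rule existence[OF assms])
  have "\<forall>v. bvp_solution \<alpha> c \<epsilon> \<phi> \<psi> v \<longrightarrow> (\<forall>(x, y)\<in>Omega_bar. v x y = u x y)"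
    using bvp_solution_unique[OF assms(1-3) _ u] by blast
  with u repr show ?thesis by blast
qed

end
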